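(* Let $k=\mathbb{F}_q$ be a finite field of odd characteristic and let $(Q,\sigma)$ be a quiver with involution and duality structure $(s,\tau)$. Let $\int_{\mathcal H}:\mathcal{H}_Q\to\hat{\mathbb{T}}_Q$ be the $\mathbb{Q}$-linear map $$[U]\mapsto\frac{q^{\frac12\chi(\mathbf{dim}\,U,\mathbf{dim}\,U)}}{\#\mathrm{Aut}(U)}\,x_{\mathbf{dim}\,U},$$ and let $\int_{\mathcal M}:\mathcal{M}_Q\to\hat{\mathbb{S}}_Q$ be the $\mathbb{Q}$-linear map $$[M]\mapsto\frac{q^{\frac12\mathcal{E}(\mathbf{dim}\,M)}}{\#\mathrm{Aut}_S(M)}\,\xi_{\mathbf{dim}\,M}.$$ Then $\int_{\mathcal M}$ is a $\int_{\mathcal H}$-morphism, that is, $$\int_{\mathcal M}(f\star m)=\Big(\int_{\mathcal H}f\Big)\star\Big(\int_{\mathcal M}m\Big)\qquad\text{for all } f\in\mathcal{H}_Q,\ m\in\mathcal{M}_Q.$$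
   Context: Quivers. $Q$ is a quiver with finite sets of nodes $Q_0$ and arrows $Q_1$; $\Lambda_Q=\mathbb{Z}Q_0$, $\Lambda_Q^+=\mathbb{Z}_{\ge 0}Q_0$. A representation $M$ consists of finite dimensional $k$-vector spaces $M_i$ and linear maps $m_\alpha:M_i\to M_j$ for arrows $\alpha:i\to j$; $\mathbf{dim}\,M=\sum_i(\dim M_i)\,i$. The Euler form on $\Lambda_Q$ is $\chi(d,d')=\sum_{i\in Q_0}d_id'_i-\sum_{\alpha:i\to j}d_id'_j$, and $\langle d,d'\rangle=\chi(d,d')-\chi(d',d)$. Involutions and duality structures. An involution $\sigma$ of $Q$ is a pair of involutions of $Q_0$ and $Q_1$ such that $\alpha:i\to j$ is sent to $\sigma(\alpha):\sigma(j)\to\sigma(i)$, and every arrow of the form $i\to\sigma(i)$ is fixed by $\sigma$. It acts on $\Lambda_Q$; $\Lambda_Q^{\sigma,+}\subset\Lambda_Q^+$ denotes the $\sigma$-invariants, and $H(d)=d+\sigma(d)$. A duality structure is a pair $s:Q_0\to\{\pm1\}$, $\tau:Q_1\to\{\pm1\}$ with $s$ $\sigma$-invariant and $\tau_\alpha\tau_{\sigma(\alpha)}=s_is_j$ for every $\alpha:i\to j$. Self-dual representations. A self-dual representation is a representation $M$ with a non-degenerate bilinear form $\langle\cdot,\cdot\rangle$ on $\bigoplus_iM_i$ such that $M_i$ and $M_j$ are orthogonal unless $i=\sigma(j)$; $\langle x,x'\rangle=s_i\langle x',x\rangle$ for $x,x'\in M_i+M_{\sigma(i)}$; and $\langle m_\alpha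 x,x'\rangle=\tau_\alpha\langle x,m_{\sigma(\alpha)}x'\rangle$ for every $\alpha:i\to j$, $x\in M_i$, $x'\in M_{\sigma(j)}$. Isometries are isomorphisms of representations preserving the forms; $M\simeq_SM'$ means isometric, and $\mathrm{Aut}_S(M)$ is the group of self-isometries. A subrepresentation $U\subset N$ is isotropic if $U\subset U^\perp$; then $N/\!/U:=U^\perp/U$ with its induced self-dual structure. The function $\mathcal{E}:\Lambda_Q\to\mathbb{Z}$. Write $Q_0=Q_0^+\sqcup Q_0^\sigma\sqcup Q_0^-$ with $Q_0^\sigma$ the $\sigma$-fixed nodes and $\sigma(Q_0^+)=Q_0^-$, and similarly $Q_1=Q_1^+\sqcup Q_1^\sigma\sqcup Q_1^-$. Then $$\mathcal{E}(d)=\sum_{i\in Q_0^\sigma}\frac{d_i(d_i-s_i)}2+\sum_{i\in Q_0^+}d_{\sigma(i)}d_i-\sum_{(\alpha:\sigma(i)\to i)\in Q_1^\sigma}\frac{d_i(d_i+\tau_\alpha s_i)}2-\sum_{(\alpha:i\to j)\in Q_1^+}d_{\sigma(i)}d_j.$$ Put $\tilde{\mathcal E}(d)=\mathcal{E}(d)-\mathcal{E}(\sigma(d))$. Hall algebra and Hall module. $\mathcal{H}_Q$ is the $\mathbb{Q}$-vector space on isomorphism classes $[U]$ of $\mathbb{F}_q$-representations, with product $[U]\cdot[V]=\sum_XF^X_{U,V}[X]$, $F^X_{U,V}=\#\{\tilde U\subset X\mid\tilde U\simeq U,\ X/\tilde U\simeq V\}$. $\mathcal{M}_Q$ is the $\mathbb{Q}$-vector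 space on isometry classes $[M]$ of self-dual $\mathbb{F}_q$-representations, with $\mathcal{H}_Q$-module structure $[U]\star[M]=\sum_NG^N_{U,M}[N]$, $G^N_{U,M}=\#\{\tilde U\subset N\mid\tilde U\simeq U,\ \tilde U\text{ isotropic},\ N/\!/\tilde U\simeq_SM\}$. Quantum torus and its module. $\hat{\mathbb{T}}_Q$ is the $\mathbb{Q}(q^{1/2})$-vector space with topological basis $\{x_d\}_{d\in\Lambda_Q^+}$ (infinite sums allowed) and product $x_d\cdot x_{d'}=q^{\frac12\langle d,d'\rangle}x_{d+d'}$. $\hat{\mathbb{S}}_Q$ is the $\mathbb{Q}(q^{1/2})$-vector space with topological basis $\{\xi_e\}_{e\in\Lambda_Q^{\sigma,+}}$, a $\hat{\mathbb{T}}_Q$-module via $x_d\star\xi_e=q^{\frac12(\langle d,e\rangle-\tilde{\mathcal E}(d))}\xi_{H(d)+e}$. *)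

theory Defs
  imports
    "Jordan_Normal_Form.VS_Connect"
    "HOL-Algebra.AbelCoset"
    "HOL-Library.Cardinality"
    "HOL-Library.Infinite_Typeclass"
begin

section \<open>Quivers with involution and duality structure\<close>

record ('v, 'a) quiver =
  nodes :: "'v set"
  arrows :: "'a set"
  src :: "'a \<Rightarrow> 'v"
  tgt :: "'a \<Rightarrow> 'v"

definition quiver :: "('v, 'a, 'z) quiver_scheme \<Rightarrow> bool" where
  "quiver Q \<longleftrightarrow> finite (nodes Q) \<and> finite (arrows Q) \<and>
     (\<forall>\<alpha>\<in>arrows Q. src Q \<alpha> \<in> nodes Q \<and> tgt Q \<alpha> \<in> nodes Q)"

record ('v, 'a) sdquiver = "('v, 'a) quiver" +
  sig0 :: "'v \<Rightarrow> 'v"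
  sig1 :: "'a \<Rightarrow> 'a"
  sgn_s :: "'v \<Rightarrow> int"
  sgn_tau :: "'a \<Rightarrow> int"

definition quiver_involution :: "('v, 'a, 'z) sdquiver_scheme \<Rightarrow> bool" where
  "quiver_involution Q \<longleftrightarrow>
     (\<forall>i\<in>nodes Q. sig0 Q i \<in> nodes Q \<and> sig0 Q (sig0 Q i) = i) \<and>
     (\<forall>\<alpha>\<in>arrows Q. sig1 Q \<alpha> \<in> arrows Q \<and> sig1 Q (sig1 Q \<alpha>) = \<alpha>) \<and>
     (\<forall>\<alpha>\<in>arrows Q. src Q (sig1 Q \<alpha>) = sig0 Q (tgt Q \<alpha>) \<and> tgt Q (sig1 Q \<alpha>) = sig0 Q (src Q \<alpha>)) \<and>
     (\<forall>\<alpha>\<in>arrows Q. tgt Q \<alpha> = sig0 Q (src Q \<alpha>) \<longrightarrow> sig1 Q \<alpha> = \<alpha>)"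

definition duality_structure :: "('v, 'a, 'z) sdquiver_scheme \<Rightarrow> bool" where
  "duality_structure Q \<longleftrightarrow>
     (\<forall>i\<in>nodes Q. sgn_s Q i \<in> {1, -1} \<and> sgn_s Q (sig0 Q i) = sgn_s Q i) \<and>
     (\<forall>\<alpha>\<in>arrows Q. sgn_tau Q \<alpha> \<in> {1, -1} \<and>
        sgn_tau Q \<alpha> * sgn_tau Q (sig1 Q \<alpha>) = sgn_s Q (src Q \<alpha>) * sgn_s Q (tgt Q \<alpha>))"

definition sd_quiver :: "('v, 'a, 'z) sdquiver_scheme \<Rightarrow> bool" where
  "sd_quiver Q \<longleftrightarrow> quiver Q \<and> quiver_involution Q \<and> duality_structure Q"

text \<open>\<open>P\<close> is a choice of \<open>X\<^sup>+\<close> in a decomposition \<open>X = X\<^sup>+ \<squnion> X\<^sup>\<sigma> \<squnion> X\<^sup>-\<close> with \<open>\<sigma>(X\<^sup>+) = X\<^sup>-\<close>.\<close>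

definition is_positive_part :: "('b \<Rightarrow> 'b) \<Rightarrow> 'b set \<Rightarrow> 'b set \<Rightarrow> bool" where
  "is_positive_part \<sigma> X P \<longleftrightarrow> P \<subseteq> X \<and> P \<inter> \<sigma> ` P = {} \<and> P \<union> \<sigma> ` P = {x \<in> X. \<sigma> x \<noteq> x}"


section \<open>Dimension vectors and the Euler forms\<close>

text \<open>An element of \<open>\<Lambda>\<^sub>Q\<close> is a function \<open>'v \<Rightarrow> int\<close> that vanishes off the nodes.\<close>

definition Lambda_pos :: "('v, 'a, 'z) quiver_scheme \<Rightarrow> ('v \<Rightarrow> int) set" where
  "Lambda_pos Q = {d. (\<forall>i\<in>nodes Q. 0 \<le> d i) \<and> (\<forall>i. i \<notin> nodes Q \<longrightarrow> d i = 0)}"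

definition sig_vec :: "('v, 'a, 'z) sdquiver_scheme \<Rightarrow> ('v \<Rightarrow> int) \<Rightarrow> 'v \<Rightarrow> int" where
  "sig_vec Q d = (\<lambda>i. if i \<in> nodes Q then d (sig0 Q i) else 0)"

definition Lambda_sig_pos :: "('v, 'a, 'z) sdquiver_scheme \<Rightarrow> ('v \<Rightarrow> int) set" where
  "Lambda_sig_pos Q = {d \<in> Lambda_pos Q. sig_vec Q d = d}"

definition hyp_vec :: "('v, 'a, 'z) sdquiver_scheme \<Rightarrow> ('v \<Rightarrow> int) \<Rightarrow> 'v \<Rightarrow> int" where
  "hyp_vec Q d = (\<lambda>i. d i + sig_vec Q d i)"

definition euler :: "('v, 'a, 'z) quiver_scheme \<Rightarrow> ('v \<Rightarrow> int) \<Rightarrow> ('v \<Rightarrow> int) \<Rightarrow> int" where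
  "euler Q d d' = (\<Sum>i\<in>nodes Q. d i * d' i) - (\<Sum>\<alpha>\<in>arrows Q. d (src Q \<alpha>) * d' (tgt Q \<alpha>))"

definition skew_euler :: "('v, 'a, 'z) quiver_scheme \<Rightarrow> ('v \<Rightarrow> int) \<Rightarrow> ('v \<Rightarrow> int) \<Rightarrow> int" where
  "skew_euler Q d d' = euler Q d d' - euler Q d' d"

text \<open>The function \<open>\<E>\<close>. The parameters \<open>P0\<close> and \<open>P1\<close> are the chosen \<open>Q\<^sub>0\<^sup>+\<close> and \<open>Q\<^sub>1\<^sup>+\<close>.
  Since \<open>s\<close> and \<open>\<tau>\<close> take values in \<open>{1, -1}\<close>, both integer divisions are exact.\<close>

definition sd_euler ::
  "('v, 'a, 'z) sdquiver_scheme \<Rightarrow> 'v set \<Rightarrow> 'a set \<Rightarrow> ('v \<Rightarrow> int) \<Rightarrow> int" where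
  "sd_euler Q P0 P1 d =
     (\<Sum>i\<in>{i \<in> nodes Q. sig0 Q i = i}. (d i * (d i - sgn_s Q i)) div 2)
   + (\<Sum>i\<in>P0. d (sig0 Q i) * d i)
   - (\<Sum>\<alpha>\<in>{\<alpha> \<in> arrows Q. sig1 Q \<alpha> = \<alpha>}.
        (d (tgt Q \<alpha>) * (d (tgt Q \<alpha>) + sgn_tau Q \<alpha> * sgn_s Q (tgt Q \<alpha>))) div 2)
   - (\<Sum>\<alpha>\<in>P1. d (sig0 Q (src Q \<alpha>)) * d (tgt Q \<alpha>))"

definition sd_euler_tilde ::
  "('v, 'a, 'z) sdquiver_scheme \<Rightarrow> 'v set \<Rightarrow> 'a set \<Rightarrow> ('v \<Rightarrow> int) \<Rightarrow> int" where
  "sd_euler_tilde Q P0 P1 d = sd_euler Q P0 P1 d - sd_euler Q P0 P1 (sig_vec Q d)"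


section \<open>Representations\<close>

text \<open>The ground field is the type \<open>'k\<close>; \<open>class_ring\<close> is that field as a HOL-Algebra ring. The
  vectors of a representation are the elements of the carriers of HOL-Algebra modules over it, with
  underlying type \<open>'w\<close>. Data off the carriers is meaningless and is ignored by isomorphisms.\<close>

record ('k, 'w, 'v, 'a) rep =
  vsp :: "'v \<Rightarrow> ('k, 'w) module"
  lmap :: "'a \<Rightarrow> 'w \<Rightarrow> 'w"

abbreviation vecs :: "('k, 'w, 'v, 'a, 'z) rep_scheme \<Rightarrow> 'v \<Rightarrow> 'w set" where
  "vecs M i \<equiv> carrier (vsp M i)"

definition is_rep ::
  "('v, 'a, 'y) quiver_scheme \<Rightarrow> ('k::field, 'w, 'v, 'a, 'z) rep_scheme \<Rightarrow> bool" where
  "is_rep Q M \<longleftrightarrow>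
     (\<forall>i\<in>nodes Q. vectorspace class_ring (vsp M i) \<and> vectorspace.fin_dim class_ring (vsp M i)) \<and>
     (\<forall>\<alpha>\<in>arrows Q. linear_map class_ring (vsp M (src Q \<alpha>)) (vsp M (tgt Q \<alpha>)) (lmap M \<alpha>))"

definition dim_vector ::
  "('v, 'a, 'y) quiver_scheme \<Rightarrow> ('k::field, 'w, 'v, 'a, 'z) rep_scheme \<Rightarrow> 'v \<Rightarrow> int" where
  "dim_vector Q M = (\<lambda>i. if i \<in> nodes Q then int (vectorspace.dim class_ring (vsp M i)) else 0)"

text \<open>Isomorphisms are made \<open>undefined\<close> off their domains, so that sets of isomorphisms have the
  intended cardinality.\<close>

definition rep_isos ::
  "('v, 'a, 'y) quiver_scheme \<Rightarrow> ('k::field, 'w, 'v, 'a, 'z) rep_scheme \<Rightarrow>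
   ('k, 'w', 'v, 'a, 'z') rep_scheme \<Rightarrow> ('v \<Rightarrow> 'w \<Rightarrow> 'w') set" where
  "rep_isos Q M M' = {\<phi> \<in> extensional (nodes Q).
     (\<forall>i\<in>nodes Q. \<phi> i \<in> extensional (vecs M i) \<and>
        linear_map class_ring (vsp M i) (vsp M' i) (\<phi> i) \<and>
        bij_betw (\<phi> i) (vecs M i) (vecs M' i)) \<and>
     (\<forall>\<alpha>\<in>arrows Q. \<forall>x\<in>vecs M (src Q \<alpha>).
        \<phi> (tgt Q \<alpha>) (lmap M \<alpha> x) = lmap M' \<alpha> (\<phi> (src Q \<alpha>) x))}"

definition rep_isomorphic ::
  "('v, 'a, 'y) quiver_scheme \<Rightarrow> ('k::field, 'w, 'v, 'a, 'z) rep_scheme \<Rightarrow>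
   ('k, 'w', 'v, 'a, 'z') rep_scheme \<Rightarrow> bool" where
  "rep_isomorphic Q M M' \<longleftrightarrow> rep_isos Q M M' \<noteq> {}"

definition aut_card ::
  "('v, 'a, 'y) quiver_scheme \<Rightarrow> ('k::field, 'w, 'v, 'a, 'z) rep_scheme \<Rightarrow> nat" where
  "aut_card Q M = card (rep_isos Q M M)"

text \<open>A subrepresentation of \<open>N\<close> is given by its family of underlying sets of vectors.\<close>

definition subreps ::
  "('v, 'a, 'y) quiver_scheme \<Rightarrow> ('k::field, 'w, 'v, 'a, 'z) rep_scheme \<Rightarrow> ('v \<Rightarrow> 'w set) set" where
  "subreps Q N = {U \<in> extensional (nodes Q).
     (\<forall>i\<in>nodes Q. VectorSpace.subspace class_ring (U i) (vsp N i)) \<and>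
     (\<forall>\<alpha>\<in>arrows Q. lmap N \<alpha> ` U (src Q \<alpha>) \<subseteq> U (tgt Q \<alpha>))}"

definition restrict_rep ::
  "('k, 'w, 'v, 'a, 'z) rep_scheme \<Rightarrow> ('v \<Rightarrow> 'w set) \<Rightarrow> ('k, 'w, 'v, 'a) rep" where
  "restrict_rep N U = \<lparr>vsp = (\<lambda>i. (vsp N i)\<lparr>carrier := U i\<rparr>), lmap = lmap N\<rparr>"

text \<open>The quotient \<open>V / W\<close>; the ring multiplication and one of the record are not part of the
  module structure. Adding \<open>W\<close> in the scalar multiplication makes \<open>0 \<cdot> (x + W) = W\<close>.\<close>

definition quot_space :: "('k, 'w, 'z) module_scheme \<Rightarrow> 'w set \<Rightarrow> ('k, 'w set) module" where
  "quot_space V W = \<lparr>carrier = a_rcosets\<^bsub>V\<^esub> W, mult = undefined, one = undefined, zero = W,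
     add = set_add V, smult = (\<lambda>c X. (\<lambda>x. c \<odot>\<^bsub>V\<^esub> x) ` X <+>\<^bsub>V\<^esub> W)\<rparr>"


section \<open>Self-dual representations\<close>

text \<open>A bilinear form on \<open>\<Oplus>\<^sub>i M\<^sub>i\<close> is given by its blocks \<open>form M i j\<close> on \<open>M\<^sub>i \<times> M\<^sub>j\<close>.\<close>

record ('k, 'w, 'v, 'a) sdrep = "('k, 'w, 'v, 'a) rep" +
  form :: "'v \<Rightarrow> 'v \<Rightarrow> 'w \<Rightarrow> 'w \<Rightarrow> 'k"

definition bilinear_form ::
  "('v, 'a, 'y) quiver_scheme \<Rightarrow> ('k::field, 'w, 'v, 'a, 'z) sdrep_scheme \<Rightarrow> bool" where
  "bilinear_form Q M \<longleftrightarrow> (\<forall>i\<in>nodes Q. \<forall>j\<in>nodes Q.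
     (\<forall>x\<in>vecs M i. \<forall>x'\<in>vecs M i. \<forall>y\<in>vecs M j.
        form M i j (x \<oplus>\<^bsub>vsp M i\<^esub> x') y = form M i j x y + form M i j x' y) \<and>
     (\<forall>x\<in>vecs M i. \<forall>y\<in>vecs M j. \<forall>y'\<in>vecs M j.
        form M i j x (y \<oplus>\<^bsub>vsp M j\<^esub> y') = form M i j x y + form M i j x y') \<and>
     (\<forall>c. \<forall>x\<in>vecs M i. \<forall>y\<in>vecs M j.
        form M i j (c \<odot>\<^bsub>vsp M i\<^esub> x) y = c * form M i j x y \<and>
        form M i j x (c \<odot>\<^bsub>vsp M j\<^esub> y) = c * form M i j x y))"

text \<open>The form on the direct sum, whose elements are families \<open>x\<close> with \<open>x i\<close> in \<open>M\<^sub>i\<close>.\<close>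

definition total_space ::
  "('v, 'a, 'y) quiver_scheme \<Rightarrow> ('k, 'w, 'v, 'a, 'z) rep_scheme \<Rightarrow> ('v \<Rightarrow> 'w) set" where
  "total_space Q M = (\<Pi>\<^sub>E i\<in>nodes Q. vecs M i)"

definition total_form ::
  "('v, 'a, 'y) quiver_scheme \<Rightarrow> ('k::field, 'w, 'v, 'a, 'z) sdrep_scheme \<Rightarrow>
   ('v \<Rightarrow> 'w) \<Rightarrow> ('v \<Rightarrow> 'w) \<Rightarrow> 'k" where
  "total_form Q M x y = (\<Sum>i\<in>nodes Q. \<Sum>j\<in>nodes Q. form M i j (x i) (y j))"

definition nondegenerate_form ::
  "('v, 'a, 'y) quiver_scheme \<Rightarrow> ('k::field, 'w, 'v, 'a, 'z) sdrep_scheme \<Rightarrow> bool" where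
  "nondegenerate_form Q M \<longleftrightarrow>
     (\<forall>x\<in>total_space Q M. (\<forall>y\<in>total_space Q M. total_form Q M x y = 0) \<longrightarrow>
        (\<forall>i\<in>nodes Q. x i = \<zero>\<^bsub>vsp M i\<^esub>)) \<and>
     (\<forall>y\<in>total_space Q M. (\<forall>x\<in>total_space Q M. total_form Q M x y = 0) \<longrightarrow>
        (\<forall>i\<in>nodes Q. y i = \<zero>\<^bsub>vsp M i\<^esub>))"

text \<open>In the fourth clause bilinearity reduces the condition for \<open>x, x'\<close> in \<open>M\<^sub>i + M\<^bsub>\<sigma>(i)\<^esub>\<close> to
  homogeneous \<open>x, x'\<close>.\<close>

definition is_sdrep ::
  "('v, 'a, 'y) sdquiver_scheme \<Rightarrow> ('k::field, 'w, 'v, 'a, 'z) sdrep_scheme \<Rightarrow> bool" where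
  "is_sdrep Q M \<longleftrightarrow> is_rep Q M \<and> bilinear_form Q M \<and> nondegenerate_form Q M \<and>
     (\<forall>i\<in>nodes Q. \<forall>j\<in>nodes Q. i \<noteq> sig0 Q j \<longrightarrow>
        (\<forall>x\<in>vecs M i. \<forall>x'\<in>vecs M j. form M i j x x' = 0)) \<and>
     (\<forall>i\<in>nodes Q. \<forall>a\<in>{i, sig0 Q i}. \<forall>b\<in>{i, sig0 Q i}. \<forall>x\<in>vecs M a. \<forall>x'\<in>vecs M b.
        form M a b x x' = of_int (sgn_s Q i) * form M b a x' x) \<and>
     (\<forall>\<alpha>\<in>arrows Q. \<forall>x\<in>vecs M (src Q \<alpha>). \<forall>x'\<in>vecs M (sig0 Q (tgt Q \<alpha>)).
        form M (tgt Q \<alpha>) (sig0 Q (tgt Q \<alpha>)) (lmap M \<alpha> x) x' =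
        of_int (sgn_tau Q \<alpha>) * form M (src Q \<alpha>) (sig0 Q (src Q \<alpha>)) x (lmap M (sig1 Q \<alpha>) x'))"

definition isometries ::
  "('v, 'a, 'y) quiver_scheme \<Rightarrow> ('k::field, 'w, 'v, 'a, 'z) sdrep_scheme \<Rightarrow>
   ('k, 'w', 'v, 'a, 'z') sdrep_scheme \<Rightarrow> ('v \<Rightarrow> 'w \<Rightarrow> 'w') set" where
  "isometries Q M M' = {\<phi> \<in> rep_isos Q M M'. \<forall>i\<in>nodes Q. \<forall>j\<in>nodes Q. \<forall>x\<in>vecs M i. \<forall>y\<in>vecs M j.
     form M' i j (\<phi> i x) (\<phi> j y) = form M i j x y}"

definition isometric ::
  "('v, 'a, 'y) quiver_scheme \<Rightarrow> ('k::field, 'w, 'v, 'a, 'z) sdrep_scheme \<Rightarrow>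
   ('k, 'w', 'v, 'a, 'z') sdrep_scheme \<Rightarrow> bool" where
  "isometric Q M M' \<longleftrightarrow> isometries Q M M' \<noteq> {}"

definition sd_aut_card ::
  "('v, 'a, 'y) quiver_scheme \<Rightarrow> ('k::field, 'w, 'v, 'a, 'z) sdrep_scheme \<Rightarrow> nat" where
  "sd_aut_card Q M = card (isometries Q M M)"

text \<open>The homogeneous components of \<open>U\<^sup>\<bottom>\<close>.\<close>

definition perp ::
  "('v, 'a, 'y) quiver_scheme \<Rightarrow> ('k::field, 'w, 'v, 'a, 'z) sdrep_scheme \<Rightarrow>
   ('v \<Rightarrow> 'w set) \<Rightarrow> 'v \<Rightarrow> 'w set" where
  "perp Q N U i = {x \<in> vecs N i. \<forall>j\<in>nodes Q. \<forall>u\<in>U j. form N i j x u = 0}"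

definition isotropic ::
  "('v, 'a, 'y) quiver_scheme \<Rightarrow> ('k::field, 'w, 'v, 'a, 'z) sdrep_scheme \<Rightarrow>
   ('v \<Rightarrow> 'w set) \<Rightarrow> bool" where
  "isotropic Q N U \<longleftrightarrow> (\<forall>i\<in>nodes Q. U i \<subseteq> perp Q N U i)"

text \<open>The reduction \<open>N // U = U\<^sup>\<bottom> / U\<close> for isotropic \<open>U\<close>; the arrows and the form act on cosets
  through representatives.\<close>

definition sd_reduction ::
  "('v, 'a, 'y) quiver_scheme \<Rightarrow> ('k::field, 'w, 'v, 'a, 'z) sdrep_scheme \<Rightarrow>
   ('v \<Rightarrow> 'w set) \<Rightarrow> ('k, 'w set, 'v, 'a) sdrep" where
  "sd_reduction Q N U =
     \<lparr>vsp = (\<lambda>i. quot_space ((vsp N i)\<lparr>carrier := perp Q N U i\<rparr>) (U i)),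
      lmap = (\<lambda>\<alpha> X. lmap N \<alpha> ` X <+>\<^bsub>vsp N (tgt Q \<alpha>)\<^esub> U (tgt Q \<alpha>)),
      form = (\<lambda>i j X Y. form N i j (SOME x. x \<in> X) (SOME y. y \<in> Y))\<rparr>"


section \<open>The Hall algebra and the Hall module\<close>

text \<open>All representations in a class have their vectors in one type \<open>'w\<close>. The theorem takes \<open>'w\<close> to
  be infinite, so that over a finite field every representation, and every self-dual one, has an
  isomorphic (isometric) copy there.\<close>

definition iso_classes ::
  "('v, 'a, 'y) quiver_scheme \<Rightarrow> ('k::field, 'w, 'v, 'a) rep set set" where
  "iso_classes Q = {M. is_rep Q M} //
     {(M, M'). is_rep Q M \<and> is_rep Q M' \<and> rep_isomorphic Q M M'}"

definition isometry_classes ::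
  "('v, 'a, 'y) sdquiver_scheme \<Rightarrow> ('k::field, 'w, 'v, 'a) sdrep set set" where
  "isometry_classes Q = {M. is_sdrep Q M} //
     {(M, M'). is_sdrep Q M \<and> is_sdrep Q M' \<and> isometric Q M M'}"

definition representative :: "'b set \<Rightarrow> 'b" where
  "representative C = (SOME M. M \<in> C)"

text \<open>The underlying \<open>\<rat>\<close>-vector spaces: finitely supported functions on the set of classes.\<close>

definition hall_algebra ::
  "('v, 'a, 'y) quiver_scheme \<Rightarrow> (('k::field, 'w, 'v, 'a) rep set \<Rightarrow> rat) set" where
  "hall_algebra Q = {f. finite {C. f C \<noteq> 0} \<and> {C. f C \<noteq> 0} \<subseteq> iso_classes Q}"

definition hall_module ::
  "('v, 'a, 'y) sdquiver_scheme \<Rightarrow> (('k::field, 'w, 'v, 'a) sdrep set \<Rightarrow> rat) set" where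
  "hall_module Q = {m. finite {D. m D \<noteq> 0} \<and> {D. m D \<noteq> 0} \<subseteq> isometry_classes Q}"

definition hall_G ::
  "('v, 'a, 'y) sdquiver_scheme \<Rightarrow> ('k::field, 'w, 'v, 'a) rep \<Rightarrow> ('k, 'w, 'v, 'a) sdrep \<Rightarrow>
   ('k, 'w, 'v, 'a) sdrep \<Rightarrow> nat" where
  "hall_G Q U M N = card {U' \<in> subreps Q N. rep_isomorphic Q (restrict_rep N U') U \<and>
     isotropic Q N U' \<and> isometric Q (sd_reduction Q N U') M}"

definition hall_act ::
  "('v, 'a, 'y) sdquiver_scheme \<Rightarrow> (('k::field, 'w, 'v, 'a) rep set \<Rightarrow> rat) \<Rightarrow>
   (('k, 'w, 'v, 'a) sdrep set \<Rightarrow> rat) \<Rightarrow> ('k, 'w, 'v, 'a) sdrep set \<Rightarrow> rat" where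
  "hall_act Q f m = (\<lambda>N. if N \<in> isometry_classes Q then
     (\<Sum>C\<in>{C. f C \<noteq> 0}. \<Sum>D\<in>{D. m D \<noteq> 0}. f C * m D *
        of_nat (hall_G Q (representative C) (representative D) (representative N)))
     else 0)"


section \<open>The quantum torus and its module\<close>

text \<open>As \<open>q\<close> is a prime power, \<open>\<rat>(q\<^bsup>1/2\<^esup>)\<close> is the subfield of the reals generated by \<open>\<surd>q\<close>;
  the square of \<open>\<surd>q\<close> is rational, so its elements are the \<open>a + b \<surd>q\<close>.\<close>

definition Q_sqrt :: "nat \<Rightarrow> real set" where
  "Q_sqrt q = {of_rat a + of_rat b * sqrt (real q) | a b. True}"

definition qhalf :: "nat \<Rightarrow> int \<Rightarrow> real" where
  "qhalf q n = sqrt (real q) powi n"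

text \<open>Arbitrary families of coefficients are allowed, since the bases are topological.\<close>

definition quantum_torus :: "nat \<Rightarrow> ('v, 'a, 'z) quiver_scheme \<Rightarrow> (('v \<Rightarrow> int) \<Rightarrow> real) set" where
  "quantum_torus q Q = {t. (\<forall>d. t d \<in> Q_sqrt q) \<and> (\<forall>d. d \<notin> Lambda_pos Q \<longrightarrow> t d = 0)}"

definition torus_module :: "nat \<Rightarrow> ('v, 'a, 'z) sdquiver_scheme \<Rightarrow> (('v \<Rightarrow> int) \<Rightarrow> real) set" where
  "torus_module q Q = {t. (\<forall>e. t e \<in> Q_sqrt q) \<and> (\<forall>e. e \<notin> Lambda_sig_pos Q \<longrightarrow> t e = 0)}"

text \<open>The basis vectors \<open>x\<^sub>d\<close> and \<open>\<xi>\<^sub>e\<close>.\<close>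

definition basis_vec :: "('v \<Rightarrow> int) \<Rightarrow> ('v \<Rightarrow> int) \<Rightarrow> real" where
  "basis_vec d = (\<lambda>d'. if d' = d then 1 else 0)"

text \<open>The continuous bilinear extension of
  \<open>x\<^sub>d \<star> \<xi>\<^sub>e = q\<^bsup>(\<langle>d,e\<rangle> - \<E>~(d))/2\<^esup> \<xi>\<^bsub>H(d)+e\<^esub>\<close>; all \<open>d\<close> and \<open>e\<close> are nonnegative, so
  each coefficient is a finite sum.\<close>

definition torus_act ::
  "nat \<Rightarrow> ('v, 'a, 'z) sdquiver_scheme \<Rightarrow> 'v set \<Rightarrow> 'a set \<Rightarrow>
   (('v \<Rightarrow> int) \<Rightarrow> real) \<Rightarrow> (('v \<Rightarrow> int) \<Rightarrow> real) \<Rightarrow> ('v \<Rightarrow> int) \<Rightarrow> real" where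
  "torus_act q Q P0 P1 t u = (\<lambda>c.
     \<Sum>(d, e) \<in> {(d, e). d \<in> Lambda_pos Q \<and> e \<in> Lambda_sig_pos Q \<and> (\<lambda>i. hyp_vec Q d i + e i) = c}.
       t d * u e * qhalf q (skew_euler Q d e - sd_euler_tilde Q P0 P1 d))"


section \<open>The integration maps\<close>

definition int_H ::
  "('v, 'a, 'y) quiver_scheme \<Rightarrow> (('k::field, 'w, 'v, 'a) rep set \<Rightarrow> rat) \<Rightarrow>
   ('v \<Rightarrow> int) \<Rightarrow> real" where
  "int_H Q f = (\<lambda>d. \<Sum>C\<in>{C. f C \<noteq> 0}. of_rat (f C) *
     (let U = representative C; dU = dim_vector Q U in
        qhalf CARD('k) (euler Q dU dU) / real (aut_card Q U) * basis_vec dU d))"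

definition int_M ::
  "('v, 'a, 'y) sdquiver_scheme \<Rightarrow> 'v set \<Rightarrow> 'a set \<Rightarrow>
   (('k::field, 'w, 'v, 'a) sdrep set \<Rightarrow> rat) \<Rightarrow> ('v \<Rightarrow> int) \<Rightarrow> real" where
  "int_M Q P0 P1 m = (\<lambda>e. \<Sum>D\<in>{D. m D \<noteq> 0}. of_rat (m D) *
     (let M = representative D; dM = dim_vector Q M in
        qhalf CARD('k) (sd_euler Q P0 P1 dM) / real (sd_aut_card Q M) * basis_vec dM e))"


section \<open>The integration maps land in the quantum torus and its module\<close>

lemma Q_sqrt_0 [simp]: "0 \<in> Q_sqrt q"
  unfolding Q_sqrt_def by (rule CollectI, rule exI[of _ 0], rule exI[of _ 0]) simp

lemma Q_sqrt_of_rat [simp]: "of_rat r \<in> Q_sqrt q"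
  unfolding Q_sqrt_def by (rule CollectI, rule exI[of _ r], rule exI[of _ 0]) simp

lemma Q_sqrt_add: "x \<in> Q_sqrt q \<Longrightarrow> y \<in> Q_sqrt q \<Longrightarrow> x + y \<in> Q_sqrt q"
proof -
  assume "x \<in> Q_sqrt q" "y \<in> Q_sqrt q"
  then obtain a b a' b' where
    "x = of_rat a + of_rat b * sqrt q" "y = of_rat a' + of_rat b' * sqrt q"
    unfolding Q_sqrt_def by auto
  then have "x + y = of_rat (a + a') + of_rat (b + b') * sqrt q"
    by (simp add: of_rat_add algebra_simps)
  then show ?thesis unfolding Q_sqrt_def by blast
qed

lemma Q_sqrt_mult: "x \<in> Q_sqrt q \<Longrightarrow> y \<in> Q_sqrt q \<Longrightarrow> x * y \<in> Q_sqrt q"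
proof -
  assume "x \<in> Q_sqrt q" "y \<in> Q_sqrt q"
  then obtain a b a' b' where
    "x = of_rat a + of_rat b * sqrt q" "y = of_rat a' + of_rat b' * sqrt q"
    unfolding Q_sqrt_def by auto
  then have "x * y = of_rat a * of_rat a' + of_rat b * of_rat b' * (sqrt q * sqrt q)
      + (of_rat a * of_rat b' + of_rat b * of_rat a') * sqrt q"
    by (simp only: algebra_simps)
  also have "\<dots> = of_rat (a * a' + b * b' * of_nat q) + of_rat (a * b' + b * a') * sqrt q"
    by (simp add: of_rat_add of_rat_mult)
  finally show ?thesis unfolding Q_sqrt_def by blast
qed

lemma Q_sqrt_sum: "(\<And>x. x \<in> A \<Longrightarrow> g x \<in> Q_sqrt q) \<Longrightarrow> sum g A \<in> Q_sqrt q"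
  by (induction A rule: infinite_finite_induct) (auto intro: Q_sqrt_add)

lemma Q_sqrt_qhalf: "qhalf q n \<in> Q_sqrt q"
proof -
  have s: "sqrt (real q) \<in> Q_sqrt q"
    unfolding Q_sqrt_def by (rule CollectI, rule exI[of _ 0], rule exI[of _ 1]) simp
  have one: "1 \<in> Q_sqrt q" using Q_sqrt_of_rat[of 1 q] by simp
  have pow: "x ^ k \<in> Q_sqrt q" if "x \<in> Q_sqrt q" for x k
    using that by (induction k) (auto intro: Q_sqrt_mult one)
  have "inverse (sqrt (real q)) = of_rat (inverse (of_nat q)) * sqrt (real q)"
    by (cases "q = 0") (auto simp: of_rat_inverse nonzero_of_rat_inverse field_simps of_rat_divide simp flip: mult.assoc)
  then have "inverse (sqrt (real q)) \<in> Q_sqrt q"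
    using Q_sqrt_mult[OF Q_sqrt_of_rat s] by simp
  then show ?thesis
    unfolding qhalf_def power_int_def using s by (auto intro: pow)
qed

lemma Q_sqrt_coeff: "of_rat r * (qhalf q n / real k * basis_vec d d') \<in> Q_sqrt q"
proof -
  have "inverse (real k) = of_rat (inverse (of_nat k))" "basis_vec d d' = of_rat (if d' = d then 1 else 0)"
    by (auto simp: of_rat_inverse basis_vec_def)
  then show ?thesis
    unfolding divide_inverse by (metis Q_sqrt_mult Q_sqrt_of_rat Q_sqrt_qhalf)
qed

lemma int_H_in_quantum_torus:
  fixes f :: "('k::{field, finite}, 'w, 'v, 'a) rep set \<Rightarrow> rat"
  shows "int_H Q f \<in> quantum_torus CARD('k) Q"
proof -
  have "dim_vector Q M \<in> Lambda_pos Q" for M :: "('k, 'w, 'v, 'a) rep"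
    unfolding dim_vector_def Lambda_pos_def by auto
  then have "basis_vec (dim_vector Q M) d = 0" if "d \<notin> Lambda_pos Q" for M :: "('k, 'w, 'v, 'a) rep" and d
    using that unfolding basis_vec_def by auto
  then show ?thesis
    unfolding quantum_torus_def int_H_def Let_def
    by (intro CollectI conjI allI impI Q_sqrt_sum Q_sqrt_coeff sum.neutral) simp_all
qed

lemma dim_le_of_pairing:
  fixes V :: "('k::field, 'b) module" and W :: "('k, 'c) module"
  assumes V: "vectorspace class_ring V" "vectorspace.fin_dim class_ring V"
    and W: "vectorspace class_ring W" "vectorspace.fin_dim class_ring W"
    and add1: "\<And>x x' y. x \<in> carrier V \<Longrightarrow> x' \<in> carrier V \<Longrightarrow> y \<in> carrier W \<Longrightarrow> B (x \<oplus>\<^bsub>V\<^esub> x') y = B x y + B x' y"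
    and add2: "\<And>x y y'. x \<in> carrier V \<Longrightarrow> y \<in> carrier W \<Longrightarrow> y' \<in> carrier W \<Longrightarrow> B x (y \<oplus>\<^bsub>W\<^esub> y') = B x y + B x y'"
    and sm1: "\<And>c x y. x \<in> carrier V \<Longrightarrow> y \<in> carrier W \<Longrightarrow> B (c \<odot>\<^bsub>V\<^esub> x) y = c * (B x y :: 'k)"
    and sm2: "\<And>c x y. x \<in> carrier V \<Longrightarrow> y \<in> carrier W \<Longrightarrow> B x (c \<odot>\<^bsub>W\<^esub> y) = c * B x y"
    and nd: "\<And>x. x \<in> carrier V \<Longrightarrow> (\<And>y. y \<in> carrier W \<Longrightarrow> B x y = 0) \<Longrightarrow> x = \<zero>\<^bsub>V\<^esub>"
  shows "vectorspace.dim class_ring V \<le> vectorspace.dim class_ring W"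
proof -
  interpret V: vectorspace class_ring V by (rule V)
  interpret W: vectorspace class_ring W by (rule W)
  obtain S where S: "finite S" "W.basis S" using W.finite_basis_exists[OF W(2)] by blast
  define n where "n = W.dim"
  have cS: "card S = n" using W.dim_basis[OF S] n_def by simp
  obtain bs where bs: "set bs = S" "length bs = n"
    using finite_distinct_list[OF S(1)] distinct_card cS by metis
  have SW: "S \<subseteq> carrier W" and gen: "W.span S = carrier W" using S(2) by (auto simp: W.basis_def)
  interpret K: vec_space "TYPE('k)" n .
  define T where "T x = vec n (\<lambda>i. B x (bs ! i))" for x
  have bsW: "bs ! i \<in> carrier W" if "i < n" for i using that bs SW nth_mem by blast
  have "T \<in> LinearCombinations.module_hom class_ring V (module_vec TYPE('k) n)"
    unfolding LinearCombinations.module_hom_def T_def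
    by (auto simp: module_vec_simps bsW add1 sm1 intro!: eq_vecI)
  then interpret T: linear_map class_ring V "module_vec TYPE('k) n" T
    by unfold_locales
  have zero2: "B x \<zero>\<^bsub>W\<^esub> = 0" if "x \<in> carrier V" for x
    using add2[OF that W.zero_closed W.zero_closed] W.l_zero[OF W.zero_closed]
    by (metis add_cancel_left_right)
  have inj0: "x = \<zero>\<^bsub>V\<^esub>" if x: "x \<in> carrier V" and Tx: "T x = 0\<^sub>v n" for x
  proof (rule nd[OF x])
    have "B x b = 0" if "b \<in> S" for b
    proof -
      have "\<exists>i < length bs. bs ! i = b" using that unfolding bs(1)[symmetric] in_set_conv_nth .
      then obtain i where i: "i < n" "b = bs ! i" unfolding bs(2) by blast
      have "T x $ i = B x b" unfolding T_def i(2) using i(1) by (rule index_vec)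
      moreover have "T x $ i = 0" unfolding Tx using i(1) by (rule index_zero_vec(1))
      ultimately show ?thesis by (rule trans[OF sym])
    qed
    then have "S \<subseteq> {y \<in> carrier W. B x y = 0}" using SW by auto
    moreover have "LinearCombinations.submodule class_ring {y \<in> carrier W. B x y = 0} W"
      by unfold_locales (auto simp: x add2 sm2 zero2)
    ultimately have "W.span S \<subseteq> {y \<in> carrier W. B x y = 0}"
      by (rule W.span_is_subset)
    then show "B x y = 0" if "y \<in> carrier W" for y using that gen by auto
  qed
  have inj: "inj_on T (carrier V)"
  proof (rule T.Ke0_imp_inj)
    show "carrier (V.vs T.kerT) = {\<zero>\<^bsub>V\<^esub>}"
      unfolding T.ker_def using inj0 T.f0_is_0 by (auto simp: module_vec_simps)
  qed
  obtain A where A: "finite A" "V.basis A" using V.finite_basis_exists[OF V(2)] by blast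
  have AV: "A \<subseteq> carrier V" and li: "V.lin_indpt A" using A(2) by (auto simp: V.basis_def)
  have "K.lin_indpt (T ` A)"
  proof (rule K.finite_lin_indpt2)
    show "finite (T ` A)" using A(1) by simp
    show "T ` A \<subseteq> carrier_vec n" unfolding T_def by auto
    fix a :: "'k vec \<Rightarrow> 'k" assume lc: "K.lincomb a (T ` A) = 0\<^sub>v n"
    have "T (V.lincomb (a \<circ> T) A) = 0\<^sub>v n"
      using T.lincomb_linear_image[OF inj AV _ A(1), of a] lc by simp
    moreover have "V.lincomb (a \<circ> T) A \<in> carrier V" using AV by (intro V.lincomb_closed) auto
    ultimately have "V.lincomb (a \<circ> T) A = \<zero>\<^bsub>V\<^esub>" using inj0 by blast
    then have "a \<circ> T \<in> A \<rightarrow> {\<zero>\<^bsub>class_ring\<^esub>}"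
      by (intro V.not_lindepD[OF li A(1)]) auto
    then show "\<forall>v\<in>T ` A. a v = 0" by auto
  qed
  then have "card (T ` A) \<le> K.dim" by (intro K.li_le_dim) (auto simp: T_def)
  moreover have "card (T ` A) = V.dim"
    using V.dim_basis[OF A] card_image[OF inj_on_subset[OF inj AV]] by simp
  ultimately have "V.dim \<le> n" using K.dim_is_n by simp
  then show ?thesis unfolding n_def .
qed

lemma block_nondegenerate:
  assumes Q: "sd_quiver Q" and M: "is_sdrep Q M" and i: "i \<in> nodes Q"
    and x: "x \<in> vecs M i" and z: "\<And>y. y \<in> vecs M (sig0 Q i) \<Longrightarrow> form M i (sig0 Q i) x y = 0"
  shows "x = \<zero>\<^bsub>vsp M i\<^esub>"
proof -
  have vs: "vectorspace class_ring (vsp M j)" if "j \<in> nodes Q" for j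
    using M that unfolding is_sdrep_def is_rep_def by auto
  have fin: "finite (nodes Q)" and sg: "sig0 Q (sig0 Q j) = j" "sig0 Q j \<in> nodes Q" if "j \<in> nodes Q" for j
    using Q that unfolding sd_quiver_def quiver_def quiver_involution_def by auto
  have zc: "\<zero>\<^bsub>vsp M j\<^esub> \<in> vecs M j" if "j \<in> nodes Q" for j
  proof -
    interpret vectorspace class_ring "vsp M j" by (rule vs[OF that])
    show ?thesis by simp
  qed
  have bil: "form M j l (c \<odot>\<^bsub>vsp M j\<^esub> u) w = c * form M j l u w"
    if "j \<in> nodes Q" "l \<in> nodes Q" "u \<in> vecs M j" "w \<in> vecs M l" for j l c u w
    using M that unfolding is_sdrep_def bilinear_form_def by blast
  have z1: "form M j l \<zero>\<^bsub>vsp M j\<^esub> w = 0" if "j \<in> nodes Q" "l \<in> nodes Q" "w \<in> vecs M l" for j l w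
  proof -
    interpret vectorspace class_ring "vsp M j" by (rule vs[OF that(1)])
    have "0 \<odot>\<^bsub>vsp M j\<^esub> \<zero>\<^bsub>vsp M j\<^esub> = \<zero>\<^bsub>vsp M j\<^esub>" by simp
    then show ?thesis using bil[OF that(1,2) zc[OF that(1)] that(3), of 0] by simp
  qed
  have orth: "form M j l u w = 0" if "j \<in> nodes Q" "l \<in> nodes Q" "j \<noteq> sig0 Q l" "u \<in> vecs M j" "w \<in> vecs M l" for j l u w
    using M that unfolding is_sdrep_def by blast
  define X where "X = (\<lambda>j\<in>nodes Q. if j = i then x else \<zero>\<^bsub>vsp M j\<^esub>)"
  have X: "X \<in> total_space Q M" unfolding X_def total_space_def using x zc by auto
  have "total_form Q M X Y = 0" if Y: "Y \<in> total_space Q M" for Y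
    unfolding total_form_def
  proof (intro sum.neutral ballI)
    fix j l assume jl: "j \<in> nodes Q" "l \<in> nodes Q"
    have Yl: "Y l \<in> vecs M l" using Y jl unfolding total_space_def by auto
    show "form M j l (X j) (Y l) = 0"
    proof (cases "j = i")
      case True
      show ?thesis
      proof (cases "l = sig0 Q i")
        case True with \<open>j = i\<close> show ?thesis using z Yl jl unfolding X_def by auto
      next
        case False
        then have "j \<noteq> sig0 Q l" using \<open>j = i\<close> sg jl by auto
        then show ?thesis using orth[OF jl _ _ Yl] X jl unfolding total_space_def by auto
      qed
    next
      case False
      then show ?thesis using z1[OF jl Yl] jl unfolding X_def by auto
    qed
  qed
  then have "X i = \<zero>\<^bsub>vsp M i\<^esub>"
    using M X i unfolding is_sdrep_def nondegenerate_form_def by blast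
  then show ?thesis using i unfolding X_def by simp
qed

lemma sdrep_dim_vector:
  assumes Q: "sd_quiver Q" and M: "is_sdrep Q M"
  shows "dim_vector Q M \<in> Lambda_sig_pos Q"
proof -
  have sg: "sig0 Q (sig0 Q j) = j" "sig0 Q j \<in> nodes Q" if "j \<in> nodes Q" for j
    using Q that unfolding sd_quiver_def quiver_involution_def by auto
  have vs: "vectorspace class_ring (vsp M j)" "vectorspace.fin_dim class_ring (vsp M j)"
    if "j \<in> nodes Q" for j
    using M that unfolding is_sdrep_def is_rep_def by auto
  have bil: "bilinear_form Q M" using M unfolding is_sdrep_def by blast
  have le: "vectorspace.dim class_ring (vsp M i) \<le> vectorspace.dim class_ring (vsp M (sig0 Q i))"
    if i: "i \<in> nodes Q" for i
  proof (rule dim_le_of_pairing[where B = "form M i (sig0 Q i)"])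
    show "x = \<zero>\<^bsub>vsp M i\<^esub>"
      if "x \<in> vecs M i" "\<And>y. y \<in> vecs M (sig0 Q i) \<Longrightarrow> form M i (sig0 Q i) x y = 0" for x
      using block_nondegenerate[OF Q M i that(1)] that(2) by blast
  qed (use i vs sg bil in \<open>auto simp: bilinear_form_def\<close>)
  have "vectorspace.dim class_ring (vsp M (sig0 Q i)) = vectorspace.dim class_ring (vsp M i)"
    if "i \<in> nodes Q" for i
    using le[OF that] le[OF sg(2)[OF that]] sg(1)[OF that] by simp
  then show ?thesis
    unfolding Lambda_sig_pos_def Lambda_pos_def sig_vec_def dim_vector_def using sg by auto
qed

lemma isometric_refl:
  assumes Q: "quiver Q" and M: "is_rep Q M"
  shows "isometric Q M M"
proof -
  define \<phi> where "\<phi> = (\<lambda>i\<in>nodes Q. \<lambda>x\<in>vecs M i. x)"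
  have \<phi>: "\<phi> i x = x"
    if "i \<in> nodes Q" "x \<in> vecs M i" for i x
    unfolding \<phi>_def using that by auto
  have ext: "\<phi> \<in> extensional (nodes Q)" "\<And>i. i \<in> nodes Q \<Longrightarrow> \<phi> i \<in> extensional (vecs M i)"
    unfolding \<phi>_def by auto
  have lin: "linear_map class_ring (vsp M i) (vsp M i) (\<phi> i)" if i: "i \<in> nodes Q" for i
  proof -
    interpret vectorspace class_ring "vsp M i" using M i unfolding is_rep_def by auto
    show ?thesis using \<phi>[OF i] by unfold_locales (auto simp: LinearCombinations.module_hom_def)
  qed
  have bij: "bij_betw (\<phi> i) (vecs M i) (vecs M i)" if "i \<in> nodes Q" for i
    using bij_betw_id \<phi>[OF that] by (subst bij_betw_cong[where g = id]) auto
  have arr: "lmap M \<alpha> x \<in> vecs M (tgt Q \<alpha>)" "src Q \<alpha> \<in> nodes Q" "tgt Q \<alpha> \<in> nodes Q"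
    if "\<alpha> \<in> arrows Q" "x \<in> vecs M (src Q \<alpha>)" for \<alpha> x
  proof -
    interpret linear_map class_ring "vsp M (src Q \<alpha>)" "vsp M (tgt Q \<alpha>)" "lmap M \<alpha>"
      using M that unfolding is_rep_def by auto
    show "lmap M \<alpha> x \<in> vecs M (tgt Q \<alpha>)" using that by simp
    show "src Q \<alpha> \<in> nodes Q" "tgt Q \<alpha> \<in> nodes Q" using Q that unfolding quiver_def by auto
  qed
  have comm: "\<phi> (tgt Q \<alpha>) (lmap M \<alpha> x) = lmap M \<alpha> (\<phi> (src Q \<alpha>) x)"
    if "\<alpha> \<in> arrows Q" "x \<in> vecs M (src Q \<alpha>)" for \<alpha> x
    using \<phi>[OF arr(3)[OF that] arr(1)[OF that]] \<phi>[OF arr(2)[OF that] that(2)] by simp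
  have "\<phi> \<in> isometries Q M M"
    unfolding isometries_def rep_isos_def using ext lin bij comm \<phi> by auto
  then show ?thesis unfolding isometric_def by blast
qed

lemma int_M_in_torus_module:
  fixes m :: "('k::{field, finite}, 'w, 'v, 'a) sdrep set \<Rightarrow> rat"
  assumes Q: "sd_quiver Q" and m: "m \<in> hall_module Q"
  shows "int_M Q P0 P1 m \<in> torus_module CARD('k) Q"
proof -
  have "basis_vec (dim_vector Q (representative D)) e = 0"
    if "m D \<noteq> 0" "e \<notin> Lambda_sig_pos Q" for D e
  proof -
    have "D \<in> isometry_classes Q" using m that unfolding hall_module_def by auto
    then obtain M :: "('k, 'w, 'v, 'a) sdrep" where "M \<in> {M. is_sdrep Q M}"
      "D = {(M, M'). is_sdrep Q M \<and> is_sdrep Q M' \<and> isometric Q M M'} `` {M}"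
      unfolding isometry_classes_def by (rule quotientE)
    then have M: "is_sdrep Q M" "D = {M'. is_sdrep Q M' \<and> isometric Q M M'}" by auto
    then have "M \<in> D" using isometric_refl Q unfolding sd_quiver_def is_sdrep_def by blast
    then have "representative D \<in> D" unfolding representative_def by (rule someI)
    then show ?thesis
      using sdrep_dim_vector[OF Q] M that unfolding basis_vec_def by auto
  qed
  then show ?thesis
    unfolding torus_module_def int_M_def Let_def
    by (intro CollectI conjI allI impI Q_sqrt_sum Q_sqrt_coeff sum.neutral) simp_all
qed

end

theory Submission
  imports Defs
begin

text \<open>
  Fix representations \<open>U\<close> and \<open>M\<close> with bases. A frame of a self-dual representation \<open>N\<close> is a basis
  of \<open>N\<close> for which the form is the hyperbolic form on \<open>U \<oplus> \<sigma>(U)\<close> plus the form of \<open>M\<close> and the structure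
  maps are block triangular, with the matrices of \<open>U\<close>, \<open>M\<close> and the dual of \<open>U\<close> on the diagonal.
  Frames are counted in two ways. The possible structure matrices are described by an arbitrary block
  \<open>\<beta>\<close> and a twisted symmetric block \<open>C\<close>; since all bases with given matrices form an \<open>Aut\<^sub>S(N)\<close>-torsor,
  the sum over \<open>N\<close> of the number of frames divided by \<open>#Aut\<^sub>S(N)\<close> is the number of pairs \<open>(\<beta>, C)\<close>.
  On the other hand, a frame of \<open>N\<close> amounts to an isotropic copy of \<open>U\<close> with a basis, a basis of the
  reduction, lifts of the latter and a dual isotropic family; the last choice comes down to solving
  \<open>C + s C\<^sup>T = D\<close>, which is possible in odd characteristic. So the number of frames is
  \<open>G #Aut(U) #Aut\<^sub>S(M)\<close> times a power of \<open>q\<close> that does not depend on \<open>N\<close>,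
  where \<open>G\<close> is the structure constant of the Hall module.
  The difference of the two exponents of \<open>q\<close> is \<open>-\<chi>(m, u) - \<E>(u)\<close>, with \<open>u\<close>, \<open>m\<close> the dimension
  vectors of \<open>U\<close>, \<open>M\<close>, and the identity
  \<open>\<E>(a + b) = \<E>(a) + \<E>(b) + \<chi>(\<sigma>(a), b)\<close> matches this with the twist in the action on \<open>\<xi>\<^sub>e\<close>.
\<close>

section \<open>Coordinates and bases\<close>

text \<open>Bases are counted rather than group elements because the objects to be compared live on
  different types: a subrepresentation has vectors in \<open>'w\<close>, a reduction has vectors in
  \<open>'w set\<close>. Matrices over a common index type make them comparable, and the infinity of
  \<open>'w\<close> ensures that every admissible set of matrices is realized by some isometry
  class.

  The exponents have the following origin. The lifts of a basis of the reduction give the node part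
  of \<chi>(m, u), and the block \<beta> gives its arrow part. The dual isotropic family is governed
  by index pairs over nodes, and the block C by index pairs over arrows. Both are solution sets of a
  twisted symmetry equation, whose dimension is half the number of pairs, corrected by the signs at
  the pairs fixed by the involution. These fixed pairs produce the linear terms of \<E>. The
  inhomogeneous term D depends on N and on choices, but the number of solutions does not; this is
  why the power of q is constant. The comparison goes through 2\<E>(d) = \<chi>(\<sigma>(d), d)
  minus a linear part, which is free of the chosen positive parts \<open>P0\<close> and
  \<open>P1\<close>.\<close>

definition lsum :: "('k::field, 'w, 'z) module_scheme \<Rightarrow> 'x set \<Rightarrow> ('x \<Rightarrow> 'k) \<Rightarrow> ('x \<Rightarrow> 'w) \<Rightarrow> 'w" where
  "lsum V B c b = (\<Oplus>\<^bsub>V\<^esub>x\<in>B. c x \<odot>\<^bsub>V\<^esub> b x)"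

lemma vectorspace_simps:
  fixes V :: "('k::field, 'w, 'z) module_scheme"
  assumes "vectorspace class_ring V"
  shows "\<And>x y. x \<in> carrier V \<Longrightarrow> y \<in> carrier V \<Longrightarrow> x \<oplus>\<^bsub>V\<^esub> y \<in> carrier V"
    and "\<And>c x. x \<in> carrier V \<Longrightarrow> c \<odot>\<^bsub>V\<^esub> x \<in> carrier V"
    and "\<zero>\<^bsub>V\<^esub> \<in> carrier V"
    and "\<And>x. x \<in> carrier V \<Longrightarrow> 0 \<odot>\<^bsub>V\<^esub> x = \<zero>\<^bsub>V\<^esub>"
    and "\<And>x. x \<in> carrier V \<Longrightarrow> 1 \<odot>\<^bsub>V\<^esub> x = x"
    and "\<And>x. x \<in> carrier V \<Longrightarrow> \<zero>\<^bsub>V\<^esub> \<oplus>\<^bsub>V\<^esub> x = x"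
    and "\<And>x. x \<in> carrier V \<Longrightarrow> x \<oplus>\<^bsub>V\<^esub> \<zero>\<^bsub>V\<^esub> = x"
    and "\<And>c. c \<odot>\<^bsub>V\<^esub> \<zero>\<^bsub>V\<^esub> = \<zero>\<^bsub>V\<^esub>"
proof -
  interpret V: vectorspace class_ring V by fact
  show "\<And>x y. x \<in> carrier V \<Longrightarrow> y \<in> carrier V \<Longrightarrow> x \<oplus>\<^bsub>V\<^esub> y \<in> carrier V" by simp
  show "\<And>c x. x \<in> carrier V \<Longrightarrow> c \<odot>\<^bsub>V\<^esub> x \<in> carrier V" by simp
  show "\<zero>\<^bsub>V\<^esub> \<in> carrier V" by simp
  show "\<And>x. x \<in> carrier V \<Longrightarrow> 0 \<odot>\<^bsub>V\<^esub> x = \<zero>\<^bsub>V\<^esub>"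
    using V.smult_l_null by simp
  show "\<And>x. x \<in> carrier V \<Longrightarrow> 1 \<odot>\<^bsub>V\<^esub> x = x" using V.smult_one by simp
  show "\<And>x. x \<in> carrier V \<Longrightarrow> \<zero>\<^bsub>V\<^esub> \<oplus>\<^bsub>V\<^esub> x = x" by simp
  show "\<And>x. x \<in> carrier V \<Longrightarrow> x \<oplus>\<^bsub>V\<^esub> \<zero>\<^bsub>V\<^esub> = x" by simp
  show "\<And>c. c \<odot>\<^bsub>V\<^esub> \<zero>\<^bsub>V\<^esub> = \<zero>\<^bsub>V\<^esub>" by simp
qed

lemma vectorspace_distrib:
  fixes V :: "('k::field, 'w, 'z) module_scheme"
  assumes "vectorspace class_ring V"
  shows "\<And>c x y. x \<in> carrier V \<Longrightarrow> y \<in> carrier V \<Longrightarrow> c \<odot>\<^bsub>V\<^esub> (x \<oplus>\<^bsub>V\<^esub> y) = c \<odot>\<^bsub>V\<^esub> x \<oplus>\<^bsub>V\<^esub> c \<odot>\<^bsub>V\<^esub> y"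
    and "\<And>c d x. x \<in> carrier V \<Longrightarrow> (c + d) \<odot>\<^bsub>V\<^esub> x = c \<odot>\<^bsub>V\<^esub> x \<oplus>\<^bsub>V\<^esub> d \<odot>\<^bsub>V\<^esub> x"
    and "\<And>c d x. x \<in> carrier V \<Longrightarrow> (c * d) \<odot>\<^bsub>V\<^esub> x = c \<odot>\<^bsub>V\<^esub> (d \<odot>\<^bsub>V\<^esub> x)"
    and "\<And>x y z. x \<in> carrier V \<Longrightarrow> y \<in> carrier V \<Longrightarrow> z \<in> carrier V \<Longrightarrow>
           (x \<oplus>\<^bsub>V\<^esub> y) \<oplus>\<^bsub>V\<^esub> z = x \<oplus>\<^bsub>V\<^esub> (y \<oplus>\<^bsub>V\<^esub> z)"
    and "\<And>x y. x \<in> carrier V \<Longrightarrow> y \<in> carrier V \<Longrightarrow> x \<oplus>\<^bsub>V\<^esub> y = y \<oplus>\<^bsub>V\<^esub> x"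
    and "\<And>x. x \<in> carrier V \<Longrightarrow> x \<oplus>\<^bsub>V\<^esub> (-1) \<odot>\<^bsub>V\<^esub> x = \<zero>\<^bsub>V\<^esub>"
proof -
  interpret V: vectorspace class_ring V by fact
  show "\<And>c x y. x \<in> carrier V \<Longrightarrow> y \<in> carrier V \<Longrightarrow> c \<odot>\<^bsub>V\<^esub> (x \<oplus>\<^bsub>V\<^esub> y) = c \<odot>\<^bsub>V\<^esub> x \<oplus>\<^bsub>V\<^esub> c \<odot>\<^bsub>V\<^esub> y"
    using V.smult_r_distr by simp
  show l: "(c + d) \<odot>\<^bsub>V\<^esub> x = c \<odot>\<^bsub>V\<^esub> x \<oplus>\<^bsub>V\<^esub> d \<odot>\<^bsub>V\<^esub> x" if "x \<in> carrier V" for c d x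
    using V.smult_l_distr[of c d x] that by simp
  show "\<And>c d x. x \<in> carrier V \<Longrightarrow> (c * d) \<odot>\<^bsub>V\<^esub> x = c \<odot>\<^bsub>V\<^esub> (d \<odot>\<^bsub>V\<^esub> x)"
    using V.smult_assoc1 by simp
  show "\<And>x y z. x \<in> carrier V \<Longrightarrow> y \<in> carrier V \<Longrightarrow> z \<in> carrier V \<Longrightarrow>
           (x \<oplus>\<^bsub>V\<^esub> y) \<oplus>\<^bsub>V\<^esub> z = x \<oplus>\<^bsub>V\<^esub> (y \<oplus>\<^bsub>V\<^esub> z)"
    by (rule V.a_assoc)
  show "\<And>x y. x \<in> carrier V \<Longrightarrow> y \<in> carrier V \<Longrightarrow> x \<oplus>\<^bsub>V\<^esub> y = y \<oplus>\<^bsub>V\<^esub> x"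
    by (rule V.a_comm)
  show "x \<oplus>\<^bsub>V\<^esub> (-1) \<odot>\<^bsub>V\<^esub> x = \<zero>\<^bsub>V\<^esub>" if "x \<in> carrier V" for x
    using l[OF that, of 1 "-1"] vectorspace_simps[OF assms] that by simp
qed

lemmas vs_add_closed = vectorspace_simps(1)
  and vs_smult_closed = vectorspace_simps(2)
  and vs_zero_closed = vectorspace_simps(3)

text \<open>All axioms are equations or closure statements, so they pass along a surjection that
  respects the operations; negatives are obtained as multiples by -1. Since \<open>W\<close> enters
  only as a record of operations, this is the tool for quotients and for spaces encoded in another
  type.\<close>

lemma vectorspace_image:
  fixes V :: "('k::field, 'w, 'z) module_scheme" and W :: "('k, 'u, 'y) module_scheme"
  assumes V: "vectorspace class_ring V"
    and sur: "carrier W = f ` carrier V"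
    and add: "\<And>x y. x \<in> carrier V \<Longrightarrow> y \<in> carrier V \<Longrightarrow> f (x \<oplus>\<^bsub>V\<^esub> y) = f x \<oplus>\<^bsub>W\<^esub> f y"
    and sm: "\<And>c x. x \<in> carrier V \<Longrightarrow> f (c \<odot>\<^bsub>V\<^esub> x) = c \<odot>\<^bsub>W\<^esub> f x"
    and zero: "\<zero>\<^bsub>W\<^esub> = f \<zero>\<^bsub>V\<^esub>"
  shows "vectorspace class_ring W"
proof -
  note s = vectorspace_simps[OF V] vectorspace_distrib[OF V]
  have closed: "f x \<oplus>\<^bsub>W\<^esub> f y \<in> carrier W" if "x \<in> carrier V" "y \<in> carrier V" for x y
    using that s(1) sur by (simp flip: add)
  have comm: "f x \<oplus>\<^bsub>W\<^esub> f y = f y \<oplus>\<^bsub>W\<^esub> f x" if "x \<in> carrier V" "y \<in> carrier V" for x y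
    using that s(13) by (simp flip: add)
  have assoc: "(f x \<oplus>\<^bsub>W\<^esub> f y) \<oplus>\<^bsub>W\<^esub> f z = f x \<oplus>\<^bsub>W\<^esub> (f y \<oplus>\<^bsub>W\<^esub> f z)"
    if "x \<in> carrier V" "y \<in> carrier V" "z \<in> carrier V" for x y z
    using that s(1,12) by (simp flip: add)
  have unit: "f \<zero>\<^bsub>V\<^esub> \<oplus>\<^bsub>W\<^esub> f x = f x" if "x \<in> carrier V" for x
    using that s(3,6) by (simp flip: add)
  have "abelian_group W"
  proof (rule abelian_groupI)
    show "\<exists>y\<in>carrier W. y \<oplus>\<^bsub>W\<^esub> x = \<zero>\<^bsub>W\<^esub>" if "x \<in> carrier W" for x
    proof -
      from that sur obtain v where v: "v \<in> carrier V" "x = f v" by auto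
      have "f ((-1) \<odot>\<^bsub>V\<^esub> v) \<oplus>\<^bsub>W\<^esub> x = f (((-1) \<odot>\<^bsub>V\<^esub> v) \<oplus>\<^bsub>V\<^esub> v)"
        unfolding v(2) using v s by (subst add) auto
      also have "\<dots> = \<zero>\<^bsub>W\<^esub>" using s(13)[of "(-1) \<odot>\<^bsub>V\<^esub> v" v] s(14)[of v] zero v s(2) by simp
      finally show ?thesis using sur s(2) v by auto
    qed
  qed (use closed comm assoc unit s(3) in \<open>auto simp: sur zero\<close>)
  moreover have "cring (class_ring :: 'k ring)"
    by (rule class_cring.is_cring)
  moreover have "c \<odot>\<^bsub>W\<^esub> f x \<in> carrier W" if "x \<in> carrier V" for c x
    using that s(2) sur by (simp flip: sm)
  moreover have "(c + d) \<odot>\<^bsub>W\<^esub> f x = c \<odot>\<^bsub>W\<^esub> f x \<oplus>\<^bsub>W\<^esub> d \<odot>\<^bsub>W\<^esub> f x" if "x \<in> carrier V" for c d x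
    using that s(2,10) by (simp flip: add sm)
  moreover have "c \<odot>\<^bsub>W\<^esub> (f x \<oplus>\<^bsub>W\<^esub> f y) = c \<odot>\<^bsub>W\<^esub> f x \<oplus>\<^bsub>W\<^esub> c \<odot>\<^bsub>W\<^esub> f y"
    if "x \<in> carrier V" "y \<in> carrier V" for c x y
    using that s(1,2,9) by (simp flip: add sm)
  moreover have "(c * d) \<odot>\<^bsub>W\<^esub> f x = c \<odot>\<^bsub>W\<^esub> (d \<odot>\<^bsub>W\<^esub> f x)" if "x \<in> carrier V" for c d x
    using that s(2,11) by (simp flip: sm)
  moreover have "1 \<odot>\<^bsub>W\<^esub> f x = f x" if "x \<in> carrier V" for x
    using that s(5) by (simp flip: sm)
  ultimately have "Module.module class_ring W"
    by (intro moduleI) (auto simp: sur)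
  moreover have "field (class_ring :: 'k ring)" by (rule class_field)
  ultimately show ?thesis unfolding vectorspace_def by blast
qed


lemma lsum_cong:
  assumes V: "vectorspace class_ring V" and b: "b \<in> B \<rightarrow> carrier V"
    and "\<And>x. x \<in> B \<Longrightarrow> c x = d x" "\<And>x. x \<in> B \<Longrightarrow> b x = b' x"
  shows "lsum V B c b = lsum V B d b'"
proof -
  interpret V: vectorspace class_ring V by (rule V)
  show ?thesis unfolding lsum_def
    by (rule V.finsum_cong') (use assms vs_smult_closed[OF V] in \<open>auto simp: Pi_def\<close>)
qed

lemma lsum_closed:
  assumes V: "vectorspace class_ring V" and b: "b \<in> B \<rightarrow> carrier V"
  shows "lsum V B c b \<in> carrier V"
proof -
  interpret V: vectorspace class_ring V by (rule V)
  show ?thesis unfolding lsum_def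
    by (rule V.finsum_closed) (use b vs_smult_closed[OF V] in \<open>auto simp: Pi_def\<close>)
qed

lemma lsum_empty: "vectorspace class_ring V \<Longrightarrow> lsum V {} c b = \<zero>\<^bsub>V\<^esub>"
proof -
  assume V: "vectorspace class_ring V"
  interpret V: vectorspace class_ring V by (rule V)
  show ?thesis unfolding lsum_def by simp
qed

lemma lsum_insert:
  assumes V: "vectorspace class_ring V" and b: "b \<in> insert y B \<rightarrow> carrier V" and "finite B" "y \<notin> B"
  shows "lsum V (insert y B) c b = c y \<odot>\<^bsub>V\<^esub> b y \<oplus>\<^bsub>V\<^esub> lsum V B c b"
proof -
  interpret V: vectorspace class_ring V by (rule V)
  show ?thesis unfolding lsum_def
    by (rule V.finsum_insert) (use assms vs_smult_closed[OF V] in \<open>auto simp: Pi_def\<close>)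
qed

text \<open>Stated for a bare additive and homogeneous function, because it is applied to inclusions
  of subspaces and to coset projections; \<open>lsum_hom'\<close> specializes it to
  \<open>linear_map\<close>.\<close>

lemma lsum_hom:
  assumes V: "vectorspace class_ring V" and W: "vectorspace class_ring W"
    and f: "f \<in> carrier V \<rightarrow> carrier W"
    and add: "\<And>x y. x \<in> carrier V \<Longrightarrow> y \<in> carrier V \<Longrightarrow> f (x \<oplus>\<^bsub>V\<^esub> y) = f x \<oplus>\<^bsub>W\<^esub> f y"
    and sm: "\<And>c x. x \<in> carrier V \<Longrightarrow> f (c \<odot>\<^bsub>V\<^esub> x) = c \<odot>\<^bsub>W\<^esub> f x"
    and b: "b \<in> B \<rightarrow> carrier V" and B: "finite B"
  shows "f (lsum V B c b) = lsum W B c (\<lambda>x. f (b x))"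
  using B b
proof (induction B)
  case empty
  have "f \<zero>\<^bsub>V\<^esub> = 0 \<odot>\<^bsub>W\<^esub> f \<zero>\<^bsub>V\<^esub>"
    using sm[of "\<zero>\<^bsub>V\<^esub>" 0] vectorspace_simps[OF V] by simp
  then show ?case
    using vectorspace_simps(4)[OF W, of "f \<zero>\<^bsub>V\<^esub>"] vs_zero_closed[OF V] f
    by (auto simp: lsum_empty[OF V] lsum_empty[OF W])
next
  case (insert y B)
  have b: "b y \<in> carrier V" "b \<in> B \<rightarrow> carrier V" "(\<lambda>x. f (b x)) \<in> insert y B \<rightarrow> carrier W"
    using insert.prems f by auto
  show ?case
    using insert b
    by (simp add: lsum_insert[OF V] lsum_insert[OF W] add sm vs_smult_closed[OF V] lsum_closed[OF V])
qed

lemma lsum_hom':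
  assumes "linear_map class_ring V W f" and b: "b \<in> B \<rightarrow> carrier V" and B: "finite B"
  shows "f (lsum V B c b) = lsum W B c (\<lambda>x. f (b x))"
proof -
  interpret linear_map class_ring V W f by fact
  show ?thesis
    by (rule lsum_hom) (use assms V.vectorspace_axioms W.vectorspace_axioms in auto)
qed

text \<open>The target is the field as a type, not a module record. Used to expand the blocks of a
  bilinear form and to read off coefficients.\<close>

lemma functional_lsum:
  assumes V: "vectorspace class_ring V"
    and add: "\<And>x y. x \<in> carrier V \<Longrightarrow> y \<in> carrier V \<Longrightarrow> f (x \<oplus>\<^bsub>V\<^esub> y) = f x + f y"
    and sm: "\<And>c x. x \<in> carrier V \<Longrightarrow> f (c \<odot>\<^bsub>V\<^esub> x) = (c * f x :: 'k :: field)"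
    and b: "b \<in> B \<rightarrow> carrier V" and B: "finite B"
  shows "f (lsum V B c b) = (\<Sum>x\<in>B. c x * f (b x))"
  using B b
proof (induction B)
  case empty
  then show ?case
    using sm[of "\<zero>\<^bsub>V\<^esub>" 0] vectorspace_simps[OF V] by (simp add: lsum_empty[OF V])
next
  case (insert y B)
  then show ?case
    by (simp add: lsum_insert[OF V] add sm vs_smult_closed[OF V] lsum_closed[OF V])
qed

lemma lsum_add:
  assumes V: "vectorspace class_ring V" and b: "b \<in> B \<rightarrow> carrier V" and B: "finite B"
  shows "lsum V B (\<lambda>x. c x + d x) b = lsum V B c b \<oplus>\<^bsub>V\<^esub> lsum V B d b"
  using B b
proof (induction B)
  case empty
  then show ?case using vectorspace_simps[OF V] by (simp add: lsum_empty[OF V])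
next
  case (insert y B)
  interpret V: vectorspace class_ring V by (rule V)
  have "b y \<in> carrier V" "lsum V B c b \<in> carrier V" "lsum V B d b \<in> carrier V"
    using insert lsum_closed[OF V, of b B] by auto
  then show ?case
    using insert
    by (simp add: lsum_insert[OF V] vectorspace_distrib(2)[OF V] vs_smult_closed[OF V] V.a_ac)
qed

lemma lsum_smult:
  assumes V: "vectorspace class_ring V" and b: "b \<in> B \<rightarrow> carrier V" and B: "finite B"
  shows "lsum V B (\<lambda>x. a * c x) b = a \<odot>\<^bsub>V\<^esub> lsum V B c b"
  using B b
proof (induction B)
  case empty
  then show ?case using vectorspace_simps[OF V] by (simp add: lsum_empty[OF V])
next
  case (insert y B)
  have "b y \<in> carrier V" "lsum V B c b \<in> carrier V"
    using insert lsum_closed[OF V, of b B] by auto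
  then show ?case
    using insert
    by (simp add: lsum_insert[OF V] vectorspace_distrib(1,3)[OF V] vs_smult_closed[OF V])
qed

lemma lsum_zero:
  assumes V: "vectorspace class_ring V" and b: "b \<in> B \<rightarrow> carrier V" and B: "finite B"
    and c: "\<And>x. x \<in> B \<Longrightarrow> c x = 0"
  shows "lsum V B c b = \<zero>\<^bsub>V\<^esub>"
proof -
  have "lsum V B c b = lsum V B (\<lambda>x. 0 * 0) b" by (rule lsum_cong[OF V b]) (auto simp: c)
  also have "\<dots> = 0 \<odot>\<^bsub>V\<^esub> lsum V B (\<lambda>x. 0) b" by (rule lsum_smult[OF V b B])
  finally show ?thesis using vectorspace_simps[OF V] lsum_closed[OF V b] by simp
qed

lemma lsum_Un:
  assumes V: "vectorspace class_ring V" and b: "b \<in> A \<union> B \<rightarrow> carrier V"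
    and "finite A" "finite B" "A \<inter> B = {}"
  shows "lsum V (A \<union> B) c b = lsum V A c b \<oplus>\<^bsub>V\<^esub> lsum V B c b"
proof -
  interpret V: vectorspace class_ring V by (rule V)
  show ?thesis unfolding lsum_def
    by (rule V.finsum_Un_disjoint) (use assms vs_smult_closed[OF V] in \<open>auto simp: Pi_def\<close>)
qed

lemma lsum_reindex:
  assumes V: "vectorspace class_ring V" and b: "b \<in> f ` B \<rightarrow> carrier V" and f: "inj_on f B"
  shows "lsum V (f ` B) c b = lsum V B (c \<circ> f) (b \<circ> f)"
proof -
  interpret V: vectorspace class_ring V by (rule V)
  show ?thesis unfolding lsum_def o_def
    by (rule V.finsum_reindex) (use assms vs_smult_closed[OF V] in \<open>auto simp: Pi_def\<close>)
qed

lemma lsum_subset: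
  assumes V: "vectorspace class_ring V" and b: "b \<in> B \<rightarrow> carrier V" and "finite B" "A \<subseteq> B"
    and c: "\<And>x. x \<in> B - A \<Longrightarrow> c x = 0"
  shows "lsum V B c b = lsum V A c b"
proof -
  have *: "A \<union> (B - A) = B" "finite A" using assms finite_subset by auto
  have "lsum V (A \<union> (B - A)) c b = lsum V A c b \<oplus>\<^bsub>V\<^esub> lsum V (B - A) c b"
    by (rule lsum_Un) (use assms * in auto)
  moreover have "lsum V (B - A) c b = \<zero>\<^bsub>V\<^esub>"
    by (rule lsum_zero) (use assms in auto)
  moreover have "lsum V A c b \<in> carrier V" by (rule lsum_closed) (use assms in auto)
  ultimately show ?thesis using * vectorspace_simps[OF V] by simp
qed

lemma lsum_delta:
  assumes V: "vectorspace class_ring V" and b: "b \<in> B \<rightarrow> carrier V" and B: "finite B" "y \<in> B"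
  shows "lsum V B (\<lambda>x. if x = y then 1 else 0) b = b y"
proof -
  have "lsum V B (\<lambda>x. if x = y then 1 else 0) b = lsum V {y} (\<lambda>x. if x = y then 1 else 0) b"
    by (rule lsum_subset) (use assms in auto)
  also have "\<dots> = 1 \<odot>\<^bsub>V\<^esub> b y \<oplus>\<^bsub>V\<^esub> lsum V {} (\<lambda>x. if x = y then 1 else 0) b"
    using lsum_insert[OF V, of b y "{}" "\<lambda>x. if x = y then 1 else 0"] assms by auto
  also have "\<dots> = b y"
    using vectorspace_simps[OF V] funcset_mem[OF b B(2)] by (simp add: lsum_empty[OF V])
  finally show ?thesis .
qed

text \<open>This is the product of the matrix \<open>A\<close> with the column \<open>c\<close>,
  with row index \<open>z\<close> and column index \<open>x\<close>.\<close>

lemma lsum_lsum: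
  assumes V: "vectorspace class_ring V" and b: "b \<in> D \<rightarrow> carrier V" and B: "finite B" "finite D"
  shows "lsum V B c (\<lambda>x. lsum V D (A x) b) = lsum V D (\<lambda>z. \<Sum>x\<in>B. c x * A x z) b"
  using B(1)
proof (induction B)
  case empty
  then show ?case using lsum_empty[OF V] lsum_zero[OF V b B(2)] by simp
next
  case (insert y B)
  then show ?case
    using lsum_closed[OF V b]
    by (simp add: lsum_insert[OF V] lsum_add[OF V b B(2)] lsum_smult[OF V b B(2)])
qed

lemma lsum_restrict_carrier:
  assumes V: "vectorspace class_ring V" and W: "vectorspace class_ring (V\<lparr>carrier := W\<rparr>)"
    and "W \<subseteq> carrier V" and b: "b \<in> B \<rightarrow> W" and B: "finite B"
  shows "lsum (V\<lparr>carrier := W\<rparr>) B c b = lsum V B c b"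
  using lsum_hom[OF W V, of "\<lambda>x. x" b B c] assms by auto

section \<open>Bases as indexed families, coordinates and cardinalities\<close>

definition is_basis :: "('k::field, 'w, 'z) module_scheme \<Rightarrow> 'x set \<Rightarrow> ('x \<Rightarrow> 'w) \<Rightarrow> bool" where
  "is_basis V B b \<longleftrightarrow> finite B \<and> b \<in> B \<rightarrow> carrier V \<and>
     (\<forall>v\<in>carrier V. \<exists>c. v = lsum V B c b) \<and>
     (\<forall>c. lsum V B c b = \<zero>\<^bsub>V\<^esub> \<longrightarrow> (\<forall>x\<in>B. c x = 0))"

lemma is_basis_cong:
  assumes V: "vectorspace class_ring V" and b: "is_basis V B b" and "\<And>x. x \<in> B \<Longrightarrow> b x = b' x"
  shows "is_basis V B b'"
proof -
  have "b \<in> B \<rightarrow> carrier V" using b by (auto simp: is_basis_def)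
  then have "lsum V B c b = lsum V B c b'" for c
    by (intro lsum_cong[OF V]) (use assms in auto)
  then show ?thesis using b assms(3) unfolding is_basis_def by (auto simp: Pi_def)
qed

lemma lsum_eq_iff:
  assumes V: "vectorspace class_ring V" and b: "is_basis V B b"
  shows "lsum V B c b = lsum V B d b \<longleftrightarrow> (\<forall>x\<in>B. c x = d x)"
proof
  have b': "finite B" "b \<in> B \<rightarrow> carrier V" using b by (auto simp: is_basis_def)
  show "lsum V B c b = lsum V B d b" if "\<forall>x\<in>B. c x = d x"
    by (rule lsum_cong[OF V b'(2)]) (use that in auto)
  assume eq: "lsum V B c b = lsum V B d b"
  have "lsum V B (\<lambda>x. c x + (-1) * d x) b = \<zero>\<^bsub>V\<^esub>"
    unfolding lsum_add[OF V b'(2,1)] lsum_smult[OF V b'(2,1)] eq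
    by (rule vectorspace_distrib(6)[OF V lsum_closed[OF V b'(2)]])
  then have "\<forall>x\<in>B. c x + (-1) * d x = 0" using b unfolding is_basis_def by blast
  then show "\<forall>x\<in>B. c x = d x" by simp
qed

text \<open>For a basis and a vector of the carrier only the values on \<open>B\<close> are
  determined; elsewhere the choice is arbitrary, hence the condition \<open>x \<in> B\<close> in the
  lemmas on coordinates.\<close>

definition coord :: "('k::field, 'w, 'z) module_scheme \<Rightarrow> 'x set \<Rightarrow> ('x \<Rightarrow> 'w) \<Rightarrow> 'w \<Rightarrow> 'x \<Rightarrow> 'k" where
  "coord V B b v = (SOME c. v = lsum V B c b)"

lemma lsum_coord:
  assumes "is_basis V B b" "v \<in> carrier V"
  shows "lsum V B (coord V B b v) b = v"
  using assms unfolding coord_def is_basis_def by (metis (mono_tags, lifting) someI_ex)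

lemma coord_lsum:
  assumes V: "vectorspace class_ring V" and b: "is_basis V B b" and x: "x \<in> B"
  shows "coord V B b (lsum V B c b) x = c x"
proof -
  have "b \<in> B \<rightarrow> carrier V" using b by (auto simp: is_basis_def)
  then have "lsum V B (coord V B b (lsum V B c b)) b = lsum V B c b"
    using lsum_coord[OF b lsum_closed[OF V]] by blast
  then show ?thesis using lsum_eq_iff[OF V b] x by blast
qed

lemma coord_add:
  assumes V: "vectorspace class_ring V" and b: "is_basis V B b" and x: "x \<in> B"
    and v: "v \<in> carrier V" "w \<in> carrier V"
  shows "coord V B b (v \<oplus>\<^bsub>V\<^esub> w) x = coord V B b v x + coord V B b w x"
proof -
  have b': "finite B" "b \<in> B \<rightarrow> carrier V" using b by (auto simp: is_basis_def)
  have "v \<oplus>\<^bsub>V\<^esub> w = lsum V B (\<lambda>x. coord V B b v x + coord V B b w x) b"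
    unfolding lsum_add[OF V b'(2,1)] using lsum_coord[OF b] v by simp
  then show ?thesis using coord_lsum[OF V b x] by simp
qed

lemma coord_smult:
  assumes V: "vectorspace class_ring V" and b: "is_basis V B b" and x: "x \<in> B"
    and v: "v \<in> carrier V"
  shows "coord V B b (a \<odot>\<^bsub>V\<^esub> v) x = a * coord V B b v x"
proof -
  have b': "finite B" "b \<in> B \<rightarrow> carrier V" using b by (auto simp: is_basis_def)
  have "a \<odot>\<^bsub>V\<^esub> v = lsum V B (\<lambda>x. a * coord V B b v x) b"
    unfolding lsum_smult[OF V b'(2,1)] using lsum_coord[OF b] v by simp
  then show ?thesis using coord_lsum[OF V b x] by simp
qed

lemma is_basis_span: "is_basis V B b \<Longrightarrow> v \<in> carrier V \<Longrightarrow> \<exists>c. v = lsum V B c b"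
  unfolding is_basis_def by blast

lemma is_basis_indep: "is_basis V B b \<Longrightarrow> lsum V B c b = \<zero>\<^bsub>V\<^esub> \<Longrightarrow> x \<in> B \<Longrightarrow> c x = 0"
  unfolding is_basis_def by blast

text \<open>Extensional coefficient families make coordinates unique as functions. This turns a
  basis into a count of vectors.\<close>

lemma bij_betw_lsum:
  assumes V: "vectorspace class_ring V" and b: "is_basis V B b"
  shows "bij_betw (\<lambda>c. lsum V B c b) (B \<rightarrow>\<^sub>E UNIV) (carrier V)"
proof -
  have b': "finite B" "b \<in> B \<rightarrow> carrier V" using b by (auto simp: is_basis_def)
  have "inj_on (\<lambda>c. lsum V B c b) (B \<rightarrow>\<^sub>E UNIV)"
    by (rule inj_onI) (auto simp: lsum_eq_iff[OF V b] intro: PiE_ext)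
  moreover have "v \<in> (\<lambda>c. lsum V B c b) ` (B \<rightarrow>\<^sub>E UNIV)" if "v \<in> carrier V" for v
  proof
    show "v = lsum V B (restrict (coord V B b v) B) b"
      using lsum_cong[OF V b'(2), of "coord V B b v" "restrict (coord V B b v) B" b] lsum_coord[OF b that]
      by simp
  qed auto
  ultimately show ?thesis using lsum_closed[OF V b'(2)] unfolding bij_betw_def by auto
qed

lemma card_of_basis:
  assumes V: "vectorspace class_ring (V :: ('k::{field,finite}, 'w, 'z) module_scheme)" and b: "is_basis V B b"
  shows "card (carrier V) = CARD('k) ^ card B" "finite (carrier V)"
proof -
  have "finite B" using b by (auto simp: is_basis_def)
  then show "card (carrier V) = CARD('k) ^ card B"
    using bij_betw_same_card[OF bij_betw_lsum[OF V b]] by (simp add: card_funcsetE)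
  show "finite (carrier V)"
    using bij_betw_finite[OF bij_betw_lsum[OF V b]] \<open>finite B\<close> finite_PiE[of B "\<lambda>_. UNIV :: 'k set"] by simp
qed

text \<open>Passes from bases that are sets of vectors to families indexed by the numbers below the
  dimension.\<close>

lemma basis_exists:
  assumes V: "vectorspace class_ring V" and fd: "vectorspace.fin_dim class_ring V"
  shows "\<exists>b. is_basis V {..<vectorspace.dim class_ring V} b"
proof -
  interpret V: vectorspace class_ring V by (rule V)
  obtain S where S: "finite S" "V.basis S" using V.finite_basis_exists[OF fd] by blast
  have SV: "S \<subseteq> carrier V" and li: "V.lin_indpt S" and gen: "V.span S = carrier V"
    using S(2) by (auto simp: V.basis_def)
  have ls: "lsum V S c id = V.lincomb c S" for c by (simp add: lsum_def V.lincomb_def)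
  obtain h where h: "bij_betw h {..<V.dim} S"
    using ex_bij_betw_nat_finite[OF S(1)] V.dim_basis[OF S] by (auto simp: atLeast0LessThan)
  have hS: "h ` {..<V.dim} = S" and inj: "inj_on h {..<V.dim}" using h by (auto simp: bij_betw_def)
  have eq: "lsum V {..<V.dim} (c \<circ> h) h = lsum V S c id" for c
    using lsum_reindex[OF V _ inj, of id c] SV hS by (simp add: Pi_def subset_iff)
  have "is_basis V {..<V.dim} h"
    unfolding is_basis_def
  proof (intro conjI ballI allI impI)
    show "h \<in> {..<V.dim} \<rightarrow> carrier V" using hS SV by auto
    show "\<exists>c. v = lsum V {..<V.dim} c h" if "v \<in> carrier V" for v
    proof -
      have "v \<in> V.span S" using gen that by simp
      then obtain a where "v = V.lincomb a S" using V.finite_in_span[OF S(1) SV] by blast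
      then show ?thesis using eq[of a] ls by metis
    qed
    show "c x = 0" if z: "lsum V {..<V.dim} c h = \<zero>\<^bsub>V\<^esub>" and x: "x \<in> {..<V.dim}" for c x
    proof -
      \<comment> \<open>The coefficients are moved from numbers to basis vectors along the inverse
        of \<open>h\<close>, so that linear independence of the set applies.\<close>
      define d where "d = c \<circ> inv_into {..<V.dim} h"
      have "lsum V {..<V.dim} c h = lsum V {..<V.dim} (d \<circ> h) h"
        by (rule lsum_cong[OF V]) (use hS SV inj in \<open>auto simp: d_def\<close>)
      then have "V.lincomb d S = \<zero>\<^bsub>V\<^esub>" using z eq ls by simp
      then have "d \<in> S \<rightarrow> {\<zero>\<^bsub>class_ring\<^esub>}" by (intro V.not_lindepD[OF li S(1)]) auto
      then have "d (h x) = 0" using x hS by auto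
      then show ?thesis using x inj by (simp add: d_def)
    qed
  qed simp
  then show ?thesis by blast
qed

lemma fin_dim_of_finite:
  assumes V: "vectorspace class_ring V" and "finite (carrier V)"
  shows "vectorspace.fin_dim class_ring V"
proof -
  interpret V: vectorspace class_ring V by (rule V)
  show ?thesis unfolding V.fin_dim_def
    using assms(2) V.span_closed[of "carrier V"] V.in_own_span[of "carrier V"] by blast
qed

lemma card_vectorspace:
  fixes V :: "('k::{field,finite}, 'w, 'z) module_scheme"
  assumes V: "vectorspace class_ring V" and fd: "vectorspace.fin_dim class_ring V"
  shows "card (carrier V) = CARD('k) ^ vectorspace.dim class_ring V" "finite (carrier V)"
  using basis_exists[OF V fd] card_of_basis[OF V] by fastforce+

lemma card_field_gt_1: "1 < CARD('k::{field,finite})"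
proof -
  have "card {0, 1 :: 'k} \<le> CARD('k)" by (rule card_mono) auto
  then show ?thesis by simp
qed

text \<open>Over a finite field the dimension can be read off from the number of vectors, because q
  > 1 makes q^n determine n.\<close>

lemma dim_of_basis:
  fixes V :: "('k::{field,finite}, 'w, 'z) module_scheme"
  assumes V: "vectorspace class_ring V" and b: "is_basis V B b"
  shows "vectorspace.dim class_ring V = card B"
  using card_vectorspace(1)[OF V fin_dim_of_finite[OF V card_of_basis(2)[OF V b]]]
    card_of_basis(1)[OF V b] card_field_gt_1[where 'k = 'k]
  by simp

section \<open>Twisted symmetric functions and dual families\<close>

text \<open>The orbits of \<open>\<theta>\<close> are independent of each other. On an orbit of two
  points the value at one point is free and fixes the other. At a fixed point of sign 1 the equation
  reads 2 C = D and has one solution. At a fixed point of sign -1 compatibility forces D = 0 and the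
  value is free. The exponents 1, 0, 1 are half of 2, 1 - 1 and 1 + 1, which is the formula for
  \<open>2 * int e\<close>; it does not involve \<open>D\<close>.\<close>

lemma card_twisted_symmetric:
  fixes \<epsilon> :: "'x \<Rightarrow> int" and D :: "'x \<Rightarrow> 'k::{field,finite}"
  assumes two: "(2 :: 'k) \<noteq> 0" and X: "finite X"
    and \<theta>: "\<And>x. x \<in> X \<Longrightarrow> \<theta> x \<in> X \<and> \<theta> (\<theta> x) = x"
    and \<epsilon>: "\<And>x. x \<in> X \<Longrightarrow> \<epsilon> x \<in> {1, -1} \<and> \<epsilon> (\<theta> x) = \<epsilon> x"
    and D: "\<And>x. x \<in> X \<Longrightarrow> D (\<theta> x) = of_int (\<epsilon> x) * D x"
  shows "\<exists>e. card {C \<in> X \<rightarrow>\<^sub>E UNIV. \<forall>x\<in>X. C x + of_int (\<epsilon> x) * C (\<theta> x) = D x} = CARD('k) ^ e \<and>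
           2 * int e = int (card X) - (\<Sum>x\<in>{x\<in>X. \<theta> x = x}. \<epsilon> x)"
  using X \<theta> \<epsilon> D
proof (induction "card X" arbitrary: X rule: less_induct)
  case less
  let ?S = "\<lambda>X. {C \<in> X \<rightarrow>\<^sub>E UNIV. \<forall>x\<in>X. C x + of_int (\<epsilon> x) * C (\<theta> x) = D x}"
  show ?case
  proof (cases "X = {}")
    case True
    then have "?S X = {\<lambda>x. undefined}" by auto
    then show ?thesis using True by (intro exI[of _ 0]) auto
  next
    case False
    then obtain y where y: "y \<in> X" by blast
    define Y where "Y = X - {y, \<theta> y}"
    have ty: "\<theta> y \<in> X" "\<theta> (\<theta> y) = y" using less.prems(2) y by auto
    have \<theta>Y: "\<theta> x \<in> Y \<and> \<theta> (\<theta> x) = x" if "x \<in> Y" for x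
    proof -
      have x: "x \<in> X" "x \<noteq> y" "x \<noteq> \<theta> y" using that by (auto simp: Y_def)
      have \<theta>x: "\<theta> x \<in> X" "\<theta> (\<theta> x) = x" using less.prems(2)[OF x(1)] by auto
      then have "\<theta> x \<noteq> y" "\<theta> x \<noteq> \<theta> y" using x ty by metis+
      then show ?thesis using \<theta>x by (auto simp: Y_def)
    qed
    have ey: "\<epsilon> y = 1 \<or> \<epsilon> y = -1" "\<epsilon> (\<theta> y) = \<epsilon> y" using less.prems(3)[OF y] by auto
    have fin: "finite Y" using less.prems(1) by (simp add: Y_def)
    have cardY: "card Y < card X" using y less.prems(1) unfolding Y_def by (intro psubset_card_mono) auto
    have "\<exists>e. card (?S Y) = CARD('k) ^ e \<and>
           2 * int e = int (card Y) - (\<Sum>x\<in>{x\<in>Y. \<theta> x = x}. \<epsilon> x)"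
      by (rule less.hyps[OF cardY fin]) (use \<theta>Y less.prems(3,4) in \<open>auto simp: Y_def\<close>)
    then obtain e where e: "card (?S Y) = CARD('k) ^ e" "2 * int e = int (card Y) - (\<Sum>x\<in>{x\<in>Y. \<theta> x = x}. \<epsilon> x)"
      by blast
    \<comment> \<open>A solution on \<open>X\<close> is a solution on \<open>Y\<close> and an admissible value at \<open>y\<close>, which fixes the value at \<open>\<theta> y\<close>.\<close>
    define A where "A = (if \<theta> y = y then {a :: 'k. a + of_int (\<epsilon> y) * a = D y} else UNIV)"
    define ext where "ext = (\<lambda>(a, C) x. if x = y then a
      else if x = \<theta> y then of_int (\<epsilon> y) * (D y - a) else (C :: 'x \<Rightarrow> 'k) x)"
    have ee: "of_int (\<epsilon> y) * of_int (\<epsilon> y) = (1 :: 'k)" using ey(1) by auto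
    have "bij_betw ext (A \<times> ?S Y) (?S X)"
    proof (rule bij_betwI[where g = "\<lambda>C. (C y, restrict C Y)"])
      show "ext \<in> A \<times> ?S Y \<rightarrow> ?S X"
      proof
        fix p assume "p \<in> A \<times> ?S Y"
        then obtain a C where p: "p = (a, C)" "a \<in> A" "C \<in> Y \<rightarrow>\<^sub>E UNIV"
          and C: "\<And>x. x \<in> Y \<Longrightarrow> C x + of_int (\<epsilon> x) * C (\<theta> x) = D x" by auto
        have "ext p \<in> X \<rightarrow>\<^sub>E UNIV"
          using p(3) y ty unfolding p(1) ext_def by (auto simp: PiE_def extensional_def Y_def)
        moreover have "ext p x + of_int (\<epsilon> x) * ext p (\<theta> x) = D x" if x: "x \<in> X" for x
        proof -
          consider "x = y" | "x = \<theta> y" "x \<noteq> y" | "x \<in> Y" using x by (auto simp: Y_def)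
          then show ?thesis
          proof cases
            case 1
            have "a + of_int (\<epsilon> y) * (of_int (\<epsilon> y) * (D y - a)) = D y"
              unfolding mult.assoc[symmetric] ee by simp
            then show ?thesis using p(2) unfolding 1 p(1) ext_def A_def by (cases "\<theta> y = y") auto
          next
            case 2
            have "ext p x = of_int (\<epsilon> y) * (D y - a)" "ext p (\<theta> x) = a"
              unfolding p(1) ext_def using 2 ty by auto
            \<comment> \<open>The equation at the partner of \<open>y\<close> is the one at
              \<open>y\<close> multiplied by the sign; compatibility of \<open>D\<close> makes the
              right sides agree.\<close>
            moreover have "D x = of_int (\<epsilon> y) * D y" "\<epsilon> x = \<epsilon> y" using 2(1) less.prems(4)[OF y] ey by auto
            ultimately show ?thesis by (simp add: right_diff_distrib)
          next
            case 3
            then show ?thesis using C[OF 3] \<theta>Y[OF 3] unfolding p(1) ext_def by (auto simp: Y_def)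
          qed
        qed
        ultimately show "ext p \<in> ?S X" by blast
      qed
      show "(\<lambda>C. (C y, restrict C Y)) \<in> ?S X \<rightarrow> A \<times> ?S Y"
      proof
        fix C assume "C \<in> ?S X"
        then have C: "\<And>x. x \<in> X \<Longrightarrow> C x + of_int (\<epsilon> x) * C (\<theta> x) = D x" by auto
        have "C y \<in> A" using C[OF y] unfolding A_def by auto
        moreover have "restrict C Y x + of_int (\<epsilon> x) * restrict C Y (\<theta> x) = D x" if "x \<in> Y" for x
          using C[of x] that \<theta>Y[OF that] by (auto simp: Y_def)
        ultimately show "(C y, restrict C Y) \<in> A \<times> ?S Y" by auto
      qed
      show "(ext p y, restrict (ext p) Y) = p" if "p \<in> A \<times> ?S Y" for p
        using that by (auto simp: ext_def Y_def fun_eq_iff PiE_def extensional_def)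
      show "ext (C y, restrict C Y) = C" if "C \<in> ?S X" for C
      proof
        fix x
        have C: "C y + of_int (\<epsilon> y) * C (\<theta> y) = D y" using that y by auto
        then have "of_int (\<epsilon> y) * (D y - C y) = C (\<theta> y)" using ee
          by (metis add_diff_cancel_left' mult.assoc mult_1)
        then show "ext (C y, restrict C Y) x = C x"
          using that by (auto simp: ext_def Y_def PiE_def extensional_def)
      qed
    qed
    from bij_betw_same_card[OF this] have card: "card (?S X) = card A * card (?S Y)"
      by (simp only: card_cartesian_product)
    have "\<exists>f. card A = CARD('k) ^ f \<and>
        2 * int f = int (card X) - int (card Y) - ((\<Sum>x\<in>{x\<in>X. \<theta> x = x}. \<epsilon> x) - (\<Sum>x\<in>{x\<in>Y. \<theta> x = x}. \<epsilon> x))"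
    proof (cases "\<theta> y = y")
      case True
      have XY: "X = insert y Y" "y \<notin> Y" using True y by (auto simp: Y_def)
      have "{x\<in>X. \<theta> x = x} = insert y {x\<in>Y. \<theta> x = x}" using XY True by auto
      then have s: "(\<Sum>x\<in>{x\<in>X. \<theta> x = x}. \<epsilon> x) = \<epsilon> y + (\<Sum>x\<in>{x\<in>Y. \<theta> x = x}. \<epsilon> x)"
        using XY(2) fin by simp
      have c: "card X = Suc (card Y)" using XY fin by simp
      show ?thesis using ey(1)
      proof
        assume e1: "\<epsilon> y = 1"
        \<comment> \<open>Odd characteristic enters here: the diagonal equation has exactly one
          solution.\<close>
        have "(a + a = D y) = (a = D y / 2)" for a
          using two eq_divide_eq[of a "D y" 2] by (simp only: mult_2_right if_True simp_thms)
        then have "A = {D y / 2}" unfolding A_def using True e1 by auto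
        then show ?thesis using s c e1 by (intro exI[of _ 0]) simp
      next
        assume e1: "\<epsilon> y = -1"
        \<comment> \<open>At this fixed point the left side of the equation is 0. Compatibility with
          2 invertible makes the right side 0 as well, so every value is allowed.\<close>
        have "D y = - D y" using less.prems(4)[OF y] True e1 by simp
        then have "D y + D y = 0" by (metis add.right_inverse)
        then have "2 * D y = 0" by (simp only: mult_2)
        then have "D y = 0" using two by simp
        then have "A = UNIV" unfolding A_def using True e1 by auto
        then show ?thesis using s c e1 by (intro exI[of _ 1]) simp
      qed
    next
      case False
      have XY: "X = insert y (insert (\<theta> y) Y)" "y \<notin> insert (\<theta> y) Y" "\<theta> y \<notin> Y"
        using False y ty by (auto simp: Y_def)
      have "{x\<in>X. \<theta> x = x} = {x\<in>Y. \<theta> x = x}" using XY False ty by (auto simp: Y_def)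
      moreover have "card X = Suc (Suc (card Y))" by (subst XY(1)) (use XY(2,3) fin in simp)
      ultimately show ?thesis using False unfolding A_def by (intro exI[of _ 1]) simp
    qed
    then obtain f where f: "card A = CARD('k) ^ f"
        "2 * int f = int (card X) - int (card Y) - ((\<Sum>x\<in>{x\<in>X. \<theta> x = x}. \<epsilon> x) - (\<Sum>x\<in>{x\<in>Y. \<theta> x = x}. \<epsilon> x))"
      by blast
    have "card (?S X) = CARD('k) ^ (f + e)" using card e(1) f(1) by (simp only: power_add)
    moreover have "2 * int (f + e) = int (card X) - (\<Sum>x\<in>{x\<in>X. \<theta> x = x}. \<epsilon> x)"
      using e(2) f(2) by simp
    ultimately have "card (?S X) = CARD('k) ^ (f + e) \<and>
        2 * int (f + e) = int (card X) - (\<Sum>x\<in>{x\<in>X. \<theta> x = x}. \<epsilon> x)" by (rule conjI)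
    then show ?thesis by blast
  qed
qed

text \<open>The hypothesis \<open>nd\<close> says that the evaluations at the points of
  \<open>I\<close> satisfy no nontrivial linear relation on \<open>R\<close>. Independent
  functionals can be given arbitrary values, and this is proved by building functions dual to the
  points, adding one point at a time.\<close>

lemma dual_family_exists:
  fixes R :: "('x \<Rightarrow> 'k::field) set"
  assumes I: "finite I"
    and add: "\<And>r r'. r \<in> R \<Longrightarrow> r' \<in> R \<Longrightarrow> (\<lambda>x. r x + r' x) \<in> R"
    and sm: "\<And>a r. r \<in> R \<Longrightarrow> (\<lambda>x. a * r x) \<in> R"
    and zero: "(\<lambda>x. 0) \<in> R"
    and nd: "\<And>c. (\<And>r. r \<in> R \<Longrightarrow> (\<Sum>x\<in>I. c x * r x) = 0) \<Longrightarrow> \<forall>x\<in>I. c x = 0"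
  shows "\<exists>r\<in>R. \<forall>x\<in>I. r x = g x"
proof -
  have sum: "(\<lambda>x. \<Sum>j\<in>J. a j * r j x) \<in> R" if "finite J" "\<And>j. j \<in> J \<Longrightarrow> r j \<in> R" for J a and r :: "'x \<Rightarrow> 'x \<Rightarrow> 'k"
    using that
  proof (induction J)
    case (insert y J)
    have "(\<lambda>x. a y * r y x + (\<Sum>j\<in>J. a j * r j x)) \<in> R"
      by (rule add[OF sm]) (use insert in auto)
    then show ?case using insert by simp
  qed (simp add: zero)
  have "\<exists>d. \<forall>k\<in>J. d k \<in> R \<and> (\<forall>x\<in>J. d k x = (if x = k then 1 else 0))" if "J \<subseteq> I" for J
    using finite_subset[OF that I] that
  proof (induction J)
    case (insert y J)
    then obtain d where d: "\<And>k. k \<in> J \<Longrightarrow> d k \<in> R"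
      "\<And>k x. k \<in> J \<Longrightarrow> x \<in> J \<Longrightarrow> d k x = (if x = k then 1 else 0)" by blast
    \<comment> \<open>The functional with these coefficients is evaluation at \<open>y\<close> minus
      the value at \<open>y\<close> predicted by \<open>d\<close> from the values on
      \<open>J\<close>; by \<open>nd\<close> it is not zero on all of \<open>R\<close>.\<close>
    define c where "c x = (if x = y then 1 else if x \<in> J then - d x y else 0)" for x
    have "\<exists>r\<in>R. (\<Sum>x\<in>I. c x * r x) \<noteq> 0"
    proof (rule ccontr)
      assume "\<not> ?thesis"
      then have "\<forall>x\<in>I. c x = 0" using nd[of c] by blast
      then have "c y = 0" using insert.prems by blast
      then show False by (simp add: c_def)
    qed
    then obtain r where r: "r \<in> R" "(\<Sum>x\<in>I. c x * r x) \<noteq> 0" by blast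
    \<comment> \<open>Subtracting the interpolation of \<open>r\<close> on \<open>J\<close> leaves a
      function that vanishes on \<open>J\<close> and whose value at \<open>y\<close> is that of the
      functional \<open>c\<close> on \<open>r\<close>.\<close>
    define s where "s x = r x + (\<Sum>j\<in>J. - r j * d j x)" for x
    have sR: "s \<in> R" unfolding s_def by (intro add r(1) sum) (use insert d in auto)
    have s0: "s x = 0" if "x \<in> J" for x
    proof -
      have "(\<Sum>j\<in>J. - r j * d j x) = (\<Sum>j\<in>J. if j = x then - r j else 0)"
        using d(2) that by (intro sum.cong) auto
      then show ?thesis using that insert.hyps by (simp add: s_def)
    qed
    have "(\<Sum>x\<in>I. c x * r x) = (\<Sum>x\<in>insert y J. c x * r x)"
      using insert.prems I by (intro sum.mono_neutral_right) (auto simp: c_def)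
    also have "\<dots> = r y + (\<Sum>x\<in>J. - d x y * r x)"
      using insert.hyps by (auto simp: c_def intro!: sum.cong)
    also have "\<dots> = s y" by (auto simp: s_def mult.commute)
    finally have sy: "s y \<noteq> 0" using r(2) by simp
    define t where "t x = inverse (s y) * s x" for x
    have "t \<in> R" unfolding t_def by (rule sm[OF sR])
    then have t: "t \<in> R" "t y = 1" "\<And>x. x \<in> J \<Longrightarrow> t x = 0"
      using sy s0 by (auto simp: t_def)
    \<comment> \<open>The old dual functions are corrected by multiples of \<open>t\<close> so that
      they vanish at \<open>y\<close> too; this does not change their values on
      \<open>J\<close>.\<close>
    define d' where "d' k = (if k = y then t else (\<lambda>x. d k x + (- d k y) * t x))" for k
    have "(\<lambda>x. d k x + (- d k y) * t x) \<in> R" if "k \<in> J" for k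
      by (rule add[OF d(1)[OF that] sm[OF t(1)]])
    then have "d' k \<in> R" if "k \<in> insert y J" for k
      using that t by (cases "k = y") (simp_all add: d'_def)
    moreover have "d' k x = (if x = k then 1 else 0)" if "k \<in> insert y J" "x \<in> insert y J" for k x
      using that d t insert.hyps by (auto simp: d'_def)
    ultimately show ?case by blast
  qed auto
  from this[OF subset_refl] obtain d where d: "\<And>k. k \<in> I \<Longrightarrow> d k \<in> R"
    "\<And>k x. k \<in> I \<Longrightarrow> x \<in> I \<Longrightarrow> d k x = (if x = k then 1 else 0)" by blast
  have "(\<Sum>j\<in>I. g j * d j x) = g x" if "x \<in> I" for x
  proof -
    have "(\<Sum>j\<in>I. g j * d j x) = (\<Sum>j\<in>I. if j = x then g j else 0)"
      using d(2) that by (intro sum.cong) auto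
    then show ?thesis using that I by simp
  qed
  moreover have "(\<lambda>x. \<Sum>j\<in>I. g j * d j x) \<in> R" by (rule sum) (use I d in auto)
  ultimately show ?thesis by (intro bexI[of _ "\<lambda>x. \<Sum>j\<in>I. g j * d j x"]) auto
qed

text \<open>A model whose vector space structure is transported to carriers inside \<open>'w\<close>
  when matrices are realized.\<close>

definition fun_module :: "('k::field, 'x \<Rightarrow> 'k) module" where
  "fun_module = \<lparr>carrier = UNIV, mult = undefined, one = undefined, zero = (\<lambda>_. 0),
     add = (\<lambda>f g x. f x + g x), smult = (\<lambda>c f x. c * f x)\<rparr>"

lemma vectorspace_fun_module: "vectorspace class_ring (fun_module :: ('k::field, 'x \<Rightarrow> 'k) module)"
proof -
  have "abelian_group (fun_module :: ('k, 'x \<Rightarrow> 'k) module)"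
  proof (rule abelian_groupI)
    show "\<exists>y\<in>carrier fun_module. y \<oplus>\<^bsub>fun_module\<^esub> x = \<zero>\<^bsub>fun_module\<^esub>" for x :: "'x \<Rightarrow> 'k"
      by (rule bexI[of _ "\<lambda>i. - x i"]) (auto simp: fun_module_def)
  qed (auto simp: fun_module_def algebra_simps)
  then have "Module.module class_ring (fun_module :: ('k, 'x \<Rightarrow> 'k) module)"
    by (intro moduleI class_cring.is_cring) (auto simp: fun_module_def algebra_simps)
  then show ?thesis unfolding vectorspace_def using class_field by blast
qed

section \<open>Bases of representations\<close>

lemma linear_mapI:
  assumes V: "vectorspace class_ring V" and W: "vectorspace class_ring W"
    and f: "\<And>x. x \<in> carrier V \<Longrightarrow> f x \<in> carrier W"
    and add: "\<And>x y. x \<in> carrier V \<Longrightarrow> y \<in> carrier V \<Longrightarrow> f (x \<oplus>\<^bsub>V\<^esub> y) = f x \<oplus>\<^bsub>W\<^esub> f y"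
    and sm: "\<And>c x. x \<in> carrier V \<Longrightarrow> f (c \<odot>\<^bsub>V\<^esub> x) = c \<odot>\<^bsub>W\<^esub> f x"
  shows "linear_map class_ring V W f"
proof -
  interpret V: vectorspace class_ring V by (rule V)
  interpret W: vectorspace class_ring W by (rule W)
  show ?thesis by unfold_locales (auto simp: LinearCombinations.module_hom_def f add sm)
qed

lemma linear_mapD:
  assumes "linear_map class_ring V W f"
  shows "vectorspace class_ring V" "vectorspace class_ring W"
    and "\<And>x. x \<in> carrier V \<Longrightarrow> f x \<in> carrier W"
    and "\<And>x y. x \<in> carrier V \<Longrightarrow> y \<in> carrier V \<Longrightarrow> f (x \<oplus>\<^bsub>V\<^esub> y) = f x \<oplus>\<^bsub>W\<^esub> f y"
    and "\<And>c x. x \<in> carrier V \<Longrightarrow> f (c \<odot>\<^bsub>V\<^esub> x) = c \<odot>\<^bsub>W\<^esub> f x"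
proof -
  interpret linear_map class_ring V W f by fact
  show "vectorspace class_ring V" by (rule V.vectorspace_axioms)
  show "vectorspace class_ring W" by (rule W.vectorspace_axioms)
  show "\<And>x. x \<in> carrier V \<Longrightarrow> f x \<in> carrier W" by simp
  show "\<And>x y. x \<in> carrier V \<Longrightarrow> y \<in> carrier V \<Longrightarrow> f (x \<oplus>\<^bsub>V\<^esub> y) = f x \<oplus>\<^bsub>W\<^esub> f y" by simp
  show "\<And>c x. x \<in> carrier V \<Longrightarrow> f (c \<odot>\<^bsub>V\<^esub> x) = c \<odot>\<^bsub>W\<^esub> f x" by simp
qed

lemma is_basisD:
  assumes "is_basis V B b"
  shows "finite B" "b \<in> B \<rightarrow> carrier V" "\<And>x. x \<in> B \<Longrightarrow> b x \<in> carrier V"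
  using assms by (auto simp: is_basis_def)

lemma is_basis_image:
  assumes f: "linear_map class_ring V W f" and bij: "bij_betw f (carrier V) (carrier W)"
    and b: "is_basis V B b"
  shows "is_basis W B (\<lambda>x. f (b x))"
  unfolding is_basis_def
proof (intro conjI ballI allI impI)
  note V = linear_mapD[OF f] and b' = is_basisD[OF b]
  show "finite B" "(\<lambda>x. f (b x)) \<in> B \<rightarrow> carrier W" using b' V(3) by auto
  have eq: "f (lsum V B c b) = lsum W B c (\<lambda>x. f (b x))" for c
    by (rule lsum_hom'[OF f b'(2,1)])
  show "\<exists>c. v = lsum W B c (\<lambda>x. f (b x))" if v: "v \<in> carrier W" for v
  proof -
    obtain w where "w \<in> carrier V" "v = f w" using bij v by (auto simp: bij_betw_def)
    then show ?thesis using eq[of "coord V B b w"] lsum_coord[OF b] by metis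
  qed
  show "c x = 0" if c: "lsum W B c (\<lambda>x. f (b x)) = \<zero>\<^bsub>W\<^esub>" and x: "x \<in> B" for c x
  proof -
    have "f \<zero>\<^bsub>V\<^esub> = \<zero>\<^bsub>W\<^esub>"
      using V(5)[OF vs_zero_closed[OF V(1)], of 0] vectorspace_simps[OF V(1)] vectorspace_simps[OF V(2)] V(3)
      by metis
    then have "f (lsum V B c b) = f \<zero>\<^bsub>V\<^esub>" using c eq by simp
    then have "lsum V B c b = \<zero>\<^bsub>V\<^esub>"
      using bij lsum_closed[OF V(1) b'(2)] vs_zero_closed[OF V(1)]
      by (auto simp: bij_betw_def dest: inj_onD)
    then show ?thesis using b x unfolding is_basis_def by blast
  qed
qed

text \<open>Made \<open>undefined\<close> off the carrier, as is demanded of the members of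
  \<open>rep_isos\<close>.\<close>

definition linext ::
  "('k::field, 'w, 'z) module_scheme \<Rightarrow> 'x set \<Rightarrow> ('x \<Rightarrow> 'w) \<Rightarrow>
   ('k, 'u, 'y) module_scheme \<Rightarrow> ('x \<Rightarrow> 'u) \<Rightarrow> 'w \<Rightarrow> 'u" where
  "linext V B b W b' = (\<lambda>v\<in>carrier V. lsum W B (coord V B b v) b')"

lemma linext_lsum:
  assumes V: "vectorspace class_ring V" and b: "is_basis V B b"
    and W: "vectorspace class_ring W" and b': "b' \<in> B \<rightarrow> carrier W"
  shows "linext V B b W b' (lsum V B c b) = lsum W B c b'"
proof -
  have "lsum W B (coord V B b (lsum V B c b)) b' = lsum W B c b'"
    by (rule lsum_cong[OF W b']) (auto simp: coord_lsum[OF V b])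
  then show ?thesis
    unfolding linext_def using lsum_closed[OF V is_basisD(2)[OF b]] by simp
qed

lemma linext_basis:
  assumes V: "vectorspace class_ring V" and b: "is_basis V B b"
    and W: "vectorspace class_ring W" and b': "b' \<in> B \<rightarrow> carrier W" and x: "x \<in> B"
  shows "linext V B b W b' (b x) = b' x"
  using linext_lsum[OF V b W b', of "\<lambda>y. if y = x then 1 else 0"]
    lsum_delta[OF V is_basisD(2,1)[OF b] x] lsum_delta[OF W b' is_basisD(1)[OF b] x] by simp

lemma linext_linear:
  assumes V: "vectorspace class_ring V" and b: "is_basis V B b"
    and W: "vectorspace class_ring W" and b': "b' \<in> B \<rightarrow> carrier W"
  shows "linear_map class_ring V W (linext V B b W b')"
proof (rule linear_mapI[OF V W])
  note fin = is_basisD(1)[OF b]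
  show "linext V B b W b' x \<in> carrier W" if "x \<in> carrier V" for x
    using that lsum_closed[OF W b'] by (simp add: linext_def)
  show "linext V B b W b' (x \<oplus>\<^bsub>V\<^esub> y) = linext V B b W b' x \<oplus>\<^bsub>W\<^esub> linext V B b W b' y"
    if "x \<in> carrier V" "y \<in> carrier V" for x y
  proof -
    have "lsum W B (coord V B b (x \<oplus>\<^bsub>V\<^esub> y)) b' = lsum W B (\<lambda>z. coord V B b x z + coord V B b y z) b'"
      by (rule lsum_cong[OF W b']) (auto simp: coord_add[OF V b] that)
    then show ?thesis using that vs_add_closed[OF V] by (simp add: linext_def lsum_add[OF W b' fin])
  qed
  show "linext V B b W b' (c \<odot>\<^bsub>V\<^esub> x) = c \<odot>\<^bsub>W\<^esub> linext V B b W b' x"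
    if "x \<in> carrier V" for c x
  proof -
    have "lsum W B (coord V B b (c \<odot>\<^bsub>V\<^esub> x)) b' = lsum W B (\<lambda>z. c * coord V B b x z) b'"
      by (rule lsum_cong[OF W b']) (auto simp: coord_smult[OF V b] that)
    then show ?thesis using that vs_smult_closed[OF V] by (simp add: linext_def lsum_smult[OF W b' fin])
  qed
qed

lemma linext_bij:
  assumes V: "vectorspace class_ring V" and b: "is_basis V B b"
    and W: "vectorspace class_ring W" and b': "is_basis W B b'"
  shows "bij_betw (linext V B b W b') (carrier V) (carrier W)"
proof (rule bij_betw_byWitness[where f' = "linext W B b' V b"])
  note B = is_basisD[OF b] and B' = is_basisD[OF b']
  show "\<forall>v\<in>carrier V. linext W B b' V b (linext V B b W b' v) = v"
    using linext_lsum[OF V b W B'(2)] linext_lsum[OF W b' V B(2)] lsum_coord[OF b] by metis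
  show "\<forall>v\<in>carrier W. linext V B b W b' (linext W B b' V b v) = v"
    using linext_lsum[OF V b W B'(2)] linext_lsum[OF W b' V B(2)] lsum_coord[OF b'] by metis
  show "linext V B b W b' ` carrier V \<subseteq> carrier W" "linext W B b' V b ` carrier W \<subseteq> carrier V"
    using linear_mapD(3)[OF linext_linear[OF V b W B'(2)]] linear_mapD(3)[OF linext_linear[OF W b' V B(2)]]
    by auto
qed

text \<open>\<open>A \<alpha> z x\<close> is the matrix entry in row \<open>z\<close> and column
  \<open>x\<close>. The families are extensional both in the node and in the index, so that the set
  has the intended cardinality.\<close>

definition rep_bases ::
  "('v, 'a, 'y) quiver_scheme \<Rightarrow> ('k::field, 'w, 'v, 'a, 'z) rep_scheme \<Rightarrow>
   ('v \<Rightarrow> 'x set) \<Rightarrow> ('a \<Rightarrow> 'x \<Rightarrow> 'x \<Rightarrow> 'k) \<Rightarrow> ('v \<Rightarrow> 'x \<Rightarrow> 'w) set" where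
  "rep_bases Q M B A = {b \<in> (\<Pi>\<^sub>E i\<in>nodes Q. B i \<rightarrow>\<^sub>E vecs M i).
     (\<forall>i\<in>nodes Q. is_basis (vsp M i) (B i) (b i)) \<and>
     (\<forall>\<alpha>\<in>arrows Q. \<forall>x\<in>B (src Q \<alpha>). lmap M \<alpha> (b (src Q \<alpha>) x) =
        lsum (vsp M (tgt Q \<alpha>)) (B (tgt Q \<alpha>)) (\<lambda>z. A \<alpha> z x) (b (tgt Q \<alpha>)))}"

lemma is_repD:
  assumes "is_rep Q M"
  shows "i \<in> nodes Q \<Longrightarrow> vectorspace class_ring (vsp M i)"
    and "i \<in> nodes Q \<Longrightarrow> vectorspace.fin_dim class_ring (vsp M i)"
    and "\<alpha> \<in> arrows Q \<Longrightarrow> linear_map class_ring (vsp M (src Q \<alpha>)) (vsp M (tgt Q \<alpha>)) (lmap M \<alpha>)"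
  using assms unfolding is_rep_def by auto

lemma rep_basesD:
  assumes "b \<in> rep_bases Q M B A"
  shows "b \<in> (\<Pi>\<^sub>E i\<in>nodes Q. B i \<rightarrow>\<^sub>E vecs M i)"
    and "i \<in> nodes Q \<Longrightarrow> is_basis (vsp M i) (B i) (b i)"
    and "i \<in> nodes Q \<Longrightarrow> b i \<in> B i \<rightarrow> vecs M i"
    and "\<alpha> \<in> arrows Q \<Longrightarrow> x \<in> B (src Q \<alpha>) \<Longrightarrow> lmap M \<alpha> (b (src Q \<alpha>) x) =
        lsum (vsp M (tgt Q \<alpha>)) (B (tgt Q \<alpha>)) (\<lambda>z. A \<alpha> z x) (b (tgt Q \<alpha>))"
  using assms unfolding rep_bases_def by (auto simp: PiE_iff)

lemma rep_isosD:
  assumes "\<phi> \<in> rep_isos Q M M'"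
  shows "\<phi> \<in> extensional (nodes Q)"
    and "i \<in> nodes Q \<Longrightarrow> \<phi> i \<in> extensional (vecs M i)"
    and "i \<in> nodes Q \<Longrightarrow> linear_map class_ring (vsp M i) (vsp M' i) (\<phi> i)"
    and "i \<in> nodes Q \<Longrightarrow> bij_betw (\<phi> i) (vecs M i) (vecs M' i)"
    and "\<alpha> \<in> arrows Q \<Longrightarrow> x \<in> vecs M (src Q \<alpha>) \<Longrightarrow> \<phi> (tgt Q \<alpha>) (lmap M \<alpha> x) = lmap M' \<alpha> (\<phi> (src Q \<alpha>) x)"
  using assms unfolding rep_isos_def by auto

lemma quiverD:
  assumes "quiver Q"
  shows "finite (nodes Q)" "finite (arrows Q)"
    and "\<alpha> \<in> arrows Q \<Longrightarrow> src Q \<alpha> \<in> nodes Q" "\<alpha> \<in> arrows Q \<Longrightarrow> tgt Q \<alpha> \<in> nodes Q"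
  using assms unfolding quiver_def by auto

lemma lmap_lsum:
  assumes Q: "quiver Q" and M: "is_rep Q M" and b: "b \<in> rep_bases Q M B A" and \<alpha>: "\<alpha> \<in> arrows Q"
  shows "lmap M \<alpha> (lsum (vsp M (src Q \<alpha>)) (B (src Q \<alpha>)) c (b (src Q \<alpha>))) =
    lsum (vsp M (tgt Q \<alpha>)) (B (tgt Q \<alpha>)) (\<lambda>z. \<Sum>x\<in>B (src Q \<alpha>). c x * A \<alpha> z x) (b (tgt Q \<alpha>))"
proof -
  let ?i = "src Q \<alpha>" and ?j = "tgt Q \<alpha>"
  note ij = quiverD(3,4)[OF Q \<alpha>]
  note l = linear_mapD[OF is_repD(3)[OF M \<alpha>]]
  have bi: "finite (B ?i)" "b ?i \<in> B ?i \<rightarrow> vecs M ?i" and bj: "finite (B ?j)" "b ?j \<in> B ?j \<rightarrow> vecs M ?j"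
    using rep_basesD(2,3)[OF b] ij is_basisD(1) by blast+
  have "lmap M \<alpha> (lsum (vsp M ?i) (B ?i) c (b ?i)) = lsum (vsp M ?j) (B ?i) c (\<lambda>x. lmap M \<alpha> (b ?i x))"
    by (rule lsum_hom'[OF is_repD(3)[OF M \<alpha>] bi(2,1)])
  also have "\<dots> = lsum (vsp M ?j) (B ?i) c (\<lambda>x. lsum (vsp M ?j) (B ?j) (\<lambda>z. A \<alpha> z x) (b ?j))"
    by (rule lsum_cong[OF l(2)]) (use bi l(3) rep_basesD(4)[OF b \<alpha>] in auto)
  also have "\<dots> = lsum (vsp M ?j) (B ?j) (\<lambda>z. \<Sum>x\<in>B ?i. c x * A \<alpha> z x) (b ?j)"
    by (rule lsum_lsum[OF l(2) bj(2) bi(1) bj(1)])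
  finally show ?thesis .
qed

lemma rep_bases_image:
  assumes Q: "quiver Q" and R: "is_rep Q R" and b: "b \<in> rep_bases Q R B A" and \<phi>: "\<phi> \<in> rep_isos Q R M"
  shows "(\<lambda>i\<in>nodes Q. \<lambda>x\<in>B i. \<phi> i (b i x)) \<in> rep_bases Q M B A"
proof -
  note p = rep_isosD[OF \<phi>] and B = rep_basesD[OF b]
  have ba: "is_basis (vsp M i) (B i) (\<lambda>x\<in>B i. \<phi> i (b i x))" if i: "i \<in> nodes Q" for i
    by (rule is_basis_cong[OF linear_mapD(2)[OF p(3)[OF i]] is_basis_image[OF p(3)[OF i] p(4)[OF i] B(2)[OF i]]])
      auto
  have "lmap M \<alpha> (\<phi> i (b i x)) = lsum (vsp M j) (B j) (\<lambda>z. A \<alpha> z x) (\<lambda>x\<in>B j. \<phi> j (b j x))"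
    if \<alpha>: "\<alpha> \<in> arrows Q" and x: "x \<in> B i" and ij: "i = src Q \<alpha>" "j = tgt Q \<alpha>" for \<alpha> x i j
  proof -
    have ijn: "i \<in> nodes Q" "j \<in> nodes Q" using quiverD(3,4)[OF Q \<alpha>] ij by auto
    note l = is_basisD[OF B(2)[OF ijn(2)]]
    have "lmap M \<alpha> (\<phi> i (b i x)) = \<phi> j (lmap R \<alpha> (b i x))"
      using p(5)[OF \<alpha>, of "b i x"] funcset_mem[OF B(3)[OF ijn(1)] x] ij by simp
    also have "lmap R \<alpha> (b i x) = lsum (vsp R j) (B j) (\<lambda>z. A \<alpha> z x) (b j)"
      using B(4)[OF \<alpha>] x ij by auto
    also have "\<phi> j \<dots> = lsum (vsp M j) (B j) (\<lambda>z. A \<alpha> z x) (\<lambda>x. \<phi> j (b j x))"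
      by (rule lsum_hom'[OF p(3)[OF ijn(2)] l(2,1)])
    also have "\<dots> = lsum (vsp M j) (B j) (\<lambda>z. A \<alpha> z x) (\<lambda>x\<in>B j. \<phi> j (b j x))"
      by (rule lsum_cong) (use l linear_mapD[OF p(3)[OF ijn(2)]] in auto)
    finally show ?thesis .
  qed
  then show ?thesis
    unfolding rep_bases_def
    using ba B(3) linear_mapD(3)[OF p(3)] quiverD(3,4)[OF Q] by (auto simp: PiE_iff Pi_def)
qed

definition iso_of_bases ::
  "('v, 'a, 'y) quiver_scheme \<Rightarrow> ('k::field, 'w, 'v, 'a, 'z) rep_scheme \<Rightarrow> ('v \<Rightarrow> 'x set) \<Rightarrow>
   ('v \<Rightarrow> 'x \<Rightarrow> 'w) \<Rightarrow> ('k, 'u, 'v, 'a, 'z') rep_scheme \<Rightarrow> ('v \<Rightarrow> 'x \<Rightarrow> 'u) \<Rightarrow> 'v \<Rightarrow> 'w \<Rightarrow> 'u" where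
  "iso_of_bases Q R B b M b' = (\<lambda>i\<in>nodes Q. linext (vsp R i) (B i) (b i) (vsp M i) (b' i))"

lemma iso_of_bases_in_rep_isos:
  assumes Q: "quiver Q" and R: "is_rep Q R" and M: "is_rep Q M"
    and b: "b \<in> rep_bases Q R B A" and b': "b' \<in> rep_bases Q M B A"
  shows "iso_of_bases Q R B b M b' \<in> rep_isos Q R M"
proof -
  note B = rep_basesD[OF b] and B' = rep_basesD[OF b'] and VR = is_repD(1)[OF R] and VM = is_repD(1)[OF M]
  note lin = linext_linear[OF VR B(2) VM B'(3)] and bij = linext_bij[OF VR B(2) VM B'(2)]
  have "linext (vsp R j) (B j) (b j) (vsp M j) (b' j) (lmap R \<alpha> v) = lmap M \<alpha> (linext (vsp R i) (B i) (b i) (vsp M i) (b' i) v)"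
    if \<alpha>: "\<alpha> \<in> arrows Q" and v: "v \<in> vecs R i" and ij: "i = src Q \<alpha>" "j = tgt Q \<alpha>" for \<alpha> v i j
  proof -
    have ijn: "i \<in> nodes Q" "j \<in> nodes Q" using quiverD(3,4)[OF Q \<alpha>] ij by auto
    define c where "c = coord (vsp R i) (B i) (b i) v"
    have vc: "v = lsum (vsp R i) (B i) c (b i)" using lsum_coord[OF B(2)[OF ijn(1)] v] c_def by simp
    let ?d = "\<lambda>z. \<Sum>x\<in>B i. c x * A \<alpha> z x"
    have "lmap R \<alpha> v = lsum (vsp R j) (B j) ?d (b j)"
      using lmap_lsum[OF Q R b \<alpha>, of c] vc ij by simp
    then have "linext (vsp R j) (B j) (b j) (vsp M j) (b' j) (lmap R \<alpha> v) = lsum (vsp M j) (B j) ?d (b' j)"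
      using linext_lsum[OF VR[OF ijn(2)] B(2)[OF ijn(2)] VM[OF ijn(2)] B'(3)[OF ijn(2)]] by simp
    moreover have "linext (vsp R i) (B i) (b i) (vsp M i) (b' i) v = lsum (vsp M i) (B i) c (b' i)"
      using linext_lsum[OF VR[OF ijn(1)] B(2)[OF ijn(1)] VM[OF ijn(1)] B'(3)[OF ijn(1)]] vc by simp
    moreover have "lmap M \<alpha> (lsum (vsp M i) (B i) c (b' i)) = lsum (vsp M j) (B j) ?d (b' j)"
      using lmap_lsum[OF Q M b' \<alpha>, of c] ij by simp
    ultimately show ?thesis by simp
  qed
  then show ?thesis
    unfolding rep_isos_def iso_of_bases_def
    using lin bij quiverD(3,4)[OF Q] by (auto simp: linext_def[of "vsp R _"])
qed

text \<open>An isomorphism is determined by the image of \<open>b\<close>. Conversely, the linear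
  extension that sends \<open>b\<close> to a basis with the same matrices commutes with the arrows,
  since both composites are given by the same matrix product.\<close>

lemma rep_isos_bij_bases:
  assumes Q: "quiver Q" and R: "is_rep Q R" and M: "is_rep Q M" and b: "b \<in> rep_bases Q R B A"
  shows "bij_betw (\<lambda>\<phi>. \<lambda>i\<in>nodes Q. \<lambda>x\<in>B i. \<phi> i (b i x)) (rep_isos Q R M) (rep_bases Q M B A)"
proof (rule bij_betwI[where g = "iso_of_bases Q R B b M"])
  note B = rep_basesD[OF b] and VR = is_repD(1)[OF R] and VM = is_repD(1)[OF M]
  show "(\<lambda>\<phi>. \<lambda>i\<in>nodes Q. \<lambda>x\<in>B i. \<phi> i (b i x)) \<in> rep_isos Q R M \<rightarrow> rep_bases Q M B A"
    using rep_bases_image[OF Q R b] by blast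
  show "iso_of_bases Q R B b M \<in> rep_bases Q M B A \<rightarrow> rep_isos Q R M"
    using iso_of_bases_in_rep_isos[OF Q R M b] by blast
  show "(\<lambda>i\<in>nodes Q. \<lambda>x\<in>B i. iso_of_bases Q R B b M b' i (b i x)) = b'" if b': "b' \<in> rep_bases Q M B A" for b'
  proof -
    note B' = rep_basesD[OF b']
    have "iso_of_bases Q R B b M b' i (b i x) = b' i x" if "i \<in> nodes Q" "x \<in> B i" for i x
      using linext_basis[OF VR[OF that(1)] B(2)[OF that(1)] VM[OF that(1)] B'(3)[OF that(1)] that(2)] that
      by (simp add: iso_of_bases_def)
    then show ?thesis
      using B'(1) by (auto simp: fun_eq_iff restrict_def PiE_iff extensional_def)
  qed
  show "iso_of_bases Q R B b M (\<lambda>i\<in>nodes Q. \<lambda>x\<in>B i. \<phi> i (b i x)) = \<phi>" if \<phi>: "\<phi> \<in> rep_isos Q R M" for \<phi>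
  proof
    fix i
    note p = rep_isosD[OF \<phi>]
    show "iso_of_bases Q R B b M (\<lambda>i\<in>nodes Q. \<lambda>x\<in>B i. \<phi> i (b i x)) i = \<phi> i"
    proof (cases "i \<in> nodes Q")
      case i: True
      note l = linear_mapD[OF p(3)[OF i]] and l' = is_basisD[OF B(2)[OF i]]
      have "lsum (vsp M i) (B i) (coord (vsp R i) (B i) (b i) v) (\<lambda>x\<in>B i. \<phi> i (b i x)) = \<phi> i v"
        if v: "v \<in> vecs R i" for v
      proof -
        let ?c = "coord (vsp R i) (B i) (b i) v"
        have "\<phi> i v = \<phi> i (lsum (vsp R i) (B i) ?c (b i))" using lsum_coord[OF B(2)[OF i] v] by simp
        also have "\<dots> = lsum (vsp M i) (B i) ?c (\<lambda>x. \<phi> i (b i x))"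
          by (rule lsum_hom'[OF p(3)[OF i] l'(2,1)])
        also have "\<dots> = lsum (vsp M i) (B i) ?c (\<lambda>x\<in>B i. \<phi> i (b i x))"
          by (rule lsum_cong[OF l(2)]) (use l l' in auto)
        finally show ?thesis by simp
      qed
      then show ?thesis
        using p(2)[OF i] i by (auto simp: iso_of_bases_def linext_def fun_eq_iff extensional_def)
    next
      case False
      then show ?thesis using p(1) by (auto simp: iso_of_bases_def extensional_def)
    qed
  qed
qed

lemma rep_bases_exist:
  assumes Q: "quiver Q" and M: "is_rep Q M"
  shows "\<exists>A. rep_bases Q M (\<lambda>i. {..<nat (dim_vector Q M i)}) A \<noteq> {}"
proof -
  let ?B = "\<lambda>i. {..<nat (dim_vector Q M i)}"
  have "\<exists>b. is_basis (vsp M i) (?B i) b" if "i \<in> nodes Q" for i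
    using basis_exists[OF is_repD(1,2)[OF M that]] that by (simp add: dim_vector_def)
  then obtain b where b: "\<And>i. i \<in> nodes Q \<Longrightarrow> is_basis (vsp M i) (?B i) (b i)" by metis
  define b' where "b' = (\<lambda>i\<in>nodes Q. restrict (b i) (?B i))"
  have b': "is_basis (vsp M i) (?B i) (b' i)" if "i \<in> nodes Q" for i
    by (rule is_basis_cong[OF is_repD(1)[OF M that] b[OF that]]) (use that in \<open>auto simp: b'_def\<close>)
  define A where "A \<alpha> z x = coord (vsp M (tgt Q \<alpha>)) (?B (tgt Q \<alpha>)) (b' (tgt Q \<alpha>)) (lmap M \<alpha> (b' (src Q \<alpha>) x)) z" for \<alpha> z x
  have "lmap M \<alpha> (b' (src Q \<alpha>) x) = lsum (vsp M (tgt Q \<alpha>)) (?B (tgt Q \<alpha>)) (\<lambda>z. A \<alpha> z x) (b' (tgt Q \<alpha>))"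
    if \<alpha>: "\<alpha> \<in> arrows Q" and x: "x \<in> ?B (src Q \<alpha>)" for \<alpha> x
    unfolding A_def
    by (rule lsum_coord[symmetric, OF b'[OF quiverD(4)[OF Q \<alpha>]] linear_mapD(3)[OF is_repD(3)[OF M \<alpha>]]])
      (use is_basisD(3)[OF b'[OF quiverD(3)[OF Q \<alpha>]] x] in simp)
  moreover have "b' \<in> (\<Pi>\<^sub>E i\<in>nodes Q. ?B i \<rightarrow>\<^sub>E vecs M i)"
    using is_basisD(3)[OF b] by (auto simp: b'_def PiE_iff)
  ultimately have "b' \<in> rep_bases Q M ?B A"
    unfolding rep_bases_def using b' by blast
  then show ?thesis by blast
qed

lemma finite_rep_bases:
  assumes Q: "quiver Q" and M: "is_rep Q (M :: ('k::{field,finite}, 'w, 'v, 'a, 'z) rep_scheme)"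
  shows "finite (rep_bases Q M B A)"
proof (cases "rep_bases Q M B A = {}")
  case False
  then obtain b where b: "b \<in> rep_bases Q M B A" by blast
  have "finite (\<Pi>\<^sub>E i\<in>nodes Q. B i \<rightarrow>\<^sub>E vecs M i)"
    using is_basisD(1)[OF rep_basesD(2)[OF b]] card_vectorspace(2)[OF is_repD(1,2)[OF M]] quiverD(1)[OF Q]
    by (intro finite_PiE) auto
  then show ?thesis by (rule finite_subset[rotated]) (auto simp: rep_bases_def)
qed simp

section \<open>Gram matrices and isometries\<close>

lemma sd_quiverD:
  assumes "sd_quiver Q"
  shows "quiver Q"
    and "i \<in> nodes Q \<Longrightarrow> sig0 Q i \<in> nodes Q" "i \<in> nodes Q \<Longrightarrow> sig0 Q (sig0 Q i) = i"
    and "\<alpha> \<in> arrows Q \<Longrightarrow> sig1 Q \<alpha> \<in> arrows Q" "\<alpha> \<in> arrows Q \<Longrightarrow> sig1 Q (sig1 Q \<alpha>) = \<alpha>"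
    and "\<alpha> \<in> arrows Q \<Longrightarrow> src Q (sig1 Q \<alpha>) = sig0 Q (tgt Q \<alpha>)"
      "\<alpha> \<in> arrows Q \<Longrightarrow> tgt Q (sig1 Q \<alpha>) = sig0 Q (src Q \<alpha>)"
    and "i \<in> nodes Q \<Longrightarrow> sgn_s Q i = 1 \<or> sgn_s Q i = -1" "i \<in> nodes Q \<Longrightarrow> sgn_s Q (sig0 Q i) = sgn_s Q i"
    and "\<alpha> \<in> arrows Q \<Longrightarrow> sgn_tau Q \<alpha> = 1 \<or> sgn_tau Q \<alpha> = -1"
      "\<alpha> \<in> arrows Q \<Longrightarrow> sgn_tau Q \<alpha> * sgn_tau Q (sig1 Q \<alpha>) = sgn_s Q (src Q \<alpha>) * sgn_s Q (tgt Q \<alpha>)"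
  using assms unfolding sd_quiver_def quiver_involution_def duality_structure_def by blast+

text \<open>The properties on which the comparison of Gram matrices rests. They are singled out so
  that the comparison can be applied to \<open>sd_reduction\<close>, whose form is defined through
  representatives of cosets.\<close>

definition form_rep ::
  "('v, 'a, 'y) sdquiver_scheme \<Rightarrow> ('k::field, 'w, 'v, 'a, 'z) sdrep_scheme \<Rightarrow> bool" where
  "form_rep Q M \<longleftrightarrow> is_rep Q M \<and> bilinear_form Q M \<and>
     (\<forall>i\<in>nodes Q. \<forall>j\<in>nodes Q. i \<noteq> sig0 Q j \<longrightarrow> (\<forall>x\<in>vecs M i. \<forall>y\<in>vecs M j. form M i j x y = 0))"

lemma form_repD:
  assumes "form_rep Q M"
  shows "is_rep Q M" "bilinear_form Q M"
    and "i \<in> nodes Q \<Longrightarrow> j \<in> nodes Q \<Longrightarrow> i \<noteq> sig0 Q j \<Longrightarrow> x \<in> vecs M i \<Longrightarrow> y \<in> vecs M j \<Longrightarrow> form M i j x y = 0"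
  using assms unfolding form_rep_def by blast+

lemma is_sdrep_form_rep: "is_sdrep Q M \<Longrightarrow> form_rep Q M"
  unfolding is_sdrep_def form_rep_def by blast

lemma form_sym:
  assumes "sd_quiver Q" "is_sdrep Q M" "i \<in> nodes Q" "x \<in> vecs M i" "y \<in> vecs M (sig0 Q i)"
  shows "form M i (sig0 Q i) x y = of_int (sgn_s Q i) * form M (sig0 Q i) i y x"
  using assms unfolding is_sdrep_def by blast

lemma form_adj:
  assumes "is_sdrep Q M" "\<alpha> \<in> arrows Q" "x \<in> vecs M (src Q \<alpha>)" "y \<in> vecs M (sig0 Q (tgt Q \<alpha>))"
  shows "form M (tgt Q \<alpha>) (sig0 Q (tgt Q \<alpha>)) (lmap M \<alpha> x) y =
    of_int (sgn_tau Q \<alpha>) * form M (src Q \<alpha>) (sig0 Q (src Q \<alpha>)) x (lmap M (sig1 Q \<alpha>) y)"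
  using assms unfolding is_sdrep_def by blast

lemma bilinear_formD:
  assumes "bilinear_form Q M" "i \<in> nodes Q" "j \<in> nodes Q"
  shows "x \<in> vecs M i \<Longrightarrow> x' \<in> vecs M i \<Longrightarrow> y \<in> vecs M j \<Longrightarrow>
        form M i j (x \<oplus>\<^bsub>vsp M i\<^esub> x') y = form M i j x y + form M i j x' y"
    and "x \<in> vecs M i \<Longrightarrow> y \<in> vecs M j \<Longrightarrow> y' \<in> vecs M j \<Longrightarrow>
        form M i j x (y \<oplus>\<^bsub>vsp M j\<^esub> y') = form M i j x y + form M i j x y'"
    and "x \<in> vecs M i \<Longrightarrow> y \<in> vecs M j \<Longrightarrow> form M i j (c \<odot>\<^bsub>vsp M i\<^esub> x) y = c * form M i j x y"
    and "x \<in> vecs M i \<Longrightarrow> y \<in> vecs M j \<Longrightarrow> form M i j x (c \<odot>\<^bsub>vsp M j\<^esub> y) = c * form M i j x y"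
  using assms unfolding bilinear_form_def by blast+

lemma form_lsum_left:
  assumes M: "is_rep Q M" "bilinear_form Q M" and ij: "i \<in> nodes Q" "j \<in> nodes Q"
    and b: "b \<in> B \<rightarrow> vecs M i" "finite B" and y: "y \<in> vecs M j"
  shows "form M i j (lsum (vsp M i) B c b) y = (\<Sum>x\<in>B. c x * form M i j (b x) y)"
  by (rule functional_lsum[OF is_repD(1)[OF M(1) ij(1)] _ _ b, where f = "\<lambda>x. form M i j x y"])
    (simp_all add: bilinear_formD[OF M(2) ij] y)

lemma form_lsum_right:
  assumes M: "is_rep Q M" "bilinear_form Q M" and ij: "i \<in> nodes Q" "j \<in> nodes Q"
    and b: "b \<in> B \<rightarrow> vecs M j" "finite B" and x: "x \<in> vecs M i"
  shows "form M i j x (lsum (vsp M j) B c b) = (\<Sum>y\<in>B. c y * form M i j x (b y))"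
  by (rule functional_lsum[OF is_repD(1)[OF M(1) ij(2)] _ _ b, where f = "\<lambda>y. form M i j x y"])
    (simp_all add: bilinear_formD[OF M(2) ij] x)

lemma form_zero:
  assumes M: "is_rep Q M" "bilinear_form Q M" and ij: "i \<in> nodes Q" "j \<in> nodes Q"
  shows "y \<in> vecs M j \<Longrightarrow> form M i j \<zero>\<^bsub>vsp M i\<^esub> y = 0" "x \<in> vecs M i \<Longrightarrow> form M i j x \<zero>\<^bsub>vsp M j\<^esub> = 0"
proof -
  note vi = vectorspace_simps[OF is_repD(1)[OF M(1) ij(1)]] and vj = vectorspace_simps[OF is_repD(1)[OF M(1) ij(2)]]
  show "form M i j \<zero>\<^bsub>vsp M i\<^esub> y = 0" if "y \<in> vecs M j"
    using bilinear_formD(3)[OF M(2) ij vi(3) that, of 0] vi(8) by simp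
  show "form M i j x \<zero>\<^bsub>vsp M j\<^esub> = 0" if "x \<in> vecs M i"
    using bilinear_formD(4)[OF M(2) ij that vj(3), of 0] vj(8) by simp
qed

text \<open>Only the blocks between a node and its \<sigma>-image are recorded, since orthogonality
  makes the other blocks vanish.\<close>

definition gram_bases ::
  "('v, 'a, 'y) sdquiver_scheme \<Rightarrow> ('k::field, 'w, 'v, 'a, 'z) sdrep_scheme \<Rightarrow> ('v \<Rightarrow> 'x set) \<Rightarrow>
   ('a \<Rightarrow> 'x \<Rightarrow> 'x \<Rightarrow> 'k) \<Rightarrow> ('v \<Rightarrow> 'x \<Rightarrow> 'x \<Rightarrow> 'k) \<Rightarrow> ('v \<Rightarrow> 'x \<Rightarrow> 'w) set" where
  "gram_bases Q M B A \<Gamma> = {b \<in> rep_bases Q M B A. \<forall>i\<in>nodes Q. \<forall>x\<in>B i. \<forall>y\<in>B (sig0 Q i).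
     form M i (sig0 Q i) (b i x) (b (sig0 Q i) y) = \<Gamma> i x y}"

lemma gram_basesD:
  assumes "b \<in> gram_bases Q M B A \<Gamma>"
  shows "b \<in> rep_bases Q M B A"
    and "i \<in> nodes Q \<Longrightarrow> x \<in> B i \<Longrightarrow> y \<in> B (sig0 Q i) \<Longrightarrow> form M i (sig0 Q i) (b i x) (b (sig0 Q i) y) = \<Gamma> i x y"
  using assms unfolding gram_bases_def by auto

text \<open>On a block of \<open>i\<close> and \<open>sig0 Q i\<close>, bilinear expansion reduces
  equality of the forms to equality of the Gram matrices; on the other blocks both forms are
  zero.\<close>

lemma iso_isometric_iff_gram:
  assumes Q: "sd_quiver Q" and R: "form_rep Q R" and M: "form_rep Q M" and b: "b \<in> gram_bases Q R B A \<Gamma>"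
    and \<phi>: "\<phi> \<in> rep_isos Q R M"
  shows "\<phi> \<in> isometries Q R M \<longleftrightarrow> (\<lambda>i\<in>nodes Q. \<lambda>x\<in>B i. \<phi> i (b i x)) \<in> gram_bases Q M B A \<Gamma>"
    (is "_ \<longleftrightarrow> ?b \<in> _")
proof
  note sg = sd_quiverD(2,3)[OF Q]
  note p = rep_isosD[OF \<phi>] and B = rep_basesD[OF gram_basesD(1)[OF b]] and G = gram_basesD(2)[OF b]
  have b': "?b \<in> rep_bases Q M B A"
    by (rule rep_bases_image[OF sd_quiverD(1)[OF Q] form_repD(1)[OF R] gram_basesD(1)[OF b] \<phi>])
  show "?b \<in> gram_bases Q M B A \<Gamma>" if "\<phi> \<in> isometries Q R M"
    using that b' B(3) sg G unfolding gram_bases_def isometries_def by (auto simp: Pi_def)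
  show "\<phi> \<in> isometries Q R M" if g: "?b \<in> gram_bases Q M B A \<Gamma>"
  proof -
    have "form M i j (\<phi> i v) (\<phi> j w) = form R i j v w"
      if ij: "i \<in> nodes Q" "j \<in> nodes Q" and v: "v \<in> vecs R i" and w: "w \<in> vecs R j" for i j v w
    proof (cases "i = sig0 Q j")
      case False
      then show ?thesis
        using form_repD(3)[OF R ij False v w] form_repD(3)[OF M ij False] linear_mapD(3)[OF p(3)] ij v w by auto
    next
      case True
      then have j: "j = sig0 Q i" using sg ij by auto
      define c where "c = coord (vsp R i) (B i) (b i) v"
      define d where "d = coord (vsp R j) (B j) (b j) w"
      have vc: "v = lsum (vsp R i) (B i) c (b i)" using lsum_coord[OF B(2)[OF ij(1)] v] c_def by simp
      have wd: "w = lsum (vsp R j) (B j) d (b j)" using lsum_coord[OF B(2)[OF ij(2)] w] d_def by simp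
      note bi = is_basisD[OF B(2)[OF ij(1)]] and bj = is_basisD[OF B(2)[OF ij(2)]]
      have bi': "(\<lambda>x. \<phi> i (b i x)) \<in> B i \<rightarrow> vecs M i" and bj': "(\<lambda>x. \<phi> j (b j x)) \<in> B j \<rightarrow> vecs M j"
        using bi bj linear_mapD(3)[OF p(3)] ij by auto
      have "\<phi> i v = lsum (vsp M i) (B i) c (\<lambda>x. \<phi> i (b i x))"
        unfolding vc by (rule lsum_hom'[OF p(3)[OF ij(1)] bi(2,1)])
      moreover have "\<phi> j w = lsum (vsp M j) (B j) d (\<lambda>x. \<phi> j (b j x))"
        unfolding wd by (rule lsum_hom'[OF p(3)[OF ij(2)] bj(2,1)])
      ultimately have "form M i j (\<phi> i v) (\<phi> j w) = (\<Sum>x\<in>B i. c x * form M i j (\<phi> i (b i x)) (\<phi> j w))"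
        using form_lsum_left[OF form_repD(1,2)[OF M] ij bi' bi(1)] linear_mapD(3)[OF p(3)[OF ij(2)] w] by simp
      also have "\<dots> = (\<Sum>x\<in>B i. c x * (\<Sum>y\<in>B j. d y * form M i j (\<phi> i (b i x)) (\<phi> j (b j y))))"
        using form_lsum_right[OF form_repD(1,2)[OF M] ij bj' bj(1)] bi'
          \<open>\<phi> j w = lsum (vsp M j) (B j) d (\<lambda>x. \<phi> j (b j x))\<close> by (intro sum.cong) auto
      also have "\<dots> = (\<Sum>x\<in>B i. c x * (\<Sum>y\<in>B j. d y * form R i j (b i x) (b j y)))"
        using gram_basesD(2)[OF g ij(1)] G[OF ij(1)] ij j by (intro sum.cong arg_cong2[of _ _ _ _ "(*)"]) auto
      also have "\<dots> = (\<Sum>x\<in>B i. c x * form R i j (b i x) w)"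
        using form_lsum_right[OF form_repD(1,2)[OF R] ij bj(2,1)] bi wd by (intro sum.cong) auto
      also have "\<dots> = form R i j v w"
        using form_lsum_left[OF form_repD(1,2)[OF R] ij bi(2,1) w] vc by simp
      finally show ?thesis .
    qed
    then show ?thesis using \<phi> unfolding isometries_def by blast
  qed
qed

lemma isometries_bij_bases:
  assumes Q: "sd_quiver Q" and R: "form_rep Q R" and M: "form_rep Q M" and b: "b \<in> gram_bases Q R B A \<Gamma>"
  shows "bij_betw (\<lambda>\<phi>. \<lambda>i\<in>nodes Q. \<lambda>x\<in>B i. \<phi> i (b i x)) (isometries Q R M) (gram_bases Q M B A \<Gamma>)"
proof -
  let ?F = "\<lambda>\<phi>. \<lambda>i\<in>nodes Q. \<lambda>x\<in>B i. \<phi> i (b i x)"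
  have bij: "bij_betw ?F (rep_isos Q R M) (rep_bases Q M B A)"
    by (rule rep_isos_bij_bases[OF sd_quiverD(1)[OF Q] form_repD(1)[OF R] form_repD(1)[OF M] gram_basesD(1)[OF b]])
  have sub: "isometries Q R M \<subseteq> rep_isos Q R M" unfolding isometries_def by blast
  note iff = iso_isometric_iff_gram[OF Q R M b]
  have "?F ` isometries Q R M = gram_bases Q M B A \<Gamma>"
  proof
    show "?F ` isometries Q R M \<subseteq> gram_bases Q M B A \<Gamma>" using iff sub by blast
    show "gram_bases Q M B A \<Gamma> \<subseteq> ?F ` isometries Q R M"
    proof
      fix b' assume b': "b' \<in> gram_bases Q M B A \<Gamma>"
      then have "b' \<in> ?F ` rep_isos Q R M" using bij gram_basesD(1) unfolding bij_betw_def by blast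
      then show "b' \<in> ?F ` isometries Q R M" using iff b' by blast
    qed
  qed
  then show ?thesis using bij_betw_subset[OF bij sub] by simp
qed

lemma gram_bases_exist:
  assumes Q: "sd_quiver Q" and M: "is_rep Q M"
  shows "\<exists>A \<Gamma>. gram_bases Q M (\<lambda>i. {..<nat (dim_vector Q M i)}) A \<Gamma> \<noteq> {}"
proof -
  obtain A b where b: "b \<in> rep_bases Q M (\<lambda>i. {..<nat (dim_vector Q M i)}) A"
    using rep_bases_exist[OF sd_quiverD(1)[OF Q] M] by blast
  have "b \<in> gram_bases Q M (\<lambda>i. {..<nat (dim_vector Q M i)}) A
      (\<lambda>i x y. form M i (sig0 Q i) (b i x) (b (sig0 Q i) y))"
    using b unfolding gram_bases_def by blast
  then show ?thesis by blast
qed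

text \<open>The matrices of one basis are thus a complete invariant of the isometry class. Symmetry
  and transitivity of \<open>isometric\<close> are read off from this, without forming inverses or
  composites of maps.\<close>

lemma isometric_iff_bases:
  assumes Q: "sd_quiver Q" and R: "form_rep Q R" and M: "form_rep Q M" and b: "gram_bases Q R B A \<Gamma> \<noteq> {}"
  shows "isometric Q R M \<longleftrightarrow> gram_bases Q M B A \<Gamma> \<noteq> {}"
proof -
  obtain b where "b \<in> gram_bases Q R B A \<Gamma>" using b by blast
  from isometries_bij_bases[OF Q R M this]
  have "(\<lambda>\<phi>. \<lambda>i\<in>nodes Q. \<lambda>x\<in>B i. \<phi> i (b i x)) ` isometries Q R M = gram_bases Q M B A \<Gamma>"
    unfolding bij_betw_def by (rule conjunct2)
  from arg_cong[OF this, of "\<lambda>S. S = {}"] show ?thesis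
    unfolding isometric_def image_is_empty by simp
qed

lemma isometric_sym:
  assumes Q: "sd_quiver Q" and R: "form_rep Q R" and M: "form_rep Q M" and RM: "isometric Q R M"
  shows "isometric Q M R"
proof -
  obtain A \<Gamma> where g: "gram_bases Q R (\<lambda>i. {..<nat (dim_vector Q R i)}) A \<Gamma> \<noteq> {}"
    using gram_bases_exist[OF Q form_repD(1)[OF R]] by blast
  show ?thesis using isometric_iff_bases[OF Q M R] isometric_iff_bases[OF Q R M g] g RM by blast
qed

lemma isometric_trans:
  assumes Q: "sd_quiver Q" and R: "form_rep Q R" and M: "form_rep Q M" and N: "form_rep Q N"
    and RM: "isometric Q R M" and MN: "isometric Q M N"
  shows "isometric Q R N"
proof -
  obtain A \<Gamma> where g: "gram_bases Q R (\<lambda>i. {..<nat (dim_vector Q R i)}) A \<Gamma> \<noteq> {}"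
    using gram_bases_exist[OF Q form_repD(1)[OF R]] by blast
  then show ?thesis
    using isometric_iff_bases[OF Q R M g] isometric_iff_bases[OF Q R N g] isometric_iff_bases[OF Q M N] RM MN
    by blast
qed

lemma finite_gram_bases:
  assumes "quiver Q" "is_rep Q (M :: ('k::{field,finite}, 'w, 'v, 'a, 'z) sdrep_scheme)"
  shows "finite (gram_bases Q M B A \<Gamma>)"
  by (rule finite_subset[OF _ finite_rep_bases[OF assms]]) (auto simp: gram_bases_def)

lemma base_change_inj:
  assumes b: "\<And>i. i \<in> nodes Q \<Longrightarrow> inj_on (\<phi> i) (vecs R i)"
  shows "inj_on (\<lambda>b. \<lambda>i\<in>nodes Q. \<lambda>x\<in>B i. \<phi> i (b i x)) (\<Pi>\<^sub>E i\<in>nodes Q. B i \<rightarrow>\<^sub>E vecs R i)"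
proof (rule inj_onI)
  fix b b' assume bb: "b \<in> (\<Pi>\<^sub>E i\<in>nodes Q. B i \<rightarrow>\<^sub>E vecs R i)" "b' \<in> (\<Pi>\<^sub>E i\<in>nodes Q. B i \<rightarrow>\<^sub>E vecs R i)"
    and eq: "(\<lambda>i\<in>nodes Q. \<lambda>x\<in>B i. \<phi> i (b i x)) = (\<lambda>i\<in>nodes Q. \<lambda>x\<in>B i. \<phi> i (b' i x))"
  show "b = b'"
  proof (rule PiE_ext[OF bb], rule PiE_ext)
    fix i assume i: "i \<in> nodes Q"
    show "b i \<in> B i \<rightarrow>\<^sub>E vecs R i" "b' i \<in> B i \<rightarrow>\<^sub>E vecs R i" using bb i by auto
    then show "b i x = b' i x" if "x \<in> B i" for x
      using fun_cong[OF fun_cong[OF eq], of i x] i that b[OF i] by (auto simp: PiE_iff dest: inj_onD)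
  qed
qed

text \<open>If the two representations are isomorphic, transport along isomorphisms in both
  directions gives injections between their sets of bases; otherwise a basis of \<open>U'\<close>
  with the matrices of \<open>U\<close> would produce an isomorphism. \<open>U'\<close> may have
  vectors of another type than \<open>U\<close>.\<close>

lemma aut_card_eq_card_bases:
  fixes U :: "('k::{field,finite}, 'w, 'v, 'a, 'z) rep_scheme"
    and U' :: "('k, 'u, 'v, 'a, 'z') rep_scheme"
  assumes Q: "quiver Q" and U: "is_rep Q U" and U': "is_rep Q U'" and b: "rep_bases Q U B A \<noteq> {}"
  shows "card (rep_bases Q U' B A) = (if rep_isomorphic Q U' U then aut_card Q U else 0)"
proof (cases "rep_isomorphic Q U' U")
  case False
  have "b' \<notin> rep_bases Q U' B A" for b'
    using iso_of_bases_in_rep_isos[OF Q U' U] b False unfolding rep_isomorphic_def by blast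
  then have "rep_bases Q U' B A = {}" by blast
  then show ?thesis using False by simp
next
  case True
  then obtain \<phi> where \<phi>: "\<phi> \<in> rep_isos Q U' U" unfolding rep_isomorphic_def by blast
  obtain b0 where b0: "b0 \<in> rep_bases Q U B A" using b by blast
  \<comment> \<open>A basis of \<open>U'\<close> and its image under \<open>\<phi>\<close> have the
    same matrices, so they define an isomorphism in the opposite direction.\<close>
  obtain A1 b1 where "b1 \<in> rep_bases Q U' (\<lambda>i. {..<nat (dim_vector Q U' i)}) A1"
    using rep_bases_exist[OF Q U'] by blast
  then obtain \<psi> where \<psi>: "\<psi> \<in> rep_isos Q U U'"
    using iso_of_bases_in_rep_isos[OF Q U U' rep_bases_image[OF Q U' _ \<phi>]] by blast
  have sub: "rep_bases Q U' B A \<subseteq> (\<Pi>\<^sub>E i\<in>nodes Q. B i \<rightarrow>\<^sub>E vecs U' i)"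
    "rep_bases Q U B A \<subseteq> (\<Pi>\<^sub>E i\<in>nodes Q. B i \<rightarrow>\<^sub>E vecs U i)" by (auto simp: rep_bases_def)
  have "inj_on (\<lambda>b. \<lambda>i\<in>nodes Q. \<lambda>x\<in>B i. \<phi> i (b i x)) (rep_bases Q U' B A)"
    by (rule inj_on_subset[OF base_change_inj sub(1)]) (use rep_isosD(4)[OF \<phi>] in \<open>auto simp: bij_betw_def\<close>)
  then have "card (rep_bases Q U' B A) \<le> card (rep_bases Q U B A)"
    by (rule card_inj_on_le) (use rep_bases_image[OF Q U' _ \<phi>] finite_rep_bases[OF Q U] in auto)
  moreover have "inj_on (\<lambda>b. \<lambda>i\<in>nodes Q. \<lambda>x\<in>B i. \<psi> i (b i x)) (rep_bases Q U B A)"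
    by (rule inj_on_subset[OF base_change_inj sub(2)]) (use rep_isosD(4)[OF \<psi>] in \<open>auto simp: bij_betw_def\<close>)
  then have "card (rep_bases Q U B A) \<le> card (rep_bases Q U' B A)"
    by (rule card_inj_on_le) (use rep_bases_image[OF Q U _ \<psi>] finite_rep_bases[OF Q U'] in auto)
  moreover have "card (rep_bases Q U B A) = aut_card Q U"
    unfolding aut_card_def using bij_betw_same_card[OF rep_isos_bij_bases[OF Q U U b0]] by simp
  ultimately show ?thesis using True by simp
qed

text \<open>The direction of \<open>isometric Q N M\<close> is the one that occurs in
  \<open>hall_G\<close>, where a reduction takes the place of \<open>N\<close>.\<close>

lemma sd_aut_card_eq_card_bases:
  fixes M :: "('k::{field,finite}, 'w, 'v, 'a, 'z) sdrep_scheme"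
    and N :: "('k, 'u, 'v, 'a, 'z') sdrep_scheme"
  assumes Q: "sd_quiver Q" and M: "form_rep Q M" and N: "form_rep Q N" and b: "gram_bases Q M B A \<Gamma> \<noteq> {}"
  shows "card (gram_bases Q N B A \<Gamma>) = (if isometric Q N M then sd_aut_card Q M else 0)"
proof (cases "isometric Q N M")
  case False
  then have "gram_bases Q N B A \<Gamma> = {}" using isometric_iff_bases[OF Q N M] b by blast
  then show ?thesis using False by simp
next
  case True
  obtain \<phi> where \<phi>: "\<phi> \<in> isometries Q N M" using True unfolding isometric_def by blast
  obtain \<psi> where \<psi>: "\<psi> \<in> isometries Q M N" using isometric_sym[OF Q N M True] unfolding isometric_def by blast
  obtain b0 where b0: "b0 \<in> gram_bases Q M B A \<Gamma>" using b by blast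
  have iso: "\<phi> \<in> rep_isos Q N M" "\<psi> \<in> rep_isos Q M N" using \<phi> \<psi> unfolding isometries_def by auto
  have sub: "gram_bases Q N B A \<Gamma> \<subseteq> (\<Pi>\<^sub>E i\<in>nodes Q. B i \<rightarrow>\<^sub>E vecs N i)"
    "gram_bases Q M B A \<Gamma> \<subseteq> (\<Pi>\<^sub>E i\<in>nodes Q. B i \<rightarrow>\<^sub>E vecs M i)" by (auto simp: rep_bases_def gram_bases_def)
  have "inj_on (\<lambda>b. \<lambda>i\<in>nodes Q. \<lambda>x\<in>B i. \<phi> i (b i x)) (gram_bases Q N B A \<Gamma>)"
    by (rule inj_on_subset[OF base_change_inj sub(1)]) (use rep_isosD(4)[OF iso(1)] in \<open>auto simp: bij_betw_def\<close>)
  then have "card (gram_bases Q N B A \<Gamma>) \<le> card (gram_bases Q M B A \<Gamma>)"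
    by (rule card_inj_on_le)
      (use iso_isometric_iff_gram[OF Q N M _ iso(1)] \<phi> finite_gram_bases[OF sd_quiverD(1)[OF Q] form_repD(1)[OF M]] in auto)
  moreover have "inj_on (\<lambda>b. \<lambda>i\<in>nodes Q. \<lambda>x\<in>B i. \<psi> i (b i x)) (gram_bases Q M B A \<Gamma>)"
    by (rule inj_on_subset[OF base_change_inj sub(2)]) (use rep_isosD(4)[OF iso(2)] in \<open>auto simp: bij_betw_def\<close>)
  then have "card (gram_bases Q M B A \<Gamma>) \<le> card (gram_bases Q N B A \<Gamma>)"
    by (rule card_inj_on_le)
      (use iso_isometric_iff_gram[OF Q M N _ iso(2)] \<psi> finite_gram_bases[OF sd_quiverD(1)[OF Q] form_repD(1)[OF N]] in auto)
  moreover have "card (gram_bases Q M B A \<Gamma>) = sd_aut_card Q M"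
    unfolding sd_aut_card_def using bij_betw_same_card[OF isometries_bij_bases[OF Q M M b0]] by simp
  ultimately show ?thesis using True by simp
qed

section \<open>Realization of Gram and structure matrices\<close>

text \<open>Testing against a vector concentrated at \<open>sig0 Q i\<close> isolates a single
  block; this links the form on the direct sum to its blocks.\<close>

lemma total_form_single:
  assumes Q: "sd_quiver Q" and M: "form_rep Q M" and i: "i \<in> nodes Q"
    and X: "X \<in> total_space Q M"
  shows "y \<in> vecs M (sig0 Q i) \<Longrightarrow>
      total_form Q M X (\<lambda>j\<in>nodes Q. if j = sig0 Q i then y else \<zero>\<^bsub>vsp M j\<^esub>) = form M i (sig0 Q i) (X i) y"
    and "y \<in> vecs M (sig0 Q i) \<Longrightarrow>
      total_form Q M (\<lambda>j\<in>nodes Q. if j = sig0 Q i then y else \<zero>\<^bsub>vsp M j\<^esub>) X = form M (sig0 Q i) i y (X i)"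
    and "y \<in> vecs M (sig0 Q i) \<Longrightarrow>
      (\<lambda>j\<in>nodes Q. if j = sig0 Q i then y else \<zero>\<^bsub>vsp M j\<^esub>) \<in> total_space Q M"
proof -
  note sg = sd_quiverD(2,3)[OF Q] and fin = quiverD(1)[OF sd_quiverD(1)[OF Q]]
  note zero = form_zero[OF form_repD(1,2)[OF M]] and orth = form_repD(3)[OF M]
    and zc = vs_zero_closed[OF is_repD(1)[OF form_repD(1)[OF M]]]
  assume y: "y \<in> vecs M (sig0 Q i)"
  let ?Y = "\<lambda>j\<in>nodes Q. if j = sig0 Q i then y else \<zero>\<^bsub>vsp M j\<^esub>"
  show Y: "?Y \<in> total_space Q M" using y zc unfolding total_space_def by auto
  have Xv: "X a \<in> vecs M a" if "a \<in> nodes Q" for a using X that unfolding total_space_def by auto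
  have Yv: "?Y a \<in> vecs M a" if "a \<in> nodes Q" for a using Y that unfolding total_space_def by blast
  have ne: "a \<noteq> sig0 Q (sig0 Q i)" if "a \<noteq> i" for a using that sg i by simp
  have *: "form M a j (X a) (?Y j) = (if j = sig0 Q i then if a = i then form M i (sig0 Q i) (X i) y else 0 else 0)"
    if aj: "a \<in> nodes Q" "j \<in> nodes Q" for a j
    using orth[OF aj _ Xv[OF aj(1)] Yv[OF aj(2)]] zero(2)[OF aj Xv[OF aj(1)]] ne aj by auto
  have "total_form Q M X ?Y = (\<Sum>a\<in>nodes Q. \<Sum>j\<in>nodes Q. if j = sig0 Q i then if a = i then form M i (sig0 Q i) (X i) y else 0 else 0)"
    unfolding total_form_def by (intro sum.cong refl *)
  then show "total_form Q M X ?Y = form M i (sig0 Q i) (X i) y" using fin i sg by simp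
  have *: "form M a j (?Y a) (X j) = (if j = i then if a = sig0 Q i then form M (sig0 Q i) i y (X i) else 0 else 0)"
    if aj: "a \<in> nodes Q" "j \<in> nodes Q" for a j
  proof (cases "a = sig0 Q i")
    case False
    then show ?thesis using zero(1)[OF aj Xv[OF aj(2)]] aj by simp
  next
    case True
    moreover have "form M a j (?Y a) (X j) = 0" if "j \<noteq> i"
    proof (rule orth[OF aj _ Yv[OF aj(1)] Xv[OF aj(2)]])
      show "a \<noteq> sig0 Q j" using True that sg(2)[OF i] sg(2)[OF aj(2)] by auto
    qed
    ultimately show ?thesis using aj by auto
  qed
  have "total_form Q M ?Y X = (\<Sum>a\<in>nodes Q. \<Sum>j\<in>nodes Q. if j = i then if a = sig0 Q i then form M (sig0 Q i) i y (X i) else 0 else 0)"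
    unfolding total_form_def by (intro sum.cong refl *)
  then show "total_form Q M ?Y X = form M (sig0 Q i) i y (X i)" using fin i sg by simp
qed

text \<open>Symmetry up to sign exchanges the two arguments, so nondegeneracy of the blocks on one
  side yields both halves of \<open>nondegenerate_form\<close>.\<close>

lemma nondegenerate_of_blocks:
  assumes Q: "sd_quiver Q" and M: "form_rep Q M"
    and sym: "\<And>i x y. i \<in> nodes Q \<Longrightarrow> x \<in> vecs M i \<Longrightarrow> y \<in> vecs M (sig0 Q i) \<Longrightarrow>
      form M i (sig0 Q i) x y = of_int (sgn_s Q i) * form M (sig0 Q i) i y x"
    and nd: "\<And>i x. i \<in> nodes Q \<Longrightarrow> x \<in> vecs M i \<Longrightarrow>
      (\<And>y. y \<in> vecs M (sig0 Q i) \<Longrightarrow> form M i (sig0 Q i) x y = 0) \<Longrightarrow> x = \<zero>\<^bsub>vsp M i\<^esub>"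
  shows "nondegenerate_form Q M"
  unfolding nondegenerate_form_def
proof (intro conjI ballI impI)
  fix X i assume X: "X \<in> total_space Q M" and z: "\<forall>Y\<in>total_space Q M. total_form Q M X Y = 0" and i: "i \<in> nodes Q"
  have Xi: "X i \<in> vecs M i" using X i unfolding total_space_def by auto
  have "form M i (sig0 Q i) (X i) y = 0" if y: "y \<in> vecs M (sig0 Q i)" for y
    using total_form_single(1,3)[OF Q M i X y] z by simp
  then show "X i = \<zero>\<^bsub>vsp M i\<^esub>" using nd[OF i Xi] by blast
next
  fix X i assume X: "X \<in> total_space Q M" and z: "\<forall>Y\<in>total_space Q M. total_form Q M Y X = 0" and i: "i \<in> nodes Q"
  have Xi: "X i \<in> vecs M i" using X i unfolding total_space_def by auto
  have "form M i (sig0 Q i) (X i) y = 0" if y: "y \<in> vecs M (sig0 Q i)" for y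
    using total_form_single(2,3)[OF Q M i X y] z sym[OF i Xi y] by simp
  then show "X i = \<zero>\<^bsub>vsp M i\<^esub>" using nd[OF i Xi] by blast
qed

text \<open>The space at \<open>i\<close> consists of the coefficient functions on
  \<open>B i\<close>, encoded injectively in \<open>'w\<close>, and the matrices define the arrows
  and the form. The hypotheses are the self-duality axioms written out on basis vectors.\<close>

lemma realization:
  fixes Q :: "('v, 'a, 'y) sdquiver_scheme" and B :: "'v \<Rightarrow> 'x set"
    and A :: "'a \<Rightarrow> 'x \<Rightarrow> 'x \<Rightarrow> 'k::{field,finite}"
  assumes Q: "sd_quiver Q" and fin: "\<And>i. i \<in> nodes Q \<Longrightarrow> finite (B i)"
    and sym: "\<And>i x y. i \<in> nodes Q \<Longrightarrow> x \<in> B i \<Longrightarrow> y \<in> B (sig0 Q i) \<Longrightarrow>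
      \<Gamma> i x y = of_int (sgn_s Q i) * \<Gamma> (sig0 Q i) y x"
    and nd: "\<And>i c. i \<in> nodes Q \<Longrightarrow> (\<And>y. y \<in> B (sig0 Q i) \<Longrightarrow> (\<Sum>x\<in>B i. c x * \<Gamma> i x y) = 0) \<Longrightarrow> \<forall>x\<in>B i. c x = 0"
    and adj: "\<And>\<alpha> x y. \<alpha> \<in> arrows Q \<Longrightarrow> x \<in> B (src Q \<alpha>) \<Longrightarrow> y \<in> B (sig0 Q (tgt Q \<alpha>)) \<Longrightarrow>
      (\<Sum>z\<in>B (tgt Q \<alpha>). A \<alpha> z x * \<Gamma> (tgt Q \<alpha>) z y) =
      of_int (sgn_tau Q \<alpha>) * (\<Sum>z\<in>B (sig0 Q (src Q \<alpha>)). \<Gamma> (src Q \<alpha>) x z * A (sig1 Q \<alpha>) z y)"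
  shows "\<exists>N :: ('k, 'w::infinite, 'v, 'a) sdrep. is_sdrep Q N \<and> gram_bases Q N B A \<Gamma> \<noteq> {}"
proof -
  note Q0 = sd_quiverD(1)[OF Q] and sg = sd_quiverD(2,3)[OF Q]
  \<comment> \<open>There are finitely many coefficient functions, and an infinite type contains
    sets of every finite size.\<close>
  have "\<exists>h :: ('x \<Rightarrow> 'k) \<Rightarrow> 'w. inj_on h (B i \<rightarrow>\<^sub>E UNIV)" if "i \<in> nodes Q" for i
  proof -
    let ?S = "B i \<rightarrow>\<^sub>E (UNIV :: 'k set)"
    have fS: "finite ?S" using fin[OF that] by (intro finite_PiE) auto
    obtain T :: "'w set" where T: "finite T" "card T = card ?S"
      using infinite_arbitrarily_large[OF infinite_UNIV, of "card ?S"] by blast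
    then obtain h where "bij_betw h ?S T" using finite_same_card_bij[OF fS T(1)] by metis
    then show ?thesis by (auto simp: bij_betw_def)
  qed
  then obtain h :: "'v \<Rightarrow> ('x \<Rightarrow> 'k) \<Rightarrow> 'w" where h: "\<And>i. i \<in> nodes Q \<Longrightarrow> inj_on (h i) (B i \<rightarrow>\<^sub>E UNIV)"
    by metis
  \<comment> \<open>\<open>p i\<close> encodes the restriction of a function to \<open>B i\<close>
    and \<open>rd i\<close> decodes it. Decoding recovers values on \<open>B i\<close> only, whence
    the congruence rule for \<open>p\<close>.\<close>
  define p where "p i f = h i (restrict f (B i))" for i f
  define rd where "rd i w = inv_into (B i \<rightarrow>\<^sub>E UNIV) (h i) w" for i w
  have rd: "rd i (p i f) x = f x" if "i \<in> nodes Q" "x \<in> B i" for i f x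
    unfolding rd_def p_def by (subst inv_into_f_f[OF h[OF that(1)]]) (use that in auto)
  have p_cong: "p i f = p i g" if "\<And>x. x \<in> B i \<Longrightarrow> f x = g x" for i f g
    using that unfolding p_def by (metis restrict_ext)
  define V :: "'v \<Rightarrow> ('k, 'w) module" where
    "V i = \<lparr>carrier = range (p i), mult = undefined, one = undefined, zero = p i (\<lambda>_. 0),
       add = (\<lambda>v w. p i (\<lambda>x. rd i v x + rd i w x)), smult = (\<lambda>c v. p i (\<lambda>x. c * rd i v x))\<rparr>" for i
  have V: "vectorspace class_ring (V i)" if i: "i \<in> nodes Q" for i
    by (rule vectorspace_image[OF vectorspace_fun_module, of "V i" "p i"])
      (auto simp: V_def fun_module_def rd[OF i] intro!: p_cong)
  have prd: "p i (rd i v) = v" if i: "i \<in> nodes Q" and v: "v \<in> carrier (V i)" for i v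
  proof -
    obtain f where "v = p i f" using v by (auto simp: V_def)
    then show ?thesis using rd[OF i] by (auto intro: p_cong)
  qed
  have rd_add: "rd i (v \<oplus>\<^bsub>V i\<^esub> w) x = rd i v x + rd i w x" if "i \<in> nodes Q" "x \<in> B i" for i v w x
    using rd[OF that] by (simp add: V_def)
  have rd_smult: "rd i (c \<odot>\<^bsub>V i\<^esub> v) x = c * rd i v x" if "i \<in> nodes Q" "x \<in> B i" for i c v x
    using rd[OF that] by (simp add: V_def)
  have pV: "p i f \<in> carrier (V i)" for i f by (simp add: V_def)
  have rd_eq: "v = w" if "i \<in> nodes Q" "v \<in> carrier (V i)" "w \<in> carrier (V i)" "\<And>x. x \<in> B i \<Longrightarrow> rd i v x = rd i w x" for i v w
  proof -
    have "p i (rd i v) = p i (rd i w)" by (rule p_cong) (rule that(4))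
    then show ?thesis unfolding prd[OF that(1,2)] prd[OF that(1,3)] .
  qed
  have rd_zero: "rd i \<zero>\<^bsub>V i\<^esub> x = 0" if "i \<in> nodes Q" "x \<in> B i" for i x
    using rd[OF that] by (simp add: V_def)
  define b where "b = (\<lambda>i\<in>nodes Q. \<lambda>x\<in>B i. p i (\<lambda>y. if y = x then 1 else 0))"
  have bV: "b i \<in> B i \<rightarrow> carrier (V i)" if "i \<in> nodes Q" for i using that pV by (auto simp: b_def)
  have rdb: "rd i (b i x) y = (if y = x then 1 else 0)" if "i \<in> nodes Q" "x \<in> B i" "y \<in> B i" for i x y
    using rd[OF that(1,3)] that by (simp add: b_def)
  have rd_lsum: "rd i (lsum (V i) (B i) c (b i)) y = c y" if i: "i \<in> nodes Q" and y: "y \<in> B i" for i c y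
  proof -
    have "rd i (lsum (V i) (B i) c (b i)) y = (\<Sum>x\<in>B i. c x * rd i (b i x) y)"
      by (rule functional_lsum[OF V[OF i] _ _ bV[OF i] fin[OF i], where f = "\<lambda>v. rd i v y"])
        (simp_all add: rd_add[OF i y] rd_smult[OF i y])
    also have "\<dots> = (\<Sum>x\<in>B i. if x = y then c y else 0)" by (rule sum.cong) (auto simp: rdb i y)
    finally show ?thesis using fin[OF i] y by simp
  qed
  have p_lsum: "p i c = lsum (V i) (B i) c (b i)" if i: "i \<in> nodes Q" for i c
    by (rule rd_eq[OF i pV lsum_closed[OF V[OF i] bV[OF i]]]) (simp add: rd[OF i] rd_lsum[OF i])
  have basis: "is_basis (V i) (B i) (b i)" if i: "i \<in> nodes Q" for i
    unfolding is_basis_def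
  proof (intro conjI ballI allI impI)
    show "\<exists>c. v = lsum (V i) (B i) c (b i)" if "v \<in> carrier (V i)" for v
      using prd[OF i that] p_lsum[OF i] by metis
    show "c x = 0" if "lsum (V i) (B i) c (b i) = \<zero>\<^bsub>V i\<^esub>" "x \<in> B i" for c x
      using rd_lsum[OF i that(2), of c] that(1) rd_zero[OF i that(2)] by simp
  qed (use fin bV i in auto)
  define N :: "('k, 'w, 'v, 'a) sdrep" where
    "N = \<lparr>vsp = V, lmap = (\<lambda>\<alpha> v. p (tgt Q \<alpha>) (\<lambda>z. \<Sum>x\<in>B (src Q \<alpha>). A \<alpha> z x * rd (src Q \<alpha>) v x)),
       form = (\<lambda>i j v w. if j = sig0 Q i then \<Sum>x\<in>B i. \<Sum>y\<in>B j. rd i v x * rd j w y * \<Gamma> i x y else 0)\<rparr>"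
  have N: "vsp N = V" "\<And>\<alpha> v. lmap N \<alpha> v = p (tgt Q \<alpha>) (\<lambda>z. \<Sum>x\<in>B (src Q \<alpha>). A \<alpha> z x * rd (src Q \<alpha>) v x)"
    "\<And>i j v w. form N i j v w = (if j = sig0 Q i then \<Sum>x\<in>B i. \<Sum>y\<in>B j. rd i v x * rd j w y * \<Gamma> i x y else 0)"
    by (simp_all add: N_def)
  have "linear_map class_ring (V (src Q \<alpha>)) (V (tgt Q \<alpha>)) (lmap N \<alpha>)" if \<alpha>: "\<alpha> \<in> arrows Q" for \<alpha>
  proof (rule linear_mapI)
    note st = quiverD(3,4)[OF Q0 \<alpha>]
    show "vectorspace class_ring (V (src Q \<alpha>))" "vectorspace class_ring (V (tgt Q \<alpha>))" using V st by auto
    show "lmap N \<alpha> v \<in> carrier (V (tgt Q \<alpha>))" for v by (simp add: N pV)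
    show "lmap N \<alpha> (v \<oplus>\<^bsub>V (src Q \<alpha>)\<^esub> w) = lmap N \<alpha> v \<oplus>\<^bsub>V (tgt Q \<alpha>)\<^esub> lmap N \<alpha> w" for v w
      by (rule rd_eq[OF st(2)])
        (simp_all add: N pV vs_add_closed[OF V[OF st(2)]] rd[OF st(2)] rd_add[OF st(2)] rd_add[OF st(1)]
          ring_distribs sum.distrib)
    show "lmap N \<alpha> (c \<odot>\<^bsub>V (src Q \<alpha>)\<^esub> v) = c \<odot>\<^bsub>V (tgt Q \<alpha>)\<^esub> lmap N \<alpha> v" for c v
      by (rule rd_eq[OF st(2)])
        (simp_all add: N pV vs_smult_closed[OF V[OF st(2)]] rd[OF st(2)] rd_smult[OF st(2)] rd_smult[OF st(1)]
          sum_distrib_left mult.left_commute)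
  qed
  moreover have "vectorspace.fin_dim class_ring (V i)" if i: "i \<in> nodes Q" for i
    by (rule fin_dim_of_finite[OF V[OF i] card_of_basis(2)[OF V[OF i] basis[OF i]]])
  ultimately have rep: "is_rep Q N" unfolding is_rep_def using V by (simp add: N)
  have bil: "bilinear_form Q N"
    unfolding bilinear_form_def N(1,3)
    by (auto simp: rd_add rd_smult ring_distribs sum.distrib sum_distrib_left mult_ac cong: sum.cong)
  have frep: "form_rep Q N" unfolding form_rep_def using rep bil sg by (auto simp: N)
  have fsym: "form N i j v w = of_int (sgn_s Q i) * form N j i w v" if i: "i \<in> nodes Q" and j: "j = sig0 Q i" for i j v w
  proof -
    have "form N i j v w = (\<Sum>x\<in>B i. \<Sum>y\<in>B j. rd i v x * rd j w y * (of_int (sgn_s Q i) * \<Gamma> j y x))"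
      unfolding N j using sym[OF i] by (auto intro!: sum.cong)
    also have "\<dots> = of_int (sgn_s Q i) * (\<Sum>x\<in>B i. \<Sum>y\<in>B j. rd j w y * rd i v x * \<Gamma> j y x)"
      by (simp add: sum_distrib_left mult_ac)
    also have "\<dots> = of_int (sgn_s Q i) * form N j i w v"
      unfolding N using sg[OF i] j by (subst sum.swap) simp
    finally show ?thesis .
  qed
  have form_b: "form N i (sig0 Q i) v (b (sig0 Q i) y) = (\<Sum>x\<in>B i. rd i v x * \<Gamma> i x y)"
    if "i \<in> nodes Q" "y \<in> B (sig0 Q i)" for i v y
  proof -
    have "rd i v x * rd (sig0 Q i) (b (sig0 Q i) y) z * \<Gamma> i x z = (if z = y then rd i v x * \<Gamma> i x y else 0)"
      if "z \<in> B (sig0 Q i)" for x z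
      using rdb[OF sg(1)[OF \<open>i \<in> nodes Q\<close>] \<open>y \<in> B (sig0 Q i)\<close> that] by simp
    then show ?thesis using fin[OF sg(1)[OF that(1)]] that(2) by (simp add: N)
  qed
  have nondeg: "nondegenerate_form Q N"
  proof (rule nondegenerate_of_blocks[OF Q frep])
    fix i v assume i: "i \<in> nodes Q" and v: "v \<in> vecs N i"
      and z: "\<And>y. y \<in> vecs N (sig0 Q i) \<Longrightarrow> form N i (sig0 Q i) v y = 0"
    have "(\<Sum>x\<in>B i. rd i v x * \<Gamma> i x y) = 0" if "y \<in> B (sig0 Q i)" for y
      using z[of "b (sig0 Q i) y"] form_b[OF i that] bV[OF sg(1)[OF i]] that by (auto simp: N)
    then have "\<forall>x\<in>B i. rd i v x = 0" by (rule nd[OF i])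
    then show "v = \<zero>\<^bsub>vsp N i\<^esub>"
      using v rd_zero[OF i] vs_zero_closed[OF V[OF i]] unfolding N by (intro rd_eq[OF i]) auto
  qed (use fsym in blast)
  have lmap_b: "lmap N \<alpha> (b (src Q \<alpha>) x) = lsum (V (tgt Q \<alpha>)) (B (tgt Q \<alpha>)) (\<lambda>z. A \<alpha> z x) (b (tgt Q \<alpha>))"
    if \<alpha>: "\<alpha> \<in> arrows Q" and x: "x \<in> B (src Q \<alpha>)" for \<alpha> x
  proof -
    have "(\<Sum>y\<in>B (src Q \<alpha>). A \<alpha> z y * rd (src Q \<alpha>) (b (src Q \<alpha>) x) y) = (\<Sum>y\<in>B (src Q \<alpha>). if y = x then A \<alpha> z x else 0)" for z
      by (rule sum.cong) (use rdb[OF quiverD(3)[OF Q0 \<alpha>] x] in auto)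
    then show ?thesis
      using fin[OF quiverD(3)[OF Q0 \<alpha>]] x p_lsum[OF quiverD(4)[OF Q0 \<alpha>]] by (simp add: N)
  qed
  have fadj: "form N j (sig0 Q j) (lmap N \<alpha> v) w = of_int (sgn_tau Q \<alpha>) * form N i (sig0 Q i) v (lmap N (sig1 Q \<alpha>) w)"
    if \<alpha>: "\<alpha> \<in> arrows Q" and ij: "i = src Q \<alpha>" "j = tgt Q \<alpha>" for \<alpha> i j v w
  proof -
    have ijn: "i \<in> nodes Q" "j \<in> nodes Q" using quiverD(3,4)[OF Q0 \<alpha>] ij by auto
    have st: "src Q (sig1 Q \<alpha>) = sig0 Q j" "tgt Q (sig1 Q \<alpha>) = sig0 Q i" using sd_quiverD(6,7)[OF Q \<alpha>] ij by auto
    let ?\<tau> = "of_int (sgn_tau Q \<alpha>) :: 'k"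
    have "form N j (sig0 Q j) (lmap N \<alpha> v) w =
        (\<Sum>z\<in>B j. \<Sum>y\<in>B (sig0 Q j). (\<Sum>x\<in>B i. A \<alpha> z x * rd i v x) * rd (sig0 Q j) w y * \<Gamma> j z y)"
      using rd[OF ijn(2)] by (simp add: N ij)
    also have "\<dots> = (\<Sum>z\<in>B j. \<Sum>y\<in>B (sig0 Q j). \<Sum>x\<in>B i. rd i v x * rd (sig0 Q j) w y * (A \<alpha> z x * \<Gamma> j z y))"
      by (simp add: sum_distrib_left sum_distrib_right mult_ac)
    \<comment> \<open>The sum over \<open>x\<close> moves outside and the sum over \<open>z\<close>
      inside, so that the inner sum becomes the left side of \<open>adj\<close>.\<close>
    also have "\<dots> = (\<Sum>x\<in>B i. \<Sum>y\<in>B (sig0 Q j). \<Sum>z\<in>B j. rd i v x * rd (sig0 Q j) w y * (A \<alpha> z x * \<Gamma> j z y))"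
      by (subst sum.swap, subst (2) sum.swap, subst sum.swap) (rule refl)
    also have "\<dots> = (\<Sum>x\<in>B i. \<Sum>y\<in>B (sig0 Q j). rd i v x * rd (sig0 Q j) w y * (?\<tau> * (\<Sum>z\<in>B (sig0 Q i). \<Gamma> i x z * A (sig1 Q \<alpha>) z y)))"
      using adj[OF \<alpha>] ij by (intro sum.cong refl) (simp add: sum_distrib_left[symmetric])
    also have "\<dots> = ?\<tau> * (\<Sum>x\<in>B i. \<Sum>y\<in>B (sig0 Q j). \<Sum>z\<in>B (sig0 Q i). rd i v x * (A (sig1 Q \<alpha>) z y * rd (sig0 Q j) w y) * \<Gamma> i x z)"
      by (simp add: sum_distrib_left mult_ac)
    also have "\<dots> = ?\<tau> * (\<Sum>x\<in>B i. \<Sum>z\<in>B (sig0 Q i). \<Sum>y\<in>B (sig0 Q j). rd i v x * (A (sig1 Q \<alpha>) z y * rd (sig0 Q j) w y) * \<Gamma> i x z)"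
      by (subst (2) sum.swap) (rule refl)
    also have "\<dots> = ?\<tau> * form N i (sig0 Q i) v (lmap N (sig1 Q \<alpha>) w)"
      using rd[OF sg(1)[OF ijn(1)]] st by (simp add: N sum_distrib_left sum_distrib_right)
    finally show ?thesis .
  qed
  have "is_sdrep Q N"
    unfolding is_sdrep_def
  proof (intro conjI ballI impI rep bil nondeg)
    show "form N i j x y = 0" if "i \<in> nodes Q" "j \<in> nodes Q" "i \<noteq> sig0 Q j" "x \<in> vecs N i" "y \<in> vecs N j" for i j x y
      by (rule form_repD(3)[OF frep that])
    show "form N a c x y = of_int (sgn_s Q i) * form N c a y x"
      if i: "i \<in> nodes Q" and ac: "a \<in> {i, sig0 Q i}" "c \<in> {i, sig0 Q i}" for i a c x y
    proof (cases "c = sig0 Q a")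
      case True
      have "a \<in> nodes Q" "sgn_s Q a = sgn_s Q i" using ac i sg sd_quiverD(9)[OF Q] by auto
      then show ?thesis using fsym[OF _ True] by simp
    next
      case False
      then have "a \<noteq> sig0 Q c" using ac i sg by auto
      then show ?thesis using False by (simp add: N)
    qed
  qed (use fadj in blast)
  moreover have "b \<in> gram_bases Q N B A \<Gamma>"
    unfolding gram_bases_def rep_bases_def
  proof (intro CollectI conjI ballI)
    show "b \<in> (\<Pi>\<^sub>E i\<in>nodes Q. B i \<rightarrow>\<^sub>E vecs N i)"
      using bV by (auto simp: N b_def PiE_iff Pi_def)
    show "form N i (sig0 Q i) (b i x) (b (sig0 Q i) y) = \<Gamma> i x y" if "i \<in> nodes Q" "x \<in> B i" "y \<in> B (sig0 Q i)" for i x y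
    proof -
      have "(\<Sum>z\<in>B i. rd i (b i x) z * \<Gamma> i z y) = (\<Sum>z\<in>B i. if z = x then \<Gamma> i x y else 0)"
        by (rule sum.cong) (auto simp: rdb that)
      then show ?thesis using form_b[OF that(1,3)] fin that by simp
    qed
  qed (simp_all add: N(1) basis lmap_b)
  ultimately show ?thesis by blast
qed

section \<open>The reduction by an isotropic subrepresentation\<close>

lemma subrepsD:
  assumes "U \<in> subreps Q N"
  shows "U \<in> extensional (nodes Q)"
    and "i \<in> nodes Q \<Longrightarrow> VectorSpace.subspace class_ring (U i) (vsp N i)"
    and "\<alpha> \<in> arrows Q \<Longrightarrow> x \<in> U (src Q \<alpha>) \<Longrightarrow> lmap N \<alpha> x \<in> U (tgt Q \<alpha>)"
  using assms unfolding subreps_def by auto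

lemma subspaceD:
  assumes "VectorSpace.subspace class_ring W V"
  shows "W \<subseteq> carrier V" "\<zero>\<^bsub>V\<^esub> \<in> W"
    and "\<And>x y. x \<in> W \<Longrightarrow> y \<in> W \<Longrightarrow> x \<oplus>\<^bsub>V\<^esub> y \<in> W"
    and "\<And>c x. x \<in> W \<Longrightarrow> c \<odot>\<^bsub>V\<^esub> x \<in> W"
    and "vectorspace class_ring (V\<lparr>carrier := W\<rparr>)"
proof -
  have W: "vectorspace class_ring V" "LinearCombinations.submodule class_ring W V"
    using assms unfolding VectorSpace.subspace_def by auto
  note s = LinearCombinations.submodule.subset[OF W(2)] LinearCombinations.submodule.zero_closed[OF W(2)]
    LinearCombinations.submodule.m_closed[OF W(2)] LinearCombinations.submodule.smult_closed[OF W(2)]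
  show "W \<subseteq> carrier V" "\<zero>\<^bsub>V\<^esub> \<in> W"
    "\<And>x y. x \<in> W \<Longrightarrow> y \<in> W \<Longrightarrow> x \<oplus>\<^bsub>V\<^esub> y \<in> W" "\<And>c x. x \<in> W \<Longrightarrow> c \<odot>\<^bsub>V\<^esub> x \<in> W"
    using s by simp_all
  show "vectorspace class_ring (V\<lparr>carrier := W\<rparr>)"
    by (rule vectorspace.subspace_is_vs[OF W(1) assms])
qed

lemma subspaceI:
  assumes V: "vectorspace class_ring V" and "W \<subseteq> carrier V" "\<zero>\<^bsub>V\<^esub> \<in> W"
    and "\<And>x y. x \<in> W \<Longrightarrow> y \<in> W \<Longrightarrow> x \<oplus>\<^bsub>V\<^esub> y \<in> W"
    and "\<And>c x. x \<in> W \<Longrightarrow> c \<odot>\<^bsub>V\<^esub> x \<in> W"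
  shows "VectorSpace.subspace class_ring W V"
proof -
  interpret V: vectorspace class_ring V by (rule V)
  show ?thesis
    unfolding VectorSpace.subspace_def LinearCombinations.submodule_def
    using V V.module_axioms assms by auto
qed

lemma restrict_rep_is_rep:
  assumes Q: "quiver Q" and N: "is_rep Q N" and fin: "\<And>i. i \<in> nodes Q \<Longrightarrow> finite (vecs N i)"
    and U: "U \<in> subreps Q N"
  shows "is_rep Q (restrict_rep N U)"
proof -
  note V = subspaceD[OF subrepsD(2)[OF U]]
  have "vectorspace.fin_dim class_ring (vsp N i\<lparr>carrier := U i\<rparr>)" if i: "i \<in> nodes Q" for i
    by (rule fin_dim_of_finite[OF V(5)[OF i]]) (use finite_subset[OF V(1)[OF i] fin[OF i]] in simp)
  moreover have "linear_map class_ring (vsp N (src Q \<alpha>)\<lparr>carrier := U (src Q \<alpha>)\<rparr>)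
      (vsp N (tgt Q \<alpha>)\<lparr>carrier := U (tgt Q \<alpha>)\<rparr>) (lmap N \<alpha>)" if \<alpha>: "\<alpha> \<in> arrows Q" for \<alpha>
  proof -
    note s = quiverD(3,4)[OF Q \<alpha>] and l = linear_mapD[OF is_repD(3)[OF N \<alpha>]]
    show ?thesis
      by (rule linear_mapI)
        (use V(5)[OF s(1)] V(5)[OF s(2)] subsetD[OF V(1)[OF s(1)]] l(4,5) subrepsD(3)[OF U \<alpha>] in auto)
  qed
  ultimately show ?thesis unfolding is_rep_def restrict_rep_def using V(5) by simp
qed

locale isotropic_sub =
  fixes Q :: "('v, 'a) sdquiver" and N :: "('k::{field,finite}, 'w, 'v, 'a) sdrep" and U :: "'v \<Rightarrow> 'w set"
  assumes Q: "sd_quiver Q" and N: "is_sdrep Q N" and U: "U \<in> subreps Q N" and iso: "isotropic Q N U"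
begin

abbreviation "\<sigma> \<equiv> sig0 Q"
abbreviation "W \<equiv> perp Q N U"
abbreviation "R \<equiv> sd_reduction Q N U"

text \<open>The projection to cosets is defined at every vector of \<open>N\<close>, although the
  vectors of the reduction are the cosets of vectors in \<open>W i\<close>.\<close>

definition pr :: "'v \<Rightarrow> 'w \<Rightarrow> 'w set" where
  "pr i x = U i +>\<^bsub>vsp N i\<^esub> x"

lemmas Q0 = sd_quiverD(1)[OF Q] and sg = sd_quiverD(2,3)[OF Q]
lemmas NF = is_sdrep_form_rep[OF N]
lemmas NR = form_repD(1)[OF NF] and NB = form_repD(2)[OF NF] and orth = form_repD(3)[OF NF]
lemmas VN = is_repD(1)[OF NR]
lemmas bil = bilinear_formD[OF NB]
lemmas fsym = form_sym[OF Q N]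
lemmas US = subspaceD[OF subrepsD(2)[OF U]]
lemmas fin_vecs = card_vectorspace(2)[OF is_repD(1,2)[OF NR]]

lemma UN: "i \<in> nodes Q \<Longrightarrow> x \<in> U i \<Longrightarrow> x \<in> vecs N i"
  using US(1) by blast

text \<open>A vector at \<open>i\<close> can pair nontrivially only with vectors at
  \<open>\<sigma> i\<close>.\<close>

lemma perp_iff:
  assumes i: "i \<in> nodes Q"
  shows "x \<in> W i \<longleftrightarrow> x \<in> vecs N i \<and> (\<forall>u\<in>U (\<sigma> i). form N i (\<sigma> i) x u = 0)"
proof
  show "x \<in> vecs N i \<and> (\<forall>u\<in>U (\<sigma> i). form N i (\<sigma> i) x u = 0)" if "x \<in> W i"
    using that i sg(1) unfolding perp_def by auto
  assume x: "x \<in> vecs N i \<and> (\<forall>u\<in>U (\<sigma> i). form N i (\<sigma> i) x u = 0)"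
  have "form N i j x u = 0" if "j \<in> nodes Q" "u \<in> U j" for j u
  proof (cases "j = \<sigma> i")
    case False
    then have "i \<noteq> \<sigma> j" using sg that by auto
    then show ?thesis using orth[OF i that(1)] x UN that by blast
  qed (use x that in auto)
  then show "x \<in> W i" unfolding perp_def using x by auto
qed

lemma WN: "x \<in> W i \<Longrightarrow> x \<in> vecs N i"
  unfolding perp_def by blast

lemma UW: "i \<in> nodes Q \<Longrightarrow> x \<in> U i \<Longrightarrow> x \<in> W i"
  using iso unfolding isotropic_def by blast

lemma W_U_zero: "i \<in> nodes Q \<Longrightarrow> j \<in> nodes Q \<Longrightarrow> x \<in> W i \<Longrightarrow> u \<in> U j \<Longrightarrow> form N i j x u = 0"
  unfolding perp_def by blast

text \<open>\<open>perp\<close> puts the vectors of \<open>U\<close> in the second argument;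
  symmetry up to sign gives the other side.\<close>

lemma U_W_zero:
  assumes ij: "i \<in> nodes Q" "j \<in> nodes Q" and u: "u \<in> U i" and x: "x \<in> W j"
  shows "form N i j u x = 0"
proof (cases "i = \<sigma> j")
  case True
  then have "j = \<sigma> i" using sg ij by auto
  then show ?thesis using fsym[OF ij(1) UN[OF ij(1) u]] WN[OF x] W_U_zero[OF ij(2,1) x u] by simp
next
  case False
  then show ?thesis using orth[OF ij False UN[OF ij(1) u] WN[OF x]] by simp
qed

lemma W_subspace:
  assumes i: "i \<in> nodes Q"
  shows "VectorSpace.subspace class_ring (W i) (vsp N i)"
proof (rule subspaceI[OF VN[OF i]])
  show "W i \<subseteq> vecs N i" using WN by blast
  show "\<zero>\<^bsub>vsp N i\<^esub> \<in> W i" using UW[OF i US(2)[OF i]] .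
  show "x \<oplus>\<^bsub>vsp N i\<^esub> y \<in> W i" if "x \<in> W i" "y \<in> W i" for x y
    using that UN[OF sg(1)[OF i]] vs_add_closed[OF VN[OF i]]
    by (simp add: perp_iff[OF i] bil(1)[OF i sg(1)[OF i]])
  show "c \<odot>\<^bsub>vsp N i\<^esub> x \<in> W i" if "x \<in> W i" for c x
    using that UN[OF sg(1)[OF i]] vs_smult_closed[OF VN[OF i]]
    by (simp add: perp_iff[OF i] bil(3)[OF i sg(1)[OF i]])
qed

lemmas WS = subspaceD[OF W_subspace]

text \<open>Adjointness replaces \<alpha> acting on \<open>x\<close> by \<sigma>(\<alpha>) acting on
  a vector of \<open>U\<close>, and \<open>U\<close> is stable under all arrows.\<close>

lemma lmap_W:
  assumes \<alpha>: "\<alpha> \<in> arrows Q" and x: "x \<in> W (src Q \<alpha>)"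
  shows "lmap N \<alpha> x \<in> W (tgt Q \<alpha>)"
proof -
  note s = quiverD(3,4)[OF Q0 \<alpha>] and \<sigma>\<alpha> = sd_quiverD(4,6,7)[OF Q \<alpha>]
  have "form N (tgt Q \<alpha>) (\<sigma> (tgt Q \<alpha>)) (lmap N \<alpha> x) w = 0" if w: "w \<in> U (\<sigma> (tgt Q \<alpha>))" for w
  proof -
    have "lmap N (sig1 Q \<alpha>) w \<in> U (\<sigma> (src Q \<alpha>))"
      using subrepsD(3)[OF U \<sigma>\<alpha>(1), of w] w \<sigma>\<alpha> by simp
    then show ?thesis
      using form_adj[OF N \<alpha> WN[OF x] UN[OF sg(1)[OF s(2)] w]] W_U_zero[OF s(1) sg(1)[OF s(1)] x] by simp
  qed
  then show ?thesis
    using perp_iff[OF s(2)] linear_mapD(3)[OF is_repD(3)[OF NR \<alpha>] WN[OF x]] by blast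
qed

lemma mem_pr: "y \<in> pr i x \<longleftrightarrow> (\<exists>w\<in>U i. y = w \<oplus>\<^bsub>vsp N i\<^esub> x)"
  unfolding pr_def a_r_coset_def' by auto

lemma pr_self:
  assumes i: "i \<in> nodes Q" and x: "x \<in> vecs N i"
  shows "x \<in> pr i x"
  using US(2)[OF i] vectorspace_simps(6)[OF VN[OF i] x] unfolding mem_pr by metis

lemma pr_subset_W:
  assumes i: "i \<in> nodes Q" and x: "x \<in> W i" and y: "y \<in> pr i x"
  shows "y \<in> W i"
  using y UW[OF i] WS(3)[OF i _ x] unfolding mem_pr by blast

lemma pr_eqI:
  assumes i: "i \<in> nodes Q" and x: "x \<in> vecs N i" and y: "y \<in> pr i x"
  shows "pr i y = pr i x"
proof -
  interpret V: vectorspace class_ring "vsp N i" by (rule VN[OF i])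
  obtain w where w: "w \<in> U i" "y = w \<oplus>\<^bsub>vsp N i\<^esub> x" using y unfolding mem_pr by blast
  have wN: "w \<in> vecs N i" using UN[OF i w(1)] .
  have "z \<in> pr i x" if z: "z \<in> pr i y" for z
  proof -
    obtain w' where w': "w' \<in> U i" "z = w' \<oplus>\<^bsub>vsp N i\<^esub> y" using z unfolding mem_pr by blast
    then have "z = (w' \<oplus>\<^bsub>vsp N i\<^esub> w) \<oplus>\<^bsub>vsp N i\<^esub> x" using w wN x UN[OF i w'(1)] V.a_assoc by simp
    then show ?thesis using US(3)[OF i w'(1) w(1)] unfolding mem_pr by blast
  qed
  moreover have "z \<in> pr i y" if z: "z \<in> pr i x" for z
  proof -
    obtain w' where w': "w' \<in> U i" "z = w' \<oplus>\<^bsub>vsp N i\<^esub> x" using z unfolding mem_pr by blast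
    let ?m = "(-1) \<odot>\<^bsub>vsp N i\<^esub> w"
    have m: "?m \<in> U i" "?m \<in> vecs N i" using US(4)[OF i w(1)] UN[OF i] by auto
    have "?m \<oplus>\<^bsub>vsp N i\<^esub> w = \<zero>\<^bsub>vsp N i\<^esub>"
      using vectorspace_distrib(6)[OF VN[OF i] wN] V.a_comm[OF m(2) wN] by simp
    then have "?m \<oplus>\<^bsub>vsp N i\<^esub> y = x" using w wN x m V.a_assoc[of ?m w x] by simp
    then have "z = (w' \<oplus>\<^bsub>vsp N i\<^esub> ?m) \<oplus>\<^bsub>vsp N i\<^esub> y"
      using w' m w wN x UN[OF i w'(1)] V.a_assoc[of w' ?m y] by simp
    then show ?thesis using US(3)[OF i w'(1) m(1)] unfolding mem_pr by blast
  qed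
  ultimately show ?thesis by blast
qed

lemma pr_eq_iff:
  assumes i: "i \<in> nodes Q" and x: "x \<in> vecs N i" and y: "y \<in> vecs N i"
  shows "pr i y = pr i x \<longleftrightarrow> (\<exists>w\<in>U i. y = w \<oplus>\<^bsub>vsp N i\<^esub> x)"
  using pr_eqI[OF i x] pr_self[OF i y] unfolding mem_pr[symmetric] by blast

lemma pr_zero_iff:
  assumes i: "i \<in> nodes Q" and x: "x \<in> vecs N i"
  shows "pr i x = U i \<longleftrightarrow> x \<in> U i" "pr i \<zero>\<^bsub>vsp N i\<^esub> = U i"
proof -
  interpret V: vectorspace class_ring "vsp N i" by (rule VN[OF i])
  show z: "pr i \<zero>\<^bsub>vsp N i\<^esub> = U i" using V.r_zero UN[OF i] by (auto simp: set_eq_iff mem_pr)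
  have "pr i x = pr i \<zero>\<^bsub>vsp N i\<^esub> \<longleftrightarrow> x \<in> U i"
    unfolding pr_eq_iff[OF i V.zero_closed x] using V.r_zero UN[OF i] by auto
  then show "pr i x = U i \<longleftrightarrow> x \<in> U i" unfolding z .
qed

text \<open>This is the number of lifts of a vector of the reduction.\<close>

lemma card_pr:
  assumes i: "i \<in> nodes Q" and x: "x \<in> vecs N i"
  shows "card (pr i x) = card (U i)"
proof -
  interpret V: vectorspace class_ring "vsp N i" by (rule VN[OF i])
  have "inj_on (\<lambda>w. w \<oplus>\<^bsub>vsp N i\<^esub> x) (U i)"
    by (rule inj_onI) (use UN[OF i] x V.add.right_cancel in blast)
  moreover have "(\<lambda>w. w \<oplus>\<^bsub>vsp N i\<^esub> x) ` U i = pr i x" by (auto simp: mem_pr)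
  ultimately show ?thesis using card_image by metis
qed

lemma R_simps:
  "vsp R i = quot_space (vsp N i\<lparr>carrier := W i\<rparr>) (U i)"
  "lmap R \<alpha> X = lmap N \<alpha> ` X <+>\<^bsub>vsp N (tgt Q \<alpha>)\<^esub> U (tgt Q \<alpha>)"
  "form R i j X Y = form N i j (SOME x. x \<in> X) (SOME y. y \<in> Y)"
  by (simp_all add: sd_reduction_def)

lemma vecs_R: "vecs R i = pr i ` W i"
  unfolding R_simps(1) quot_space_def A_RCOSETS_def' pr_def by (auto simp: a_r_coset_def')

lemma zero_R: "\<zero>\<^bsub>vsp R i\<^esub> = U i"
  by (simp add: R_simps quot_space_def)

lemma add_R:
  assumes i: "i \<in> nodes Q" and x: "x \<in> vecs N i" and y: "y \<in> vecs N i"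
  shows "pr i x \<oplus>\<^bsub>vsp R i\<^esub> pr i y = pr i (x \<oplus>\<^bsub>vsp N i\<^esub> y)"
proof -
  interpret V: vectorspace class_ring "vsp N i" by (rule VN[OF i])
  have eq: "pr i x \<oplus>\<^bsub>vsp R i\<^esub> pr i y = (\<Union>h\<in>pr i x. \<Union>k\<in>pr i y. {h \<oplus>\<^bsub>vsp N i\<^esub> k})"
    by (simp add: R_simps quot_space_def set_add_def')
  have ac: "(w \<oplus>\<^bsub>vsp N i\<^esub> x) \<oplus>\<^bsub>vsp N i\<^esub> (w' \<oplus>\<^bsub>vsp N i\<^esub> y) = (w \<oplus>\<^bsub>vsp N i\<^esub> w') \<oplus>\<^bsub>vsp N i\<^esub> (x \<oplus>\<^bsub>vsp N i\<^esub> y)"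
    if "w \<in> U i" "w' \<in> U i" for w w'
    using UN[OF i] that x y by (simp add: V.a_ac)
  show ?thesis
  proof
    show "pr i x \<oplus>\<^bsub>vsp R i\<^esub> pr i y \<subseteq> pr i (x \<oplus>\<^bsub>vsp N i\<^esub> y)"
    proof
      fix z assume "z \<in> pr i x \<oplus>\<^bsub>vsp R i\<^esub> pr i y"
      then obtain w w' where w: "w \<in> U i" "w' \<in> U i" "z = (w \<oplus>\<^bsub>vsp N i\<^esub> x) \<oplus>\<^bsub>vsp N i\<^esub> (w' \<oplus>\<^bsub>vsp N i\<^esub> y)"
        unfolding eq by (auto simp: mem_pr)
      then show "z \<in> pr i (x \<oplus>\<^bsub>vsp N i\<^esub> y)" using ac[OF w(1,2)] US(3)[OF i w(1,2)] unfolding mem_pr by blast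
    qed
    show "pr i (x \<oplus>\<^bsub>vsp N i\<^esub> y) \<subseteq> pr i x \<oplus>\<^bsub>vsp R i\<^esub> pr i y"
    proof
      fix z assume "z \<in> pr i (x \<oplus>\<^bsub>vsp N i\<^esub> y)"
      then obtain w where w: "w \<in> U i" "z = w \<oplus>\<^bsub>vsp N i\<^esub> (x \<oplus>\<^bsub>vsp N i\<^esub> y)" unfolding mem_pr by blast
      then have "z = (w \<oplus>\<^bsub>vsp N i\<^esub> x) \<oplus>\<^bsub>vsp N i\<^esub> y" using UN[OF i] x y V.a_assoc by simp
      moreover have "w \<oplus>\<^bsub>vsp N i\<^esub> x \<in> pr i x" using w by (auto simp: mem_pr)
      ultimately show "z \<in> pr i x \<oplus>\<^bsub>vsp R i\<^esub> pr i y" unfolding eq using pr_self[OF i y] by blast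
    qed
  qed
qed

text \<open>The operations of the quotient act on all elements of a coset and then add
  \<open>U\<close>. This common computation serves scalar multiplication, where \<open>f\<close>
  multiplies by a constant, and the arrows.\<close>

lemma image_add_U:
  assumes i: "i \<in> nodes Q" and j: "j \<in> nodes Q" and x: "x \<in> vecs N i"
    and f: "f x \<in> vecs N j" "\<And>w. w \<in> U i \<Longrightarrow> f (w \<oplus>\<^bsub>vsp N i\<^esub> x) = f w \<oplus>\<^bsub>vsp N j\<^esub> f x"
      "\<And>w. w \<in> U i \<Longrightarrow> f w \<in> U j"
  shows "f ` pr i x <+>\<^bsub>vsp N j\<^esub> U j = pr j (f x)"
proof -
  interpret V: vectorspace class_ring "vsp N j" by (rule VN[OF j])
  have eq: "f ` pr i x <+>\<^bsub>vsp N j\<^esub> U j = (\<Union>h\<in>pr i x. \<Union>k\<in>U j. {f h \<oplus>\<^bsub>vsp N j\<^esub> k})"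
    by (auto simp: set_add_def')
  show ?thesis
  proof
    show "f ` pr i x <+>\<^bsub>vsp N j\<^esub> U j \<subseteq> pr j (f x)"
    proof
      fix z assume "z \<in> f ` pr i x <+>\<^bsub>vsp N j\<^esub> U j"
      then obtain w k where w: "w \<in> U i" "k \<in> U j" "z = f (w \<oplus>\<^bsub>vsp N i\<^esub> x) \<oplus>\<^bsub>vsp N j\<^esub> k"
        unfolding eq by (auto simp: mem_pr)
      then have "z = (f w \<oplus>\<^bsub>vsp N j\<^esub> f x) \<oplus>\<^bsub>vsp N j\<^esub> k" using f(2) by simp
      also have "\<dots> = (f w \<oplus>\<^bsub>vsp N j\<^esub> k) \<oplus>\<^bsub>vsp N j\<^esub> f x"
        using UN[OF j] f(1) f(3)[OF w(1)] w(2) by (simp add: V.a_ac)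
      finally show "z \<in> pr j (f x)" using US(3)[OF j f(3)[OF w(1)] w(2)] unfolding mem_pr by blast
    qed
    show "pr j (f x) \<subseteq> f ` pr i x <+>\<^bsub>vsp N j\<^esub> U j"
    proof
      fix z assume "z \<in> pr j (f x)"
      then obtain k where k: "k \<in> U j" "z = k \<oplus>\<^bsub>vsp N j\<^esub> f x" unfolding mem_pr by blast
      then have "z = f x \<oplus>\<^bsub>vsp N j\<^esub> k" using V.a_comm UN[OF j] f(1) by simp
      then show "z \<in> f ` pr i x <+>\<^bsub>vsp N j\<^esub> U j" unfolding eq using pr_self[OF i x] k(1) by blast
    qed
  qed
qed

lemma smult_R:
  assumes i: "i \<in> nodes Q" and x: "x \<in> vecs N i"
  shows "c \<odot>\<^bsub>vsp R i\<^esub> pr i x = pr i (c \<odot>\<^bsub>vsp N i\<^esub> x)"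
proof -
  have "c \<odot>\<^bsub>vsp R i\<^esub> pr i x = (\<lambda>x. c \<odot>\<^bsub>vsp N i\<^esub> x) ` pr i x <+>\<^bsub>vsp N i\<^esub> U i"
    by (simp add: R_simps quot_space_def set_add_def')
  also have "\<dots> = pr i (c \<odot>\<^bsub>vsp N i\<^esub> x)"
    by (rule image_add_U[OF i i x])
      (use vs_smult_closed[OF VN[OF i] x] vectorspace_distrib(1)[OF VN[OF i] _ x] UN[OF i] US(4)[OF i] in auto)
  finally show ?thesis .
qed

lemma lmap_R:
  assumes \<alpha>: "\<alpha> \<in> arrows Q" and x: "x \<in> vecs N (src Q \<alpha>)"
  shows "lmap R \<alpha> (pr (src Q \<alpha>) x) = pr (tgt Q \<alpha>) (lmap N \<alpha> x)"
  unfolding R_simps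
proof (rule image_add_U[OF quiverD(3,4)[OF Q0 \<alpha>] x])
  note l = linear_mapD[OF is_repD(3)[OF NR \<alpha>]]
  show "lmap N \<alpha> x \<in> vecs N (tgt Q \<alpha>)" by (rule l(3)[OF x])
  show "lmap N \<alpha> (w \<oplus>\<^bsub>vsp N (src Q \<alpha>)\<^esub> x) = lmap N \<alpha> w \<oplus>\<^bsub>vsp N (tgt Q \<alpha>)\<^esub> lmap N \<alpha> x"
    if "w \<in> U (src Q \<alpha>)" for w
    by (rule l(4)[OF UN[OF quiverD(3)[OF Q0 \<alpha>] that] x])
  show "lmap N \<alpha> w \<in> U (tgt Q \<alpha>)" if "w \<in> U (src Q \<alpha>)" for w
    by (rule subrepsD(3)[OF U \<alpha> that])
qed

text \<open>The form of the reduction uses arbitrary representatives. Changing them adds vectors of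
  \<open>U\<close>, which are orthogonal to \<open>W\<close> in either argument.\<close>

lemma form_R:
  assumes ij: "i \<in> nodes Q" "j \<in> nodes Q" and x: "x \<in> W i" and y: "y \<in> W j"
  shows "form R i j (pr i x) (pr j y) = form N i j x y"
proof -
  have "(SOME x'. x' \<in> pr i x) \<in> pr i x" by (rule someI[of "\<lambda>x'. x' \<in> pr i x", OF pr_self[OF ij(1) WN[OF x]]])
  then obtain w where w: "w \<in> U i" "(SOME x'. x' \<in> pr i x) = w \<oplus>\<^bsub>vsp N i\<^esub> x" unfolding mem_pr by blast
  have "(SOME y'. y' \<in> pr j y) \<in> pr j y" by (rule someI[of "\<lambda>y'. y' \<in> pr j y", OF pr_self[OF ij(2) WN[OF y]]])
  then obtain w' where w': "w' \<in> U j" "(SOME y'. y' \<in> pr j y) = w' \<oplus>\<^bsub>vsp N j\<^esub> y" unfolding mem_pr by blast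
  have y': "w' \<oplus>\<^bsub>vsp N j\<^esub> y \<in> W j" using WS(3)[OF ij(2) UW[OF ij(2) w'(1)] y] .
  have "form R i j (pr i x) (pr j y) = form N i j w (w' \<oplus>\<^bsub>vsp N j\<^esub> y) + form N i j x (w' \<oplus>\<^bsub>vsp N j\<^esub> y)"
    unfolding R_simps w(2) w'(2) by (rule bil(1)[OF ij UN[OF ij(1) w(1)] WN[OF x] WN[OF y']])
  also have "\<dots> = form N i j x w' + form N i j x y"
    using U_W_zero[OF ij w(1) y'] bil(2)[OF ij WN[OF x] UN[OF ij(2) w'(1)] WN[OF y]] by simp
  finally show ?thesis using W_U_zero[OF ij x w'(1)] by simp
qed

lemma VR:
  assumes i: "i \<in> nodes Q"
  shows "vectorspace class_ring (vsp R i)"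
proof (rule vectorspace_image[OF WS(5)[OF i], of "vsp R i" "pr i"])
  show "vecs R i = pr i ` carrier (vsp N i\<lparr>carrier := W i\<rparr>)" by (simp add: vecs_R)
  show "\<zero>\<^bsub>vsp R i\<^esub> = pr i \<zero>\<^bsub>vsp N i\<lparr>carrier := W i\<rparr>\<^esub>"
    using pr_zero_iff(2)[OF i WN[OF WS(2)[OF i]]] by (simp add: zero_R)
qed (use add_R[OF i] smult_R[OF i] WN in auto)

lemma R_form_rep: "form_rep Q R"
proof -
  have fin: "finite (vecs R i)" if "i \<in> nodes Q" for i
    unfolding vecs_R using finite_subset[OF WS(1)[OF that] fin_vecs[OF that that]] by blast
  have lin: "linear_map class_ring (vsp R (src Q \<alpha>)) (vsp R (tgt Q \<alpha>)) (lmap R \<alpha>)" if \<alpha>: "\<alpha> \<in> arrows Q" for \<alpha>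
  proof (rule linear_mapI)
    note s = quiverD(3,4)[OF Q0 \<alpha>] and l = linear_mapD[OF is_repD(3)[OF NR \<alpha>]]
    show "vectorspace class_ring (vsp R (src Q \<alpha>))" "vectorspace class_ring (vsp R (tgt Q \<alpha>))" using VR s by auto
    show "lmap R \<alpha> X \<in> vecs R (tgt Q \<alpha>)" if "X \<in> vecs R (src Q \<alpha>)" for X
      using that lmap_R[OF \<alpha>] lmap_W[OF \<alpha>] WN unfolding vecs_R by auto
    show "lmap R \<alpha> (X \<oplus>\<^bsub>vsp R (src Q \<alpha>)\<^esub> Y) = lmap R \<alpha> X \<oplus>\<^bsub>vsp R (tgt Q \<alpha>)\<^esub> lmap R \<alpha> Y"
      if "X \<in> vecs R (src Q \<alpha>)" "Y \<in> vecs R (src Q \<alpha>)" for X Y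
      using that WN vs_add_closed[OF VN[OF s(1)]] l(3,4) unfolding vecs_R
      by (auto simp: add_R[OF s(1)] add_R[OF s(2)] lmap_R[OF \<alpha>])
    show "lmap R \<alpha> (c \<odot>\<^bsub>vsp R (src Q \<alpha>)\<^esub> X) = c \<odot>\<^bsub>vsp R (tgt Q \<alpha>)\<^esub> lmap R \<alpha> X"
      if "X \<in> vecs R (src Q \<alpha>)" for c X
      using that WN vs_smult_closed[OF VN[OF s(1)]] l(3,5) unfolding vecs_R
      by (auto simp: smult_R[OF s(1)] smult_R[OF s(2)] lmap_R[OF \<alpha>])
  qed
  have bilR: "bilinear_form Q R"
    unfolding bilinear_form_def vecs_R
    using WS(3,4) WN
    by (auto simp: add_R smult_R form_R bil)
  have "form R i j X Y = 0" if "i \<in> nodes Q" "j \<in> nodes Q" "i \<noteq> \<sigma> j" "X \<in> vecs R i" "Y \<in> vecs R j" for i j X Y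
    using that(4,5) orth[OF that(1-3)] WN unfolding vecs_R by (auto simp: form_R[OF that(1,2)])
  then show ?thesis
    unfolding form_rep_def is_rep_def using VR fin_dim_of_finite[OF VR fin] lin bilR by blast
qed

lemma lsum_R:
  assumes i: "i \<in> nodes Q" and b: "b \<in> B \<rightarrow> W i" and B: "finite B"
  shows "pr i (lsum (vsp N i) B c b) = lsum (vsp R i) B c (\<lambda>x. pr i (b x))"
proof -
  have "pr i (lsum (vsp N i\<lparr>carrier := W i\<rparr>) B c b) = lsum (vsp R i) B c (\<lambda>x. pr i (b x))"
    by (rule lsum_hom[OF WS(5)[OF i] VR[OF i]])
      (use b B add_R[OF i] smult_R[OF i] WN in \<open>auto simp: vecs_R\<close>)
  then show ?thesis
    using lsum_restrict_carrier[OF VN[OF i] WS(5)[OF i] WS(1)[OF i] b B] by simp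
qed

lemma lsum_in_U:
  assumes i: "i \<in> nodes Q" and b: "b \<in> B \<rightarrow> U i" and B: "finite B"
  shows "lsum (vsp N i) B c b \<in> U i"
  using lsum_closed[OF US(5)[OF i], of b B c] b lsum_restrict_carrier[OF VN[OF i] US(5)[OF i] US(1)[OF i] b B]
  by simp

end

section \<open>Frames\<close>

lemma sum_mult_delta:
  fixes a :: "'k::comm_ring_1"
  shows "(\<Sum>k<(n::nat). c k * (if k = l then a else 0)) = (if l < n then c l * a else 0)"
    and "(\<Sum>k<(n::nat). (if l = k then a else 0) * c k) = (if l < n then a * c l else 0)"
proof -
  have "(\<Sum>k<n. c k * (if k = l then a else 0)) = (\<Sum>k<n. if k = l then c l * a else 0)"
    by (rule sum.cong) auto
  then show "(\<Sum>k<n. c k * (if k = l then a else 0)) = (if l < n then c l * a else 0)" by simp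
  have "(\<Sum>k<n. (if l = k then a else 0) * c k) = (\<Sum>k<n. if k = l then a * c l else 0)"
    by (rule sum.cong) auto
  then show "(\<Sum>k<n. (if l = k then a else 0) * c k) = (if l < n then a * c l else 0)" by simp
qed

text \<open>\<open>Iso\<close> indexes the isotropic part, \<open>Mid\<close> the lifts of a basis
  of the reduction and \<open>Dual\<close> the vectors dual to the isotropic part. The form pairs a
  node with its \<sigma>-image, so \<open>Dual k\<close> at \<open>i\<close> belongs to
  \<open>Iso k\<close> at \<sigma>(i) and its range is bounded by the dimension there.\<close>

datatype ix = Iso nat | Mid nat | Dual nat

text \<open>The numerical shadow of \<open>U\<close> and \<open>M\<close>: dimensions and matrices.
  The matrices \<open>AU\<close> are arbitrary, as for any representation; the conditions on
  \<open>m\<close>, \<open>G\<close> and \<open>AM\<close> express the self-duality of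
  \<open>M\<close> on a basis.\<close>

locale split_data =
  fixes Q :: "('v, 'a) sdquiver" and u m :: "'v \<Rightarrow> nat"
    and AU AM :: "'a \<Rightarrow> nat \<Rightarrow> nat \<Rightarrow> 'k::{field,finite}" and G :: "'v \<Rightarrow> nat \<Rightarrow> nat \<Rightarrow> 'k"
  assumes sdQ: "sd_quiver Q"
    and two: "(2 :: 'k) \<noteq> 0"
    and m_sig: "i \<in> nodes Q \<Longrightarrow> m (sig0 Q i) = m i"
    and G_sym: "i \<in> nodes Q \<Longrightarrow> x < m i \<Longrightarrow> y < m i \<Longrightarrow> G i x y = of_int (sgn_s Q i) * G (sig0 Q i) y x"
    and G_nd: "i \<in> nodes Q \<Longrightarrow> (\<And>y. y < m i \<Longrightarrow> (\<Sum>x<m i. c x * G i x y) = 0) \<Longrightarrow> x < m i \<Longrightarrow> c x = 0"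
    and AM_adj: "\<alpha> \<in> arrows Q \<Longrightarrow> x < m (src Q \<alpha>) \<Longrightarrow> y < m (tgt Q \<alpha>) \<Longrightarrow>
      (\<Sum>z<m (tgt Q \<alpha>). AM \<alpha> z x * G (tgt Q \<alpha>) z y) =
      of_int (sgn_tau Q \<alpha>) * (\<Sum>z<m (src Q \<alpha>). G (src Q \<alpha>) x z * AM (sig1 Q \<alpha>) z y)"
begin

lemmas qv = sd_quiverD(1)[OF sdQ]
lemmas sig = sd_quiverD(2,3)[OF sdQ]
lemmas sig_arr = sd_quiverD(4-7)[OF sdQ]
lemmas st = quiverD(3,4)[OF qv]

lemma sgn_sq:
  "i \<in> nodes Q \<Longrightarrow> of_int (sgn_s Q i) * of_int (sgn_s Q i) = (1 :: 'k)"
  "\<alpha> \<in> arrows Q \<Longrightarrow> of_int (sgn_tau Q \<alpha>) * of_int (sgn_tau Q \<alpha>) = (1 :: 'k)"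
  using sd_quiverD(8,10)[OF sdQ] by fastforce+

text \<open>Multiply the axiom relating \<tau> and \<open>s\<close> by the signs of the target and
  of \<alpha>; signs square to 1.\<close>

lemma sgn_s_tau:
  assumes \<alpha>: "\<alpha> \<in> arrows Q"
  shows "sgn_s Q (tgt Q \<alpha>) * sgn_tau Q (sig1 Q \<alpha>) = sgn_tau Q \<alpha> * sgn_s Q (src Q \<alpha>)"
  using sd_quiverD(11)[OF sdQ \<alpha>] sd_quiverD(10)[OF sdQ \<alpha>] sd_quiverD(10)[OF sdQ sig_arr(1)[OF \<alpha>]]
    sd_quiverD(8)[OF sdQ st(1)[OF \<alpha>]] sd_quiverD(8)[OF sdQ st(2)[OF \<alpha>]] by auto

lemma of_int_sgn_s_tau:
  "\<alpha> \<in> arrows Q \<Longrightarrow> of_int (sgn_s Q (tgt Q \<alpha>)) * of_int (sgn_tau Q (sig1 Q \<alpha>)) =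
     (of_int (sgn_tau Q \<alpha>) * of_int (sgn_s Q (src Q \<alpha>)) :: 'k)"
  using sgn_s_tau by (simp flip: of_int_mult)

definition idx :: "'v \<Rightarrow> ix set" where
  "idx i = Iso ` {..<u i} \<union> (Mid ` {..<m i} \<union> Dual ` {..<u (sig0 Q i)})"

lemma finite_idx [simp]: "finite (idx i)"
  by (simp add: idx_def)

lemma mem_idx [simp]:
  "Iso k \<in> idx i \<longleftrightarrow> k < u i" "Mid k \<in> idx i \<longleftrightarrow> k < m i" "Dual k \<in> idx i \<longleftrightarrow> k < u (sig0 Q i)"
  by (auto simp: idx_def)

lemma idx_cases:
  assumes "x \<in> idx i"
  obtains k where "x = Iso k" "k < u i" | k where "x = Mid k" "k < m i" | k where "x = Dual k" "k < u (sig0 Q i)"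
  using assms by (auto simp: idx_def)

lemma card_idx: "card (idx i) = u i + (m i + u (sig0 Q i))"
  unfolding idx_def
  by (subst card_Un_disjoint; (subst card_Un_disjoint)?) (auto simp: card_image inj_on_def)

lemma sum_idx: "(\<Sum>x\<in>idx i. f x) = (\<Sum>k<u i. f (Iso k)) + ((\<Sum>k<m i. f (Mid k)) + (\<Sum>k<u (sig0 Q i). f (Dual k)))"
proof -
  have "(\<Sum>x\<in>idx i. f x) = (\<Sum>x\<in>Iso ` {..<u i}. f x) + ((\<Sum>x\<in>Mid ` {..<m i}. f x) + (\<Sum>x\<in>Dual ` {..<u (sig0 Q i)}. f x))"
    unfolding idx_def by (subst sum.union_disjoint; (subst sum.union_disjoint)?) auto
  then show ?thesis by (simp add: sum.reindex inj_on_def)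
qed

lemma lsum_idx:
  assumes V: "vectorspace class_ring V" and b: "b \<in> idx i \<rightarrow> carrier V"
  shows "lsum V (idx i) c b = lsum V {..<u i} (\<lambda>k. c (Iso k)) (\<lambda>k. b (Iso k)) \<oplus>\<^bsub>V\<^esub>
    (lsum V {..<m i} (\<lambda>k. c (Mid k)) (\<lambda>k. b (Mid k)) \<oplus>\<^bsub>V\<^esub>
     lsum V {..<u (sig0 Q i)} (\<lambda>k. c (Dual k)) (\<lambda>k. b (Dual k)))"
proof -
  have b: "b \<in> Iso ` {..<u i} \<union> (Mid ` {..<m i} \<union> Dual ` {..<u (sig0 Q i)}) \<rightarrow> carrier V"
    using b by (simp add: idx_def)
  have "lsum V (idx i) c b = lsum V (Iso ` {..<u i}) c b \<oplus>\<^bsub>V\<^esub> lsum V (Mid ` {..<m i} \<union> Dual ` {..<u (sig0 Q i)}) c b"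
    unfolding idx_def by (rule lsum_Un[OF V b]) auto
  also have "lsum V (Mid ` {..<m i} \<union> Dual ` {..<u (sig0 Q i)}) c b =
      lsum V (Mid ` {..<m i}) c b \<oplus>\<^bsub>V\<^esub> lsum V (Dual ` {..<u (sig0 Q i)}) c b"
    by (rule lsum_Un[OF V]) (use b in auto)
  also have "lsum V (Iso ` {..<u i}) c b = lsum V {..<u i} (\<lambda>k. c (Iso k)) (\<lambda>k. b (Iso k))"
    using lsum_reindex[OF V, of b Iso "{..<u i}" c] b by (simp add: inj_on_def o_def Pi_iff)
  also have "lsum V (Mid ` {..<m i}) c b = lsum V {..<m i} (\<lambda>k. c (Mid k)) (\<lambda>k. b (Mid k))"
    using lsum_reindex[OF V, of b Mid "{..<m i}" c] b by (simp add: inj_on_def o_def Pi_iff)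
  also have "lsum V (Dual ` {..<u (sig0 Q i)}) c b =
      lsum V {..<u (sig0 Q i)} (\<lambda>k. c (Dual k)) (\<lambda>k. b (Dual k))"
    using lsum_reindex[OF V, of b Dual "{..<u (sig0 Q i)}" c] b by (simp add: inj_on_def o_def Pi_iff)
  finally show ?thesis .
qed

text \<open>The isotropic and dual parts form a hyperbolic space. The entry for \<open>Iso\<close>
  against \<open>Dual\<close> is normalized to 1, and symmetry then forces the sign of the node in
  the opposite order.\<close>

definition gram :: "'v \<Rightarrow> ix \<Rightarrow> ix \<Rightarrow> 'k" where
  "gram i x y = (case x of
     Iso k \<Rightarrow> (case y of Dual l \<Rightarrow> if k = l then 1 else 0 | _ \<Rightarrow> 0)
   | Mid k \<Rightarrow> (case y of Mid l \<Rightarrow> G i k l | _ \<Rightarrow> 0)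
   | Dual k \<Rightarrow> (case y of Iso l \<Rightarrow> if k = l then of_int (sgn_s Q i) else 0 | _ \<Rightarrow> 0))"

lemma gram_simps [simp]:
  "gram i (Iso k) (Iso l) = 0" "gram i (Iso k) (Mid l) = 0" "gram i (Iso k) (Dual l) = (if k = l then 1 else 0)"
  "gram i (Mid k) (Iso l) = 0" "gram i (Mid k) (Mid l) = G i k l" "gram i (Mid k) (Dual l) = 0"
  "gram i (Dual k) (Iso l) = (if k = l then of_int (sgn_s Q i) else 0)" "gram i (Dual k) (Mid l) = 0"
  "gram i (Dual k) (Dual l) = 0"
  by (simp_all add: gram_def)

text \<open>Pairing with one member of a hyperbolic pair extracts the coordinate at the other
  member, up to sign.\<close>

lemma sum_gram_left:
  assumes i: "i \<in> nodes Q"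
  shows "l < u (sig0 Q i) \<Longrightarrow> (\<Sum>x\<in>idx i. c x * gram i x (Iso l)) = c (Dual l) * of_int (sgn_s Q i)"
    and "l < u i \<Longrightarrow> (\<Sum>x\<in>idx i. c x * gram i x (Dual l)) = c (Iso l)"
    and "(\<Sum>x\<in>idx i. c x * gram i x (Mid l)) = (\<Sum>k<m i. c (Mid k) * G i k l)"
  by (simp_all add: sum_idx sum_mult_delta)

lemma sum_gram_right:
  assumes i: "i \<in> nodes Q"
  shows "k < u i \<Longrightarrow> (\<Sum>z\<in>idx (sig0 Q i). gram i (Iso k) z * c z) = c (Dual k)"
    and "k < u (sig0 Q i) \<Longrightarrow> (\<Sum>z\<in>idx (sig0 Q i). gram i (Dual k) z * c z) = of_int (sgn_s Q i) * c (Iso k)"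
    and "(\<Sum>z\<in>idx (sig0 Q i). gram i (Mid k) z * c z) = (\<Sum>z<m i. G i k z * c (Mid z))"
  by (simp_all add: sum_idx sum_mult_delta sig[OF i] m_sig[OF i])

lemma gram_sym:
  assumes i: "i \<in> nodes Q" and x: "x \<in> idx i" and y: "y \<in> idx (sig0 Q i)"
  shows "gram i x y = of_int (sgn_s Q i) * gram (sig0 Q i) y x"
  using x
proof (cases rule: idx_cases)
  case (1 k)
  then show ?thesis using sgn_sq(1)[OF i] sd_quiverD(9)[OF sdQ i] by (cases y) auto
next
  case (2 k)
  then show ?thesis using G_sym[OF i] y m_sig[OF i] by (cases y) auto
next
  case (3 k)
  then show ?thesis by (cases y) auto
qed

lemma gram_nd:
  assumes i: "i \<in> nodes Q" and z: "\<And>y. y \<in> idx (sig0 Q i) \<Longrightarrow> (\<Sum>x\<in>idx i. c x * gram i x y) = 0"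
  shows "\<forall>x\<in>idx i. c x = 0"
proof
  fix x assume "x \<in> idx i"
  then show "c x = 0"
  proof (cases rule: idx_cases)
    case (1 k)
    then show ?thesis using z[of "Dual k"] sum_gram_left(2)[OF i, of k c] sig(2)[OF i] by simp
  next
    case (2 k)
    have "(\<Sum>x<m i. c (Mid x) * G i x y) = 0" if "y < m i" for y
      using z[of "Mid y"] sum_gram_left(3)[OF i, of c y] m_sig[OF i] that by simp
    from G_nd[OF i this] 2 show ?thesis by simp
  next
    case (3 k)
    then have "c (Dual k) * of_int (sgn_s Q i) = 0" using z[of "Iso k"] sum_gram_left(1)[OF i, of k c] by simp
    then show ?thesis using sgn_sq(1)[OF i] 3 by auto
  qed
qed

text \<open>A self-dual structure map that is block triangular for an adapted basis is determined by its
  block \<open>\<beta>\<close> from the dual part to the middle part and its block \<open>C\<close> from the dual part to the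
  isotropic part; only \<open>C\<close> is constrained.\<close>

definition mid_block :: "('a \<times> nat \<times> nat) set" where
  "mid_block = (SIGMA \<alpha>:arrows Q. {..<m (tgt Q \<alpha>)} \<times> {..<u (sig0 Q (src Q \<alpha>))})"

definition corner_block :: "('a \<times> nat \<times> nat) set" where
  "corner_block = (SIGMA \<alpha>:arrows Q. {..<u (tgt Q \<alpha>)} \<times> {..<u (sig0 Q (src Q \<alpha>))})"

text \<open>Adjointness between two dual vectors reads C(\<alpha>, l, k) = \<tau> s
  C(\<sigma>(\<alpha>), k, l), with s taken at the source. Moving the right side to the left gives
  the minus sign.\<close>

definition corner_sign :: "'a \<times> nat \<times> nat \<Rightarrow> int" where
  "corner_sign = (\<lambda>(\<alpha>, l, k). - (sgn_tau Q \<alpha> * sgn_s Q (src Q \<alpha>)))"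

text \<open>Transposition combined with \<sigma> on arrows. The ranges of the two indices are
  exchanged because \<sigma>(\<alpha>) runs from the \<sigma>-image of the target to that of the
  source.\<close>

definition corner_flip :: "'a \<times> nat \<times> nat \<Rightarrow> 'a \<times> nat \<times> nat" where
  "corner_flip = (\<lambda>(\<alpha>, l, k). (sig1 Q \<alpha>, k, l))"

definition params :: "(('a \<times> nat \<times> nat \<Rightarrow> 'k) \<times> ('a \<times> nat \<times> nat \<Rightarrow> 'k)) set" where
  "params = (mid_block \<rightarrow>\<^sub>E UNIV) \<times>
     {C \<in> corner_block \<rightarrow>\<^sub>E UNIV. \<forall>x\<in>corner_block. C x + of_int (corner_sign x) * C (corner_flip x) = 0}"

text \<open>\<open>fst p\<close> is \<beta> and \<open>snd p\<close> is C; \<open>x\<close> is the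
  column and \<open>z\<close> the row. The block from the middle to the isotropic part is the
  adjoint of the \<beta> of \<sigma>(\<alpha>), and the dual diagonal block is the adjoint of the
  matrix of \<open>U\<close> at \<sigma>(\<alpha>).\<close>

definition coef ::
  "('a \<times> nat \<times> nat \<Rightarrow> 'k) \<times> ('a \<times> nat \<times> nat \<Rightarrow> 'k) \<Rightarrow> 'a \<Rightarrow> ix \<Rightarrow> ix \<Rightarrow> 'k" where
  "coef p \<alpha> z x = (case x of
     Iso k \<Rightarrow> (case z of Iso l \<Rightarrow> AU \<alpha> l k | _ \<Rightarrow> 0)
   | Mid k \<Rightarrow> (case z of
         Iso l \<Rightarrow> of_int (sgn_tau Q \<alpha>) * (\<Sum>y<m (src Q \<alpha>). G (src Q \<alpha>) k y * fst p (sig1 Q \<alpha>, y, l))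
       | Mid l \<Rightarrow> AM \<alpha> l k | Dual l \<Rightarrow> 0)
   | Dual k \<Rightarrow> (case z of Iso l \<Rightarrow> snd p (\<alpha>, l, k) | Mid l \<Rightarrow> fst p (\<alpha>, l, k)
       | Dual l \<Rightarrow> of_int (sgn_tau Q (sig1 Q \<alpha>)) * AU (sig1 Q \<alpha>) k l))"

lemma coef_simps [simp]:
  "coef p \<alpha> (Iso l) (Iso k) = AU \<alpha> l k" "coef p \<alpha> (Mid l) (Iso k) = 0" "coef p \<alpha> (Dual l) (Iso k) = 0"
  "coef p \<alpha> (Iso l) (Mid k) =
     of_int (sgn_tau Q \<alpha>) * (\<Sum>y<m (src Q \<alpha>). G (src Q \<alpha>) k y * fst p (sig1 Q \<alpha>, y, l))"
  "coef p \<alpha> (Mid l) (Mid k) = AM \<alpha> l k" "coef p \<alpha> (Dual l) (Mid k) = 0"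
  "coef p \<alpha> (Iso l) (Dual k) = snd p (\<alpha>, l, k)" "coef p \<alpha> (Mid l) (Dual k) = fst p (\<alpha>, l, k)"
  "coef p \<alpha> (Dual l) (Dual k) = of_int (sgn_tau Q (sig1 Q \<alpha>)) * AU (sig1 Q \<alpha>) k l"
  by (simp_all add: coef_def)

lemma mid_block_iff: "(\<alpha>, l, k) \<in> mid_block \<longleftrightarrow> \<alpha> \<in> arrows Q \<and> l < m (tgt Q \<alpha>) \<and> k < u (sig0 Q (src Q \<alpha>))"
  by (auto simp: mid_block_def)

lemma corner_block_iff:
  "(\<alpha>, l, k) \<in> corner_block \<longleftrightarrow> \<alpha> \<in> arrows Q \<and> l < u (tgt Q \<alpha>) \<and> k < u (sig0 Q (src Q \<alpha>))"
  by (auto simp: corner_block_def)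

lemma corner_eq:
  assumes p: "p \<in> params" and \<alpha>: "\<alpha> \<in> arrows Q" and l: "l < u (tgt Q \<alpha>)" and k: "k < u (sig0 Q (src Q \<alpha>))"
  shows "snd p (\<alpha>, l, k) = of_int (sgn_tau Q \<alpha>) * of_int (sgn_s Q (src Q \<alpha>)) * snd p (sig1 Q \<alpha>, k, l)"
proof -
  have "(\<alpha>, l, k) \<in> corner_block" using \<alpha> l k by (simp add: corner_block_iff)
  then have "snd p (\<alpha>, l, k) + of_int (corner_sign (\<alpha>, l, k)) * snd p (corner_flip (\<alpha>, l, k)) = 0"
    using p unfolding params_def by auto
  then show ?thesis by (simp add: corner_sign_def corner_flip_def)
qed

text \<open>The identity is compared block by block. The middle block is the self-duality of
  \<open>M\<close>, and the pairing of two dual vectors is the twisted symmetry of C. The remaining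
  nonzero blocks hold by the choice of \<open>coef\<close>, with signs matched through the relation
  between \<open>s\<close> and \<tau>.\<close>

lemma coef_adj:
  assumes p: "p \<in> params" and \<alpha>: "\<alpha> \<in> arrows Q" and x: "x \<in> idx (src Q \<alpha>)" and y: "y \<in> idx (sig0 Q (tgt Q \<alpha>))"
  shows "(\<Sum>z\<in>idx (tgt Q \<alpha>). coef p \<alpha> z x * gram (tgt Q \<alpha>) z y) =
    of_int (sgn_tau Q \<alpha>) * (\<Sum>z\<in>idx (sig0 Q (src Q \<alpha>)). gram (src Q \<alpha>) x z * coef p (sig1 Q \<alpha>) z y)"
proof -
  note s = st(1)[OF \<alpha>] and t = st(2)[OF \<alpha>]
  note L = sum_gram_left[OF t] and R = sum_gram_right[OF s]
  have \<tau>: "of_int (sgn_tau Q \<alpha>) * (of_int (sgn_tau Q \<alpha>) * a) = (a :: 'k)" for a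
    using sgn_sq(2)[OF \<alpha>] by (simp flip: mult.assoc)
  \<comment> \<open>Trades the sign of the target for that of the source.\<close>
  have s\<tau>: "a * of_int (sgn_s Q (tgt Q \<alpha>)) = of_int (sgn_tau Q \<alpha>) * (of_int (sgn_s Q (src Q \<alpha>)) * b)"
    if "a = of_int (sgn_tau Q (sig1 Q \<alpha>)) * b" for a b :: 'k
  proof -
    have "a * of_int (sgn_s Q (tgt Q \<alpha>)) = (of_int (sgn_s Q (tgt Q \<alpha>)) * of_int (sgn_tau Q (sig1 Q \<alpha>))) * b"
      by (simp add: that mult_ac)
    then show ?thesis by (simp only: of_int_sgn_s_tau[OF \<alpha>] mult.assoc)
  qed
  from y show ?thesis
  proof (cases rule: idx_cases)
    case y: (1 l)
    from x show ?thesis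
    proof (cases rule: idx_cases)
      case (1 k)
      then show ?thesis using y L(1) R(1) by simp
    next
      case (2 k)
      then show ?thesis using y L(1) R(3) by simp
    next
      case (3 k)
      then show ?thesis using y L(1)[of l "\<lambda>z. coef p \<alpha> z (Dual k)"] R(2)[of k "\<lambda>z. coef p (sig1 Q \<alpha>) z (Iso l)"] s\<tau>
        by simp
    qed
  next
    case y: (2 l)
    have l: "l < m (tgt Q \<alpha>)" using y m_sig[OF t] by simp
    from x show ?thesis
    proof (cases rule: idx_cases)
      case (1 k)
      then show ?thesis using y L(3) R(1) by simp
    next
      case (2 k)
      then show ?thesis using y L(3) R(3) AM_adj[OF \<alpha> _ l] by simp
    next
      case (3 k)
      \<comment> \<open>The entry on the right involves the \<beta> of \<sigma>(\<sigma>(\<alpha>))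
        = \<alpha>, contracted with \<open>G\<close> in the opposite order; symmetry of
        \<open>G\<close> supplies the sign of the target.\<close>
      let ?b = "\<lambda>z. fst p (\<alpha>, z, k)"
      have "(\<Sum>z<m (tgt Q \<alpha>). ?b z * G (tgt Q \<alpha>) z l) =
          (\<Sum>z<m (tgt Q \<alpha>). ?b z * (of_int (sgn_s Q (tgt Q \<alpha>)) * G (sig0 Q (tgt Q \<alpha>)) l z))"
        using G_sym[OF t _ l] by (intro sum.cong) auto
      also have "\<dots> = (\<Sum>z<m (tgt Q \<alpha>). G (sig0 Q (tgt Q \<alpha>)) l z * ?b z) * of_int (sgn_s Q (tgt Q \<alpha>))"
        by (simp add: sum_distrib_left sum_distrib_right mult_ac)
      also have "\<dots> = (\<Sum>z<m (tgt Q \<alpha>). G (sig0 Q (tgt Q \<alpha>)) l z * ?b z) *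
          (of_int (sgn_tau Q \<alpha>) * of_int (sgn_s Q (src Q \<alpha>)) * of_int (sgn_tau Q (sig1 Q \<alpha>)))"
        using sgn_sq(2)[OF sig_arr(1)[OF \<alpha>]] by (simp only: of_int_sgn_s_tau[OF \<alpha>, symmetric] mult.assoc mult_1_right)
      finally show ?thesis
        using 3 y L(3)[of "\<lambda>z. coef p \<alpha> z (Dual k)" l] R(2)[of k "\<lambda>z. coef p (sig1 Q \<alpha>) z (Mid l)"]
          sig_arr[OF \<alpha>] m_sig[OF t]
        by (simp add: mult_ac)
    qed
  next
    case y: (3 l)
    have l: "l < u (tgt Q \<alpha>)" using y sig(2)[OF t] by simp
    from x show ?thesis
    proof (cases rule: idx_cases)
      case (1 k)
      then show ?thesis using y L(2)[OF l] R(1) \<tau> sig_arr(2)[OF \<alpha>] by simp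
    next
      case (2 k)
      then show ?thesis using y L(2)[OF l] R(3) by simp
    next
      case (3 k)
      then show ?thesis using y L(2)[OF l] R(2) corner_eq[OF p \<alpha> l] by (simp add: mult.assoc)
    qed
  qed
qed

section \<open>Counting the free parameters and the frames belonging to them\<close>

lemma finite_corner_block [simp]: "finite corner_block" and finite_mid_block [simp]: "finite mid_block"
  unfolding corner_block_def mid_block_def using quiverD(2)[OF qv] by auto

text \<open>The block \<beta> is free. The corner is the homogeneous case of the twisted symmetry
  count for the involution \<open>corner_flip\<close>.\<close>

lemma card_params:
  "\<exists>e. card params = CARD('k) ^ (card mid_block + e) \<and>
     2 * int e = int (card corner_block) - (\<Sum>x\<in>{x\<in>corner_block. corner_flip x = x}. corner_sign x)"
proof -
  have flip: "corner_flip x \<in> corner_block \<and> corner_flip (corner_flip x) = x" if "x \<in> corner_block" for x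
    using that sig_arr st sig unfolding corner_block_def corner_flip_def by (auto split: prod.splits)
  \<comment> \<open>Invariance of the sign under the flip is the relation between \<open>s\<close>
    and \<tau> at \<alpha> and \<sigma>(\<alpha>).\<close>
  have sign: "corner_sign x \<in> {1, -1} \<and> corner_sign (corner_flip x) = corner_sign x" if x: "x \<in> corner_block" for x
  proof -
    obtain \<alpha> l k where [simp]: "x = (\<alpha>, l, k)" by (cases x)
    have \<alpha>: "\<alpha> \<in> arrows Q" using x by (simp add: corner_block_iff)
    have "sgn_tau Q (sig1 Q \<alpha>) * sgn_s Q (sig0 Q (tgt Q \<alpha>)) = sgn_tau Q \<alpha> * sgn_s Q (src Q \<alpha>)"
      using sgn_s_tau[OF \<alpha>] sd_quiverD(9)[OF sdQ st(2)[OF \<alpha>]] by (simp add: mult.commute)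
    then show ?thesis
      using sd_quiverD(10)[OF sdQ \<alpha>] sd_quiverD(8)[OF sdQ st(1)[OF \<alpha>]] sig_arr(3)[OF \<alpha>]
      by (auto simp: corner_sign_def corner_flip_def)
  qed
  obtain e where e:
    "card {C \<in> corner_block \<rightarrow>\<^sub>E (UNIV :: 'k set). \<forall>x\<in>corner_block. C x + of_int (corner_sign x) * C (corner_flip x) = 0} = CARD('k) ^ e"
    "2 * int e = int (card corner_block) - (\<Sum>x\<in>{x\<in>corner_block. corner_flip x = x}. corner_sign x)"
    using card_twisted_symmetric[OF two, of corner_block corner_flip corner_sign "\<lambda>_. 0"] flip sign by fastforce
  have "card params = CARD('k) ^ (card mid_block + e)"
    unfolding params_def by (simp add: card_cartesian_product e(1) card_funcsetE power_add)
  then show ?thesis using e(2) by blast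
qed

lemma finite_params: "finite params"
proof -
  have "finite (corner_block \<rightarrow>\<^sub>E (UNIV :: 'k set))" "finite (mid_block \<rightarrow>\<^sub>E (UNIV :: 'k set))"
    by (intro finite_PiE; simp)+
  then show ?thesis unfolding params_def by (intro finite_cartesian_product) auto
qed

text \<open>Both parameters occur verbatim in the \<open>Dual\<close> columns.\<close>

lemma coef_inj:
  assumes p: "p \<in> params" "q \<in> params"
    and eq: "\<And>\<alpha> z x. \<alpha> \<in> arrows Q \<Longrightarrow> z \<in> idx (tgt Q \<alpha>) \<Longrightarrow> x \<in> idx (src Q \<alpha>) \<Longrightarrow> coef p \<alpha> z x = coef q \<alpha> z x"
  shows "p = q"
proof (rule prod_eqI)
  show "fst p = fst q"
  proof (rule PiE_ext)
    show "fst p \<in> mid_block \<rightarrow>\<^sub>E UNIV" "fst q \<in> mid_block \<rightarrow>\<^sub>E UNIV" using p by (auto simp: params_def)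
    show "fst p x = fst q x" if "x \<in> mid_block" for x
      using that eq[of "fst x" "Mid (fst (snd x))" "Dual (snd (snd x))"] by (cases x) (auto simp: mid_block_iff)
  qed
  show "snd p = snd q"
  proof (rule PiE_ext)
    show "snd p \<in> corner_block \<rightarrow>\<^sub>E UNIV" "snd q \<in> corner_block \<rightarrow>\<^sub>E UNIV" using p by (auto simp: params_def)
    show "snd p x = snd q x" if "x \<in> corner_block" for x
      using that eq[of "fst x" "Iso (fst (snd x))" "Dual (snd (snd x))"] by (cases x) (auto simp: corner_block_iff)
  qed
qed

lemma realization_params:
  assumes "p \<in> params"
  shows "\<exists>N :: ('k, 'w::infinite, 'v, 'a) sdrep. is_sdrep Q N \<and> gram_bases Q N idx (coef p) gram \<noteq> {}"
proof (rule realization[OF sdQ])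
  show "\<forall>x\<in>idx i. c x = 0"
    if "i \<in> nodes Q" "\<And>y. y \<in> idx (sig0 Q i) \<Longrightarrow> (\<Sum>x\<in>idx i. c x * gram i x y) = 0" for i c
    by (rule gram_nd[OF that])
qed (rule finite_idx gram_sym coef_adj[OF assms]; assumption)+

definition frames :: "('k, 'w, 'v, 'a) sdrep \<Rightarrow> ('v \<Rightarrow> ix \<Rightarrow> 'w) set" where
  "frames N = (\<Union>p\<in>params. gram_bases Q N idx (coef p) gram)"

text \<open>A basis determines the matrices of the arrows and therefore, by \<open>coef_inj\<close>,
  the parameter; so the union over \<open>params\<close> is disjoint.\<close>

lemma card_frames:
  assumes N: "is_sdrep Q N"
  shows "card (frames N) = (\<Sum>p\<in>params. card (gram_bases Q N idx (coef p) gram))"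
  unfolding frames_def
proof (rule card_UN_disjoint[OF finite_params])
  note NF = is_sdrep_form_rep[OF N]
  show "\<forall>p\<in>params. finite (gram_bases Q N idx (coef p) gram)"
    using finite_gram_bases[OF qv form_repD(1)[OF NF]] by blast
  have "p = q" if p: "p \<in> params" "q \<in> params"
    and b: "b \<in> gram_bases Q N idx (coef p) gram" "b \<in> gram_bases Q N idx (coef q) gram" for p q b
  proof (rule coef_inj[OF p])
    note P = rep_basesD[OF gram_basesD(1)[OF b(1)]] and P' = rep_basesD[OF gram_basesD(1)[OF b(2)]]
    fix \<alpha> z x assume \<alpha>: "\<alpha> \<in> arrows Q" and z: "z \<in> idx (tgt Q \<alpha>)" and x: "x \<in> idx (src Q \<alpha>)"
    have "lsum (vsp N (tgt Q \<alpha>)) (idx (tgt Q \<alpha>)) (\<lambda>z. coef p \<alpha> z x) (b (tgt Q \<alpha>)) =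
      lsum (vsp N (tgt Q \<alpha>)) (idx (tgt Q \<alpha>)) (\<lambda>z. coef q \<alpha> z x) (b (tgt Q \<alpha>))"
      using P(4)[OF \<alpha> x] P'(4)[OF \<alpha> x] by simp
    from iffD1[OF lsum_eq_iff[OF is_repD(1)[OF form_repD(1)[OF NF] st(2)[OF \<alpha>]] P(2)[OF st(2)[OF \<alpha>]]] this] z
    show "coef p \<alpha> z x = coef q \<alpha> z x" by (rule bspec)
  qed
  then show "\<forall>p\<in>params. \<forall>q\<in>params. p \<noteq> q \<longrightarrow>
      gram_bases Q N idx (coef p) gram \<inter> gram_bases Q N idx (coef q) gram = {}" by blast
qed

text \<open>It is enough to know the \<open>Iso\<close> columns and the \<open>Mid\<close> columns
  modulo the isotropic part. Adjointness for the known Gram matrix then forces the other blocks: it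
  expresses them by the known ones and by \<beta>, and it imposes the symmetry of C.\<close>

lemma frameI:
  assumes N: "is_sdrep Q N" and bP: "b \<in> (\<Pi>\<^sub>E i\<in>nodes Q. idx i \<rightarrow>\<^sub>E vecs N i)"
    and basis: "\<And>i. i \<in> nodes Q \<Longrightarrow> is_basis (vsp N i) (idx i) (b i)"
    and gr: "\<And>i x y. i \<in> nodes Q \<Longrightarrow> x \<in> idx i \<Longrightarrow> y \<in> idx (sig0 Q i) \<Longrightarrow>
       form N i (sig0 Q i) (b i x) (b (sig0 Q i) y) = gram i x y"
    and lI: "\<And>\<alpha> k. \<alpha> \<in> arrows Q \<Longrightarrow> k < u (src Q \<alpha>) \<Longrightarrow> \<exists>c. lmap N \<alpha> (b (src Q \<alpha>) (Iso k)) =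
       lsum (vsp N (tgt Q \<alpha>)) (idx (tgt Q \<alpha>)) c (b (tgt Q \<alpha>)) \<and>
       (\<forall>l<u (tgt Q \<alpha>). c (Iso l) = AU \<alpha> l k) \<and> (\<forall>l. c (Mid l) = 0 \<and> c (Dual l) = 0)"
    and lM: "\<And>\<alpha> k. \<alpha> \<in> arrows Q \<Longrightarrow> k < m (src Q \<alpha>) \<Longrightarrow> \<exists>c. lmap N \<alpha> (b (src Q \<alpha>) (Mid k)) =
       lsum (vsp N (tgt Q \<alpha>)) (idx (tgt Q \<alpha>)) c (b (tgt Q \<alpha>)) \<and>
       (\<forall>l<m (tgt Q \<alpha>). c (Mid l) = AM \<alpha> l k) \<and> (\<forall>l. c (Dual l) = 0)"
  shows "b \<in> frames N"
proof -
  note NF = is_sdrep_form_rep[OF N]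
  note NR = form_repD(1)[OF NF] and NB = form_repD(2)[OF NF]
  note VN = is_repD(1)[OF NR]
  have bV: "b i \<in> idx i \<rightarrow> vecs N i" if "i \<in> nodes Q" for i using is_basisD(2)[OF basis[OF that]] .
  define K where "K \<alpha> z x = coord (vsp N (tgt Q \<alpha>)) (idx (tgt Q \<alpha>)) (b (tgt Q \<alpha>)) (lmap N \<alpha> (b (src Q \<alpha>) x)) z" for \<alpha> z x
  have K: "lmap N \<alpha> (b (src Q \<alpha>) x) = lsum (vsp N (tgt Q \<alpha>)) (idx (tgt Q \<alpha>)) (\<lambda>z. K \<alpha> z x) (b (tgt Q \<alpha>))"
    if \<alpha>: "\<alpha> \<in> arrows Q" and x: "x \<in> idx (src Q \<alpha>)" for \<alpha> x
    unfolding K_def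
    using lsum_coord[OF basis[OF st(2)[OF \<alpha>]] linear_mapD(3)[OF is_repD(3)[OF NR \<alpha>]]] funcset_mem[OF bV[OF st(1)[OF \<alpha>]] x]
    by simp
  have K_eq: "K \<alpha> z x = c z" if \<alpha>: "\<alpha> \<in> arrows Q" and z: "z \<in> idx (tgt Q \<alpha>)"
    and "lmap N \<alpha> (b (src Q \<alpha>) x) = lsum (vsp N (tgt Q \<alpha>)) (idx (tgt Q \<alpha>)) c (b (tgt Q \<alpha>))" for \<alpha> z x c
    unfolding K_def that(3) by (rule coord_lsum[OF VN[OF st(2)[OF \<alpha>]] basis[OF st(2)[OF \<alpha>]] z])
  \<comment> \<open>The disjunctions cover indices outside \<open>idx\<close>, where
    \<open>coord\<close> leaves \<open>K\<close> unspecified.\<close>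
  have KI: "K \<alpha> (Mid l) (Iso k) = 0 \<or> \<not> l < m (tgt Q \<alpha>)" "K \<alpha> (Dual l) (Iso k) = 0 \<or> \<not> l < u (sig0 Q (tgt Q \<alpha>))"
    "l < u (tgt Q \<alpha>) \<Longrightarrow> K \<alpha> (Iso l) (Iso k) = AU \<alpha> l k"
    if \<alpha>: "\<alpha> \<in> arrows Q" and k: "k < u (src Q \<alpha>)" for \<alpha> k l
  proof -
    obtain c where c: "lmap N \<alpha> (b (src Q \<alpha>) (Iso k)) = lsum (vsp N (tgt Q \<alpha>)) (idx (tgt Q \<alpha>)) c (b (tgt Q \<alpha>))"
      "\<And>l. l < u (tgt Q \<alpha>) \<Longrightarrow> c (Iso l) = AU \<alpha> l k" "\<And>l. c (Mid l) = 0 \<and> c (Dual l) = 0"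
      using lI[OF \<alpha> k] by blast
    show "K \<alpha> (Mid l) (Iso k) = 0 \<or> \<not> l < m (tgt Q \<alpha>)" "K \<alpha> (Dual l) (Iso k) = 0 \<or> \<not> l < u (sig0 Q (tgt Q \<alpha>))"
      "l < u (tgt Q \<alpha>) \<Longrightarrow> K \<alpha> (Iso l) (Iso k) = AU \<alpha> l k"
      using K_eq[OF \<alpha> _ c(1)] c(2,3) by auto
  qed
  have KM: "l < m (tgt Q \<alpha>) \<Longrightarrow> K \<alpha> (Mid l) (Mid k) = AM \<alpha> l k" "K \<alpha> (Dual l) (Mid k) = 0 \<or> \<not> l < u (sig0 Q (tgt Q \<alpha>))"
    if \<alpha>: "\<alpha> \<in> arrows Q" and k: "k < m (src Q \<alpha>)" for \<alpha> k l
  proof -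
    obtain c where c: "lmap N \<alpha> (b (src Q \<alpha>) (Mid k)) = lsum (vsp N (tgt Q \<alpha>)) (idx (tgt Q \<alpha>)) c (b (tgt Q \<alpha>))"
      "\<And>l. l < m (tgt Q \<alpha>) \<Longrightarrow> c (Mid l) = AM \<alpha> l k" "\<And>l. c (Dual l) = 0"
      using lM[OF \<alpha> k] by blast
    show "l < m (tgt Q \<alpha>) \<Longrightarrow> K \<alpha> (Mid l) (Mid k) = AM \<alpha> l k" "K \<alpha> (Dual l) (Mid k) = 0 \<or> \<not> l < u (sig0 Q (tgt Q \<alpha>))"
      using K_eq[OF \<alpha> _ c(1)] c(2,3) by auto
  qed
  have adj: "(\<Sum>z\<in>idx (tgt Q \<alpha>). K \<alpha> z x * gram (tgt Q \<alpha>) z y) =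
      of_int (sgn_tau Q \<alpha>) * (\<Sum>z\<in>idx (sig0 Q (src Q \<alpha>)). gram (src Q \<alpha>) x z * K (sig1 Q \<alpha>) z y)"
    if \<alpha>: "\<alpha> \<in> arrows Q" and x: "x \<in> idx (src Q \<alpha>)" and y: "y \<in> idx (sig0 Q (tgt Q \<alpha>))" for \<alpha> x y
  proof -
    note s = st(1)[OF \<alpha>] and t = st(2)[OF \<alpha>]
    note s' = sig(1)[OF s] and t' = sig(1)[OF t]
    have bx: "b (src Q \<alpha>) x \<in> vecs N (src Q \<alpha>)" and by': "b (sig0 Q (tgt Q \<alpha>)) y \<in> vecs N (sig0 Q (tgt Q \<alpha>))"
      using bV[OF s] bV[OF t'] x y by auto
    have K': "lmap N (sig1 Q \<alpha>) (b (sig0 Q (tgt Q \<alpha>)) y) =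
        lsum (vsp N (sig0 Q (src Q \<alpha>))) (idx (sig0 Q (src Q \<alpha>))) (\<lambda>z. K (sig1 Q \<alpha>) z y) (b (sig0 Q (src Q \<alpha>)))"
      using K[OF sig_arr(1)[OF \<alpha>], of y] y by (simp add: sig_arr(3,4)[OF \<alpha>])
    have "(\<Sum>z\<in>idx (tgt Q \<alpha>). K \<alpha> z x * gram (tgt Q \<alpha>) z y) =
        form N (tgt Q \<alpha>) (sig0 Q (tgt Q \<alpha>)) (lmap N \<alpha> (b (src Q \<alpha>) x)) (b (sig0 Q (tgt Q \<alpha>)) y)"
      unfolding K[OF \<alpha> x] form_lsum_left[OF NR NB t t' bV[OF t] finite_idx by'] using gr[OF t _ y] by simp
    also have "\<dots> = of_int (sgn_tau Q \<alpha>) * form N (src Q \<alpha>) (sig0 Q (src Q \<alpha>)) (b (src Q \<alpha>) x)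
        (lmap N (sig1 Q \<alpha>) (b (sig0 Q (tgt Q \<alpha>)) y))"
      by (rule form_adj[OF N \<alpha> bx by'])
    also have "\<dots> = of_int (sgn_tau Q \<alpha>) * (\<Sum>z\<in>idx (sig0 Q (src Q \<alpha>)). gram (src Q \<alpha>) x z * K (sig1 Q \<alpha>) z y)"
      unfolding K' form_lsum_right[OF NR NB s s' bV[OF s'] finite_idx bx] using gr[OF s x] by (simp add: mult.commute)
    finally show ?thesis .
  qed
  \<comment> \<open>The parameters are read off from the \<open>Dual\<close> columns of the actual
    matrix \<open>K\<close>.\<close>
  define p where "p = ((\<lambda>(\<alpha>, l, k)\<in>mid_block. K \<alpha> (Mid l) (Dual k)), (\<lambda>(\<alpha>, l, k)\<in>corner_block. K \<alpha> (Iso l) (Dual k)))"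
  have corner: "K \<alpha> (Iso l) (Dual k) = of_int (sgn_tau Q \<alpha>) * (of_int (sgn_s Q (src Q \<alpha>)) * K (sig1 Q \<alpha>) (Iso k) (Dual l))"
    if \<alpha>: "\<alpha> \<in> arrows Q" and l: "l < u (tgt Q \<alpha>)" and k: "k < u (sig0 Q (src Q \<alpha>))" for \<alpha> l k
    using adj[OF \<alpha>, of "Dual k" "Dual l"] sum_gram_left(2)[OF st(2)[OF \<alpha>] l] sum_gram_right(2)[OF st(1)[OF \<alpha>] k] k l
      sig(2)[OF st(2)[OF \<alpha>]] by simp
  have flip: "corner_flip x \<in> corner_block" if "x \<in> corner_block" for x
    using that sig_arr st sig unfolding corner_block_def corner_flip_def by (auto split: prod.splits)
  have "snd p x + of_int (corner_sign x) * snd p (corner_flip x) = 0" if x: "x \<in> corner_block" for x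
  proof -
    obtain \<alpha> l k where [simp]: "x = (\<alpha>, l, k)" by (cases x)
    have a: "\<alpha> \<in> arrows Q" "l < u (tgt Q \<alpha>)" "k < u (sig0 Q (src Q \<alpha>))" using x by (auto simp: corner_block_iff)
    have f: "(sig1 Q \<alpha>, k, l) \<in> corner_block" using flip[OF x] by (simp add: corner_flip_def)
    show ?thesis using corner[OF a] x f by (simp add: p_def corner_sign_def corner_flip_def mult.assoc)
  qed
  then have pP: "p \<in> params" unfolding params_def by (auto simp: p_def)
  have coef: "K \<alpha> z x = coef p \<alpha> z x" if \<alpha>: "\<alpha> \<in> arrows Q" and z: "z \<in> idx (tgt Q \<alpha>)" and x: "x \<in> idx (src Q \<alpha>)" for \<alpha> z x
    using x
  proof (cases rule: idx_cases)
    case (1 k)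
    then show ?thesis using KI[OF \<alpha>] z by (cases z) auto
  next
    case (2 k)
    from z show ?thesis
    proof (cases rule: idx_cases)
      case z: (1 l)
      have l: "(sig1 Q \<alpha>, y, l) \<in> mid_block" if "y < m (src Q \<alpha>)" for y
        using that z sig_arr[OF \<alpha>] sig(2)[OF st(2)[OF \<alpha>]] m_sig[OF st(1)[OF \<alpha>]] by (simp add: mid_block_iff)
      \<comment> \<open>Pairing with \<open>Dual l\<close> extracts the coordinate at
        \<open>Iso l\<close>, and adjointness turns it into the middle coordinates of the column
        \<open>Dual l\<close> for \<sigma>(\<alpha>).\<close>
      have "K \<alpha> (Iso l) (Mid k) = of_int (sgn_tau Q \<alpha>) * (\<Sum>y<m (src Q \<alpha>). G (src Q \<alpha>) k y * K (sig1 Q \<alpha>) (Mid y) (Dual l))"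
        using adj[OF \<alpha>, of "Mid k" "Dual l"] sum_gram_left(2)[OF st(2)[OF \<alpha>] z(2)] sum_gram_right(3)[OF st(1)[OF \<alpha>]] 2 z
          sig(2)[OF st(2)[OF \<alpha>]] by simp
      then show ?thesis using 2 z l by (simp add: p_def)
    qed (use KM[OF \<alpha>] 2 in auto)
  next
    case x: (3 k)
    from z show ?thesis
    proof (cases rule: idx_cases)
      case (1 l)
      then show ?thesis using x \<alpha> by (simp add: p_def corner_block_iff)
    next
      case (2 l)
      then show ?thesis using x \<alpha> by (simp add: p_def mid_block_iff)
    next
      case z: (3 l)
      have AU': "K (sig1 Q \<alpha>) (Iso k) (Iso l) = AU (sig1 Q \<alpha>) k l"
        using KI(3)[OF sig_arr(1)[OF \<alpha>]] sig_arr[OF \<alpha>] x z by simp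
      have "K \<alpha> (Dual l) (Dual k) * of_int (sgn_s Q (tgt Q \<alpha>)) =
          of_int (sgn_tau Q \<alpha>) * (of_int (sgn_s Q (src Q \<alpha>)) * AU (sig1 Q \<alpha>) k l)"
        using adj[OF \<alpha>, of "Dual k" "Iso l"] sum_gram_left(1)[OF st(2)[OF \<alpha>] z(2)] sum_gram_right(2)[OF st(1)[OF \<alpha>] x(2)]
          x z AU' by simp
      also have "\<dots> = (of_int (sgn_tau Q (sig1 Q \<alpha>)) * AU (sig1 Q \<alpha>) k l) * of_int (sgn_s Q (tgt Q \<alpha>))"
        by (simp only: mult.assoc[symmetric] of_int_sgn_s_tau[OF \<alpha>, symmetric]) (simp add: mult_ac)
      finally have "K \<alpha> (Dual l) (Dual k) = of_int (sgn_tau Q (sig1 Q \<alpha>)) * AU (sig1 Q \<alpha>) k l"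
        using sgn_sq(1)[OF st(2)[OF \<alpha>]] by (metis mult_cancel_right mult_zero_left zero_neq_one)
      then show ?thesis using x z by simp
    qed
  qed
  have "lmap N \<alpha> (b (src Q \<alpha>) x) = lsum (vsp N (tgt Q \<alpha>)) (idx (tgt Q \<alpha>)) (\<lambda>z. coef p \<alpha> z x) (b (tgt Q \<alpha>))"
    if \<alpha>: "\<alpha> \<in> arrows Q" and x: "x \<in> idx (src Q \<alpha>)" for \<alpha> x
    unfolding K[OF \<alpha> x] by (rule lsum_cong[OF VN[OF st(2)[OF \<alpha>]] bV[OF st(2)[OF \<alpha>]]]) (use coef \<alpha> x in auto)
  then have "b \<in> gram_bases Q N idx (coef p) gram"
    unfolding gram_bases_def rep_bases_def using bP basis gr by blast
  then show ?thesis using pP unfolding frames_def by blast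
qed

end

section \<open>Adapted bases and the exponent for the dual isotropic family\<close>

context split_data
begin

text \<open>A triple \<open>(i, l, k)\<close> indexes the coefficient at the basis vector
  \<open>l\<close> of \<open>U i\<close> in the correction of the dual vector \<open>k\<close> at
  \<open>i\<close>.\<close>

definition node_block :: "('v \<times> nat \<times> nat) set" where
  "node_block = (SIGMA i:nodes Q. {..<u i} \<times> {..<u (sig0 Q i)})"

definition node_sign :: "'v \<times> nat \<times> nat \<Rightarrow> int" where
  "node_sign = (\<lambda>(i, l, k). sgn_s Q i)"

definition node_flip :: "'v \<times> nat \<times> nat \<Rightarrow> 'v \<times> nat \<times> nat" where
  "node_flip = (\<lambda>(i, l, k). (sig0 Q i, k, l))"

lemma node_block_iff: "(i, l, k) \<in> node_block \<longleftrightarrow> i \<in> nodes Q \<and> l < u i \<and> k < u (sig0 Q i)"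
  by (auto simp: node_block_def)

lemma node_flip_block: "x \<in> node_block \<Longrightarrow> node_flip x \<in> node_block \<and> node_flip (node_flip x) = x"
  using sig unfolding node_block_def node_flip_def by (auto split: prod.splits)

text \<open>Besides the choice of lifts, only the pairings whose first argument is a dual vector are
  imposed; the rest of the Gram matrix follows from the properties of \<open>e\<close> and
  \<open>c\<close>.\<close>

definition adapted :: "('k, 'w, 'v, 'a) sdrep \<Rightarrow> ('v \<Rightarrow> nat \<Rightarrow> 'w) \<Rightarrow> ('v \<Rightarrow> nat \<Rightarrow> 'w set) \<Rightarrow> ('v \<Rightarrow> ix \<Rightarrow> 'w) set" where
  "adapted N e c = {b \<in> (\<Pi>\<^sub>E i\<in>nodes Q. idx i \<rightarrow>\<^sub>E vecs N i). \<forall>i\<in>nodes Q.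
     (\<forall>k<u i. b i (Iso k) = e i k) \<and> (\<forall>x<m i. b i (Mid x) \<in> c i x) \<and>
     (\<forall>k<u (sig0 Q i).
        (\<forall>l<u (sig0 Q i). form N i (sig0 Q i) (b i (Dual k)) (e (sig0 Q i) l) = (if k = l then of_int (sgn_s Q i) else 0)) \<and>
        (\<forall>y<m i. form N i (sig0 Q i) (b i (Dual k)) (b (sig0 Q i) (Mid y)) = 0) \<and>
        (\<forall>l<u i. form N i (sig0 Q i) (b i (Dual k)) (b (sig0 Q i) (Dual l)) = 0))}"

text \<open>The exponent is specified by an equation for its double, in the form given by the
  twisted symmetry count; the count with zero right side shows that a solution exists.\<close>

definition node_exp :: nat where
  "node_exp = (THE e. 2 * int e = int (card node_block) - (\<Sum>x\<in>{x\<in>node_block. node_flip x = x}. node_sign x))"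

text \<open>Because the equation has only one solution, the same exponent serves every compatible
  \<open>D\<close>. This makes the number of dual isotropic families independent of \<open>N\<close>
  and of the auxiliary choices.\<close>

lemma node_exp_card:
  shows "2 * int node_exp = int (card node_block) - (\<Sum>x\<in>{x\<in>node_block. node_flip x = x}. node_sign x)"
    and "(\<And>x. x \<in> node_block \<Longrightarrow> D (node_flip x) = of_int (node_sign x) * D x) \<Longrightarrow>
      card {C \<in> node_block \<rightarrow>\<^sub>E (UNIV :: 'k set). \<forall>x\<in>node_block. C x + of_int (node_sign x) * C (node_flip x) = D x} =
      CARD('k) ^ node_exp"
proof -
  have fin: "finite node_block" unfolding node_block_def using quiverD(1)[OF qv] by auto
  have sign: "node_sign x \<in> {1, -1} \<and> node_sign (node_flip x) = node_sign x" if "x \<in> node_block" for x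
    using that sd_quiverD(8,9)[OF sdQ] by (auto simp: node_block_def node_sign_def node_flip_def)
  have ex: "\<exists>e. card {C \<in> node_block \<rightarrow>\<^sub>E (UNIV :: 'k set). \<forall>x\<in>node_block. C x + of_int (node_sign x) * C (node_flip x) = D x} =
      CARD('k) ^ e \<and> 2 * int e = int (card node_block) - (\<Sum>x\<in>{x\<in>node_block. node_flip x = x}. node_sign x)"
    if "\<And>x. x \<in> node_block \<Longrightarrow> D (node_flip x) = of_int (node_sign x) * D x" for D
    by (rule card_twisted_symmetric[OF two fin]) (use node_flip_block sign that in auto)
  obtain e where e: "2 * int e = int (card node_block) - (\<Sum>x\<in>{x\<in>node_block. node_flip x = x}. node_sign x)"
    using ex[of "\<lambda>_. 0"] by auto
  have exp: "node_exp = e" unfolding node_exp_def by (rule the_equality) (use e in auto)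
  then show "2 * int node_exp = int (card node_block) - (\<Sum>x\<in>{x\<in>node_block. node_flip x = x}. node_sign x)"
    using e by simp
  assume "\<And>x. x \<in> node_block \<Longrightarrow> D (node_flip x) = of_int (node_sign x) * D x"
  from ex[OF this] obtain e' where e': "card {C \<in> node_block \<rightarrow>\<^sub>E (UNIV :: 'k set).
      \<forall>x\<in>node_block. C x + of_int (node_sign x) * C (node_flip x) = D x} = CARD('k) ^ e'"
    "2 * int e' = int (card node_block) - (\<Sum>x\<in>{x\<in>node_block. node_flip x = x}. node_sign x)" by blast
  then have "e' = node_exp" using e exp by simp
  then show "card {C \<in> node_block \<rightarrow>\<^sub>E (UNIV :: 'k set). \<forall>x\<in>node_block. C x + of_int (node_sign x) * C (node_flip x) = D x} =
      CARD('k) ^ node_exp" using e'(1) by simp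
qed

end

section \<open>Frames adapted to an isotropic subrepresentation\<close>

text \<open>\<open>e\<close> is a basis of the isotropic subrepresentation with the matrices
  \<open>AU\<close>, and \<open>c\<close> a basis of the reduction, so its members are
  cosets.\<close>

locale split_frame =
  split_data Q u m AU AM G + isotropic_sub Q N U
  for Q :: "('v, 'a) sdquiver" and u m :: "'v \<Rightarrow> nat"
    and AU AM :: "'a \<Rightarrow> nat \<Rightarrow> nat \<Rightarrow> 'k::{field,finite}" and G :: "'v \<Rightarrow> nat \<Rightarrow> nat \<Rightarrow> 'k"
    and N :: "('k, 'w, 'v, 'a) sdrep" and U :: "'v \<Rightarrow> 'w set" +
  fixes e :: "'v \<Rightarrow> nat \<Rightarrow> 'w" and c :: "'v \<Rightarrow> nat \<Rightarrow> 'w set"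
  assumes e: "e \<in> rep_bases Q (restrict_rep N U) (\<lambda>i. {..<u i}) AU"
    and c: "c \<in> gram_bases Q R (\<lambda>i. {..<m i}) AM G"
begin

lemmas e' = rep_basesD[OF e, unfolded restrict_rep_def, simplified]
lemmas c' = rep_basesD[OF gram_basesD(1)[OF c]]

lemma e_U: "i \<in> nodes Q \<Longrightarrow> k < u i \<Longrightarrow> e i k \<in> U i"
  using e'(3)[of i] by auto

lemma e_funcset: "i \<in> nodes Q \<Longrightarrow> e i \<in> {..<u i} \<rightarrow> U i"
  using e_U by auto

lemma e_N: "i \<in> nodes Q \<Longrightarrow> e i \<in> {..<u i} \<rightarrow> vecs N i"
  using e_U UN by blast

lemma lsum_e: "i \<in> nodes Q \<Longrightarrow> lsum (vsp N i\<lparr>carrier := U i\<rparr>) {..<u i} a (e i) = lsum (vsp N i) {..<u i} a (e i)"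
  using lsum_restrict_carrier[OF VN US(5) US(1) e_funcset] by blast

lemma e_span: "i \<in> nodes Q \<Longrightarrow> w \<in> U i \<Longrightarrow> \<exists>a. w = lsum (vsp N i) {..<u i} a (e i)"
  using e'(2)[of i] lsum_e[of i] unfolding is_basis_def by auto

lemma e_eq:
  assumes i: "i \<in> nodes Q" and "lsum (vsp N i) {..<u i} a (e i) = lsum (vsp N i) {..<u i} a' (e i)" and "k < u i"
  shows "a k = a' k"
  using lsum_eq_iff[OF US(5)[OF i] e'(2)[OF i], of a a'] assms lsum_e[OF i] by auto

lemma e_struct:
  "\<alpha> \<in> arrows Q \<Longrightarrow> k < u (src Q \<alpha>) \<Longrightarrow> lmap N \<alpha> (e (src Q \<alpha>) k) =
     lsum (vsp N (tgt Q \<alpha>)) {..<u (tgt Q \<alpha>)} (\<lambda>l. AU \<alpha> l k) (e (tgt Q \<alpha>))"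
  using e'(4)[of \<alpha> k] lsum_e[OF st(2)] by simp

section \<open>Lifts of a basis of the reduction and vectors dual to the isotropic part\<close>

definition lifts :: "('v \<Rightarrow> nat \<Rightarrow> 'w) \<Rightarrow> bool" where
  "lifts f \<longleftrightarrow> (\<forall>i\<in>nodes Q. \<forall>x<m i. f i x \<in> c i x)"

lemma c_R: "i \<in> nodes Q \<Longrightarrow> x < m i \<Longrightarrow> c i x \<in> pr i ` W i"
  using c'(3)[of i] vecs_R by auto

lemma lift:
  assumes f: "lifts f" and i: "i \<in> nodes Q" and x: "x < m i"
  shows "f i x \<in> W i" "pr i (f i x) = c i x"
proof -
  obtain w where w: "w \<in> W i" "c i x = pr i w" using c_R[OF i x] by blast
  have "f i x \<in> pr i w" using f i x w unfolding lifts_def by auto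
  then show "f i x \<in> W i" "pr i (f i x) = c i x"
    using pr_subset_W[OF i w(1)] pr_eqI[OF i WN[OF w(1)]] w(2) by auto
qed

lemma lift_funcset:
  assumes f: "lifts f" and i: "i \<in> nodes Q"
  shows "f i \<in> {..<m i} \<rightarrow> W i" "f i \<in> {..<m i} \<rightarrow> vecs N i"
  using lift(1)[OF f i] WN by auto

lemma lift_form:
  assumes f: "lifts f" and i: "i \<in> nodes Q" and x: "x < m i" and y: "y < m i"
  shows "form N i (\<sigma> i) (f i x) (f (\<sigma> i) y) = G i x y"
proof -
  have y': "y < m (\<sigma> i)" using y m_sig[OF i] by simp
  show ?thesis
    using form_R[OF i sg(1)[OF i] lift(1)[OF f i x] lift(1)[OF f sg(1)[OF i] y']]
      gram_basesD(2)[OF c i, of x y] x y' lift(2)[OF f i x] lift(2)[OF f sg(1)[OF i] y'] by simp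
qed

lemma pr_lsum_lift:
  assumes f: "lifts f" and i: "i \<in> nodes Q"
  shows "pr i (lsum (vsp N i) {..<m i} a (f i)) = lsum (vsp R i) {..<m i} a (c i)"
proof -
  have "pr i (lsum (vsp N i) {..<m i} a (f i)) = lsum (vsp R i) {..<m i} a (\<lambda>x. pr i (f i x))"
    by (rule lsum_R[OF i lift_funcset(1)[OF f i]]) simp
  also have "\<dots> = lsum (vsp R i) {..<m i} a (c i)"
    by (rule lsum_cong[OF VR[OF i]]) (use lift[OF f i] in \<open>auto simp: vecs_R\<close>)
  finally show ?thesis .
qed

lemma lift_span:
  assumes f: "lifts f" and i: "i \<in> nodes Q" and v: "v \<in> vecs N i"
    and eq: "pr i v = lsum (vsp R i) {..<m i} a (c i)"
  shows "\<exists>w\<in>U i. v = w \<oplus>\<^bsub>vsp N i\<^esub> lsum (vsp N i) {..<m i} a (f i)"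
proof -
  have "pr i v = pr i (lsum (vsp N i) {..<m i} a (f i))" using eq pr_lsum_lift[OF f i, of a] by simp
  then show ?thesis unfolding pr_eq_iff[OF i lsum_closed[OF VN[OF i] lift_funcset(2)[OF f i]] v] .
qed

lemma W_span:
  assumes f: "lifts f" and i: "i \<in> nodes Q" and v: "v \<in> W i"
  shows "\<exists>a. \<exists>w\<in>U i. v = w \<oplus>\<^bsub>vsp N i\<^esub> lsum (vsp N i) {..<m i} a (f i)"
proof -
  have "pr i v \<in> vecs R i" using v by (simp add: vecs_R)
  then obtain a where "pr i v = lsum (vsp R i) {..<m i} a (c i)" using is_basis_span[OF c'(2)[OF i]] by blast
  from lift_span[OF f i WN[OF v] this] show ?thesis by blast
qed

lemma lift_indep:
  assumes f: "lifts f" and i: "i \<in> nodes Q" and z: "lsum (vsp N i) {..<m i} a (f i) \<in> U i" and x: "x < m i"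
  shows "a x = 0"
proof -
  have "lsum (vsp R i) {..<m i} a (c i) = \<zero>\<^bsub>vsp R i\<^esub>"
    using pr_zero_iff(1)[OF i UN[OF i z]] z pr_lsum_lift[OF f i] zero_R by simp
  then show ?thesis using is_basis_indep[OF c'(2)[OF i]] x by blast
qed

lemma lift_struct:
  assumes f: "lifts f" and \<alpha>: "\<alpha> \<in> arrows Q" and x: "x < m (src Q \<alpha>)"
  shows "\<exists>w\<in>U (tgt Q \<alpha>). lmap N \<alpha> (f (src Q \<alpha>) x) =
     w \<oplus>\<^bsub>vsp N (tgt Q \<alpha>)\<^esub> lsum (vsp N (tgt Q \<alpha>)) {..<m (tgt Q \<alpha>)} (\<lambda>l. AM \<alpha> l x) (f (tgt Q \<alpha>))"
proof (rule lift_span[OF f st(2)[OF \<alpha>]])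
  note fx = lift[OF f st(1)[OF \<alpha>] x]
  show "lmap N \<alpha> (f (src Q \<alpha>) x) \<in> vecs N (tgt Q \<alpha>)" using WN[OF lmap_W[OF \<alpha> fx(1)]] .
  show "pr (tgt Q \<alpha>) (lmap N \<alpha> (f (src Q \<alpha>) x)) =
      lsum (vsp R (tgt Q \<alpha>)) {..<m (tgt Q \<alpha>)} (\<lambda>l. AM \<alpha> l x) (c (tgt Q \<alpha>))"
    using lmap_R[OF \<alpha> WN[OF fx(1)]] fx(2) c'(4)[OF \<alpha>, of x] x by simp
qed

lemma form_e_span:
  assumes i: "i \<in> nodes Q" and v: "v \<in> vecs N i"
    and z: "\<And>l. l < u (\<sigma> i) \<Longrightarrow> form N i (\<sigma> i) v (e (\<sigma> i) l) = 0"
  shows "v \<in> W i"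
proof -
  have "form N i (\<sigma> i) v w = 0" if w: "w \<in> U (\<sigma> i)" for w
  proof -
    obtain a where a: "w = lsum (vsp N (\<sigma> i)) {..<u (\<sigma> i)} a (e (\<sigma> i))" using e_span[OF sg(1)[OF i] w] by blast
    show ?thesis unfolding a form_lsum_right[OF NR NB i sg(1)[OF i] e_N[OF sg(1)[OF i]] _ v, simplified] using z by simp
  qed
  then show ?thesis using perp_iff[OF i] v by blast
qed

text \<open>Orthogonality to \<open>e\<close> puts \<open>v\<close> into \<open>U\<close> plus the
  span of the lifts; orthogonality to the lifts kills the second component, since \<open>G\<close>
  is nondegenerate. Hence two dual vectors with the same pairings differ by an element of
  \<open>U\<close>.\<close>

lemma kernel_in_U:
  assumes f: "lifts f" and i: "i \<in> nodes Q" and v: "v \<in> vecs N i"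
    and z: "\<And>l. l < u (\<sigma> i) \<Longrightarrow> form N i (\<sigma> i) v (e (\<sigma> i) l) = 0"
    and zf: "\<And>y. y < m i \<Longrightarrow> form N i (\<sigma> i) v (f (\<sigma> i) y) = 0"
  shows "v \<in> U i"
proof -
  have vW: "v \<in> W i" by (rule form_e_span[OF i v z])
  obtain a w where w: "w \<in> U i" "v = w \<oplus>\<^bsub>vsp N i\<^esub> lsum (vsp N i) {..<m i} a (f i)"
    using W_span[OF f i vW] by blast
  note ls = lsum_closed[OF VN[OF i] lift_funcset(2)[OF f i], of a]
  have "(\<Sum>x<m i. a x * G i x y) = 0" if y: "y < m i" for y
  proof -
    have y': "y < m (\<sigma> i)" using y m_sig[OF i] by simp
    have fy: "f (\<sigma> i) y \<in> W (\<sigma> i)" by (rule lift(1)[OF f sg(1)[OF i] y'])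
    have "0 = form N i (\<sigma> i) w (f (\<sigma> i) y) + form N i (\<sigma> i) (lsum (vsp N i) {..<m i} a (f i)) (f (\<sigma> i) y)"
      using zf[OF y] bil(1)[OF i sg(1)[OF i] UN[OF i w(1)] ls WN[OF fy]] w(2) by simp
    also have "\<dots> = (\<Sum>x<m i. a x * G i x y)"
      using U_W_zero[OF i sg(1)[OF i] w(1) fy] lift_form[OF f i _ y]
      by (simp add: form_lsum_left[OF NR NB i sg(1)[OF i] lift_funcset(2)[OF f i] _ WN[OF fy]])
    finally show ?thesis by simp
  qed
  from G_nd[OF i this] have "a x = 0" if "x < m i" for x using that by blast
  then have "lsum (vsp N i) {..<m i} a (f i) = \<zero>\<^bsub>vsp N i\<^esub>"
    by (intro lsum_zero[OF VN[OF i] lift_funcset(2)[OF f i]]) auto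
  then show ?thesis using w vectorspace_simps(7)[OF VN[OF i] UN[OF i w(1)]] by simp
qed

text \<open>The vectors \<open>e\<close> and \<open>f\<close> at \<open>\<sigma> i\<close> are
  linearly independent and the block of the form is nondegenerate, so the pairings with them can be
  prescribed arbitrarily.\<close>

lemma dual_vector_exists:
  assumes f: "lifts f" and i: "i \<in> nodes Q"
  shows "\<exists>v\<in>vecs N i. (\<forall>l<u (\<sigma> i). form N i (\<sigma> i) v (e (\<sigma> i) l) = g l) \<and>
    (\<forall>y<m i. form N i (\<sigma> i) v (f (\<sigma> i) y) = 0)"
proof -
  let ?j = "\<sigma> i"
  note j = sg(1)[OF i]
  let ?I = "Iso ` {..<u ?j} \<union> Mid ` {..<m ?j}"
  \<comment> \<open>The two families are joined into one. The default zero makes every value a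
    vector of \<open>N\<close>, so that the rules for the form apply at every index.\<close>
  define fam where "fam x = (if x \<in> ?I then case x of Iso l \<Rightarrow> e ?j l | Mid y \<Rightarrow> f ?j y | Dual l \<Rightarrow> \<zero>\<^bsub>vsp N ?j\<^esub>
    else \<zero>\<^bsub>vsp N ?j\<^esub>)" for x
  have fam: "fam x \<in> vecs N ?j" for x
    using e_N[OF j] lift_funcset(2)[OF f j] vs_zero_closed[OF VN[OF j]] by (auto simp: fam_def)
  let ?R = "(\<lambda>v x. form N i ?j v (fam x)) ` vecs N i"
  have "\<exists>r\<in>?R. \<forall>x\<in>?I. r x = (case x of Iso l \<Rightarrow> g l | _ \<Rightarrow> 0)"
  proof (rule dual_family_exists)
    show "(\<lambda>x. r x + r' x) \<in> ?R" if r: "r \<in> ?R" and r': "r' \<in> ?R" for r r'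
    proof -
      obtain v v' where v: "v \<in> vecs N i" "v' \<in> vecs N i" "r = (\<lambda>x. form N i ?j v (fam x))" "r' = (\<lambda>x. form N i ?j v' (fam x))"
        using r r' by blast
      have "(\<lambda>x. r x + r' x) = (\<lambda>x. form N i ?j (v \<oplus>\<^bsub>vsp N i\<^esub> v') (fam x))"
        using v bil(1)[OF i j v(1,2) fam] by simp
      then show ?thesis using vs_add_closed[OF VN[OF i] v(1,2)] by blast
    qed
    show "(\<lambda>x. a * r x) \<in> ?R" if r: "r \<in> ?R" for a r
    proof -
      obtain v where v: "v \<in> vecs N i" "r = (\<lambda>x. form N i ?j v (fam x))" using r by blast
      have "(\<lambda>x. a * r x) = (\<lambda>x. form N i ?j (a \<odot>\<^bsub>vsp N i\<^esub> v) (fam x))"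
        using v bil(3)[OF i j v(1) fam] by simp
      then show ?thesis using vs_smult_closed[OF VN[OF i] v(1)] by blast
    qed
    have "(\<lambda>x. 0) = (\<lambda>x. form N i ?j \<zero>\<^bsub>vsp N i\<^esub> (fam x))"
      using form_zero(1)[OF NR NB i j fam] by simp
    then show "(\<lambda>x. 0) \<in> ?R" using vs_zero_closed[OF VN[OF i]] by blast
    show "finite ?I" by simp
    show "\<forall>x\<in>?I. a x = 0" if z: "\<And>r. r \<in> ?R \<Longrightarrow> (\<Sum>x\<in>?I. a x * r x) = 0" for a
    proof -
      \<comment> \<open>A relation \<open>a\<close> makes \<open>L\<close> orthogonal to everything,
        so \<open>L\<close> is zero. Its projection modulo \<open>U\<close> kills the coefficients
        of the lifts, and independence of \<open>e\<close> then kills the others.\<close>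
      define L where "L = lsum (vsp N ?j) ?I a fam"
      define A where "A = lsum (vsp N ?j) {..<u ?j} (\<lambda>l. a (Iso l)) (e ?j)"
      define B where "B = lsum (vsp N ?j) {..<m ?j} (\<lambda>l. a (Mid l)) (f ?j)"
      have famI: "fam \<in> ?I \<rightarrow> vecs N ?j" using fam by blast
      have LN: "L \<in> vecs N ?j" unfolding L_def by (rule lsum_closed[OF VN[OF j] famI])
      have AU: "A \<in> U ?j" unfolding A_def by (rule lsum_in_U[OF j e_funcset[OF j]]) simp
      have BN: "B \<in> vecs N ?j" unfolding B_def by (rule lsum_closed[OF VN[OF j] lift_funcset(2)[OF f j]])
      have L0: "L = \<zero>\<^bsub>vsp N ?j\<^esub>"
      proof (rule block_nondegenerate[OF sdQ N j LN])
        fix v assume v: "v \<in> vecs N (\<sigma> ?j)"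
        then have v': "v \<in> vecs N i" using sg(2)[OF i] by simp
        have "form N i ?j v L = (\<Sum>x\<in>?I. a x * form N i ?j v (fam x))"
          unfolding L_def by (rule form_lsum_right[OF NR NB i j famI _ v']) simp
        also have "\<dots> = 0" by (rule z) (use v' in blast)
        finally show "form N ?j (\<sigma> ?j) L v = 0" using fsym[OF j LN v] sg(2)[OF i] by simp
      qed
      have "L = lsum (vsp N ?j) (Iso ` {..<u ?j}) a fam \<oplus>\<^bsub>vsp N ?j\<^esub> lsum (vsp N ?j) (Mid ` {..<m ?j}) a fam"
        unfolding L_def by (rule lsum_Un[OF VN[OF j] famI]) auto
      moreover have "lsum (vsp N ?j) (Iso ` {..<u ?j}) a fam = lsum (vsp N ?j) {..<u ?j} (a \<circ> Iso) (fam \<circ> Iso)"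
        by (rule lsum_reindex[OF VN[OF j]]) (use fam in \<open>auto simp: inj_on_def\<close>)
      moreover have "lsum (vsp N ?j) {..<u ?j} (a \<circ> Iso) (fam \<circ> Iso) = A"
        unfolding A_def by (rule lsum_cong[OF VN[OF j]]) (use e_N[OF j] in \<open>auto simp: fam_def\<close>)
      moreover have "lsum (vsp N ?j) (Mid ` {..<m ?j}) a fam = lsum (vsp N ?j) {..<m ?j} (a \<circ> Mid) (fam \<circ> Mid)"
        by (rule lsum_reindex[OF VN[OF j]]) (use fam in \<open>auto simp: inj_on_def\<close>)
      moreover have "lsum (vsp N ?j) {..<m ?j} (a \<circ> Mid) (fam \<circ> Mid) = B"
        unfolding B_def by (rule lsum_cong[OF VN[OF j]]) (use lift_funcset(2)[OF f j] in \<open>auto simp: fam_def\<close>)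
      ultimately have AB: "\<zero>\<^bsub>vsp N ?j\<^esub> = A \<oplus>\<^bsub>vsp N ?j\<^esub> B" using L0 by simp
      then have "pr ?j \<zero>\<^bsub>vsp N ?j\<^esub> = pr ?j B"
        unfolding pr_eq_iff[OF j BN vs_zero_closed[OF VN[OF j]]] using AU by blast
      then have "B \<in> U ?j" using pr_zero_iff[OF j BN] by simp
      then have aM: "a (Mid x) = 0" if "x < m ?j" for x
        using lift_indep[OF f j _ that, of "\<lambda>l. a (Mid l)"] by (simp add: B_def)
      then have "B = \<zero>\<^bsub>vsp N ?j\<^esub>"
        unfolding B_def by (intro lsum_zero[OF VN[OF j] lift_funcset(2)[OF f j]]) auto
      then have "A = \<zero>\<^bsub>vsp N ?j\<^esub>" using AB vectorspace_simps(7)[OF VN[OF j] UN[OF j AU]] by simp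
      also have "\<dots> = lsum (vsp N ?j) {..<u ?j} (\<lambda>_. 0) (e ?j)"
        by (rule lsum_zero[OF VN[OF j] e_N[OF j], symmetric]) auto
      finally have "a (Iso l) = 0" if "l < u ?j" for l
        using e_eq[OF j _ that, of "\<lambda>l. a (Iso l)" "\<lambda>_. 0"] by (simp add: A_def)
      then show ?thesis using aM by auto
    qed
  qed
  then obtain v where "v \<in> vecs N i" "\<And>x. x \<in> ?I \<Longrightarrow> form N i ?j v (fam x) = (case x of Iso l \<Rightarrow> g l | _ \<Rightarrow> 0)"
    by blast
  then have v: "v \<in> vecs N i" "\<And>x. x \<in> ?I \<Longrightarrow> form N i ?j v (fam x) = (case x of Iso l \<Rightarrow> g l | _ \<Rightarrow> 0)"
    by blast+
  have "form N i ?j v (e ?j l) = g l" if "l < u ?j" for l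
    using v(2)[of "Iso l"] that by (simp add: fam_def)
  moreover have "form N i ?j v (f ?j y) = 0" if "y < m i" for y
    using v(2)[of "Mid y"] that m_sig[OF i] by (simp add: fam_def image_iff)
  ultimately show ?thesis using v(1) by blast
qed


section \<open>Adapted bases are frames\<close>

lemma adaptedD:
  assumes "b \<in> adapted N e c"
  shows "b \<in> (\<Pi>\<^sub>E i\<in>nodes Q. idx i \<rightarrow>\<^sub>E vecs N i)"
    and "i \<in> nodes Q \<Longrightarrow> b i \<in> idx i \<rightarrow> vecs N i"
    and "i \<in> nodes Q \<Longrightarrow> k < u i \<Longrightarrow> b i (Iso k) = e i k"
    and "i \<in> nodes Q \<Longrightarrow> x < m i \<Longrightarrow> b i (Mid x) \<in> c i x"
    and "i \<in> nodes Q \<Longrightarrow> k < u (\<sigma> i) \<Longrightarrow> l < u (\<sigma> i) \<Longrightarrow>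
      form N i (\<sigma> i) (b i (Dual k)) (e (\<sigma> i) l) = (if k = l then of_int (sgn_s Q i) else 0)"
    and "i \<in> nodes Q \<Longrightarrow> k < u (\<sigma> i) \<Longrightarrow> y < m i \<Longrightarrow> form N i (\<sigma> i) (b i (Dual k)) (b (\<sigma> i) (Mid y)) = 0"
    and "i \<in> nodes Q \<Longrightarrow> k < u (\<sigma> i) \<Longrightarrow> l < u i \<Longrightarrow> form N i (\<sigma> i) (b i (Dual k)) (b (\<sigma> i) (Dual l)) = 0"
    and "lifts (\<lambda>i x. b i (Mid x))"
  using assms unfolding adapted_def lifts_def by (auto simp: PiE_iff)

text \<open>The blocks without dual vectors follow from isotropy of \<open>U\<close>, from the lifts
  being orthogonal to \<open>U\<close> and from the Gram matrix of \<open>c\<close>. A dual vector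
  in the second argument is moved to the first by symmetry.\<close>

lemma adapted_gram:
  assumes b: "b \<in> adapted N e c" and i: "i \<in> nodes Q" and x: "x \<in> idx i" and y: "y \<in> idx (\<sigma> i)"
  shows "form N i (\<sigma> i) (b i x) (b (\<sigma> i) y) = gram i x y"
proof -
  note B = adaptedD[OF b] and j = sg(1)[OF i] and ij = sg(2)[OF i]
  have sym: "form N i (\<sigma> i) (b i x) (b (\<sigma> i) y) = of_int (sgn_s Q i) * form N (\<sigma> i) i (b (\<sigma> i) y) (b i x)"
    using fsym[OF i] B(2)[OF i] B(2)[OF j] x y by auto
  from x show ?thesis
  proof (cases rule: idx_cases)
    case x: (1 k)
    from y show ?thesis
    proof (cases rule: idx_cases)
      case (1 l)
      then show ?thesis
        using x B(3)[OF i] B(3)[OF j] U_W_zero[OF i j e_U[OF i] UW[OF j e_U[OF j]]] by simp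
    next
      case (2 l)
      then show ?thesis
        using x B(3)[OF i] U_W_zero[OF i j e_U[OF i] lift(1)[OF B(8) j]] by simp
    next
      case (3 l)
      then show ?thesis
        using sym x B(3)[OF i x(2)] B(5)[OF j, of l k] ij sgn_sq(1)[OF i] sd_quiverD(9)[OF sdQ i] by auto
    qed
  next
    case x: (2 k)
    from y show ?thesis
    proof (cases rule: idx_cases)
      case (1 l)
      then show ?thesis
        using x B(3)[OF j] W_U_zero[OF i j lift(1)[OF B(8) i] e_U[OF j]] by simp
    next
      case (2 l)
      then show ?thesis using x lift_form[OF B(8) i x(2)] m_sig[OF i] by simp
    next
      case (3 l)
      then show ?thesis using sym x B(6)[OF j, of l k] ij m_sig[OF i] by simp
    qed
  next
    case x: (3 k)
    from y show ?thesis
    proof (cases rule: idx_cases)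
      case (1 l)
      then show ?thesis using x B(3)[OF j] B(5)[OF i] by simp
    next
      case (2 l)
      then show ?thesis using x B(6)[OF i] m_sig[OF i] by simp
    next
      case (3 l)
      then show ?thesis using x B(7)[OF i] ij by simp
    qed
  qed
qed

lemma lsum_adapted:
  assumes b: "b \<in> adapted N e c" and i: "i \<in> nodes Q"
  shows "lsum (vsp N i) (idx i) a (b i) = lsum (vsp N i) {..<u i} (\<lambda>k. a (Iso k)) (e i) \<oplus>\<^bsub>vsp N i\<^esub>
    (lsum (vsp N i) {..<m i} (\<lambda>k. a (Mid k)) (\<lambda>x. b i (Mid x)) \<oplus>\<^bsub>vsp N i\<^esub>
     lsum (vsp N i) {..<u (\<sigma> i)} (\<lambda>k. a (Dual k)) (\<lambda>k. b i (Dual k)))"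
proof -
  have "lsum (vsp N i) {..<u i} (\<lambda>k. a (Iso k)) (\<lambda>k. b i (Iso k)) = lsum (vsp N i) {..<u i} (\<lambda>k. a (Iso k)) (e i)"
    by (rule lsum_cong[OF VN[OF i]]) (use adaptedD(2,3)[OF b i] in auto)
  then show ?thesis using lsum_idx[OF VN[OF i] adaptedD(2)[OF b i]] by simp
qed

text \<open>Independence follows from nondegeneracy of \<open>gram\<close>. For spanning, a
  combination of dual vectors is subtracted that has the same pairings with \<open>e\<close>; what
  remains is orthogonal to \<open>U\<close>, hence a combination of \<open>e\<close> and the
  lifts.\<close>

lemma adapted_basis:
  assumes b: "b \<in> adapted N e c" and i: "i \<in> nodes Q"
  shows "is_basis (vsp N i) (idx i) (b i)"
  unfolding is_basis_def
proof (intro conjI ballI allI impI)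
  note B = adaptedD[OF b] and j = sg(1)[OF i]
  interpret V: vectorspace class_ring "vsp N i" by (rule VN[OF i])
  have gr: "form N i (\<sigma> i) (lsum (vsp N i) (idx i) a (b i)) (b (\<sigma> i) y) = (\<Sum>x\<in>idx i. a x * gram i x y)"
    if "y \<in> idx (\<sigma> i)" for a y
  proof -
    have "b (\<sigma> i) y \<in> vecs N (\<sigma> i)" using B(2)[OF j] that by auto
    from form_lsum_left[OF NR NB i j B(2)[OF i] finite_idx this, of a]
    show ?thesis using adapted_gram[OF b i _ that] by simp
  qed
  show "finite (idx i)" "b i \<in> idx i \<rightarrow> vecs N i" using B(2)[OF i] by auto
  show "a x = 0" if z: "lsum (vsp N i) (idx i) a (b i) = \<zero>\<^bsub>vsp N i\<^esub>" and x: "x \<in> idx i" for a x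
  proof -
    have "(\<Sum>x\<in>idx i. a x * gram i x y) = 0" if "y \<in> idx (\<sigma> i)" for y
    proof -
      have "b (\<sigma> i) y \<in> vecs N (\<sigma> i)" using B(2)[OF j] that by auto
      then show ?thesis using gr[OF that, of a] form_zero(1)[OF NR NB i j] z by simp
    qed
    then show ?thesis using gram_nd[OF i] x by blast
  qed
  fix v assume v: "v \<in> vecs N i"
  let ?d = "\<lambda>k. b i (Dual k)"
  have dN: "?d \<in> {..<u (\<sigma> i)} \<rightarrow> vecs N i" using B(2)[OF i] by auto
  \<comment> \<open>The sign compensates the sign in the pairing of the dual vectors with
    \<open>e\<close>, as it squares to 1.\<close>
  define a where "a k = of_int (sgn_s Q i) * form N i (\<sigma> i) v (e (\<sigma> i) k)" for k
  define D where "D = lsum (vsp N i) {..<u (\<sigma> i)} a ?d"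
  define D' where "D' = lsum (vsp N i) {..<u (\<sigma> i)} (\<lambda>k. (-1) * a k) ?d"
  have DN: "D \<in> vecs N i" "D' \<in> vecs N i" unfolding D_def D'_def by (rule lsum_closed[OF VN[OF i] dN])+
  have DD: "D' \<oplus>\<^bsub>vsp N i\<^esub> D = \<zero>\<^bsub>vsp N i\<^esub>"
    unfolding D_def D'_def
    by (subst lsum_add[OF VN[OF i] dN, symmetric]) (simp_all add: lsum_zero[OF VN[OF i] dN])
  have "v \<oplus>\<^bsub>vsp N i\<^esub> D' \<in> W i"
  proof (rule form_e_span[OF i vs_add_closed[OF VN[OF i] v DN(2)]])
    fix l assume l: "l < u (\<sigma> i)"
    have eN: "e (\<sigma> i) l \<in> vecs N (\<sigma> i)" using e_N[OF j] l by auto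
    have "form N i (\<sigma> i) D' (e (\<sigma> i) l) = (\<Sum>k<u (\<sigma> i). (-1) * a k * form N i (\<sigma> i) (?d k) (e (\<sigma> i) l))"
      unfolding D'_def by (rule form_lsum_left[OF NR NB i j dN _ eN]) simp
    also have "\<dots> = (\<Sum>k<u (\<sigma> i). if k = l then - (a l * of_int (sgn_s Q i)) else 0)"
      by (rule sum.cong) (use B(5)[OF i] l in auto)
    also have "\<dots> = - (of_int (sgn_s Q i) * of_int (sgn_s Q i)) * form N i (\<sigma> i) v (e (\<sigma> i) l)"
      using l by (simp add: a_def)
    finally show "form N i (\<sigma> i) (v \<oplus>\<^bsub>vsp N i\<^esub> D') (e (\<sigma> i) l) = 0"
      using bil(1)[OF i j v DN(2) eN] sgn_sq(1)[OF i] by simp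
  qed
  from W_span[OF B(8) i this] obtain a' w where w: "w \<in> U i"
    "v \<oplus>\<^bsub>vsp N i\<^esub> D' = w \<oplus>\<^bsub>vsp N i\<^esub> lsum (vsp N i) {..<m i} a' (\<lambda>x. b i (Mid x))" by blast
  obtain a'' where a'': "w = lsum (vsp N i) {..<u i} a'' (e i)" using e_span[OF i w(1)] by blast
  have M: "lsum (vsp N i) {..<m i} a' (\<lambda>x. b i (Mid x)) \<in> vecs N i"
    by (rule lsum_closed[OF VN[OF i] lift_funcset(2)[OF B(8) i]])
  have "v = v \<oplus>\<^bsub>vsp N i\<^esub> (D' \<oplus>\<^bsub>vsp N i\<^esub> D)" using v DD by simp
  also have "\<dots> = (v \<oplus>\<^bsub>vsp N i\<^esub> D') \<oplus>\<^bsub>vsp N i\<^esub> D" using v DN by (simp add: V.a_assoc)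
  also have "\<dots> = w \<oplus>\<^bsub>vsp N i\<^esub> (lsum (vsp N i) {..<m i} a' (\<lambda>x. b i (Mid x)) \<oplus>\<^bsub>vsp N i\<^esub> D)"
    unfolding w(2) using UN[OF i w(1)] M DN(1) by (rule V.a_assoc)
  also have "\<dots> = lsum (vsp N i) (idx i) (\<lambda>x. case x of Iso k \<Rightarrow> a'' k | Mid k \<Rightarrow> a' k | Dual k \<Rightarrow> a k) (b i)"
    unfolding lsum_adapted[OF b i] a'' D_def by simp
  finally show "\<exists>a. v = lsum (vsp N i) (idx i) a (b i)" by blast
qed

text \<open>Triangularity has geometric reasons: \<open>U\<close> is stable under the arrows, and
  modulo \<open>U\<close> a lift is mapped as its coset is mapped in the reduction.\<close>

lemma adapted_frames: "adapted N e c \<subseteq> frames N"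
proof
  fix b assume b: "b \<in> adapted N e c"
  note B = adaptedD[OF b]
  have Z: "lsum (vsp N i) {..<u (\<sigma> i)} (\<lambda>_. 0) (\<lambda>k. b i (Dual k)) = \<zero>\<^bsub>vsp N i\<^esub>"
    "lsum (vsp N i) {..<m i} (\<lambda>_. 0) (\<lambda>k. b i (Mid k)) = \<zero>\<^bsub>vsp N i\<^esub>" if i: "i \<in> nodes Q" for i
    using lsum_zero[OF VN[OF i], of "\<lambda>k. b i (Dual k)" "{..<u (\<sigma> i)}" "\<lambda>_. 0"]
      lsum_zero[OF VN[OF i], of "\<lambda>k. b i (Mid k)" "{..<m i}" "\<lambda>_. 0"] B(2)[OF i] by (auto simp: Pi_iff)
  show "b \<in> frames N"
  proof (rule frameI[OF N B(1) adapted_basis[OF b] adapted_gram[OF b]])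
    fix \<alpha> k assume \<alpha>: "\<alpha> \<in> arrows Q" and k: "k < u (src Q \<alpha>)"
    let ?j = "tgt Q \<alpha>" and ?a = "\<lambda>x. case x of Iso l \<Rightarrow> AU \<alpha> l k | _ \<Rightarrow> 0"
    note j = st(2)[OF \<alpha>]
    have "lmap N \<alpha> (b (src Q \<alpha>) (Iso k)) = lsum (vsp N ?j) {..<u ?j} (\<lambda>l. AU \<alpha> l k) (e ?j)"
      using e_struct[OF \<alpha> k] B(3)[OF st(1)[OF \<alpha>] k] by simp
    also have "\<dots> = lsum (vsp N ?j) (idx ?j) ?a (b ?j)"
      unfolding lsum_adapted[OF b j]
      using Z[OF j] vectorspace_simps(7)[OF VN[OF j] lsum_closed[OF VN[OF j] e_N[OF j]]]
        vectorspace_simps(6)[OF VN[OF j] vs_zero_closed[OF VN[OF j]]] by simp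
    finally show "\<exists>a. lmap N \<alpha> (b (src Q \<alpha>) (Iso k)) = lsum (vsp N ?j) (idx ?j) a (b ?j) \<and>
       (\<forall>l<u ?j. a (Iso l) = AU \<alpha> l k) \<and> (\<forall>l. a (Mid l) = 0 \<and> a (Dual l) = 0)"
      by (intro exI[of _ ?a]) auto
  next
    fix \<alpha> k assume \<alpha>: "\<alpha> \<in> arrows Q" and k: "k < m (src Q \<alpha>)"
    let ?j = "tgt Q \<alpha>"
    note j = st(2)[OF \<alpha>]
    let ?M = "lsum (vsp N ?j) {..<m ?j} (\<lambda>l. AM \<alpha> l k) (\<lambda>x. b ?j (Mid x))"
    obtain w where w: "w \<in> U ?j" "lmap N \<alpha> (b (src Q \<alpha>) (Mid k)) = w \<oplus>\<^bsub>vsp N ?j\<^esub> ?M"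
      using lift_struct[OF B(8) \<alpha> k] by blast
    obtain a where a: "w = lsum (vsp N ?j) {..<u ?j} a (e ?j)" using e_span[OF j w(1)] by blast
    let ?a = "\<lambda>x. case x of Iso l \<Rightarrow> a l | Mid l \<Rightarrow> AM \<alpha> l k | Dual l \<Rightarrow> 0"
    have "w \<oplus>\<^bsub>vsp N ?j\<^esub> ?M = lsum (vsp N ?j) (idx ?j) ?a (b ?j)"
      unfolding lsum_adapted[OF b j] a
      using Z[OF j] vectorspace_simps(7)[OF VN[OF j] lsum_closed[OF VN[OF j] lift_funcset(2)[OF B(8) j]]] by simp
    then show "\<exists>a. lmap N \<alpha> (b (src Q \<alpha>) (Mid k)) = lsum (vsp N ?j) (idx ?j) a (b ?j) \<and>
       (\<forall>l<m ?j. a (Mid l) = AM \<alpha> l k) \<and> (\<forall>l. a (Dual l) = 0)"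
      using w(2) by (intro exI[of _ ?a]) auto
  qed
qed

section \<open>Counting the adapted bases\<close>

definition lift_set :: "('v \<Rightarrow> nat \<Rightarrow> 'w) set" where
  "lift_set = (\<Pi>\<^sub>E i\<in>nodes Q. \<Pi>\<^sub>E x\<in>{..<m i}. c i x)"

definition mid_part :: "('v \<Rightarrow> ix \<Rightarrow> 'w) \<Rightarrow> 'v \<Rightarrow> nat \<Rightarrow> 'w" where
  "mid_part b = (\<lambda>i\<in>nodes Q. \<lambda>x\<in>{..<m i}. b i (Mid x))"

text \<open>Each of the \<open>m i\<close> lifts at a node ranges over one coset of
  \<open>U i\<close>, which has q^(u i) elements.\<close>

lemma card_lift_set: "card lift_set = CARD('k) ^ (\<Sum>i\<in>nodes Q. m i * u i)"
proof -
  have cU: "card (U i) = CARD('k) ^ u i" if "i \<in> nodes Q" for i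
    using card_of_basis(1)[OF US(5)[OF that] e'(2)[OF that]] by simp
  have "card (c i x) = CARD('k) ^ u i" if i: "i \<in> nodes Q" and x: "x < m i" for i x
    using c_R[OF i x] card_pr[OF i WN] cU[OF i] by auto
  then have "card lift_set = (\<Prod>i\<in>nodes Q. \<Prod>x<m i. CARD('k) ^ u i)"
    unfolding lift_set_def using quiverD(1)[OF qv] by (simp add: card_PiE)
  also have "\<dots> = CARD('k) ^ (\<Sum>i\<in>nodes Q. m i * u i)"
    by (simp add: power_sum power_mult[symmetric] mult.commute)
  finally show ?thesis .
qed

lemma finite_lift_set: "finite lift_set"
proof -
  have "finite (c i x)" if i: "i \<in> nodes Q" and x: "x < m i" for i x
  proof -
    obtain w where "w \<in> W i" "c i x = pr i w" using c_R[OF i x] by blast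
    then have "c i x \<subseteq> vecs N i" using pr_subset_W[OF i] WN by blast
    then show ?thesis using finite_subset fin_vecs[OF i i] by blast
  qed
  then show ?thesis unfolding lift_set_def using quiverD(1)[OF qv] by (intro finite_PiE) auto
qed

text \<open>With the lifts fixed, provisional dual vectors \<open>d\<close> are chosen that have the
  right pairings with \<open>e\<close> and \<open>f\<close> but need not be isotropic. All other
  candidates differ from them by elements of \<open>U\<close>, with coefficients \<open>C\<close>,
  and isotropy becomes a twisted symmetry equation for \<open>C\<close>.\<close>

lemma card_adapted_fibre:
  assumes fL: "f \<in> lift_set"
  shows "card {b \<in> adapted N e c. mid_part b = f} = CARD('k) ^ node_exp"
proof -
  have f: "lifts f" using fL unfolding lift_set_def lifts_def by auto
  have "\<exists>v\<in>vecs N i. (\<forall>l<u (\<sigma> i). form N i (\<sigma> i) v (e (\<sigma> i) l) = (if k = l then of_int (sgn_s Q i) else 0)) \<and>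
    (\<forall>y<m i. form N i (\<sigma> i) v (f (\<sigma> i) y) = 0)" if "i \<in> nodes Q" for i k
    by (rule dual_vector_exists[OF f that])
  then obtain d where dN: "\<And>i k. i \<in> nodes Q \<Longrightarrow> d i k \<in> vecs N i"
    and de: "\<And>i k l. i \<in> nodes Q \<Longrightarrow> l < u (\<sigma> i) \<Longrightarrow>
      form N i (\<sigma> i) (d i k) (e (\<sigma> i) l) = (if k = l then of_int (sgn_s Q i) else 0)"
    and df: "\<And>i k y. i \<in> nodes Q \<Longrightarrow> y < m i \<Longrightarrow> form N i (\<sigma> i) (d i k) (f (\<sigma> i) y) = 0"
    by metis
  \<comment> \<open>Minus the Gram matrix of the provisional dual vectors is the inhomogeneous term
    of the isotropy condition.\<close>
  define D where "D = (\<lambda>(i, l, k). - form N i (\<sigma> i) (d i k) (d (\<sigma> i) l))"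
  have D: "D (node_flip x) = of_int (node_sign x) * D x" if x: "x \<in> node_block" for x
  proof -
    obtain i l k where [simp]: "x = (i, l, k)" by (cases x)
    have i: "i \<in> nodes Q" using x by (simp add: node_block_iff)
    have "form N (\<sigma> i) i (d (\<sigma> i) l) (d i k) = of_int (sgn_s Q (\<sigma> i)) * form N i (\<sigma> i) (d i k) (d (\<sigma> i) l)"
      using fsym[OF sg(1)[OF i] dN[OF sg(1)[OF i]], of "d i k" l] dN[OF i] sg(2)[OF i] by simp
    then show ?thesis using sg(2)[OF i] sd_quiverD(9)[OF sdQ i] by (simp add: D_def node_flip_def node_sign_def)
  qed
  let ?S = "{C \<in> node_block \<rightarrow>\<^sub>E (UNIV :: 'k set). \<forall>x\<in>node_block. C x + of_int (node_sign x) * C (node_flip x) = D x}"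
  define dv where "dv C i k = d i k \<oplus>\<^bsub>vsp N i\<^esub> lsum (vsp N i) {..<u i} (\<lambda>l. C (i, l, k)) (e i)"
    for C :: "'v \<times> nat \<times> nat \<Rightarrow> 'k" and i k
  define F where "F C = (\<lambda>i\<in>nodes Q. \<lambda>x\<in>idx i. case x of Iso k \<Rightarrow> e i k | Mid k \<Rightarrow> f i k | Dual k \<Rightarrow> dv C i k)"
    for C :: "'v \<times> nat \<times> nat \<Rightarrow> 'k"
  have ls: "lsum (vsp N i) {..<u i} a (e i) \<in> U i" "lsum (vsp N i) {..<u i} a (e i) \<in> vecs N i" if i: "i \<in> nodes Q" for i a
    using lsum_in_U[OF i e_funcset[OF i]] UN[OF i] by auto
  have dvN: "dv C i k \<in> vecs N i" if i: "i \<in> nodes Q" for C i k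
    unfolding dv_def by (rule vs_add_closed[OF VN[OF i] dN[OF i] ls(2)[OF i]])
  have dvW: "form N i (\<sigma> i) (dv C i k) v = form N i (\<sigma> i) (d i k) v" if i: "i \<in> nodes Q" and v: "v \<in> W (\<sigma> i)" for C i k v
    unfolding dv_def using bil(1)[OF i sg(1)[OF i] dN[OF i] ls(2)[OF i] WN[OF v]] U_W_zero[OF i sg(1)[OF i] ls(1)[OF i] v] by simp
  \<comment> \<open>The corrections lie in \<open>U\<close> and pair to zero with each other, so
    only the two mixed terms survive; each contributes one entry of \<open>C\<close>.\<close>
  have dvd: "form N i (\<sigma> i) (dv C i k) (dv C (\<sigma> i) l) = - D (i, l, k) + C (i, l, k) + of_int (sgn_s Q i) * C (\<sigma> i, k, l)"
    if i: "i \<in> nodes Q" and l: "l < u i" and k: "k < u (\<sigma> i)" for C i k l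
  proof -
    let ?j = "\<sigma> i"
    note j = sg(1)[OF i]
    let ?A = "lsum (vsp N i) {..<u i} (\<lambda>l. C (i, l, k)) (e i)" and ?A' = "lsum (vsp N ?j) {..<u ?j} (\<lambda>k. C (?j, k, l)) (e ?j)"
    have "form N i ?j (dv C i k) (dv C ?j l) = form N i ?j (dv C i k) (d ?j l) + form N i ?j (dv C i k) ?A'"
      unfolding dv_def[of C ?j] by (rule bil(2)[OF i j dvN[OF i] dN[OF j] ls(2)[OF j]])
    also have "form N i ?j (dv C i k) ?A' = form N i ?j (d i k) ?A'"
      by (rule dvW[OF i UW[OF j ls(1)[OF j]]])
    also have "\<dots> = (\<Sum>k'<u ?j. C (?j, k', l) * form N i ?j (d i k) (e ?j k'))"
      by (rule form_lsum_right[OF NR NB i j e_N[OF j] _ dN[OF i]]) simp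
    also have "\<dots> = (\<Sum>k'<u ?j. if k' = k then of_int (sgn_s Q i) * C (?j, k, l) else 0)"
      by (rule sum.cong) (use de[OF i] in auto)
    also have "\<dots> = of_int (sgn_s Q i) * C (?j, k, l)" using k by simp
    also have "form N i ?j (dv C i k) (d ?j l) = form N i ?j (d i k) (d ?j l) + form N i ?j ?A (d ?j l)"
      unfolding dv_def by (rule bil(1)[OF i j dN[OF i] ls(2)[OF i] dN[OF j]])
    also have "form N i ?j ?A (d ?j l) = (\<Sum>l'<u i. C (i, l', k) * form N i ?j (e i l') (d ?j l))"
      by (rule form_lsum_left[OF NR NB i j e_N[OF i] _ dN[OF j]]) simp
    also have "\<dots> = (\<Sum>l'<u i. if l' = l then C (i, l, k) else 0)"
    proof (rule sum.cong[OF refl])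
      fix l' assume "l' \<in> {..<u i}"
      then have l': "l' < u i" by simp
      have "form N i ?j (e i l') (d ?j l) = of_int (sgn_s Q i) * form N ?j i (d ?j l) (e i l')"
        by (rule fsym[OF i UN[OF i e_U[OF i l']] dN[OF j]])
      also have "form N ?j i (d ?j l) (e i l') = (if l = l' then of_int (sgn_s Q i) else 0)"
        using de[OF j, of l' l] l' sg(2)[OF i] sd_quiverD(9)[OF sdQ i] by simp
      finally show "C (i, l', k) * form N i ?j (e i l') (d ?j l) = (if l' = l then C (i, l, k) else 0)"
        using sgn_sq(1)[OF i] by auto
    qed
    also have "\<dots> = C (i, l, k)" using l by simp
    finally show ?thesis by (simp add: D_def)
  qed
  have Fv: "F C i (Iso k) = (if k < u i then e i k else undefined)" "F C i (Mid k) = (if k < m i then f i k else undefined)"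
    "F C i (Dual k) = (if k < u (\<sigma> i) then dv C i k else undefined)" if "i \<in> nodes Q" for C i k
    using that by (simp_all add: F_def)
  \<comment> \<open>Equality with \<open>mid_part\<close> as functions also concerns indices out of
    range, where both sides are \<open>undefined\<close>.\<close>
  have fext: "f i x = undefined" if "i \<in> nodes Q" "\<not> x < m i" for i x
    using fL that unfolding lift_set_def by (auto simp: PiE_iff extensional_def)
  have "bij_betw F ?S {b \<in> adapted N e c. mid_part b = f}"
  proof (rule bij_betw_imageI)
    show "inj_on F ?S"
    proof (rule inj_onI)
      fix C C' assume C: "C \<in> ?S" "C' \<in> ?S" and eq: "F C = F C'"
      show "C = C'"
      proof (rule PiE_ext)
        show "C \<in> node_block \<rightarrow>\<^sub>E UNIV" "C' \<in> node_block \<rightarrow>\<^sub>E UNIV" using C by auto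
        fix x assume x: "x \<in> node_block"
        obtain i l k where [simp]: "x = (i, l, k)" by (cases x)
        have i: "i \<in> nodes Q" and l: "l < u i" and k: "k < u (\<sigma> i)" using x by (auto simp: node_block_iff)
        interpret V: vectorspace class_ring "vsp N i" by (rule VN[OF i])
        have "dv C i k = dv C' i k" using Fv(3)[OF i] k eq by metis
        then have "lsum (vsp N i) {..<u i} (\<lambda>l. C (i, l, k)) (e i) \<oplus>\<^bsub>vsp N i\<^esub> d i k =
            lsum (vsp N i) {..<u i} (\<lambda>l. C' (i, l, k)) (e i) \<oplus>\<^bsub>vsp N i\<^esub> d i k"
          unfolding dv_def by (simp only: V.a_comm[OF ls(2)[OF i] dN[OF i]])
        then have "lsum (vsp N i) {..<u i} (\<lambda>l. C (i, l, k)) (e i) = lsum (vsp N i) {..<u i} (\<lambda>l. C' (i, l, k)) (e i)"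
          using V.add.right_cancel[OF dN[OF i] ls(2)[OF i] ls(2)[OF i]] by simp
        from e_eq[OF i this l] show "C x = C' x" by simp
      qed
    qed
    show "F ` ?S = {b \<in> adapted N e c. mid_part b = f}"
    proof (intro equalityI subsetI)
      fix b assume "b \<in> F ` ?S"
      then obtain C where C: "C \<in> ?S" and b: "b = F C" by blast
      have iso: "form N i (\<sigma> i) (dv C i k) (dv C (\<sigma> i) l) = 0" if i: "i \<in> nodes Q" "l < u i" "k < u (\<sigma> i)" for i k l
      proof -
        have "(i, l, k) \<in> node_block" using i by (simp add: node_block_iff)
        then have "C (i, l, k) + of_int (node_sign (i, l, k)) * C (node_flip (i, l, k)) = D (i, l, k)" using C by blast
        then show ?thesis unfolding dvd[OF i] by (simp add: node_sign_def node_flip_def algebra_simps)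
      qed
      have "b \<in> (\<Pi>\<^sub>E i\<in>nodes Q. idx i \<rightarrow>\<^sub>E vecs N i)"
        unfolding b F_def using UN e_U WN lift(1)[OF f] dvN by (auto simp: PiE_iff split: ix.splits)
      moreover have "b i (Iso k) = e i k" if "i \<in> nodes Q" "k < u i" for i k using that Fv by (simp add: b)
      moreover have "b i (Mid k) \<in> c i k" if "i \<in> nodes Q" "k < m i" for i k
        using that Fv f by (simp add: b lifts_def)
      moreover have "form N i (\<sigma> i) (b i (Dual k)) (e (\<sigma> i) l) = (if k = l then of_int (sgn_s Q i) else 0)"
        if "i \<in> nodes Q" "k < u (\<sigma> i)" "l < u (\<sigma> i)" for i k l
        using that Fv(3) dvW[OF that(1) UW[OF sg(1)[OF that(1)] e_U[OF sg(1)[OF that(1)] that(3)]]] de by (simp add: b)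
      moreover have "form N i (\<sigma> i) (b i (Dual k)) (b (\<sigma> i) (Mid y)) = 0"
        if i: "i \<in> nodes Q" and k: "k < u (\<sigma> i)" and y: "y < m i" for i k y
      proof -
        have y': "y < m (\<sigma> i)" using y m_sig[OF i] by simp
        show ?thesis
          using dvW[OF i lift(1)[OF f sg(1)[OF i] y']] df[OF i y] Fv(3)[OF i] k Fv(2)[OF sg(1)[OF i]] y' by (simp add: b)
      qed
      moreover have "form N i (\<sigma> i) (b i (Dual k)) (b (\<sigma> i) (Dual l)) = 0"
        if i: "i \<in> nodes Q" and k: "k < u (\<sigma> i)" and l: "l < u i" for i k l
        using iso[OF i l k] Fv(3)[OF i] Fv(3)[OF sg(1)[OF i]] k l sg(2)[OF i] by (simp add: b)
      ultimately have "b \<in> adapted N e c" unfolding adapted_def by blast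
      moreover have "mid_part b = f"
      proof
        fix i
        show "mid_part b i = f i"
        proof (cases "i \<in> nodes Q")
          case True
          then show ?thesis using Fv(2)[OF True] fext[OF True] by (auto simp: mid_part_def b)
        next
          case False
          then show ?thesis using fL unfolding lift_set_def by (auto simp: mid_part_def PiE_iff extensional_def)
        qed
      qed
      ultimately show "b \<in> {b \<in> adapted N e c. mid_part b = f}" by blast
    next
      fix b assume "b \<in> {b \<in> adapted N e c. mid_part b = f}"
      then have b: "b \<in> adapted N e c" and bf: "mid_part b = f" by auto
      note B = adaptedD[OF b]
      have bM: "b i (Mid x) = f i x" if "i \<in> nodes Q" "x < m i" for i x
        using fun_cong[OF fun_cong[OF bf], of i x] that by (simp add: mid_part_def)
      have "\<exists>a. b i (Dual k) = d i k \<oplus>\<^bsub>vsp N i\<^esub> lsum (vsp N i) {..<u i} a (e i)"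
        if i: "i \<in> nodes Q" and k: "k < u (\<sigma> i)" for i k
      proof -
        note j = sg(1)[OF i]
        interpret V: vectorspace class_ring "vsp N i" by (rule VN[OF i])
        have bD: "b i (Dual k) \<in> vecs N i" using B(2)[OF i] k by auto
        \<comment> \<open>The dual vector of \<open>b\<close> has the same pairings with
          \<open>e\<close> and \<open>f\<close> as \<open>d i k\<close>, so the difference lies in
          \<open>U\<close>.\<close>
        let ?w = "b i (Dual k) \<oplus>\<^bsub>vsp N i\<^esub> (-1) \<odot>\<^bsub>vsp N i\<^esub> d i k"
        have m1: "(-1) \<odot>\<^bsub>vsp N i\<^esub> d i k \<in> vecs N i" by (rule vs_smult_closed[OF VN[OF i] dN[OF i]])
        have fw: "form N i (\<sigma> i) ?w v = form N i (\<sigma> i) (b i (Dual k)) v - form N i (\<sigma> i) (d i k) v"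
          if "v \<in> vecs N (\<sigma> i)" for v
          using bil(1)[OF i j bD m1 that] bil(3)[OF i j dN[OF i] that] by simp
        have "?w \<in> U i"
        proof (rule kernel_in_U[OF f i vs_add_closed[OF VN[OF i] bD m1]])
          show "form N i (\<sigma> i) ?w (e (\<sigma> i) l) = 0" if "l < u (\<sigma> i)" for l
            using fw[OF UN[OF j e_U[OF j that]]] B(5)[OF i k that] de[OF i that] by simp
          show "form N i (\<sigma> i) ?w (f (\<sigma> i) y) = 0" if y: "y < m i" for y
          proof -
            have y': "y < m (\<sigma> i)" using y m_sig[OF i] by simp
            show ?thesis
              using fw[OF WN[OF lift(1)[OF f j y']]] B(6)[OF i k y] bM[OF j y'] df[OF i y] by simp
          qed
        qed
        then obtain a where a: "?w = lsum (vsp N i) {..<u i} a (e i)" using e_span[OF i] by blast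
        have "d i k \<oplus>\<^bsub>vsp N i\<^esub> ?w = b i (Dual k) \<oplus>\<^bsub>vsp N i\<^esub> (d i k \<oplus>\<^bsub>vsp N i\<^esub> (-1) \<odot>\<^bsub>vsp N i\<^esub> d i k)"
          using bD m1 dN[OF i] by (simp add: V.a_lcomm)
        also have "\<dots> = b i (Dual k)" using vectorspace_distrib(6)[OF VN[OF i] dN[OF i]] bD by simp
        finally show ?thesis using a by metis
      qed
      then obtain a where a: "\<And>i k. i \<in> nodes Q \<Longrightarrow> k < u (\<sigma> i) \<Longrightarrow>
          b i (Dual k) = d i k \<oplus>\<^bsub>vsp N i\<^esub> lsum (vsp N i) {..<u i} (a i k) (e i)" by metis
      define C where "C = (\<lambda>(i, l, k)\<in>node_block. a i k l)"
      have dvb: "dv C i k = b i (Dual k)" if i: "i \<in> nodes Q" and k: "k < u (\<sigma> i)" for i k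
      proof -
        have "lsum (vsp N i) {..<u i} (\<lambda>l. C (i, l, k)) (e i) = lsum (vsp N i) {..<u i} (a i k) (e i)"
          by (rule lsum_cong[OF VN[OF i] e_N[OF i]]) (use i k in \<open>auto simp: C_def node_block_iff\<close>)
        then show ?thesis unfolding dv_def a[OF i k] by simp
      qed
      have "C x + of_int (node_sign x) * C (node_flip x) = D x" if x: "x \<in> node_block" for x
      proof -
        obtain i l k where [simp]: "x = (i, l, k)" by (cases x)
        have i: "i \<in> nodes Q" and l: "l < u i" and k: "k < u (\<sigma> i)" using x by (auto simp: node_block_iff)
        have l': "l < u (\<sigma> (\<sigma> i))" using l sg(2)[OF i] by simp
        show ?thesis
          using dvd[OF i l k, of C] B(7)[OF i k l] dvb[OF i k] dvb[OF sg(1)[OF i] l']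
          by (simp add: node_sign_def node_flip_def algebra_simps)
      qed
      then have C: "C \<in> ?S" by (auto simp: C_def)
      have "b = F C"
      proof
        fix i
        show "b i = F C i"
        proof (cases "i \<in> nodes Q")
          case i: True
          have "b i x = undefined" if "x \<notin> idx i" for x using B(1) i that by (auto simp: PiE_iff extensional_def)
          then show ?thesis
            using Fv[OF i] B(3)[OF i] bM[OF i] dvb[OF i] i by (auto simp: fun_eq_iff F_def split: ix.splits)
        next
          case False
          then show ?thesis using B(1) by (auto simp: F_def PiE_iff extensional_def)
        qed
      qed
      then show "b \<in> F ` ?S" using C by blast
    qed
  qed
  from bij_betw_same_card[OF this] have "card {b \<in> adapted N e c. mid_part b = f} = card ?S" by (rule sym)
  also have "\<dots> = CARD('k) ^ node_exp" by (rule node_exp_card(2)) (rule D)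
  finally show ?thesis .
qed

lemma finite_adapted: "finite (adapted N e c)"
proof (rule finite_subset)
  show "adapted N e c \<subseteq> (\<Pi>\<^sub>E i\<in>nodes Q. idx i \<rightarrow>\<^sub>E vecs N i)" using adaptedD(1) by blast
  show "finite (\<Pi>\<^sub>E i\<in>nodes Q. idx i \<rightarrow>\<^sub>E vecs N i)"
    using quiverD(1)[OF qv] fin_vecs by (intro finite_PiE) auto
qed

text \<open>Adapted bases are fibred over the choices of lifts, with fibres of constant
  size.\<close>

lemma card_adapted: "card (adapted N e c) = CARD('k) ^ ((\<Sum>i\<in>nodes Q. m i * u i) + node_exp)"
proof -
  have "mid_part ` adapted N e c \<subseteq> lift_set"
    unfolding mid_part_def lift_set_def by (simp only: restrict_PiE_iff image_subset_iff) (auto simp: adaptedD(4))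
  then have "(\<Sum>f\<in>lift_set. \<Sum>b\<in>{b \<in> adapted N e c. mid_part b = f}. 1) = (\<Sum>b\<in>adapted N e c. 1 :: nat)"
    by (rule sum.group[OF finite_adapted finite_lift_set])
  then have "card (adapted N e c) = (\<Sum>f\<in>lift_set. card {b \<in> adapted N e c. mid_part b = f})" by simp
  also have "\<dots> = card lift_set * CARD('k) ^ node_exp" by (simp add: card_adapted_fibre)
  finally show ?thesis by (simp add: card_lift_set power_add)
qed

end

section \<open>Frames sorted by their isotropic subrepresentation\<close>

context split_data
begin

definition triples :: "('k, 'w, 'v, 'a) sdrep \<Rightarrow> (('v \<Rightarrow> 'w set) \<times> ('v \<Rightarrow> nat \<Rightarrow> 'w) \<times> ('v \<Rightarrow> nat \<Rightarrow> 'w set)) set" where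
  "triples N = (SIGMA U:{U \<in> subreps Q N. isotropic Q N U}.
     rep_bases Q (restrict_rep N U) (\<lambda>i. {..<u i}) AU \<times>
     gram_bases Q (sd_reduction Q N U) (\<lambda>i. {..<m i}) AM G)"

lemma triple_frame:
  assumes "is_sdrep Q N" "(U, e, c) \<in> triples N"
  shows "split_frame Q u m AU AM G N U e c"
  using assms split_data_axioms
  unfolding split_frame_def split_frame_axioms_def isotropic_sub_def triples_def by (auto simp: sdQ)

text \<open>The frame remembers all three data: \<open>e\<close> is its isotropic part,
  \<open>U\<close> is the span of \<open>e\<close>, and \<open>c\<close> consists of the cosets of
  its middle vectors.\<close>

lemma adapted_inj:
  assumes N: "is_sdrep Q N" and t: "(U, e, c) \<in> triples N" and t': "(U', e', c') \<in> triples N"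
    and b: "b \<in> adapted N e c" and b': "b \<in> adapted N e' c'"
  shows "(U, e, c) = (U', e', c')"
proof -
  interpret F: split_frame Q u m AU AM G N U e c by (rule triple_frame[OF N t])
  interpret F': split_frame Q u m AU AM G N U' e' c' by (rule triple_frame[OF N t'])
  have e: "e = e'"
  proof (intro ext)
    fix i k
    have "e i k = e' i k" if "i \<in> nodes Q" "k < u i"
      using F.adaptedD(3)[OF b that] F'.adaptedD(3)[OF b' that] by simp
    then show "e i k = e' i k"
      using F.e'(1) F'.e'(1) by (cases "i \<in> nodes Q"; cases "k < u i") (auto simp: PiE_iff extensional_def)
  qed
  have U: "U = U'"
  proof
    fix i
    show "U i = U' i"
    proof (cases "i \<in> nodes Q")
      case True
      then show ?thesis
        using F.e_span[OF True] F'.e_span[OF True] F.lsum_in_U[OF True F.e_funcset[OF True]]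
          F'.lsum_in_U[OF True F'.e_funcset[OF True]] e by (auto simp: set_eq_iff)
    next
      case False
      then show ?thesis using subrepsD(1)[OF F.U] subrepsD(1)[OF F'.U] by (simp add: extensional_def)
    qed
  qed
  have "c = c'"
  proof (intro ext)
    fix i x
    have "c i x = c' i x" if "i \<in> nodes Q" "x < m i"
      using F.lift(2)[OF F.adaptedD(8)[OF b] that] F'.lift(2)[OF F'.adaptedD(8)[OF b'] that] U
      by (simp add: F.pr_def F'.pr_def)
    then show "c i x = c' i x"
      using F.c'(1) F'.c'(1) by (cases "i \<in> nodes Q"; cases "x < m i") (auto simp: PiE_iff extensional_def)
  qed
  then show ?thesis using e U by simp
qed

text \<open>Take \<open>U\<close> to be the span of the \<open>Iso\<close> vectors and
  \<open>c\<close> the cosets of the \<open>Mid\<close> vectors. The zero blocks of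
  \<open>coef\<close> make \<open>U\<close> stable and give the matrices on the reduction; the zero
  blocks of \<open>gram\<close> make \<open>U\<close> isotropic and the middle vectors orthogonal to
  it.\<close>

lemma frame_triple:
  assumes N: "is_sdrep Q N" and b: "b \<in> frames N"
  shows "\<exists>U e c. (U, e, c) \<in> triples N \<and> b \<in> adapted N e c"
proof -
  obtain p where p: "p \<in> params" and bp: "b \<in> gram_bases Q N idx (coef p) gram"
    using b unfolding frames_def by blast
  note NF = is_sdrep_form_rep[OF N]
  note NR = form_repD(1)[OF NF] and NB = form_repD(2)[OF NF]
  note VN = is_repD(1)[OF NR]
  note B = rep_basesD[OF gram_basesD(1)[OF bp]] and gr = gram_basesD(2)[OF bp]
  define e where "e = (\<lambda>i\<in>nodes Q. \<lambda>k\<in>{..<u i}. b i (Iso k))"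
  define U where "U = (\<lambda>i\<in>nodes Q. range (\<lambda>a. lsum (vsp N i) {..<u i} a (e i)))"
  have e: "e i k = b i (Iso k)" if "i \<in> nodes Q" "k < u i" for i k using that by (simp add: e_def)
  have eN: "e i \<in> {..<u i} \<rightarrow> vecs N i" if "i \<in> nodes Q" for i using B(3)[OF that] e[OF that] by auto
  have Uiff: "w \<in> U i \<longleftrightarrow> (\<exists>a. w = lsum (vsp N i) {..<u i} a (e i))" if "i \<in> nodes Q" for i w
    using that by (auto simp: U_def)
  have lsI: "lsum (vsp N i) {..<u i} a (e i) \<in> U i" if "i \<in> nodes Q" for i a using Uiff[OF that] by blast
  have lidx: "lsum (vsp N i) (idx i) a (b i) = lsum (vsp N i) {..<u i} (\<lambda>k. a (Iso k)) (e i) \<oplus>\<^bsub>vsp N i\<^esub>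
      (lsum (vsp N i) {..<m i} (\<lambda>k. a (Mid k)) (\<lambda>x. b i (Mid x)) \<oplus>\<^bsub>vsp N i\<^esub>
       lsum (vsp N i) {..<u (sig0 Q i)} (\<lambda>k. a (Dual k)) (\<lambda>k. b i (Dual k)))" if i: "i \<in> nodes Q" for i a
  proof -
    have "lsum (vsp N i) {..<u i} (\<lambda>k. a (Iso k)) (\<lambda>k. b i (Iso k)) = lsum (vsp N i) {..<u i} (\<lambda>k. a (Iso k)) (e i)"
      by (rule lsum_cong[OF VN[OF i]]) (use B(3)[OF i] e[OF i] in auto)
    then show ?thesis using lsum_idx[OF VN[OF i] B(3)[OF i]] by simp
  qed
  have bM: "(\<lambda>x. b i (Mid x)) \<in> {..<m i} \<rightarrow> vecs N i" and bD: "(\<lambda>k. b i (Dual k)) \<in> {..<u (sig0 Q i)} \<rightarrow> vecs N i"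
    if "i \<in> nodes Q" for i using B(3)[OF that] by auto
  have ZM: "lsum (vsp N i) {..<m i} a (\<lambda>x. b i (Mid x)) = \<zero>\<^bsub>vsp N i\<^esub>" if "i \<in> nodes Q" "\<And>x. x < m i \<Longrightarrow> a x = 0" for i a
    by (rule lsum_zero[OF VN[OF that(1)] bM[OF that(1)]]) (use that in auto)
  have ZD: "lsum (vsp N i) {..<u (sig0 Q i)} a (\<lambda>x. b i (Dual x)) = \<zero>\<^bsub>vsp N i\<^esub>"
    if "i \<in> nodes Q" "\<And>x. x < u (sig0 Q i) \<Longrightarrow> a x = 0" for i a
    by (rule lsum_zero[OF VN[OF that(1)] bD[OF that(1)]]) (use that in auto)
  have eidx: "lsum (vsp N i) {..<u i} a (e i) = lsum (vsp N i) (idx i) (\<lambda>x. case x of Iso k \<Rightarrow> a k | _ \<Rightarrow> 0) (b i)"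
    if i: "i \<in> nodes Q" for i a
    unfolding lidx[OF i]
    using ZM[OF i, of "\<lambda>_. 0"] ZD[OF i, of "\<lambda>_. 0"] vectorspace_simps(7)[OF VN[OF i] lsum_closed[OF VN[OF i] eN[OF i]]]
      vectorspace_simps(6)[OF VN[OF i] vs_zero_closed[OF VN[OF i]]] by simp
  have Midx: "lsum (vsp N i) {..<m i} a (\<lambda>x. b i (Mid x)) = lsum (vsp N i) (idx i) (\<lambda>x. case x of Mid k \<Rightarrow> a k | _ \<Rightarrow> 0) (b i)"
    if i: "i \<in> nodes Q" for i a
    unfolding lidx[OF i]
    using lsum_zero[OF VN[OF i] eN[OF i], of "\<lambda>_. 0"] ZD[OF i, of "\<lambda>_. 0"]
      vectorspace_simps(7)[OF VN[OF i] lsum_closed[OF VN[OF i] bM[OF i]]]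
      vectorspace_simps(6)[OF VN[OF i] lsum_closed[OF VN[OF i] bM[OF i]]] by simp
  have e_struct: "lmap N \<alpha> (e (src Q \<alpha>) k) = lsum (vsp N (tgt Q \<alpha>)) {..<u (tgt Q \<alpha>)} (\<lambda>l. AU \<alpha> l k) (e (tgt Q \<alpha>))"
    if \<alpha>: "\<alpha> \<in> arrows Q" and k: "k < u (src Q \<alpha>)" for \<alpha> k
  proof -
    have "lmap N \<alpha> (e (src Q \<alpha>) k) = lsum (vsp N (tgt Q \<alpha>)) (idx (tgt Q \<alpha>)) (\<lambda>z. coef p \<alpha> z (Iso k)) (b (tgt Q \<alpha>))"
      using B(4)[OF \<alpha>, of "Iso k"] e[OF st(1)[OF \<alpha>] k] k by simp
    also have "\<dots> = lsum (vsp N (tgt Q \<alpha>)) (idx (tgt Q \<alpha>)) (\<lambda>x. case x of Iso l \<Rightarrow> AU \<alpha> l k | _ \<Rightarrow> 0) (b (tgt Q \<alpha>))"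
      by (rule lsum_cong[OF VN[OF st(2)[OF \<alpha>]] B(3)[OF st(2)[OF \<alpha>]]]) (auto split: ix.splits)
    also have "\<dots> = lsum (vsp N (tgt Q \<alpha>)) {..<u (tgt Q \<alpha>)} (\<lambda>l. AU \<alpha> l k) (e (tgt Q \<alpha>))"
      by (rule eidx[OF st(2)[OF \<alpha>], symmetric])
    finally show ?thesis .
  qed
  have Usub: "VectorSpace.subspace class_ring (U i) (vsp N i)" if i: "i \<in> nodes Q" for i
  proof (rule subspaceI[OF VN[OF i]])
    show "U i \<subseteq> vecs N i" using lsum_closed[OF VN[OF i] eN[OF i]] by (auto simp: Uiff[OF i])
    have "lsum (vsp N i) {..<u i} (\<lambda>_. 0) (e i) = \<zero>\<^bsub>vsp N i\<^esub>" by (rule lsum_zero[OF VN[OF i] eN[OF i]]) auto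
    then show "\<zero>\<^bsub>vsp N i\<^esub> \<in> U i" using lsI[OF i, of "\<lambda>_. 0"] by simp
    show "x \<oplus>\<^bsub>vsp N i\<^esub> y \<in> U i" if "x \<in> U i" "y \<in> U i" for x y
      using that lsum_add[OF VN[OF i] eN[OF i] finite_lessThan, symmetric] lsI[OF i] unfolding Uiff[OF i] by auto
    show "a \<odot>\<^bsub>vsp N i\<^esub> x \<in> U i" if "x \<in> U i" for a x
      using that lsum_smult[OF VN[OF i] eN[OF i] finite_lessThan, symmetric] lsI[OF i] unfolding Uiff[OF i] by auto
  qed
  have Uarr: "lmap N \<alpha> w \<in> U (tgt Q \<alpha>)" if \<alpha>: "\<alpha> \<in> arrows Q" and w: "w \<in> U (src Q \<alpha>)" for \<alpha> w
  proof -
    note s = st(1)[OF \<alpha>] and t = st(2)[OF \<alpha>]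
    obtain a where a: "w = lsum (vsp N (src Q \<alpha>)) {..<u (src Q \<alpha>)} a (e (src Q \<alpha>))" using w Uiff[OF s] by blast
    have "lmap N \<alpha> w = lsum (vsp N (tgt Q \<alpha>)) {..<u (src Q \<alpha>)} a (\<lambda>k. lmap N \<alpha> (e (src Q \<alpha>) k))"
      unfolding a by (rule lsum_hom'[OF is_repD(3)[OF NR \<alpha>] eN[OF s]]) simp
    also have "\<dots> = lsum (vsp N (tgt Q \<alpha>)) {..<u (src Q \<alpha>)} a
        (\<lambda>k. lsum (vsp N (tgt Q \<alpha>)) {..<u (tgt Q \<alpha>)} (\<lambda>l. AU \<alpha> l k) (e (tgt Q \<alpha>)))"
      by (rule lsum_cong[OF VN[OF t]]) (use e_struct[OF \<alpha>] lsum_closed[OF VN[OF t] eN[OF t]] in auto)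
    also have "\<dots> = lsum (vsp N (tgt Q \<alpha>)) {..<u (tgt Q \<alpha>)} (\<lambda>l. \<Sum>k<u (src Q \<alpha>). a k * AU \<alpha> l k) (e (tgt Q \<alpha>))"
      by (rule lsum_lsum[OF VN[OF t] eN[OF t]]) simp_all
    finally show ?thesis using lsI[OF t] by simp
  qed
  have "U \<in> extensional (nodes Q)" by (simp add: U_def)
  then have Usr: "U \<in> subreps Q N" unfolding subreps_def using Usub Uarr by blast
  have form_e: "form N i (sig0 Q i) v (lsum (vsp N (sig0 Q i)) {..<u (sig0 Q i)} a (e (sig0 Q i))) =
      (\<Sum>l<u (sig0 Q i). a l * form N i (sig0 Q i) v (b (sig0 Q i) (Iso l)))" if i: "i \<in> nodes Q" and v: "v \<in> vecs N i" for i a v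
    using form_lsum_right[OF NR NB i sig(1)[OF i] eN[OF sig(1)[OF i]] _ v, of a] e[OF sig(1)[OF i]] by simp
  have perp: "v \<in> perp Q N U i" if i: "i \<in> nodes Q" and v: "v \<in> vecs N i"
    and z: "\<And>l. l < u (sig0 Q i) \<Longrightarrow> form N i (sig0 Q i) v (b (sig0 Q i) (Iso l)) = 0" for i v
  proof -
    have "form N i j v w = 0" if j: "j \<in> nodes Q" and w: "w \<in> U j" for j w
    proof (cases "j = sig0 Q i")
      case True
      obtain a where "w = lsum (vsp N j) {..<u j} a (e j)" using w Uiff[OF j] by blast
      then show ?thesis using form_e[OF i v, of a] z True by simp
    next
      case False
      then have "i \<noteq> sig0 Q j" using sig i j by auto
      then show ?thesis using form_repD(3)[OF NF i j _ v] w subspaceD(1)[OF Usub[OF j]] by blast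
    qed
    then show ?thesis unfolding perp_def using v by blast
  qed
  have iso: "isotropic Q N U"
    unfolding isotropic_def
  proof (intro ballI subsetI)
    fix i w assume i: "i \<in> nodes Q" and w: "w \<in> U i"
    obtain a where a: "w = lsum (vsp N i) {..<u i} a (e i)" using w Uiff[OF i] by blast
    show "w \<in> perp Q N U i"
    proof (rule perp[OF i subsetD[OF subspaceD(1)[OF Usub[OF i]] w]])
      fix l assume l: "l < u (sig0 Q i)"
      have "b (sig0 Q i) (Iso l) \<in> vecs N (sig0 Q i)" using B(3)[OF sig(1)[OF i]] l by auto
      from form_lsum_left[OF NR NB i sig(1)[OF i] eN[OF i] _ this, of a]
      have "form N i (sig0 Q i) w (b (sig0 Q i) (Iso l)) = (\<Sum>k<u i. a k * form N i (sig0 Q i) (e i k) (b (sig0 Q i) (Iso l)))"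
        unfolding a by simp
      also have "\<dots> = 0" by (rule sum.neutral) (use e[OF i] gr[OF i, of "Iso _" "Iso l"] l in simp)
      finally show "form N i (sig0 Q i) w (b (sig0 Q i) (Iso l)) = 0" .
    qed
  qed
  interpret I: isotropic_sub Q N U by unfold_locales (rule sdQ N Usr iso)+
  have eb: "e \<in> rep_bases Q (restrict_rep N U) (\<lambda>i. {..<u i}) AU"
    unfolding rep_bases_def restrict_rep_def
  proof (intro CollectI conjI ballI; simp)
    have eU: "e i k \<in> U i" if "i \<in> nodes Q" "k < u i" for i k
      using lsI[OF that(1), of "\<lambda>x. if x = k then 1 else 0"] lsum_delta[OF VN[OF that(1)] eN[OF that(1)], of k] that by simp
    then have eF: "e i \<in> {..<u i} \<rightarrow> U i" if "i \<in> nodes Q" for i using that by auto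
    show "e \<in> (\<Pi>\<^sub>E i\<in>nodes Q. {..<u i} \<rightarrow>\<^sub>E U i)" using eU by (auto simp: PiE_iff e_def)
    have ls: "lsum (vsp N i\<lparr>carrier := U i\<rparr>) {..<u i} a (e i) = lsum (vsp N i) {..<u i} a (e i)" if "i \<in> nodes Q" for i a
      by (rule lsum_restrict_carrier[OF VN[OF that] subspaceD(5,1)[OF Usub[OF that]] eF[OF that]]) simp
    show "is_basis (vsp N i\<lparr>carrier := U i\<rparr>) {..<u i} (e i)" if i: "i \<in> nodes Q" for i
      unfolding is_basis_def
    proof (intro conjI ballI allI impI)
      show "e i \<in> {..<u i} \<rightarrow> carrier (vsp N i\<lparr>carrier := U i\<rparr>)" using eF[OF i] by simp
      show "\<exists>a. v = lsum (vsp N i\<lparr>carrier := U i\<rparr>) {..<u i} a (e i)" if "v \<in> carrier (vsp N i\<lparr>carrier := U i\<rparr>)" for v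
        unfolding ls[OF i] using that Uiff[OF i] by simp
      show "a x = 0" if "lsum (vsp N i\<lparr>carrier := U i\<rparr>) {..<u i} a (e i) = \<zero>\<^bsub>vsp N i\<lparr>carrier := U i\<rparr>\<^esub>" "x \<in> {..<u i}" for a x
      proof -
        have "lsum (vsp N i) (idx i) (\<lambda>x. case x of Iso k \<Rightarrow> a k | _ \<Rightarrow> 0) (b i) = \<zero>\<^bsub>vsp N i\<^esub>"
          using that(1) unfolding ls[OF i] eidx[OF i] by simp
        then have "\<forall>x\<in>idx i. (case x of Iso k \<Rightarrow> a k | _ \<Rightarrow> 0) = 0" using B(2)[OF i] unfolding is_basis_def by blast
        from bspec[OF this, of "Iso x"] that(2) show ?thesis by simp
      qed
    qed simp
    show "lmap N \<alpha> (e (src Q \<alpha>) x) = lsum (vsp N (tgt Q \<alpha>)\<lparr>carrier := U (tgt Q \<alpha>)\<rparr>) {..<u (tgt Q \<alpha>)} (\<lambda>z. AU \<alpha> z x) (e (tgt Q \<alpha>))"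
      if "\<alpha> \<in> arrows Q" "x < u (src Q \<alpha>)" for \<alpha> x
      unfolding ls[OF st(2)[OF that(1)]] by (rule e_struct[OF that])
  qed
  have bMW: "b i (Mid x) \<in> I.W i" if i: "i \<in> nodes Q" and x: "x < m i" for i x
    by (rule perp[OF i]) (use bM[OF i] x gr[OF i, of "Mid x" "Iso _"] in auto)
  then have bMWF: "(\<lambda>x. b i (Mid x)) \<in> {..<m i} \<rightarrow> I.W i" if "i \<in> nodes Q" for i using that by auto
  define c where "c = (\<lambda>i\<in>nodes Q. \<lambda>x\<in>{..<m i}. I.pr i (b i (Mid x)))"
  have cR: "c i \<in> {..<m i} \<rightarrow> vecs I.R i" if "i \<in> nodes Q" for i using that bMW by (auto simp: c_def I.vecs_R)
  have lsc: "lsum (vsp I.R i) {..<m i} a (c i) = I.pr i (lsum (vsp N i) {..<m i} a (\<lambda>x. b i (Mid x)))" if i: "i \<in> nodes Q" for i a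
  proof -
    have "I.pr i (lsum (vsp N i) {..<m i} a (\<lambda>x. b i (Mid x))) = lsum (vsp I.R i) {..<m i} a (\<lambda>x. I.pr i (b i (Mid x)))"
      by (rule I.lsum_R[OF i bMWF[OF i]]) simp
    also have "\<dots> = lsum (vsp I.R i) {..<m i} a (c i)"
      by (rule lsum_cong[OF I.VR[OF i]]) (use bMW[OF i] i in \<open>auto simp: I.vecs_R c_def\<close>)
    finally show ?thesis by simp
  qed
  have Mcl: "lsum (vsp N i) {..<m i} a (\<lambda>x. b i (Mid x)) \<in> vecs N i" if "i \<in> nodes Q" for i a
    by (rule lsum_closed[OF VN[OF that] bM[OF that]])
  \<comment> \<open>Without \<open>Dual\<close> coordinates the vector lies in \<open>U\<close> plus
    the middle span, and the projection forgets the \<open>Iso\<close> coordinates.\<close>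
  have pr_idx: "I.pr i (lsum (vsp N i) (idx i) a (b i)) = lsum (vsp I.R i) {..<m i} (\<lambda>k. a (Mid k)) (c i)"
    if i: "i \<in> nodes Q" and a: "\<And>k. k < u (sig0 Q i) \<Longrightarrow> a (Dual k) = 0" for i a
  proof -
    have "lsum (vsp N i) (idx i) a (b i) = lsum (vsp N i) {..<u i} (\<lambda>k. a (Iso k)) (e i) \<oplus>\<^bsub>vsp N i\<^esub>
        lsum (vsp N i) {..<m i} (\<lambda>k. a (Mid k)) (\<lambda>x. b i (Mid x))"
      unfolding lidx[OF i] using ZD[OF i, of "\<lambda>k. a (Dual k)"] a vectorspace_simps(7)[OF VN[OF i] Mcl[OF i]] by simp
    moreover have "lsum (vsp N i) (idx i) a (b i) \<in> vecs N i" by (rule lsum_closed[OF VN[OF i] B(3)[OF i]])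
    ultimately have "I.pr i (lsum (vsp N i) (idx i) a (b i)) = I.pr i (lsum (vsp N i) {..<m i} (\<lambda>k. a (Mid k)) (\<lambda>x. b i (Mid x)))"
      unfolding I.pr_eq_iff[OF i Mcl[OF i] \<open>lsum (vsp N i) (idx i) a (b i) \<in> vecs N i\<close>] using lsI[OF i] by blast
    then show ?thesis using lsc[OF i] by simp
  qed
  have cb: "c \<in> gram_bases Q I.R (\<lambda>i. {..<m i}) AM G"
    unfolding gram_bases_def rep_bases_def
  proof (intro CollectI conjI ballI)
    show "c \<in> (\<Pi>\<^sub>E i\<in>nodes Q. {..<m i} \<rightarrow>\<^sub>E vecs I.R i)" using cR by (auto simp: PiE_iff c_def Pi_iff)
    show "is_basis (vsp I.R i) {..<m i} (c i)" if i: "i \<in> nodes Q" for i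
      unfolding is_basis_def
    proof (intro conjI ballI allI impI cR[OF i])
      show "\<exists>a. X = lsum (vsp I.R i) {..<m i} a (c i)" if X: "X \<in> vecs I.R i" for X
      proof -
        obtain v where v: "v \<in> I.W i" "X = I.pr i v" using X by (auto simp: I.vecs_R)
        obtain a where a: "v = lsum (vsp N i) (idx i) a (b i)"
          using B(2)[OF i] I.WN[OF v(1)] unfolding is_basis_def by blast
        \<comment> \<open>A vector orthogonal to \<open>U\<close> has no dual coordinates: pairing
          with \<open>Iso k\<close> at the \<sigma>-image extracts the coordinate at
          \<open>Dual k\<close>, up to sign.\<close>
        have "a (Dual k) = 0" if k: "k < u (sig0 Q i)" for k
        proof -
          have bk: "b (sig0 Q i) (Iso k) \<in> vecs N (sig0 Q i)" using B(3)[OF sig(1)[OF i]] k by auto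
          have "b (sig0 Q i) (Iso k) \<in> U (sig0 Q i)"
            using funcset_mem[OF rep_basesD(3)[OF eb sig(1)[OF i]], of k] e[OF sig(1)[OF i] k] k
            by (simp add: restrict_rep_def)
          then have "0 = form N i (sig0 Q i) v (b (sig0 Q i) (Iso k))" using I.W_U_zero[OF i sig(1)[OF i] v(1)] by simp
          also have "\<dots> = (\<Sum>x\<in>idx i. a x * form N i (sig0 Q i) (b i x) (b (sig0 Q i) (Iso k)))"
            unfolding a by (rule form_lsum_left[OF NR NB i sig(1)[OF i] B(3)[OF i] finite_idx bk])
          also have "\<dots> = (\<Sum>x\<in>idx i. a x * gram i x (Iso k))" using gr[OF i] k by (intro sum.cong) auto
          also have "\<dots> = a (Dual k) * of_int (sgn_s Q i)" by (rule sum_gram_left(1)[OF i k])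
          finally show ?thesis using sgn_sq(1)[OF i] by auto
        qed
        then show ?thesis using pr_idx[OF i] v(2) a by blast
      qed
      show "a x = 0" if z: "lsum (vsp I.R i) {..<m i} a (c i) = \<zero>\<^bsub>vsp I.R i\<^esub>" and x: "x \<in> {..<m i}" for a x
      proof -
        have "lsum (vsp N i) {..<m i} a (\<lambda>x. b i (Mid x)) \<in> U i"
          using z I.pr_zero_iff(1)[OF i Mcl[OF i]] unfolding lsc[OF i] I.zero_R by simp
        then obtain a' where "lsum (vsp N i) {..<m i} a (\<lambda>x. b i (Mid x)) = lsum (vsp N i) {..<u i} a' (e i)"
          using Uiff[OF i] by blast
        then have "\<forall>x\<in>idx i. (case x of Mid k \<Rightarrow> a k | _ \<Rightarrow> 0) = (case x of Iso k \<Rightarrow> a' k | _ \<Rightarrow> 0)"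
          unfolding Midx[OF i] eidx[OF i] lsum_eq_iff[OF VN[OF i] B(2)[OF i]] .
        from bspec[OF this, of "Mid x"] x show ?thesis by simp
      qed
    qed simp
    show "lmap I.R \<alpha> (c (src Q \<alpha>) x) = lsum (vsp I.R (tgt Q \<alpha>)) {..<m (tgt Q \<alpha>)} (\<lambda>z. AM \<alpha> z x) (c (tgt Q \<alpha>))"
      if \<alpha>: "\<alpha> \<in> arrows Q" and x: "x \<in> {..<m (src Q \<alpha>)}" for \<alpha> x
    proof -
      have xm: "x < m (src Q \<alpha>)" using x by simp
      have "lmap I.R \<alpha> (c (src Q \<alpha>) x) = I.pr (tgt Q \<alpha>) (lmap N \<alpha> (b (src Q \<alpha>) (Mid x)))"
        using I.lmap_R[OF \<alpha> I.WN[OF bMW[OF st(1)[OF \<alpha>] xm]]] xm st(1)[OF \<alpha>] by (simp add: c_def)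
      also have "lmap N \<alpha> (b (src Q \<alpha>) (Mid x)) = lsum (vsp N (tgt Q \<alpha>)) (idx (tgt Q \<alpha>)) (\<lambda>z. coef p \<alpha> z (Mid x)) (b (tgt Q \<alpha>))"
        using B(4)[OF \<alpha>, of "Mid x"] xm by simp
      also have "I.pr (tgt Q \<alpha>) \<dots> = lsum (vsp I.R (tgt Q \<alpha>)) {..<m (tgt Q \<alpha>)} (\<lambda>z. coef p \<alpha> (Mid z) (Mid x)) (c (tgt Q \<alpha>))"
        by (rule pr_idx[OF st(2)[OF \<alpha>]]) simp
      finally show ?thesis by simp
    qed
    show "form I.R i (sig0 Q i) (c i x) (c (sig0 Q i) y) = G i x y"
      if i: "i \<in> nodes Q" and x: "x \<in> {..<m i}" and y: "y \<in> {..<m (sig0 Q i)}" for i x y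
      using I.form_R[OF i sig(1)[OF i] bMW[OF i] bMW[OF sig(1)[OF i]], of x y] gr[OF i, of "Mid x" "Mid y"] x y i sig(1)[OF i]
      by (simp add: c_def)
  qed
  have "(U, e, c) \<in> triples N" unfolding triples_def using Usr iso eb cb by blast
  moreover have "b \<in> adapted N e c"
    unfolding adapted_def
  proof (intro CollectI conjI ballI allI impI)
    show "b \<in> (\<Pi>\<^sub>E i\<in>nodes Q. idx i \<rightarrow>\<^sub>E vecs N i)" by (rule B(1))
    fix i assume i: "i \<in> nodes Q"
    show "b i (Iso k) = e i k" if "k < u i" for k using e[OF i that] by simp
    show "b i (Mid x) \<in> c i x" if "x < m i" for x
      using I.pr_self[OF i I.WN[OF bMW[OF i that]]] i that by (simp add: c_def)
    show "form N i (sig0 Q i) (b i (Dual k)) (e (sig0 Q i) l) = (if k = l then of_int (sgn_s Q i) else 0)"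
      if "k < u (sig0 Q i)" "l < u (sig0 Q i)" for k l
      using gr[OF i, of "Dual k" "Iso l"] e[OF sig(1)[OF i]] that by simp
    show "form N i (sig0 Q i) (b i (Dual k)) (b (sig0 Q i) (Mid y)) = 0" if "k < u (sig0 Q i)" "y < m i" for k y
      using gr[OF i, of "Dual k" "Mid y"] that m_sig[OF i] by simp
    show "form N i (sig0 Q i) (b i (Dual k)) (b (sig0 Q i) (Dual l)) = 0" if "k < u (sig0 Q i)" "l < u i" for k l
      using gr[OF i, of "Dual k" "Dual l"] that sig(2)[OF i] by simp
  qed
  ultimately show ?thesis by blast
qed

lemma finite_triples:
  assumes N: "is_sdrep Q N"
  shows "finite (triples N)" "finite {U \<in> subreps Q N. isotropic Q N U}"
    and "U \<in> subreps Q N \<Longrightarrow> is_rep Q (restrict_rep N U)"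
proof -
  note NR = form_repD(1)[OF is_sdrep_form_rep[OF N]]
  note fin = card_vectorspace(2)[OF is_repD(1,2)[OF NR]]
  have "U \<in> (\<Pi>\<^sub>E i\<in>nodes Q. Pow (vecs N i))" if U: "U \<in> subreps Q N" for U
    using subspaceD(1)[OF subrepsD(2)[OF U]] subrepsD(1)[OF U] by (simp add: PiE_iff)
  moreover have "finite (\<Pi>\<^sub>E i\<in>nodes Q. Pow (vecs N i))"
    using quiverD(1)[OF qv] fin by (intro finite_PiE) auto
  ultimately show finU: "finite {U \<in> subreps Q N. isotropic Q N U}"
    by (auto intro: rev_finite_subset)
  show R: "is_rep Q (restrict_rep N U)" if "U \<in> subreps Q N" for U
    by (rule restrict_rep_is_rep[OF qv NR fin that])
  show "finite (triples N)"
    unfolding triples_def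
  proof (intro finite_SigmaI finU finite_cartesian_product)
    fix U assume U: "U \<in> {U \<in> subreps Q N. isotropic Q N U}"
    show "finite (rep_bases Q (restrict_rep N U) (\<lambda>i. {..<u i}) AU)"
      by (rule finite_rep_bases[OF qv R]) (use U in simp)
    interpret I: isotropic_sub Q N U by unfold_locales (use sdQ N U in auto)
    show "finite (gram_bases Q (sd_reduction Q N U) (\<lambda>i. {..<m i}) AM G)"
      by (rule finite_gram_bases[OF qv form_repD(1)[OF I.R_form_rep]])
  qed
qed

text \<open>Every frame is adapted to exactly one triple, and all triples have equally many adapted
  frames.\<close>

lemma card_frames_triples:
  assumes N: "is_sdrep Q N"
  shows "card (frames N) = card (triples N) * CARD('k) ^ ((\<Sum>i\<in>nodes Q. m i * u i) + node_exp)"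
proof -
  let ?A = "\<lambda>t. adapted N (fst (snd t)) (snd (snd t))"
  have sub: "?A t \<subseteq> frames N" "finite (?A t)" "card (?A t) = CARD('k) ^ ((\<Sum>i\<in>nodes Q. m i * u i) + node_exp)"
    if t: "t \<in> triples N" for t
  proof -
    interpret F: split_frame Q u m AU AM G N "fst t" "fst (snd t)" "snd (snd t)"
      by (rule triple_frame[OF N]) (use t in simp)
    show "?A t \<subseteq> frames N" "finite (?A t)" "card (?A t) = CARD('k) ^ ((\<Sum>i\<in>nodes Q. m i * u i) + node_exp)"
      using F.adapted_frames F.finite_adapted F.card_adapted by auto
  qed
  have "frames N = (\<Union>t\<in>triples N. ?A t)"
    using sub(1) frame_triple[OF N] by fastforce
  moreover have "card (\<Union>t\<in>triples N. ?A t) = (\<Sum>t\<in>triples N. card (?A t))"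
  proof (rule card_UN_disjoint[OF finite_triples(1)[OF N]])
    show "\<forall>t\<in>triples N. finite (?A t)" using sub(2) by blast
    have "t = t'" if "t \<in> triples N" "t' \<in> triples N" "b \<in> ?A t" "b \<in> ?A t'" for t t' b
      using adapted_inj[OF N, of "fst t" "fst (snd t)" "snd (snd t)" "fst t'" "fst (snd t')" "snd (snd t')" b] that by simp
    then show "\<forall>t\<in>triples N. \<forall>t'\<in>triples N. t \<noteq> t' \<longrightarrow> ?A t \<inter> ?A t' = {}" by blast
  qed
  ultimately show ?thesis using sub(3) by simp
qed

lemma card_triples:
  assumes N: "is_sdrep Q N"
  shows "card (triples N) = (\<Sum>U\<in>{U \<in> subreps Q N. isotropic Q N U}.
     card (rep_bases Q (restrict_rep N U) (\<lambda>i. {..<u i}) AU) *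
     card (gram_bases Q (sd_reduction Q N U) (\<lambda>i. {..<m i}) AM G))"
proof -
  have "finite (rep_bases Q (restrict_rep N U) (\<lambda>i. {..<u i}) AU \<times> gram_bases Q (sd_reduction Q N U) (\<lambda>i. {..<m i}) AM G)"
    if U: "U \<in> subreps Q N" "isotropic Q N U" for U
  proof -
    interpret I: isotropic_sub Q N U by unfold_locales (use sdQ N U in auto)
    show ?thesis
      by (intro finite_cartesian_product finite_rep_bases[OF qv finite_triples(3)[OF N U(1)]]
          finite_gram_bases[OF qv form_repD(1)[OF I.R_form_rep]])
  qed
  then show ?thesis
    unfolding triples_def
    by (subst card_SigmaI[OF finite_triples(2)[OF N]]) (auto simp: card_cartesian_product)
qed

end

section \<open>The Euler form and the function \<open>\<E>\<close>\<close>

lemma euler_add: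
  "euler Q (\<lambda>i. a i + b i) d = euler Q a d + euler Q b d"
  "euler Q d (\<lambda>i. a i + b i) = euler Q d a + euler Q d b"
  by (simp_all add: euler_def ring_distribs sum.distrib)

text \<open>The involution reverses arrows, so reindexing by it exchanges the two arguments.\<close>

lemma euler_sig:
  assumes Q: "sd_quiver Q"
  shows "euler Q (sig_vec Q a) (sig_vec Q b) = euler Q b a"
proof -
  note q = quiverD[OF sd_quiverD(1)[OF Q]] and sg = sd_quiverD(2,3)[OF Q] and sa = sd_quiverD(4-7)[OF Q]
  have "(\<Sum>i\<in>nodes Q. sig_vec Q a i * sig_vec Q b i) = (\<Sum>i\<in>nodes Q. b i * a i)"
    by (rule sum.reindex_bij_witness[where i = "sig0 Q" and j = "sig0 Q"]) (auto simp: sig_vec_def sg)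
  moreover have "(\<Sum>\<alpha>\<in>arrows Q. sig_vec Q a (src Q \<alpha>) * sig_vec Q b (tgt Q \<alpha>)) =
      (\<Sum>\<alpha>\<in>arrows Q. b (src Q \<alpha>) * a (tgt Q \<alpha>))"
    by (rule sum.reindex_bij_witness[where i = "sig1 Q" and j = "sig1 Q"]) (auto simp: sig_vec_def sg sa q)
  ultimately show ?thesis by (simp add: euler_def)
qed

lemma sum_positive_part:
  fixes g :: "'b \<Rightarrow> int"
  assumes P: "is_positive_part \<sigma> X P" and X: "finite X"
    and inv: "\<And>x. x \<in> X \<Longrightarrow> \<sigma> (\<sigma> x) = x" and g: "\<And>x. x \<in> X \<Longrightarrow> g (\<sigma> x) = g x"
  shows "(\<Sum>x\<in>X. g x) = (\<Sum>x\<in>{x \<in> X. \<sigma> x = x}. g x) + 2 * (\<Sum>x\<in>P. g x)"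
proof -
  have PX: "P \<subseteq> X" "P \<inter> \<sigma> ` P = {}" "P \<union> \<sigma> ` P = {x \<in> X. \<sigma> x \<noteq> x}"
    using P unfolding is_positive_part_def by auto
  have fin: "finite P" using finite_subset[OF PX(1) X] .
  have inj: "inj_on \<sigma> P" using inv PX(1) by (metis inj_onI subsetD)
  have "(\<Sum>x\<in>X. g x) = (\<Sum>x\<in>{x \<in> X. \<sigma> x = x} \<union> {x \<in> X. \<sigma> x \<noteq> x}. g x)" by (rule sum.cong) auto
  also have "\<dots> = (\<Sum>x\<in>{x \<in> X. \<sigma> x = x}. g x) + (\<Sum>x\<in>{x \<in> X. \<sigma> x \<noteq> x}. g x)"
    by (rule sum.union_disjoint) (use X in auto)
  also have "(\<Sum>x\<in>{x \<in> X. \<sigma> x \<noteq> x}. g x) = (\<Sum>x\<in>P. g x) + (\<Sum>x\<in>\<sigma> ` P. g x)"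
    unfolding PX(3)[symmetric] by (rule sum.union_disjoint) (use fin PX(2) in auto)
  also have "(\<Sum>x\<in>\<sigma> ` P. g x) = (\<Sum>x\<in>P. g x)"
    using g PX(1) by (subst sum.reindex[OF inj]) (auto intro!: sum.cong)
  finally show ?thesis by simp
qed

text \<open>The negative of the linear part of 2\<E>. Its terms will be matched with the index pairs
  fixed by \<open>node_flip\<close> and \<open>corner_flip\<close>.\<close>

definition sd_linear :: "('v, 'a, 'z) sdquiver_scheme \<Rightarrow> ('v \<Rightarrow> int) \<Rightarrow> int" where
  "sd_linear Q d = (\<Sum>i\<in>{i \<in> nodes Q. sig0 Q i = i}. sgn_s Q i * d i) +
     (\<Sum>\<alpha>\<in>{\<alpha> \<in> arrows Q. sig1 Q \<alpha> = \<alpha>}. sgn_tau Q \<alpha> * sgn_s Q (tgt Q \<alpha>) * d (tgt Q \<alpha>))"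

text \<open>Fixed nodes and arrows contribute squares once and the others contribute in pairs, so
  twice the quadratic part is a sum over all nodes and arrows. The choices \<open>P0\<close> and
  \<open>P1\<close> disappear from the right side.\<close>

lemma sd_euler_double:
  assumes Q: "sd_quiver Q" and P0: "is_positive_part (sig0 Q) (nodes Q) P0"
    and P1: "is_positive_part (sig1 Q) (arrows Q) P1"
  shows "2 * sd_euler Q P0 P1 d = euler Q (sig_vec Q d) d - sd_linear Q d"
proof -
  note q = quiverD[OF sd_quiverD(1)[OF Q]] and sg = sd_quiverD(2,3)[OF Q] and sa = sd_quiverD(4-7)[OF Q]
  have half: "2 * ((a * (a - s)) div 2) = a * (a - s)" "2 * ((a * (a + s)) div 2) = a * (a + s)"
    if "s = 1 \<or> s = -1" for a s :: int
    using that by auto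
  have half0: "2 * ((d i * (d i - sgn_s Q i)) div 2) = d (sig0 Q i) * d i - sgn_s Q i * d i"
    if "i \<in> {i \<in> nodes Q. sig0 Q i = i}" for i
    using half(1)[of "sgn_s Q i" "d i"] sd_quiverD(8)[OF Q, of i] that by (simp add: algebra_simps)
  have half1: "2 * ((d (tgt Q \<alpha>) * (d (tgt Q \<alpha>) + sgn_tau Q \<alpha> * sgn_s Q (tgt Q \<alpha>))) div 2) =
      d (sig0 Q (src Q \<alpha>)) * d (tgt Q \<alpha>) + sgn_tau Q \<alpha> * sgn_s Q (tgt Q \<alpha>) * d (tgt Q \<alpha>)"
    if "\<alpha> \<in> {\<alpha> \<in> arrows Q. sig1 Q \<alpha> = \<alpha>}" for \<alpha>
  proof -
    have \<alpha>: "\<alpha> \<in> arrows Q" "sig1 Q \<alpha> = \<alpha>" using that by auto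
    \<comment> \<open>A fixed arrow ends at the \<sigma>-image of its source, so the square of the
      dimension at its target is the corresponding term of \<chi>(\<sigma>(d), d).\<close>
    have "tgt Q \<alpha> = sig0 Q (src Q \<alpha>)" using sa(4)[OF \<alpha>(1)] \<alpha>(2) by simp
    moreover have "sgn_tau Q \<alpha> * sgn_s Q (tgt Q \<alpha>) = 1 \<or> sgn_tau Q \<alpha> * sgn_s Q (tgt Q \<alpha>) = -1"
      using sd_quiverD(8)[OF Q q(4)[OF \<alpha>(1)]] sd_quiverD(10)[OF Q \<alpha>(1)] by auto
    ultimately show ?thesis
      using half(2)[of "sgn_tau Q \<alpha> * sgn_s Q (tgt Q \<alpha>)" "d (tgt Q \<alpha>)"] by (simp add: algebra_simps)
  qed
  have N: "(\<Sum>i\<in>nodes Q. d (sig0 Q i) * d i) =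
      (\<Sum>i\<in>{i \<in> nodes Q. sig0 Q i = i}. d (sig0 Q i) * d i) + 2 * (\<Sum>i\<in>P0. d (sig0 Q i) * d i)"
    by (rule sum_positive_part[OF P0 q(1)]) (auto simp: sg)
  have A: "(\<Sum>\<alpha>\<in>arrows Q. d (sig0 Q (src Q \<alpha>)) * d (tgt Q \<alpha>)) =
      (\<Sum>\<alpha>\<in>{\<alpha> \<in> arrows Q. sig1 Q \<alpha> = \<alpha>}. d (sig0 Q (src Q \<alpha>)) * d (tgt Q \<alpha>)) +
      2 * (\<Sum>\<alpha>\<in>P1. d (sig0 Q (src Q \<alpha>)) * d (tgt Q \<alpha>))"
    by (rule sum_positive_part[OF P1 q(2)]) (auto simp: sa sg q)
  have E: "euler Q (sig_vec Q d) d = (\<Sum>i\<in>nodes Q. d (sig0 Q i) * d i) - (\<Sum>\<alpha>\<in>arrows Q. d (sig0 Q (src Q \<alpha>)) * d (tgt Q \<alpha>))"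
    unfolding euler_def using q by (simp add: sig_vec_def cong: sum.cong)
  have "2 * sd_euler Q P0 P1 d =
      (\<Sum>i\<in>{i \<in> nodes Q. sig0 Q i = i}. 2 * ((d i * (d i - sgn_s Q i)) div 2)) + 2 * (\<Sum>i\<in>P0. d (sig0 Q i) * d i)
    - (\<Sum>\<alpha>\<in>{\<alpha> \<in> arrows Q. sig1 Q \<alpha> = \<alpha>}. 2 * ((d (tgt Q \<alpha>) * (d (tgt Q \<alpha>) + sgn_tau Q \<alpha> * sgn_s Q (tgt Q \<alpha>))) div 2))
    - 2 * (\<Sum>\<alpha>\<in>P1. d (sig0 Q (src Q \<alpha>)) * d (tgt Q \<alpha>))"
    unfolding sd_euler_def by (simp add: sum_distrib_left right_diff_distrib)
  also have "\<dots> = (\<Sum>i\<in>{i \<in> nodes Q. sig0 Q i = i}. d (sig0 Q i) * d i - sgn_s Q i * d i) + 2 * (\<Sum>i\<in>P0. d (sig0 Q i) * d i)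
    - (\<Sum>\<alpha>\<in>{\<alpha> \<in> arrows Q. sig1 Q \<alpha> = \<alpha>}. d (sig0 Q (src Q \<alpha>)) * d (tgt Q \<alpha>) + sgn_tau Q \<alpha> * sgn_s Q (tgt Q \<alpha>) * d (tgt Q \<alpha>))
    - 2 * (\<Sum>\<alpha>\<in>P1. d (sig0 Q (src Q \<alpha>)) * d (tgt Q \<alpha>))"
    by (intro arg_cong2[of _ _ _ _ "(-)"] arg_cong2[of _ _ _ _ "(+)"] sum.cong refl half0 half1)
  also have "\<dots> = euler Q (sig_vec Q d) d - sd_linear Q d"
    unfolding E N A sd_linear_def sum_subtractf sum.distrib by simp
  finally show ?thesis .
qed

lemma sig_vec_add: "sig_vec Q (\<lambda>i. a i + b i) = (\<lambda>i. sig_vec Q a i + sig_vec Q b i)"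
  by (auto simp: sig_vec_def)

lemma sig_vec_sig:
  assumes "sd_quiver Q" "d \<in> Lambda_pos Q"
  shows "sig_vec Q (sig_vec Q d) = d"
  using assms sd_quiverD(2,3)[OF assms(1)] by (auto simp: sig_vec_def Lambda_pos_def fun_eq_iff)

text \<open>Polarization of 2\<E>: the form \<chi>(\<sigma>(a), b) is symmetric because \<sigma>
  reverses arrows, so the two mixed terms coincide and the factor 2 cancels.\<close>

lemma sd_euler_add:
  assumes Q: "sd_quiver Q" and P0: "is_positive_part (sig0 Q) (nodes Q) P0"
    and P1: "is_positive_part (sig1 Q) (arrows Q) P1" and b: "b \<in> Lambda_pos Q"
  shows "sd_euler Q P0 P1 (\<lambda>i. a i + b i) = sd_euler Q P0 P1 a + sd_euler Q P0 P1 b + euler Q (sig_vec Q a) b"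
proof -
  note D = sd_euler_double[OF Q P0 P1]
  have "euler Q (sig_vec Q b) a = euler Q (sig_vec Q a) b"
    using euler_sig[OF Q, of a "sig_vec Q b"] sig_vec_sig[OF Q b] by simp
  moreover have "sd_linear Q (\<lambda>i. a i + b i) = sd_linear Q a + sd_linear Q b"
    by (simp add: sd_linear_def ring_distribs sum.distrib)
  ultimately have "2 * sd_euler Q P0 P1 (\<lambda>i. a i + b i) =
      2 * (sd_euler Q P0 P1 a + sd_euler Q P0 P1 b + euler Q (sig_vec Q a) b)"
    unfolding distrib_left D by (simp add: sig_vec_add euler_add)
  then show ?thesis by simp
qed

lemma Lambda_pos_sig: "sd_quiver Q \<Longrightarrow> d \<in> Lambda_pos Q \<Longrightarrow> sig_vec Q d \<in> Lambda_pos Q"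
  using sd_quiverD(2) by (fastforce simp: Lambda_pos_def sig_vec_def)

lemma sd_euler_hyp_add:
  assumes Q: "sd_quiver Q" and P0: "is_positive_part (sig0 Q) (nodes Q) P0"
    and P1: "is_positive_part (sig1 Q) (arrows Q) P1"
    and d: "d \<in> Lambda_pos Q" and e: "e \<in> Lambda_sig_pos Q"
  shows "sd_euler Q P0 P1 (\<lambda>i. hyp_vec Q d i + e i) =
    sd_euler Q P0 P1 d + sd_euler Q P0 P1 (sig_vec Q d) + sd_euler Q P0 P1 e +
    euler Q d d + euler Q e d + euler Q d e"
proof -
  note add = sd_euler_add[OF Q P0 P1]
  have e': "e \<in> Lambda_pos Q" "sig_vec Q e = e" using e by (auto simp: Lambda_sig_pos_def)
  have "sd_euler Q P0 P1 (\<lambda>i. (d i + sig_vec Q d i) + e i) =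
      sd_euler Q P0 P1 d + sd_euler Q P0 P1 (sig_vec Q d) + euler Q (sig_vec Q d) (sig_vec Q d) +
      sd_euler Q P0 P1 e + euler Q (\<lambda>i. sig_vec Q d i + d i) e"
    by (simp add: add[OF e'(1)] add[OF Lambda_pos_sig[OF Q d]] sig_vec_add sig_vec_sig[OF Q d])
  moreover have "euler Q (sig_vec Q d) e = euler Q e d" using euler_sig[OF Q, of d e] e'(2) by simp
  ultimately show ?thesis by (simp add: hyp_vec_def euler_add euler_sig[OF Q])
qed

section \<open>The exponents of q as values of the Euler forms\<close>

context split_data
begin

text \<open>Reindexing by \<sigma> exhibits the size of \<beta> as the arrow sum in \<chi>(m,
  u).\<close>

lemma card_mid_block: "int (card mid_block) = (\<Sum>\<alpha>\<in>arrows Q. int (m (src Q \<alpha>)) * int (u (tgt Q \<alpha>)))"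
proof -
  have "int (card mid_block) = (\<Sum>\<alpha>\<in>arrows Q. int (m (tgt Q \<alpha>)) * int (u (sig0 Q (src Q \<alpha>))))"
    unfolding mid_block_def using quiverD(2)[OF qv] by (simp add: card_cartesian_product)
  also have "\<dots> = (\<Sum>\<alpha>\<in>arrows Q. int (m (src Q \<alpha>)) * int (u (tgt Q \<alpha>)))"
    by (rule sum.reindex_bij_witness[where i = "sig1 Q" and j = "sig1 Q"]) (auto simp: sig_arr sig st m_sig)
  finally show ?thesis .
qed

text \<open>The numbers of index pairs over nodes and over arrows are the two sums in
  \<chi>(\<sigma>(d), d). A fixed pair has equal indices and lies over a fixed node or arrow, so the
  fixed pairs add up to the linear part.\<close>

lemma corner_node_exp:
  assumes P0: "is_positive_part (sig0 Q) (nodes Q) P0" and P1: "is_positive_part (sig1 Q) (arrows Q) P1"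
    and e: "2 * int e = int (card corner_block) - (\<Sum>x\<in>{x\<in>corner_block. corner_flip x = x}. corner_sign x)"
    and d: "\<And>i. i \<in> nodes Q \<Longrightarrow> d i = int (u i)"
  shows "int node_exp - int e = sd_euler Q P0 P1 d"
proof -
  have C: "int (card corner_block) = (\<Sum>\<alpha>\<in>arrows Q. int (u (sig0 Q (src Q \<alpha>))) * int (u (tgt Q \<alpha>)))"
    unfolding corner_block_def using quiverD(2)[OF qv] by (simp add: card_cartesian_product mult.commute)
  have B: "int (card node_block) = (\<Sum>i\<in>nodes Q. int (u (sig0 Q i)) * int (u i))"
    unfolding node_block_def using quiverD(1)[OF qv] by (simp add: card_cartesian_product mult.commute)
  let ?A = "{\<alpha> \<in> arrows Q. sig1 Q \<alpha> = \<alpha>}" and ?N = "{i \<in> nodes Q. sig0 Q i = i}"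
  have fin: "finite ?A" "finite ?N" using quiverD(1,2)[OF qv] by auto
  have fixed: "tgt Q \<alpha> = sig0 Q (src Q \<alpha>)" if "\<alpha> \<in> ?A" for \<alpha> using sig_arr(4)[of \<alpha>] that by simp
  have "{x\<in>corner_block. corner_flip x = x} = (\<lambda>(\<alpha>, l). (\<alpha>, l, l)) ` (SIGMA \<alpha>:?A. {..<u (tgt Q \<alpha>)})"
    unfolding corner_block_def corner_flip_def using fixed by (auto simp: image_iff)
  moreover have "inj_on (\<lambda>(\<alpha>, l). (\<alpha>, l, l)) (SIGMA \<alpha>:?A. {..<u (tgt Q \<alpha>)})" by (auto simp: inj_on_def)
  ultimately have "(\<Sum>x\<in>{x\<in>corner_block. corner_flip x = x}. corner_sign x) =
      (\<Sum>(\<alpha>, l)\<in>(SIGMA \<alpha>:?A. {..<u (tgt Q \<alpha>)}). - (sgn_tau Q \<alpha> * sgn_s Q (src Q \<alpha>)))"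
    by (simp add: sum.reindex corner_sign_def o_def case_prod_unfold)
  also have "\<dots> = (\<Sum>\<alpha>\<in>?A. \<Sum>l<u (tgt Q \<alpha>). - (sgn_tau Q \<alpha> * sgn_s Q (src Q \<alpha>)))"
    by (rule sum.Sigma[symmetric]) (use fin in auto)
  also have "\<dots> = - (\<Sum>\<alpha>\<in>?A. sgn_tau Q \<alpha> * sgn_s Q (tgt Q \<alpha>) * int (u (tgt Q \<alpha>)))"
    unfolding sum_negf[symmetric]
    using fixed sd_quiverD(9)[OF sdQ st(1)] by (intro sum.cong) (auto simp: algebra_simps)
  finally have CF: "(\<Sum>x\<in>{x\<in>corner_block. corner_flip x = x}. corner_sign x) =
      - (\<Sum>\<alpha>\<in>?A. sgn_tau Q \<alpha> * sgn_s Q (tgt Q \<alpha>) * int (u (tgt Q \<alpha>)))" .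
  have "{x\<in>node_block. node_flip x = x} = (\<lambda>(i, l). (i, l, l)) ` (SIGMA i:?N. {..<u i})"
    unfolding node_block_def node_flip_def by (auto simp: image_iff)
  moreover have "inj_on (\<lambda>(i, l). (i, l, l)) (SIGMA i:?N. {..<u i})" by (auto simp: inj_on_def)
  ultimately have "(\<Sum>x\<in>{x\<in>node_block. node_flip x = x}. node_sign x) = (\<Sum>(i, l)\<in>(SIGMA i:?N. {..<u i}). sgn_s Q i)"
    by (simp add: sum.reindex node_sign_def o_def case_prod_unfold)
  also have "\<dots> = (\<Sum>i\<in>?N. \<Sum>l<u i. sgn_s Q i)"
    by (rule sum.Sigma[symmetric]) (use fin in auto)
  also have "\<dots> = (\<Sum>i\<in>?N. sgn_s Q i * int (u i))" by (simp add: mult.commute)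
  finally have NF: "(\<Sum>x\<in>{x\<in>node_block. node_flip x = x}. node_sign x) = (\<Sum>i\<in>?N. sgn_s Q i * int (u i))" .
  have "euler Q (sig_vec Q d) d = (\<Sum>i\<in>nodes Q. int (u (sig0 Q i)) * int (u i)) -
      (\<Sum>\<alpha>\<in>arrows Q. int (u (sig0 Q (src Q \<alpha>))) * int (u (tgt Q \<alpha>)))"
    unfolding euler_def using d sig st by (simp add: sig_vec_def cong: sum.cong)
  moreover have "sd_linear Q d = (\<Sum>i\<in>?N. sgn_s Q i * int (u i)) +
      (\<Sum>\<alpha>\<in>?A. sgn_tau Q \<alpha> * sgn_s Q (tgt Q \<alpha>) * int (u (tgt Q \<alpha>)))"
    unfolding sd_linear_def using d st by (auto intro!: sum.cong arg_cong2[of _ _ _ _ "(+)"])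
  ultimately have "2 * (int node_exp - int e) = 2 * sd_euler Q P0 P1 d"
    unfolding sd_euler_double[OF sdQ P0 P1] right_diff_distrib e node_exp_card(1) C B CF NF by simp
  then show ?thesis by simp
qed

end

text \<open>Reads the self-duality axioms of \<open>M\<close> in a basis. Nondegeneracy passes to
  the Gram matrix because a combination orthogonal to all basis vectors is orthogonal to the whole
  block.\<close>

lemma split_data_of_reps:
  fixes M :: "('k::{field,finite}, 'w, 'v, 'a) sdrep"
  assumes odd: "odd CHAR('k)" and Q: "sd_quiver Q" and M: "is_sdrep Q M"
    and m: "\<And>i. i \<in> nodes Q \<Longrightarrow> int (m i) = dim_vector Q M i" and b: "b \<in> gram_bases Q M (\<lambda>i. {..<m i}) AM G"
  shows "split_data Q m AM G"
proof
  note MF = is_sdrep_form_rep[OF M]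
  note MR = form_repD(1)[OF MF] and MB = form_repD(2)[OF MF]
  note VM = is_repD(1)[OF MR] and sg = sd_quiverD(2,3)[OF Q] and sa = sd_quiverD(4-7)[OF Q]
  note B = rep_basesD[OF gram_basesD(1)[OF b]] and gr = gram_basesD(2)[OF b]
  note st = quiverD(3,4)[OF sd_quiverD(1)[OF Q]]
  show "sd_quiver Q" by (rule Q)
  show "(2 :: 'k) \<noteq> 0"
  proof
    \<comment> \<open>Then the characteristic divides 2. It is not 1, and 2 is excluded by
      oddness.\<close>
    assume "(2 :: 'k) = 0"
    then have "of_nat 2 = (0 :: 'k)" by simp
    then have dvd: "CHAR('k) dvd 2" by (rule of_nat_eq_0_iff_char_dvd[THEN iffD1])
    then have "CHAR('k) = 1 \<or> CHAR('k) = 2" using two_is_prime_nat prime_nat_iff by blast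
    then show False using odd CHAR_not_1' by auto
  qed
  show m_sig: "m (sig0 Q i) = m i" if i: "i \<in> nodes Q" for i
  proof -
    have "sig_vec Q (dim_vector Q M) i = dim_vector Q M i"
      using sdrep_dim_vector[OF Q M] unfolding Lambda_sig_pos_def by simp
    then show ?thesis using m[OF i] m[OF sg(1)[OF i]] i by (simp add: sig_vec_def)
  qed
  have bM: "b i x \<in> vecs M i" if "i \<in> nodes Q" "x < m i" for i x using B(3)[OF that(1)] that(2) by auto
  show "G i x y = of_int (sgn_s Q i) * G (sig0 Q i) y x" if i: "i \<in> nodes Q" and x: "x < m i" and y: "y < m i" for i x y
  proof -
    have y': "y < m (sig0 Q i)" using y m_sig[OF i] by simp
    show ?thesis
      using form_sym[OF Q M i bM[OF i x] bM[OF sg(1)[OF i] y']] gr[OF i, of x y] gr[OF sg(1)[OF i], of y x] x y' sg(2)[OF i]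
      by simp
  qed
  show "c x = 0" if i: "i \<in> nodes Q" and z: "\<And>y. y < m i \<Longrightarrow> (\<Sum>x<m i. c x * G i x y) = 0" and x: "x < m i" for i c x
  proof -
    define v where "v = lsum (vsp M i) {..<m i} c (b i)"
    note j = sg(1)[OF i]
    have vM: "v \<in> vecs M i" unfolding v_def by (rule lsum_closed[OF VM[OF i] B(3)[OF i]])
    have vb: "form M i (sig0 Q i) v (b (sig0 Q i) y) = 0" if y: "y < m (sig0 Q i)" for y
    proof -
      have "form M i (sig0 Q i) v (b (sig0 Q i) y) = (\<Sum>x<m i. c x * form M i (sig0 Q i) (b i x) (b (sig0 Q i) y))"
        unfolding v_def by (rule form_lsum_left[OF MR MB i j B(3)[OF i] finite_lessThan bM[OF j y]])
      also have "\<dots> = (\<Sum>x<m i. c x * G i x y)" using gr[OF i] y by (intro sum.cong) auto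
      finally show ?thesis using z[of y] y m_sig[OF i] by simp
    qed
    have "v = \<zero>\<^bsub>vsp M i\<^esub>"
    proof (rule block_nondegenerate[OF Q M i vM])
      fix w assume w: "w \<in> vecs M (sig0 Q i)"
      obtain a where a: "w = lsum (vsp M (sig0 Q i)) {..<m (sig0 Q i)} a (b (sig0 Q i))"
        using is_basis_span[OF B(2)[OF j] w] by blast
      have "form M i (sig0 Q i) v w = (\<Sum>y<m (sig0 Q i). a y * form M i (sig0 Q i) v (b (sig0 Q i) y))"
        unfolding a by (rule form_lsum_right[OF MR MB i j B(3)[OF j] finite_lessThan vM])
      then show "form M i (sig0 Q i) v w = 0" using vb by simp
    qed
    then show ?thesis using is_basis_indep[OF B(2)[OF i], of c x] x by (simp add: v_def)
  qed
  show "(\<Sum>z<m (tgt Q \<alpha>). AM \<alpha> z x * G (tgt Q \<alpha>) z y) =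
      of_int (sgn_tau Q \<alpha>) * (\<Sum>z<m (src Q \<alpha>). G (src Q \<alpha>) x z * AM (sig1 Q \<alpha>) z y)"
    if \<alpha>: "\<alpha> \<in> arrows Q" and x: "x < m (src Q \<alpha>)" and y: "y < m (tgt Q \<alpha>)" for \<alpha> x y
  proof -
    let ?i = "src Q \<alpha>" and ?j = "tgt Q \<alpha>"
    note i = st(1)[OF \<alpha>] and j = st(2)[OF \<alpha>]
    have y': "y < m (sig0 Q ?j)" using y m_sig[OF j] by simp
    note bx = bM[OF i x] and by' = bM[OF sg(1)[OF j] y']
    have "form M ?j (sig0 Q ?j) (lmap M \<alpha> (b ?i x)) (b (sig0 Q ?j) y) =
        (\<Sum>z<m ?j. AM \<alpha> z x * form M ?j (sig0 Q ?j) (b ?j z) (b (sig0 Q ?j) y))"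
      using form_lsum_left[OF MR MB j sg(1)[OF j] B(3)[OF j] finite_lessThan by', of "\<lambda>z. AM \<alpha> z x"] B(4)[OF \<alpha>, of x] x by simp
    also have "\<dots> = (\<Sum>z<m ?j. AM \<alpha> z x * G ?j z y)" using gr[OF j] y' by (intro sum.cong) auto
    finally have L: "form M ?j (sig0 Q ?j) (lmap M \<alpha> (b ?i x)) (b (sig0 Q ?j) y) = (\<Sum>z<m ?j. AM \<alpha> z x * G ?j z y)" .
    have "lmap M (sig1 Q \<alpha>) (b (sig0 Q ?j) y) =
        lsum (vsp M (sig0 Q ?i)) {..<m (sig0 Q ?i)} (\<lambda>z. AM (sig1 Q \<alpha>) z y) (b (sig0 Q ?i))"
      using B(4)[OF sa(1)[OF \<alpha>], of y] y' by (simp add: sa(3,4)[OF \<alpha>])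
    then have "form M ?i (sig0 Q ?i) (b ?i x) (lmap M (sig1 Q \<alpha>) (b (sig0 Q ?j) y)) =
        (\<Sum>z<m (sig0 Q ?i). AM (sig1 Q \<alpha>) z y * form M ?i (sig0 Q ?i) (b ?i x) (b (sig0 Q ?i) z))"
      using form_lsum_right[OF MR MB i sg(1)[OF i] B(3)[OF sg(1)[OF i]] finite_lessThan bx] by simp
    also have "\<dots> = (\<Sum>z<m ?i. G ?i x z * AM (sig1 Q \<alpha>) z y)"
      using gr[OF i] x m_sig[OF i] by (intro sum.cong) auto
    finally show ?thesis using form_adj[OF M \<alpha> bx by'] L by simp
  qed
qed

section \<open>The mass formula and the integration maps\<close>

text \<open>Reflexivity makes the class nonempty, so the choice in \<open>representative\<close>
  falls inside it; symmetry and transitivity then allow the chosen member to stand for the one that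
  defined the class.\<close>

lemma isometry_class:
  fixes D :: "('k::field, 'w, 'v, 'a) sdrep set"
  assumes Q: "sd_quiver Q" and D: "D \<in> isometry_classes Q"
  shows "is_sdrep Q (representative D)" "D = {X. is_sdrep Q X \<and> isometric Q (representative D) X}"
proof -
  note F = is_sdrep_form_rep
  obtain M :: "('k, 'w, 'v, 'a) sdrep" where "M \<in> {M. is_sdrep Q M}"
    "D = {(M, M'). is_sdrep Q M \<and> is_sdrep Q M' \<and> isometric Q M M'} `` {M}"
    using D unfolding isometry_classes_def by (rule quotientE)
  then have M: "is_sdrep Q M" "D = {M'. is_sdrep Q M' \<and> isometric Q M M'}" by auto
  have "M \<in> D" using isometric_refl[OF sd_quiverD(1)[OF Q] form_repD(1)[OF F[OF M(1)]]] M by blast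
  then have "representative D \<in> D" unfolding representative_def by (rule someI)
  then have R: "is_sdrep Q (representative D)" "isometric Q M (representative D)" using M(2) by auto
  show "is_sdrep Q (representative D)" by (rule R(1))
  show "D = {X. is_sdrep Q X \<and> isometric Q (representative D) X}"
  proof (intro equalityI subsetI)
    note sym = isometric_sym[OF Q F[OF M(1)] F[OF R(1)] R(2)]
    fix X
    show "X \<in> {X. is_sdrep Q X \<and> isometric Q (representative D) X}" if "X \<in> D"
    proof -
      have X: "is_sdrep Q X" "isometric Q M X" using that by (auto simp: M(2))
      show ?thesis using isometric_trans[OF Q F[OF R(1)] F[OF M(1)] F[OF X(1)] sym X(2)] X(1) by simp
    qed
    show "X \<in> D" if "X \<in> {X. is_sdrep Q X \<and> isometric Q (representative D) X}"
    proof -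
      have X: "is_sdrep Q X" "isometric Q (representative D) X" using that by auto
      show ?thesis
        using isometric_trans[OF Q F[OF M(1)] F[OF R(1)] F[OF X(1)] R(2) X(2)] X(1) by (subst M(2)) simp
    qed
  qed
qed

lemma isometry_class_eqI:
  fixes D D' :: "('k::field, 'w, 'v, 'a) sdrep set"
  assumes Q: "sd_quiver Q" and D: "D \<in> isometry_classes Q" "D' \<in> isometry_classes Q"
    and iso: "isometric Q (representative D) (representative D')"
  shows "D = D'"
proof -
  note F = is_sdrep_form_rep
  note A = isometry_class[OF Q D(1)] and B = isometry_class[OF Q D(2)]
  note sym = isometric_sym[OF Q F[OF A(1)] F[OF B(1)] iso]
  have "X \<in> D \<longleftrightarrow> X \<in> D'" for X
  proof
    assume "X \<in> D"
    then have X: "is_sdrep Q X" "isometric Q (representative D) X" using A(2) by auto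
    from isometric_trans[OF Q F[OF B(1)] F[OF A(1)] F[OF X(1)] sym X(2)]
    show "X \<in> D'" using X(1) by (subst B(2)) simp
  next
    assume "X \<in> D'"
    then have X: "is_sdrep Q X" "isometric Q (representative D') X" using B(2) by auto
    from isometric_trans[OF Q F[OF A(1)] F[OF B(1)] F[OF X(1)] iso X(2)]
    show "X \<in> D" using X(1) by (subst A(2)) simp
  qed
  then show ?thesis by blast
qed

lemma isometry_class_exists:
  fixes X :: "('k::field, 'w, 'v, 'a) sdrep"
  assumes Q: "sd_quiver Q" and X: "is_sdrep Q X"
  shows "\<exists>D\<in>(isometry_classes Q :: ('k, 'w, 'v, 'a) sdrep set set). isometric Q X (representative D)"
proof -
  define D :: "('k, 'w, 'v, 'a) sdrep set" where "D = {(M, M'). is_sdrep Q M \<and> is_sdrep Q M' \<and> isometric Q M M'} `` {X}"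
  have D: "D \<in> isometry_classes Q" unfolding isometry_classes_def D_def by (rule quotientI) (simp add: X)
  have "X \<in> D"
    using isometric_refl[OF sd_quiverD(1)[OF Q] form_repD(1)[OF is_sdrep_form_rep[OF X]]] X by (simp add: D_def)
  then have "representative D \<in> D" unfolding representative_def by (rule someI)
  then show ?thesis using D by (auto simp: D_def)
qed

lemma iso_class_rep:
  fixes C :: "('k::field, 'w, 'v, 'a) rep set"
  assumes Q: "quiver Q" and C: "C \<in> iso_classes Q"
  shows "is_rep Q (representative C)"
proof -
  obtain M :: "('k, 'w, 'v, 'a) rep" where "M \<in> {M. is_rep Q M}"
    "C = {(M, M'). is_rep Q M \<and> is_rep Q M' \<and> rep_isomorphic Q M M'} `` {M}"
    using C unfolding iso_classes_def by (rule quotientE)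
  then have M: "is_rep Q M" "C = {M'. is_rep Q M' \<and> rep_isomorphic Q M M'}" by auto
  obtain A b where "b \<in> rep_bases Q M (\<lambda>i. {..<nat (dim_vector Q M i)}) A"
    using rep_bases_exist[OF Q M(1)] by blast
  then have "rep_isomorphic Q M M"
    unfolding rep_isomorphic_def using iso_of_bases_in_rep_isos[OF Q M(1) M(1)] by blast
  then have "M \<in> C" using M by simp
  then have "representative C \<in> C" unfolding representative_def by (rule someI)
  then show ?thesis using M(2) by blast
qed

section \<open>Frames summed over isometry classes\<close>

context split_data
begin

text \<open>An isotropic subrepresentation contributes the product of the two automorphism numbers
  exactly when it is counted by \<open>hall_G\<close>, and otherwise nothing.\<close>

lemma card_frames_hall_G:
  fixes N :: "('k, 'w, 'v, 'a) sdrep"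
  assumes N: "is_sdrep Q N" and U: "is_rep Q U" "rep_bases Q U (\<lambda>i. {..<u i}) AU \<noteq> {}"
    and M: "is_sdrep Q M" "gram_bases Q M (\<lambda>i. {..<m i}) AM G \<noteq> {}"
  shows "card (frames N) =
    hall_G Q U M N * (aut_card Q U * sd_aut_card Q M) * CARD('k) ^ ((\<Sum>i\<in>nodes Q. m i * u i) + node_exp)"
proof -
  let ?S = "{U' \<in> subreps Q N. isotropic Q N U'}"
  let ?P = "\<lambda>U'. rep_isomorphic Q (restrict_rep N U') U \<and> isometric Q (sd_reduction Q N U') M"
  have "card (triples N) = (\<Sum>U'\<in>?S. if ?P U' then aut_card Q U * sd_aut_card Q M else 0)"
    unfolding card_triples[OF N]
  proof (rule sum.cong[OF refl])
    fix U' assume U': "U' \<in> ?S"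
    interpret I: isotropic_sub Q N U' by unfold_locales (use sdQ N U' in auto)
    have "is_rep Q (restrict_rep N U')" using finite_triples(3)[OF N] U' by blast
    from aut_card_eq_card_bases[OF qv U(1) this U(2)]
      sd_aut_card_eq_card_bases[OF sdQ is_sdrep_form_rep[OF M(1)] I.R_form_rep M(2)]
    show "card (rep_bases Q (restrict_rep N U') (\<lambda>i. {..<u i}) AU) *
        card (gram_bases Q (sd_reduction Q N U') (\<lambda>i. {..<m i}) AM G) =
        (if ?P U' then aut_card Q U * sd_aut_card Q M else 0)" by simp
  qed
  also have "\<dots> = card {U' \<in> ?S. ?P U'} * (aut_card Q U * sd_aut_card Q M)"
    using finite_triples(2)[OF N] by (simp add: sum.If_cases Int_def)
  also have "{U' \<in> ?S. ?P U'} = {U' \<in> subreps Q N. rep_isomorphic Q (restrict_rep N U') U \<and>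
     isotropic Q N U' \<and> isometric Q (sd_reduction Q N U') M}" by blast
  finally show ?thesis unfolding card_frames_triples[OF N] hall_G_def by simp
qed

lemma frames_dim:
  assumes N: "is_sdrep Q N" and b: "frames N \<noteq> {}" and i: "i \<in> nodes Q"
  shows "dim_vector Q N i = int (u i) + int (u (sig0 Q i)) + int (m i)"
proof -
  obtain b p where b: "b \<in> gram_bases Q N idx (coef p) gram" using assms(2) unfolding frames_def by blast
  note NR = form_repD(1)[OF is_sdrep_form_rep[OF N]]
  show ?thesis
    using dim_of_basis[OF is_repD(1)[OF NR i] rep_basesD(2)[OF gram_basesD(1)[OF b] i]] i
    by (simp add: dim_vector_def card_idx)
qed

text \<open>Each parameter is realized in exactly one isometry class, and there its bases are as
  many as the self-isometries; so it contributes 1 to the sum. \<open>T\<close> may be larger than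
  the support, so that one set can serve several pairs of \<open>U\<close> and
  \<open>M\<close>.\<close>

lemma sum_frames_over_classes:
  fixes T :: "('k, 'w::infinite, 'v, 'a) sdrep set set"
  assumes T: "finite T" "T \<subseteq> isometry_classes Q"
    and sub: "\<And>D. D \<in> isometry_classes Q \<Longrightarrow> frames (representative D) \<noteq> {} \<Longrightarrow> D \<in> T"
  shows "(\<Sum>D\<in>T. real (card (frames (representative D))) / real (sd_aut_card Q (representative D))) = real (card params)"
proof -
  note F = is_sdrep_form_rep
  let ?G = "\<lambda>D p. gram_bases Q (representative D) idx (coef p) gram"
  have cls_unique: "D = D'"
    if "D \<in> isometry_classes Q" "D' \<in> isometry_classes Q" "?G D p \<noteq> {}" "?G D' p \<noteq> {}"
    for D D' :: "('k, 'w, 'v, 'a) sdrep set" and p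
    using isometry_class_eqI[OF sdQ that(1,2)] that(3,4)
      isometric_iff_bases[OF sdQ F[OF isometry_class(1)[OF sdQ that(1)]] F[OF isometry_class(1)[OF sdQ that(2)]] that(3)]
    by blast
  have "\<exists>D. D \<in> T \<and> ?G D p \<noteq> {}" if p: "p \<in> params" for p
  proof -
    obtain X :: "('k, 'w, 'v, 'a) sdrep" where X: "is_sdrep Q X" "gram_bases Q X idx (coef p) gram \<noteq> {}"
      using realization_params[OF p] by blast
    obtain D :: "('k, 'w, 'v, 'a) sdrep set" where D: "D \<in> isometry_classes Q" "isometric Q X (representative D)"
      using isometry_class_exists[OF sdQ X(1)] by blast
    then have "?G D p \<noteq> {}"
      using isometric_iff_bases[OF sdQ F[OF X(1)] F[OF isometry_class(1)[OF sdQ D(1)]] X(2)] by blast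
    then show ?thesis using sub[OF D(1)] p unfolding frames_def by blast
  qed
  then obtain cls where cls: "\<And>p. p \<in> params \<Longrightarrow> cls p \<in> T" "\<And>p. p \<in> params \<Longrightarrow> ?G (cls p) p \<noteq> {}" by metis
  \<comment> \<open>The contribution of one parameter is concentrated in its own class.\<close>
  have one: "real (card (?G D p)) / real (sd_aut_card Q (representative D)) = (if D = cls p then 1 else 0)"
    if D: "D \<in> T" and p: "p \<in> params" for D p
  proof -
    have Dc: "D \<in> isometry_classes Q" using D T(2) by blast
    note R = isometry_class(1)[OF sdQ Dc]
    show ?thesis
    proof (cases "?G D p = {}")
      case True
      then have "D \<noteq> cls p" using cls(2)[OF p] by blast
      then show ?thesis using True by simp
    next
      case False
      have "D = cls p" by (rule cls_unique[OF Dc _ False cls(2)[OF p]]) (use cls(1)[OF p] T(2) in blast)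
      moreover have "card (?G D p) = sd_aut_card Q (representative D)"
        using sd_aut_card_eq_card_bases[OF sdQ F[OF R] F[OF R] False]
          isometric_refl[OF qv form_repD(1)[OF F[OF R]]] by simp
      moreover have "card (?G D p) \<noteq> 0"
        using False finite_gram_bases[OF qv form_repD(1)[OF F[OF R]], of idx "coef p" gram] by (simp add: card_eq_0_iff)
      ultimately show ?thesis by simp
    qed
  qed
  have "(\<Sum>D\<in>T. real (card (frames (representative D))) / real (sd_aut_card Q (representative D))) =
      (\<Sum>D\<in>T. \<Sum>p\<in>params. if D = cls p then 1 else 0)"
  proof (rule sum.cong[OF refl])
    fix D assume D: "D \<in> T"
    note R = isometry_class(1)[OF sdQ subsetD[OF T(2) D]]
    have "real (card (frames (representative D))) / real (sd_aut_card Q (representative D)) =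
        (\<Sum>p\<in>params. real (card (?G D p)) / real (sd_aut_card Q (representative D)))"
      by (simp add: card_frames[OF R] sum_divide_distrib)
    also have "\<dots> = (\<Sum>p\<in>params. if D = cls p then 1 else 0)" by (rule sum.cong[OF refl]) (rule one[OF D])
    finally show "real (card (frames (representative D))) / real (sd_aut_card Q (representative D)) =
        (\<Sum>p\<in>params. if D = cls p then 1 else 0)" .
  qed
  also have "\<dots> = (\<Sum>p\<in>params. \<Sum>D\<in>T. if D = cls p then 1 else 0)" by (rule sum.swap)
  also have "\<dots> = (\<Sum>p\<in>params. 1)" by (rule sum.cong[OF refl]) (use cls(1) T(1) in simp)
  finally show ?thesis by simp
qed

text \<open>There are finitely many parameters, and each occurs in at most one class.\<close>

lemma finite_frame_classes:
  "finite {D :: ('k, 'w, 'v, 'a) sdrep set. D \<in> isometry_classes Q \<and> frames (representative D) \<noteq> {}}"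
proof -
  note F = is_sdrep_form_rep
  let ?G = "\<lambda>(D :: ('k, 'w, 'v, 'a) sdrep set) p. gram_bases Q (representative D) idx (coef p) gram"
  let ?S = "\<lambda>p. {D :: ('k, 'w, 'v, 'a) sdrep set. D \<in> isometry_classes Q \<and> ?G D p \<noteq> {}}"
  have "finite (?S p)" for p
  proof (cases "?S p = {}")
    case False
    then obtain D where D: "D \<in> ?S p" by blast
    then have D: "D \<in> isometry_classes Q" "?G D p \<noteq> {}" by auto
    have "D = D'" if D': "D' \<in> isometry_classes Q" "?G D' p \<noteq> {}" for D'
      by (rule isometry_class_eqI[OF sdQ D(1) D'(1)])
        (use isometric_iff_bases[OF sdQ F[OF isometry_class(1)[OF sdQ D(1)]] F[OF isometry_class(1)[OF sdQ D'(1)]] D(2)] D'(2)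
          in blast)
    then have "?S p \<subseteq> {D}" by blast
    then show ?thesis using finite_subset by blast
  next
    case True
    show ?thesis unfolding True by simp
  qed
  then have "finite (\<Union>p\<in>params. ?S p)" using finite_params by blast
  then show ?thesis by (rule rev_finite_subset) (auto simp: frames_def)
qed

end

section \<open>Half-integral powers of q and the mass formula\<close>

lemma qhalf_add: "q > 0 \<Longrightarrow> qhalf q (a + b) = qhalf q a * qhalf q b"
  by (simp add: qhalf_def power_int_add)

lemma power_qhalf: "real q ^ n = qhalf q (2 * int n)"
proof -
  have "qhalf q (2 * int n) = sqrt (real q) ^ (2 * n)"
    unfolding qhalf_def by (simp flip: power_int_of_nat)
  then show ?thesis by (simp add: power_mult)
qed

text \<open>The number of parameters equals the weighted sum of frames over classes, in which the
  frames of each class are the structure constant times factors common to all classes. Dividing by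
  these factors leaves the sum of the constants. The exponent is doubled because
  \<open>qhalf\<close> counts powers of the square root of q.\<close>

lemma mass_formula:
  fixes Q :: "('v, 'a) sdquiver" and U :: "('k::{field,finite}, 'w::infinite, 'v, 'a) rep" and M :: "('k, 'w, 'v, 'a) sdrep"
  assumes odd: "odd CHAR('k)" and Q: "sd_quiver Q"
    and P0: "is_positive_part (sig0 Q) (nodes Q) P0" and P1: "is_positive_part (sig1 Q) (arrows Q) P1"
    and U: "is_rep Q U" and M: "is_sdrep Q M"
  shows "finite {D \<in> isometry_classes Q. hall_G Q U M (representative D) \<noteq> 0}"
    and "D \<in> isometry_classes Q \<Longrightarrow> hall_G Q U M (representative D) \<noteq> 0 \<Longrightarrow>
      dim_vector Q (representative D) = (\<lambda>i. hyp_vec Q (dim_vector Q U) i + dim_vector Q M i)"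
    and "finite T \<Longrightarrow> T \<subseteq> isometry_classes Q \<Longrightarrow>
      {D \<in> isometry_classes Q. hall_G Q U M (representative D) \<noteq> 0} \<subseteq> T \<Longrightarrow>
      (\<Sum>D\<in>T. real (hall_G Q U M (representative D)) / real (sd_aut_card Q (representative D))) =
      qhalf CARD('k) (- 2 * (euler Q (dim_vector Q M) (dim_vector Q U) + sd_euler Q P0 P1 (dim_vector Q U))) /
        (real (aut_card Q U) * real (sd_aut_card Q M))"
proof -
  note Q0 = sd_quiverD(1)[OF Q]
  define u where "u i = nat (dim_vector Q U i)" for i
  define m where "m i = nat (dim_vector Q M i)" for i
  have u: "int (u i) = dim_vector Q U i" and m: "int (m i) = dim_vector Q M i" if "i \<in> nodes Q" for i
    using that by (simp_all add: u_def m_def dim_vector_def)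
  obtain AU where AU: "rep_bases Q U (\<lambda>i. {..<u i}) AU \<noteq> {}" using rep_bases_exist[OF Q0 U] unfolding u_def by blast
  obtain AM G where AM: "gram_bases Q M (\<lambda>i. {..<m i}) AM G \<noteq> {}"
    using gram_bases_exist[OF Q form_repD(1)[OF is_sdrep_form_rep[OF M]]] unfolding m_def by blast
  interpret split_data Q u m AU AM G
    using split_data_of_reps[OF odd Q M m] AM by blast
  have autU: "aut_card Q U \<noteq> 0"
  proof -
    obtain b where b: "b \<in> rep_bases Q U (\<lambda>i. {..<u i}) AU" using AU by blast
    have "rep_isomorphic Q U U" using iso_of_bases_in_rep_isos[OF Q0 U U b b] unfolding rep_isomorphic_def by blast
    then have "card (rep_bases Q U (\<lambda>i. {..<u i}) AU) = aut_card Q U"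
      using aut_card_eq_card_bases[OF Q0 U U AU] by simp
    then show ?thesis using AU finite_rep_bases[OF Q0 U, of "\<lambda>i. {..<u i}" AU] by (auto simp: card_eq_0_iff)
  qed
  have autM: "sd_aut_card Q M \<noteq> 0"
  proof -
    note F = is_sdrep_form_rep[OF M]
    have "card (gram_bases Q M (\<lambda>i. {..<m i}) AM G) = sd_aut_card Q M"
      using sd_aut_card_eq_card_bases[OF Q F F AM] isometric_refl[OF Q0 form_repD(1)[OF F]] by simp
    then show ?thesis using AM finite_gram_bases[OF Q0 form_repD(1)[OF F], of "\<lambda>i. {..<m i}" AM G] by (auto simp: card_eq_0_iff)
  qed
  let ?a = "(\<Sum>i\<in>nodes Q. m i * u i) + node_exp"
  have q: "CARD('k) > 0" using card_field_gt_1[where 'k = 'k] by simp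
  have cf: "card (frames N) = hall_G Q U M N * (aut_card Q U * sd_aut_card Q M) * CARD('k) ^ ?a"
    if "is_sdrep Q N" for N :: "('k, 'w, 'v, 'a) sdrep"
    by (rule card_frames_hall_G[OF that U AU M AM])
  have ff: "finite (frames N)" if "is_sdrep Q N" for N :: "('k, 'w, 'v, 'a) sdrep"
    unfolding frames_def using finite_params finite_gram_bases[OF Q0 form_repD(1)[OF is_sdrep_form_rep[OF that]]] by blast
  have iff: "frames N \<noteq> {} \<longleftrightarrow> hall_G Q U M N \<noteq> 0" if "is_sdrep Q N" for N :: "('k, 'w, 'v, 'a) sdrep"
    using cf[OF that] autU autM q card_0_eq[OF ff[OF that]] by auto
  have eq: "{D :: ('k, 'w, 'v, 'a) sdrep set. D \<in> isometry_classes Q \<and> frames (representative D) \<noteq> {}} =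
      {D \<in> isometry_classes Q. hall_G Q U M (representative D) \<noteq> 0}"
    using iff isometry_class(1)[OF Q] by blast
  show "finite {D \<in> isometry_classes Q. hall_G Q U M (representative D) \<noteq> 0}"
    unfolding eq[symmetric] by (rule finite_frame_classes)
  show "dim_vector Q (representative D) = (\<lambda>i. hyp_vec Q (dim_vector Q U) i + dim_vector Q M i)"
    if D: "D \<in> isometry_classes Q" "hall_G Q U M (representative D) \<noteq> 0"
  proof
    fix i
    note R = isometry_class(1)[OF Q D(1)]
    show "dim_vector Q (representative D) i = hyp_vec Q (dim_vector Q U) i + dim_vector Q M i"
    proof (cases "i \<in> nodes Q")
      case True
      then show ?thesis
        using frames_dim[OF R _ True] iff[OF R] D(2) u m sd_quiverD(2)[OF Q True] by (simp add: hyp_vec_def sig_vec_def)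
    next
      case False
      then show ?thesis by (simp add: dim_vector_def hyp_vec_def sig_vec_def)
    qed
  qed
  assume T: "finite T" "T \<subseteq> isometry_classes Q"
    "{D \<in> isometry_classes Q. hall_G Q U M (representative D) \<noteq> 0} \<subseteq> T"
  let ?S = "\<Sum>D\<in>T. real (hall_G Q U M (representative D)) / real (sd_aut_card Q (representative D))"
  let ?au = "real (aut_card Q U) * real (sd_aut_card Q M)"
  have "?S * (?au * real CARD('k) ^ ?a) =
      (\<Sum>D\<in>T. real (card (frames (representative D))) / real (sd_aut_card Q (representative D)))"
    unfolding sum_distrib_right
  proof (rule sum.cong[OF refl])
    fix D assume "D \<in> T"
    then have "is_sdrep Q (representative D)" using isometry_class(1)[OF Q] T(2) by blast
    from cf[OF this] show "real (hall_G Q U M (representative D)) / real (sd_aut_card Q (representative D)) *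
        (?au * real CARD('k) ^ ?a) = real (card (frames (representative D))) / real (sd_aut_card Q (representative D))"
      by simp
  qed
  also have "\<dots> = real (card params)"
    by (rule sum_frames_over_classes[OF T(1,2)]) (use T(3) eq in blast)
  finally have S: "?S * (?au * real CARD('k) ^ ?a) = real (card params)" .
  obtain e where e: "card params = CARD('k) ^ (card mid_block + e)"
    "2 * int e = int (card corner_block) - (\<Sum>x\<in>{x\<in>corner_block. corner_flip x = x}. corner_sign x)"
    using card_params by blast
  have E1: "int node_exp - int e = sd_euler Q P0 P1 (dim_vector Q U)"
    by (rule corner_node_exp[OF P0 P1 e(2)]) (use u in simp)
  have "euler Q (dim_vector Q M) (dim_vector Q U) = (\<Sum>i\<in>nodes Q. int (m i) * int (u i)) - int (card mid_block)"
    unfolding euler_def card_mid_block using u m quiverD(3,4)[OF Q0] by (simp cong: sum.cong)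
  \<comment> \<open>Node part and arrow part combine to \<chi>(m, u), and the two twisted symmetry
    exponents to \<E>(u).\<close>
  then have X: "2 * int (card mid_block + e) =
      - 2 * (euler Q (dim_vector Q M) (dim_vector Q U) + sd_euler Q P0 P1 (dim_vector Q U)) + 2 * int ?a"
    using E1 by simp
  have "real (card params) = qhalf CARD('k) (2 * int (card mid_block + e))"
    unfolding e(1) of_nat_power by (rule power_qhalf)
  also have "\<dots> = qhalf CARD('k) (- 2 * (euler Q (dim_vector Q M) (dim_vector Q U) + sd_euler Q P0 P1 (dim_vector Q U))) * real CARD('k) ^ ?a"
    by (simp only: X qhalf_add[OF q] power_qhalf)
  finally have S': "?S * (?au * real CARD('k) ^ ?a) =
      qhalf CARD('k) (- 2 * (euler Q (dim_vector Q M) (dim_vector Q U) + sd_euler Q P0 P1 (dim_vector Q U))) * real CARD('k) ^ ?a"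
    unfolding S .
  have cancel: "x * y = z" if "x * (y * w) = z * w" "w \<noteq> 0" for x y z w :: real
    using that by (simp flip: mult.assoc)
  have "real CARD('k) ^ ?a \<noteq> 0" using q by simp
  with S' have "?S * ?au = qhalf CARD('k) (- 2 * (euler Q (dim_vector Q M) (dim_vector Q U) + sd_euler Q P0 P1 (dim_vector Q U)))"
    by (rule cancel)
  then show "?S = qhalf CARD('k) (- 2 * (euler Q (dim_vector Q M) (dim_vector Q U) + sd_euler Q P0 P1 (dim_vector Q U))) / ?au"
    using autU autM by (simp add: nonzero_eq_divide_eq)
qed

section \<open>Comparison of coefficients on both sides\<close>

lemma sum_product_distrib:
  fixes y :: real
  shows "(\<Sum>i\<in>A. a i) * (\<Sum>j\<in>B. b j) * y = (\<Sum>i\<in>A. \<Sum>j\<in>B. a i * b j * y)"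
  by (subst sum_product) (simp only: sum_distrib_right)

lemma sum_swap3:
  "(\<Sum>x\<in>A. \<Sum>y\<in>B. \<Sum>z\<in>C. g x y z) = (\<Sum>y\<in>B. \<Sum>z\<in>C. \<Sum>x\<in>A. g x y z)"
  by (subst sum.swap) (intro sum.cong refl sum.swap)

text \<open>All entries are nonnegative, so those of \<open>d\<close> and \<open>e\<close> are
  bounded by \<open>c\<close>. Finiteness matters because a sum over an infinite set would be 0 by
  convention.\<close>

lemma finite_torus_index:
  assumes "finite (nodes Q)"
  shows "finite {(d, e). d \<in> Lambda_pos Q \<and> e \<in> Lambda_sig_pos Q \<and> (\<lambda>i. hyp_vec Q d i + e i) = c}"
proof -
  let ?B = "\<Union>i\<in>nodes Q. {0..c i}"
  let ?F = "{f. \<forall>i. (i \<in> nodes Q \<longrightarrow> f i \<in> ?B) \<and> (i \<notin> nodes Q \<longrightarrow> f i = 0)}"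
  have fin: "finite ?F" by (rule finite_set_of_finite_funs) (use assms in auto)
  have "d \<in> ?F \<and> e \<in> ?F" if de: "d \<in> Lambda_pos Q" "e \<in> Lambda_sig_pos Q" "(\<lambda>i. hyp_vec Q d i + e i) = c" for d e
  proof -
    have e: "e \<in> Lambda_pos Q" "sig_vec Q e = e" using de(2) by (auto simp: Lambda_sig_pos_def)
    have "d i \<in> {0..c i} \<and> e i \<in> {0..c i}" if i: "i \<in> nodes Q" for i
    proof -
      have "d i \<ge> 0" "e i \<ge> 0" "d (sig0 Q i) \<ge> 0"
        using de(1) e(1) i by (auto simp: Lambda_pos_def)
      then show ?thesis using fun_cong[OF de(3), of i] i by (auto simp: hyp_vec_def sig_vec_def)
    qed
    then show ?thesis using de(1) e(1) unfolding Lambda_pos_def by blast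
  qed
  then have "{(d, e). d \<in> Lambda_pos Q \<and> e \<in> Lambda_sig_pos Q \<and> (\<lambda>i. hyp_vec Q d i + e i) = c} \<subseteq> ?F \<times> ?F"
    by auto
  then show ?thesis using finite_subset finite_cartesian_product[OF fin fin] by blast
qed

theorem theorem3p1:
  fixes Q :: "('v, 'a) sdquiver"
    and P0 :: "'v set" and P1 :: "'a set"
    and f :: "('k::{field, finite}, 'w::infinite, 'v, 'a) rep set \<Rightarrow> rat"
    and m :: "('k, 'w, 'v, 'a) sdrep set \<Rightarrow> rat"
  assumes "odd CHAR('k)"
    and "sd_quiver Q"
    and "is_positive_part (sig0 Q) (nodes Q) P0"
    and "is_positive_part (sig1 Q) (arrows Q) P1"
    and "f \<in> hall_algebra Q"
    and "m \<in> hall_module Q"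
  shows "int_M Q P0 P1 (hall_act Q f m) =
         torus_act CARD('k) Q P0 P1 (int_H Q f) (int_M Q P0 P1 m)"
proof
  fix c :: "'v \<Rightarrow> int"
  note Q = assms(2)
  note mass = mass_formula[OF assms(1-4)]
  have q: "CARD('k) > 0" using card_field_gt_1[where 'k = 'k] by simp
  let ?Cs = "{C. f C \<noteq> 0}" and ?Ds = "{D. m D \<noteq> 0}"
  have fin: "finite ?Cs" "finite ?Ds" and cls: "?Cs \<subseteq> iso_classes Q" "?Ds \<subseteq> isometry_classes Q"
    using assms(5,6) unfolding hall_algebra_def hall_module_def by auto
  have C: "is_rep Q (representative C)" if "C \<in> ?Cs" for C
    using iso_class_rep[OF sd_quiverD(1)[OF Q]] cls(1) that by blast
  have D: "is_sdrep Q (representative D)" if "D \<in> ?Ds" for D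
    using isometry_class(1)[OF Q] cls(2) that by blast
  let ?H = "\<lambda>C D N. hall_G Q (representative C) (representative D) (representative N)"
  let ?F = "\<lambda>C D. {N \<in> isometry_classes Q. ?H C D N \<noteq> 0}"
  \<comment> \<open>One finite set of classes carries all structure constants that occur, so that
    the sums can be interchanged.\<close>
  define T where "T = (\<Union>C\<in>?Cs. \<Union>D\<in>?Ds. ?F C D)"
  have T: "finite T" "T \<subseteq> isometry_classes Q" "\<And>C D. C \<in> ?Cs \<Longrightarrow> D \<in> ?Ds \<Longrightarrow> ?F C D \<subseteq> T"
    unfolding T_def using fin mass(1)[OF C D] by auto
  have act0: "hall_act Q f m N = 0" if N: "N \<notin> T" for N
  proof -
    have "?H C D N = 0" if "C \<in> ?Cs" "D \<in> ?Ds" "N \<in> isometry_classes Q" for C D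
      using that N unfolding T_def by blast
    then show ?thesis unfolding hall_act_def by (auto intro!: sum.neutral)
  qed
  define dC where "dC C = dim_vector Q (representative C)" for C :: "('k, 'w, 'v, 'a) rep set"
  define dD where "dD D = dim_vector Q (representative D)" for D :: "('k, 'w, 'v, 'a) sdrep set"
  define wC where "wC C = qhalf CARD('k) (euler Q (dC C) (dC C)) / real (aut_card Q (representative C))" for C :: "('k, 'w, 'v, 'a) rep set"
  define wD where "wD D = qhalf CARD('k) (sd_euler Q P0 P1 (dD D)) / real (sd_aut_card Q (representative D))" for D :: "('k, 'w, 'v, 'a) sdrep set"
  have dCp: "dC C \<in> Lambda_pos Q" for C by (auto simp: dC_def dim_vector_def Lambda_pos_def)
  have dDp: "dD D \<in> Lambda_sig_pos Q" if "D \<in> ?Ds" for D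
    unfolding dD_def by (rule sdrep_dim_vector[OF Q D[OF that]])
  let ?h = "\<lambda>C D. (\<lambda>i. hyp_vec Q (dC C) i + dD D i)"
  let ?x = "\<lambda>C D. skew_euler Q (dC C) (dD D) - sd_euler_tilde Q P0 P1 (dC C)"
  have key: "(\<Sum>N\<in>T. real (?H C D N) * (wD N * basis_vec (dD N) c)) =
      wC C * wD D * qhalf CARD('k) (?x C D) * (if ?h C D = c then 1 else 0)" if CD: "C \<in> ?Cs" "D \<in> ?Ds" for C D
  proof -
    have "(\<Sum>N\<in>T. real (?H C D N) * (wD N * basis_vec (dD N) c)) =
        (\<Sum>N\<in>T. (real (?H C D N) / real (sd_aut_card Q (representative N))) * (qhalf CARD('k) (sd_euler Q P0 P1 (?h C D)) * (if ?h C D = c then 1 else 0)))"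
    proof (rule sum.cong[OF refl])
      fix N assume N: "N \<in> T"
      show "real (?H C D N) * (wD N * basis_vec (dD N) c) =
        (real (?H C D N) / real (sd_aut_card Q (representative N))) * (qhalf CARD('k) (sd_euler Q P0 P1 (?h C D)) * (if ?h C D = c then 1 else 0))"
      proof (cases "?H C D N = 0")
        case False
        have "dD N = ?h C D"
          using mass(2)[OF C[OF CD(1)] D[OF CD(2)] subsetD[OF T(2) N] False] by (simp add: dD_def dC_def)
        then show ?thesis unfolding wD_def basis_vec_def by auto
      qed simp
    qed
    then have 1: "(\<Sum>N\<in>T. real (?H C D N) * (wD N * basis_vec (dD N) c)) =
        (\<Sum>N\<in>T. real (?H C D N) / real (sd_aut_card Q (representative N))) *
        (qhalf CARD('k) (sd_euler Q P0 P1 (?h C D)) * (if ?h C D = c then 1 else 0))"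
      by (simp only: sum_distrib_right)
    let ?E = "- 2 * (euler Q (dD D) (dC C) + sd_euler Q P0 P1 (dC C))"
    let ?u = "real (aut_card Q (representative C))" and ?v = "real (sd_aut_card Q (representative D))"
    have 2: "(\<Sum>N\<in>T. real (?H C D N) / real (sd_aut_card Q (representative N))) = qhalf CARD('k) ?E / (?u * ?v)"
      unfolding dD_def dC_def by (rule mass(3)[OF C[OF CD(1)] D[OF CD(2)] T(1,2) T(3)[OF CD]])
    \<comment> \<open>Expanding \<E>(H(d) + e), the mass exponent removes 2\<chi>(e, d) and
      2\<E>(d). What is left over from the mixed terms is \<chi>(d, e) - \<chi>(e, d), and
      \<E>(\<sigma>(d)) - \<E>(d) is the negative of the tilde term: this is the twist of the
      action.\<close>
    have "?E + sd_euler Q P0 P1 (?h C D) = euler Q (dC C) (dC C) + (sd_euler Q P0 P1 (dD D) + ?x C D)"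
      unfolding sd_euler_hyp_add[OF Q assms(3,4) dCp dDp[OF CD(2)]] skew_euler_def sd_euler_tilde_def by simp
    then have 3: "qhalf CARD('k) ?E * qhalf CARD('k) (sd_euler Q P0 P1 (?h C D)) =
        qhalf CARD('k) (euler Q (dC C) (dC C)) * (qhalf CARD('k) (sd_euler Q P0 P1 (dD D)) * qhalf CARD('k) (?x C D))"
      by (simp only: qhalf_add[OF q, symmetric])
    have 4: "a / (x * y) * (b * k) = p / x * (r / y) * t * k" if "a * b = p * (r * t)" for a b p r t x y k :: real
    proof -
      have "a / (x * y) * (b * k) = (a * b) * k / (x * y)" by simp
      then show ?thesis unfolding that by simp
    qed
    show ?thesis unfolding 1 2 unfolding wC_def wD_def by (rule 4[OF 3])
  qed
  have "int_M Q P0 P1 (hall_act Q f m) c = (\<Sum>N\<in>{N. hall_act Q f m N \<noteq> 0}. of_rat (hall_act Q f m N) * (wD N * basis_vec (dD N) c))"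
    unfolding int_M_def Let_def wD_def dD_def by simp
  \<comment> \<open>The support of the product may be smaller than \<open>T\<close>, since
    coefficients can cancel.\<close>
  also have "\<dots> = (\<Sum>N\<in>T. of_rat (hall_act Q f m N) * (wD N * basis_vec (dD N) c))"
    by (rule sum.mono_neutral_left) (use T(1) act0 in auto)
  also have "\<dots> = (\<Sum>N\<in>T. \<Sum>C\<in>?Cs. \<Sum>D\<in>?Ds. of_rat (f C) * of_rat (m D) * (real (?H C D N) * (wD N * basis_vec (dD N) c)))"
    by (rule sum.cong[OF refl])
      (use T(2) in \<open>auto simp: hall_act_def of_rat_sum of_rat_mult sum_distrib_right mult.assoc\<close>)
  also have "\<dots> = (\<Sum>C\<in>?Cs. \<Sum>D\<in>?Ds. \<Sum>N\<in>T. of_rat (f C) * of_rat (m D) * (real (?H C D N) * (wD N * basis_vec (dD N) c)))"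
    by (rule sum_swap3)
  also have "\<dots> = (\<Sum>C\<in>?Cs. \<Sum>D\<in>?Ds. of_rat (f C) * of_rat (m D) *
      (wC C * wD D * qhalf CARD('k) (?x C D) * (if ?h C D = c then 1 else 0)))"
    by (intro sum.cong refl) (simp only: sum_distrib_left[symmetric] key)
  finally have L: "int_M Q P0 P1 (hall_act Q f m) c = \<dots>" .
  let ?I = "{(d, e). d \<in> Lambda_pos Q \<and> e \<in> Lambda_sig_pos Q \<and> (\<lambda>i. hyp_vec Q d i + e i) = c}"
  have finI: "finite ?I" by (rule finite_torus_index[OF quiverD(1)[OF sd_quiverD(1)[OF Q]]])
  let ?y = "\<lambda>d e. qhalf CARD('k) (skew_euler Q d e - sd_euler_tilde Q P0 P1 d)"
  have "torus_act CARD('k) Q P0 P1 (int_H Q f) (int_M Q P0 P1 m) c =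
      (\<Sum>p\<in>?I. (\<Sum>C\<in>?Cs. of_rat (f C) * (wC C * basis_vec (dC C) (fst p))) *
        (\<Sum>D\<in>?Ds. of_rat (m D) * (wD D * basis_vec (dD D) (snd p))) * ?y (fst p) (snd p))"
    unfolding torus_act_def int_H_def int_M_def Let_def wC_def wD_def dC_def dD_def by (simp add: case_prod_unfold)
  also have "\<dots> = (\<Sum>p\<in>?I. \<Sum>C\<in>?Cs. \<Sum>D\<in>?Ds. of_rat (f C) * of_rat (m D) *
      (if p = (dC C, dD D) then wC C * wD D * ?y (dC C) (dD D) else 0))"
  proof (rule sum.cong[OF refl])
    fix p :: "('v \<Rightarrow> int) \<times> ('v \<Rightarrow> int)"
    have "of_rat (f C) * (wC C * basis_vec (dC C) (fst p)) * (of_rat (m D) * (wD D * basis_vec (dD D) (snd p))) * ?y (fst p) (snd p) =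
        of_rat (f C) * of_rat (m D) * (if p = (dC C, dD D) then wC C * wD D * ?y (dC C) (dD D) else 0)" for C D
      by (cases p) (simp add: basis_vec_def)
    then show "(\<Sum>C\<in>?Cs. of_rat (f C) * (wC C * basis_vec (dC C) (fst p))) *
        (\<Sum>D\<in>?Ds. of_rat (m D) * (wD D * basis_vec (dD D) (snd p))) * ?y (fst p) (snd p) =
      (\<Sum>C\<in>?Cs. \<Sum>D\<in>?Ds. of_rat (f C) * of_rat (m D) *
        (if p = (dC C, dD D) then wC C * wD D * ?y (dC C) (dD D) else 0))"
      by (simp only: sum_product_distrib)
  qed
  also have "\<dots> = (\<Sum>C\<in>?Cs. \<Sum>D\<in>?Ds. \<Sum>p\<in>?I. of_rat (f C) * of_rat (m D) *
      (if p = (dC C, dD D) then wC C * wD D * ?y (dC C) (dD D) else 0))"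
    by (rule sum_swap3)
  also have "\<dots> = (\<Sum>C\<in>?Cs. \<Sum>D\<in>?Ds. of_rat (f C) * of_rat (m D) *
      (wC C * wD D * qhalf CARD('k) (?x C D) * (if ?h C D = c then 1 else 0)))"
  proof (intro sum.cong refl)
    fix C D assume CD: "C \<in> ?Cs" "D \<in> ?Ds"
    \<comment> \<open>For given classes only the pair of their dimension vectors contributes, and it
      is an index exactly when it has degree \<open>c\<close>.\<close>
    have "(dC C, dD D) \<in> ?I \<longleftrightarrow> ?h C D = c" using dCp dDp[OF CD(2)] by auto
    then show "(\<Sum>p\<in>?I. of_rat (f C) * of_rat (m D) * (if p = (dC C, dD D) then wC C * wD D * ?y (dC C) (dD D) else 0)) =
        of_rat (f C) * of_rat (m D) * (wC C * wD D * qhalf CARD('k) (?x C D) * (if ?h C D = c then 1 else 0))"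
      unfolding sum_distrib_left[symmetric] sum.delta[OF finI] by simp
  qed
  finally show "int_M Q P0 P1 (hall_act Q f m) c = torus_act CARD('k) Q P0 P1 (int_H Q f) (int_M Q P0 P1 m) c"
    using L by simp
qed

end
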